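(* Let $\mathbf u$ be the outgoing solution of the exterior Navier problem and let $\phi_p,\phi_s$ be the solutions of the coupled Helmholtz problem, both described in the context, outside the disk of radius $a$ with boundary data $\mathbf g_1$. Then $\mathbf u$ and $\phi_t$ admit the convergent series expansions $$\mathbf u(r,\vartheta)=H_0^{(1)}(k_pr)\sum_{l=0}^\infty\frac{\mathbf F_{p,l}(\vartheta)}{(k_pr)^l}+H_1^{(1)}(k_pr)\sum_{l=0}^\infty\frac{\mathbf G_{p,l}(\vartheta)}{(k_pr)^l}+H_0^{(1)}(k_sr)\sum_{l=0}^\infty\frac{\mathbf F_{s,l}(\vartheta)}{(k_sr)^l}+H_1^{(1)}(k_sr)\sum_{l=0}^\infty\frac{\mathbf G_{s,l}(\vartheta)}{(k_sr)^l},$$ $$\phi_t(r,\vartheta)=H_0^{(1)}(k_tr)\sum_{l=0}^\infty\frac{h_{t,l}(\vartheta)}{(k_tr)^l}+H_1^{(1)}(k_tr)\sum_{l=0}^\infty\frac{q_{t,l}(\vartheta)}{(k_tr)^l},\qquad t=p,s,$$ for $r>a$, and the series converge absolutely and uniformly in $r\ge a+\epsilon>a$ (for each $\epsilon>0$). The series are infinitely differentiable term by term with respect to $r$ and $\vartheta$, with all resulting series converging absolutely and uniformly. The coefficients $\{\mathbf F_{t,l},\mathbf G_{t,l},h_{t,l},q_{t,l}\}$ are functions of $\vartheta$ that can be determined recursively by the boundary data $\mathbf g_1$.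
   Context: $(r,\vartheta)$ are polar coordinates in $\mathbb R^2$, with polar unit vectors $\mathbf e_r,\mathbf e_\vartheta$. $B_a=\{|\mathbf x|<a\}$, $\Gamma_1=\partial B_a$, and $\Omega_1^c=\mathbb R^2\setminus\overline{B_a}$ is the exterior domain. $\rho>0$, $\omega>0$, and $\lambda,\mu$ are Lamé constants with $\mu>0$, $\lambda+\mu>0$; $\Delta^*=\mu\Delta+(\lambda+\mu)\nabla\nabla\cdot$, $k_p=\omega\sqrt{\rho/(\lambda+2\mu)}$, $k_s=\omega\sqrt{\rho/\mu}$. $H_n^{(1)}$ is the Hankel function of the first kind of order $n$. $\mathrm{curl}\,\mathbf v=\partial_{x_1}v_2-\partial_{x_2}v_1$ for vector fields; on scalars, $\mathbf{curl}=(\partial_{x_2},-\partial_{x_1})^\top$. Exterior Navier problem: $\Delta^*\mathbf u+\rho\omega^2\mathbf u=\mathbf 0$ in $\Omega_1^c$, $\mathbf u=\mathbf g_1=g_r(\vartheta)\mathbf e_r+g_\vartheta(\vartheta)\mathbf e_\vartheta$ on $\Gamma_1$ (with $\mathbf g_1\in H^{1/2}(\Gamma_1)^2$ and $\mathbf u\in H^1_{\rm loc}$), and the Kupradze radiation condition: with $\mathbf u_p=-k_p^{-2}\nabla\nabla\cdot\mathbf u$ and $\mathbf u_s=k_s^{-2}\,\mathbf{curl}\,\mathrm{curl}\,\mathbf u$, $\lim_{|\mathbf x|\to\infty}|\mathbf x|(\partial\mathbf u_t/\partial|\mathbf x|-\mathrm ik_t\mathbf u_t)=0$ for $t=p,s$.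 Coupled Helmholtz problem (arising from the Helmholtz decomposition $\mathbf u=\nabla\phi_p+\mathbf{curl}\,\phi_s$): $\Delta\phi_t+k_t^2\phi_t=0$ in $\Omega_1^c$ for $t=p,s$; $\partial_{\boldsymbol\nu}\phi_p+\partial_{\boldsymbol\tau}\phi_s=\boldsymbol\nu\cdot\mathbf g_1$ and $\partial_{\boldsymbol\tau}\phi_p-\partial_{\boldsymbol\nu}\phi_s=\boldsymbol\tau\cdot\mathbf g_1$ on $\Gamma_1$; $\lim_{r\to\infty}r^{1/2}(\partial_r\phi_t-\mathrm ik_t\phi_t)=0$. Here $\boldsymbol\nu=(\nu_1,\nu_2)^\top$ is the unit outward normal to $B_a$ on $\Gamma_1$ and $\boldsymbol\tau=(-\nu_2,\nu_1)^\top$ the unit tangent. *)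

theory Defs
  imports "HOL-Analysis.Analysis"
begin

section \<open>Hankel functions of the first kind\<close>

definition bessel_J :: "nat \<Rightarrow> real \<Rightarrow> real" where
  "bessel_J n x = (\<Sum>k. (-1) ^ k / (fact k * fact (n + k)) * (x / 2) ^ (2 * k + n))"

text \<open>The Weber function \<open>Y\<^sub>n\<close> on the positive half-line, by its classical ascending series
  (NIST DLMF, equation 10.8.1).\<close>

definition bessel_Y :: "nat \<Rightarrow> real \<Rightarrow> real" where
  "bessel_Y n x =
     2 / pi * ln (x / 2) * bessel_J n x
     - 1 / pi * (\<Sum>k<n. fact (n - k - 1) / fact k * (x / 2) ^ (2 * k) / (x / 2) ^ n)
     - 1 / pi * (\<Sum>k. (Digamma (of_nat (k + 1)) + Digamma (of_nat (n + k + 1)))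
                       * (-1) ^ k / (fact k * fact (n + k)) * (x / 2) ^ (2 * k + n))"

definition hankel1 :: "nat \<Rightarrow> real \<Rightarrow> complex" where
  "hankel1 n x = Complex (bessel_J n x) (bessel_Y n x)"

section \<open>Differential operators in the plane\<close>

definition partial :: "2 \<Rightarrow> (real^2 \<Rightarrow> 'b::real_normed_vector) \<Rightarrow> real^2 \<Rightarrow> 'b" where
  "partial j f x = frechet_derivative f (at x) (axis j 1)"

definition dir_deriv :: "real^2 \<Rightarrow> (real^2 \<Rightarrow> 'b::real_normed_vector) \<Rightarrow> real^2 \<Rightarrow> 'b" where
  "dir_deriv v f x = frechet_derivative f (at x) v"

definition radial_deriv :: "(real^2 \<Rightarrow> 'b::real_normed_vector) \<Rightarrow> real^2 \<Rightarrow> 'b" where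
  "radial_deriv f x = dir_deriv (x /\<^sub>R norm x) f x"

primrec C_on :: "nat \<Rightarrow> (real^2) set \<Rightarrow> (real^2 \<Rightarrow> 'b::real_normed_vector) \<Rightarrow> bool" where
  "C_on 0 S f = continuous_on S f"
| "C_on (Suc k) S f = (f differentiable_on S \<and> (\<forall>j. C_on k S (partial j f)))"

definition laplacian :: "(real^2 \<Rightarrow> 'b::real_normed_vector) \<Rightarrow> real^2 \<Rightarrow> 'b" where
  "laplacian f x = (\<Sum>j\<in>UNIV. partial j (partial j f) x)"

definition grad2 :: "(real^2 \<Rightarrow> complex) \<Rightarrow> real^2 \<Rightarrow> complex^2" where
  "grad2 f x = (\<chi> j. partial j f x)"

definition div2 :: "(real^2 \<Rightarrow> complex^2) \<Rightarrow> real^2 \<Rightarrow> complex" where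
  "div2 v x = (\<Sum>j\<in>UNIV. partial j (\<lambda>y. v y $ j) x)"

definition scalar_curl :: "(real^2 \<Rightarrow> complex^2) \<Rightarrow> real^2 \<Rightarrow> complex" where
  "scalar_curl v x = partial 1 (\<lambda>y. v y $ 2) x - partial 2 (\<lambda>y. v y $ 1) x"

definition vector_curl :: "(real^2 \<Rightarrow> complex) \<Rightarrow> real^2 \<Rightarrow> complex^2" where
  "vector_curl f x = vector [partial 2 f x, - partial 1 f x]"

definition lame_op :: "real \<Rightarrow> real \<Rightarrow> (real^2 \<Rightarrow> complex^2) \<Rightarrow> real^2 \<Rightarrow> complex^2" where
  "lame_op lam \<mu> u x = \<mu> *\<^sub>R laplacian u x + (lam + \<mu>) *\<^sub>R grad2 (div2 u) x"

section \<open>Polar coordinates and function spaces\<close>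

definition exterior :: "real \<Rightarrow> (real^2) set" where
  "exterior a = {x. norm x > a}"

definition e_r :: "real \<Rightarrow> real^2" where "e_r \<theta> = vector [cos \<theta>, sin \<theta>]"
definition e_\<theta> :: "real \<Rightarrow> real^2" where "e_\<theta> \<theta> = vector [- sin \<theta>, cos \<theta>]"

abbreviation polar :: "real \<Rightarrow> real \<Rightarrow> real^2" where "polar r \<theta> \<equiv> r *\<^sub>R e_r \<theta>"

definition cvec :: "real^2 \<Rightarrow> complex^2" where
  "cvec v = (\<chi> j. complex_of_real (v $ j))"

definition rdot :: "real^2 \<Rightarrow> complex^2 \<Rightarrow> complex" where
  "rdot v w = (\<Sum>j\<in>UNIV. complex_of_real (v $ j) * w $ j)"

text \<open>Functions on the circle are represented by functions of the angle; only their restriction to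
  \<open>[0, 2\<pi>]\<close> is ever used, and only up to null sets.\<close>

definition fourier_coeff :: "(real \<Rightarrow> complex) \<Rightarrow> int \<Rightarrow> complex" where
  "fourier_coeff f n =
     1 / (2 * pi) * (\<integral>\<theta>. f \<theta> * cis (- of_int n * \<theta>) \<partial>lebesgue_on {0..2 * pi})"

definition H_half :: "(real \<Rightarrow> complex) \<Rightarrow> bool" where
  "H_half f \<longleftrightarrow>
     f \<in> borel_measurable (lebesgue_on {0..2 * pi}) \<and>
     integrable (lebesgue_on {0..2 * pi}) (\<lambda>\<theta>. (norm (f \<theta>))\<^sup>2) \<and>
     (\<lambda>n::int. sqrt (1 + (of_int n)\<^sup>2) * (norm (fourier_coeff f n))\<^sup>2) summable_on UNIV"

text \<open>\<open>w r\<close> is the restriction of a function of the exterior domain to the circle of radius \<open>r\<close>.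
  For functions that are \<open>H\<^sup>1\<close> up to the circle of radius \<open>a\<close>, the \<open>L\<^sup>2\<close>-limit below is the Sobolev
  trace.\<close>

definition has_trace :: "real \<Rightarrow> (real \<Rightarrow> real \<Rightarrow> 'b::real_normed_vector) \<Rightarrow> (real \<Rightarrow> 'b) \<Rightarrow> bool" where
  "has_trace a w g \<longleftrightarrow>
     ((\<lambda>r. \<integral>\<theta>. (norm (w r \<theta> - g \<theta>))\<^sup>2 \<partial>lebesgue_on {0..2 * pi}) \<longlongrightarrow> 0) (at_right a)"

text \<open>Local \<open>H\<^sup>1\<close>-regularity up to the inner boundary, for functions differentiable in the open
  exterior domain.\<close>

definition H1_loc :: "real \<Rightarrow> (real^2 \<Rightarrow> complex^2) \<Rightarrow> bool" where
  "H1_loc a u \<longleftrightarrow> (\<forall>R>a.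
     integrable (lebesgue_on {x. a < norm x \<and> norm x < R}) (\<lambda>x. (norm (u x))\<^sup>2) \<and>
     (\<forall>j. integrable (lebesgue_on {x. a < norm x \<and> norm x < R}) (\<lambda>x. (norm (partial j u x))\<^sup>2)))"

section \<open>The two boundary value problems\<close>

definition kupradze :: "real \<Rightarrow> (real^2 \<Rightarrow> complex^2) \<Rightarrow> bool" where
  "kupradze k v \<longleftrightarrow>
     ((\<lambda>x. norm x *\<^sub>R (radial_deriv v x - (\<i> * of_real k) *s v x)) \<longlongrightarrow> 0) at_infinity"

definition sommerfeld :: "real \<Rightarrow> (real^2 \<Rightarrow> complex) \<Rightarrow> bool" where
  "sommerfeld k f \<longleftrightarrow>
     ((\<lambda>x. sqrt (norm x) *\<^sub>R (radial_deriv f x - \<i> * of_real k * f x)) \<longlongrightarrow> 0) at_infinity"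

text \<open>Three continuous derivatives are what the radiation condition needs in order to make classical
  sense; by interior regularity every weak solution has such a representative.\<close>

definition navier_solution ::
  "real \<Rightarrow> real \<Rightarrow> real \<Rightarrow> real \<Rightarrow> real \<Rightarrow> real \<Rightarrow> real \<Rightarrow> (real \<Rightarrow> complex^2) \<Rightarrow> (real^2 \<Rightarrow> complex^2) \<Rightarrow> bool"
where
  "navier_solution a \<rho> \<omega> lam \<mu> kp ks g u \<longleftrightarrow>
     C_on 3 (exterior a) u \<and> H1_loc a u \<and>
     (\<forall>x\<in>exterior a. lame_op lam \<mu> u x + (\<rho> * \<omega>\<^sup>2) *\<^sub>R u x = 0) \<and>
     has_trace a (\<lambda>r \<theta>. u (polar r \<theta>)) g \<and>
     kupradze kp (\<lambda>x. - (1 / kp\<^sup>2) *\<^sub>R grad2 (div2 u) x) \<and>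
     kupradze ks (\<lambda>x. (1 / ks\<^sup>2) *\<^sub>R vector_curl (scalar_curl u) x)"

text \<open>On the circle the normal and the tangent are \<open>e_r\<close> and \<open>e_\<theta>\<close>. The boundary operators are read
  as traces of the combined expressions: for \<open>H\<^sup>1\<^sup>/\<^sup>2\<close> data the individual potentials need not have
  traces of their gradients.\<close>

definition coupled_solution ::
  "real \<Rightarrow> real \<Rightarrow> real \<Rightarrow> (real \<Rightarrow> complex^2) \<Rightarrow> (real^2 \<Rightarrow> complex) \<Rightarrow> (real^2 \<Rightarrow> complex) \<Rightarrow> bool"
where
  "coupled_solution a kp ks g \<phi>p \<phi>s \<longleftrightarrow>
     C_on 2 (exterior a) \<phi>p \<and> C_on 2 (exterior a) \<phi>s \<and>
     (\<forall>x\<in>exterior a. laplacian \<phi>p x + of_real (kp\<^sup>2) * \<phi>p x = 0) \<and>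
     (\<forall>x\<in>exterior a. laplacian \<phi>s x + of_real (ks\<^sup>2) * \<phi>s x = 0) \<and>
     has_trace a (\<lambda>r \<theta>. dir_deriv (e_r \<theta>) \<phi>p (polar r \<theta>) + dir_deriv (e_\<theta> \<theta>) \<phi>s (polar r \<theta>))
       (\<lambda>\<theta>. rdot (e_r \<theta>) (g \<theta>)) \<and>
     has_trace a (\<lambda>r \<theta>. dir_deriv (e_\<theta> \<theta>) \<phi>p (polar r \<theta>) - dir_deriv (e_r \<theta>) \<phi>s (polar r \<theta>))
       (\<lambda>\<theta>. rdot (e_\<theta> \<theta>) (g \<theta>)) \<and>
     sommerfeld kp \<phi>p \<and> sommerfeld ks \<phi>s"

section \<open>Termwise differentiable series in polar coordinates\<close>

definition d_r :: "(real \<Rightarrow> real \<Rightarrow> 'b::real_normed_vector) \<Rightarrow> real \<Rightarrow> real \<Rightarrow> 'b" where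
  "d_r f r \<theta> = vector_derivative (\<lambda>s. f s \<theta>) (at r)"

definition d_\<theta> :: "(real \<Rightarrow> real \<Rightarrow> 'b::real_normed_vector) \<Rightarrow> real \<Rightarrow> real \<Rightarrow> 'b" where
  "d_\<theta> f r \<theta> = vector_derivative (\<lambda>t. f r t) (at \<theta>)"

text \<open>Mixed derivatives of arbitrary order: \<open>ds\<close> is a list of operators from \<open>{d_r, d_\<theta>}\<close>.\<close>

abbreviation mixed_deriv where "mixed_deriv ds f \<equiv> foldr (\<lambda>d. d) ds f"

definition polar_smooth :: "real \<Rightarrow> (real \<Rightarrow> real \<Rightarrow> 'b::real_normed_vector) \<Rightarrow> bool" where
  "polar_smooth a f \<longleftrightarrow> (\<forall>ds. set ds \<subseteq> {d_r, d_\<theta>} \<longrightarrow>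
     continuous_on ({a<..} \<times> UNIV) (\<lambda>(r, \<theta>). mixed_deriv ds f r \<theta>) \<and>
     (\<forall>r>a. \<forall>\<theta>. (\<lambda>s. mixed_deriv ds f s \<theta>) differentiable (at r) \<and>
                 (\<lambda>t. mixed_deriv ds f r t) differentiable (at \<theta>)))"

definition conv_abs_unif :: "('x \<Rightarrow> bool) \<Rightarrow> (nat \<Rightarrow> 'x \<Rightarrow> 'b::real_normed_vector) \<Rightarrow> bool" where
  "conv_abs_unif P T \<longleftrightarrow>
     (\<forall>x. P x \<longrightarrow> summable (\<lambda>l. norm (T l x))) \<and>
     uniformly_convergent_on {x. P x} (\<lambda>N x. \<Sum>l<N. T l x)"

text \<open>The choice \<open>ds = []\<close> gives absolute and uniform convergence of the series itself.\<close>

definition termwise_smooth :: "real \<Rightarrow> (nat \<Rightarrow> real \<Rightarrow> real \<Rightarrow> 'b::real_normed_vector) \<Rightarrow> bool" where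
  "termwise_smooth a T \<longleftrightarrow>
     (\<forall>l. polar_smooth a (T l)) \<and> polar_smooth a (\<lambda>r \<theta>. \<Sum>l. T l r \<theta>) \<and>
     (\<forall>ds. set ds \<subseteq> {d_r, d_\<theta>} \<longrightarrow>
        (\<forall>\<epsilon>>0. conv_abs_unif (\<lambda>(r, \<theta>). r \<ge> a + \<epsilon>) (\<lambda>l (r, \<theta>). mixed_deriv ds (T l) r \<theta>)) \<and>
        (\<forall>r>a. \<forall>\<theta>. mixed_deriv ds (\<lambda>r \<theta>. \<Sum>l. T l r \<theta>) r \<theta> = (\<Sum>l. mixed_deriv ds (T l) r \<theta>)))"

definition inv_term :: "real \<Rightarrow> (nat \<Rightarrow> real \<Rightarrow> 'b::real_normed_vector) \<Rightarrow> nat \<Rightarrow> real \<Rightarrow> real \<Rightarrow> 'b" where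
  "inv_term k F l r \<theta> = (1 / (k * r) ^ l) *\<^sub>R F l \<theta>"

text \<open>The convergence and differentiability claims are made for the power series in \<open>1 / (k r)\<close> as well as
  for the series whose terms carry the Hankel factor.\<close>

definition scalar_series_smooth ::
  "real \<Rightarrow> real \<Rightarrow> (nat \<Rightarrow> real \<Rightarrow> complex) \<Rightarrow> (nat \<Rightarrow> real \<Rightarrow> complex) \<Rightarrow> bool" where
  "scalar_series_smooth a k h q \<longleftrightarrow>
     termwise_smooth a (inv_term k h) \<and> termwise_smooth a (inv_term k q) \<and>
     termwise_smooth a (\<lambda>l r \<theta>. hankel1 0 (k * r) * inv_term k h l r \<theta>) \<and>
     termwise_smooth a (\<lambda>l r \<theta>. hankel1 1 (k * r) * inv_term k q l r \<theta>)"

definition vector_series_smooth ::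
  "real \<Rightarrow> real \<Rightarrow> (nat \<Rightarrow> real \<Rightarrow> complex^2) \<Rightarrow> (nat \<Rightarrow> real \<Rightarrow> complex^2) \<Rightarrow> bool" where
  "vector_series_smooth a k F G \<longleftrightarrow>
     termwise_smooth a (inv_term k F) \<and> termwise_smooth a (inv_term k G) \<and>
     termwise_smooth a (\<lambda>l r \<theta>. hankel1 0 (k * r) *s inv_term k F l r \<theta>) \<and>
     termwise_smooth a (\<lambda>l r \<theta>. hankel1 1 (k * r) *s inv_term k G l r \<theta>)"

section \<open>Recursive determination of the coefficients\<close>

definition deriv2 :: "(real \<Rightarrow> 'b::real_normed_vector) \<Rightarrow> real \<Rightarrow> 'b" where
  "deriv2 f \<theta> = vector_derivative (\<lambda>t. vector_derivative f (at t)) (at \<theta>)"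

text \<open>Obtained by inserting the expansion into the Helmholtz equation and equating the coefficients of
  \<open>H\<^sub>0(k r) (k r)\<^sup>-\<^sup>l\<close> and \<open>H\<^sub>1(k r) (k r)\<^sup>-\<^sup>l\<close>; the Cartesian components of the compressional and
  shear parts of a Navier solution satisfy it as well.\<close>

definition karp_recursion ::
  "(nat \<Rightarrow> real \<Rightarrow> 'b::real_normed_vector) \<Rightarrow> (nat \<Rightarrow> real \<Rightarrow> 'b) \<Rightarrow> bool" where
  "karp_recursion F G \<longleftrightarrow> (\<forall>l \<theta>.
     (2 * real (Suc l)) *\<^sub>R F (Suc l) \<theta> = - ((real (Suc l))\<^sup>2 *\<^sub>R G l \<theta> + deriv2 (G l) \<theta>) \<and>
     (2 * real (Suc l)) *\<^sub>R G (Suc l) \<theta> = (real l)\<^sup>2 *\<^sub>R F l \<theta> + deriv2 (F l) \<theta>)"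

text \<open>The boundary conditions for the \<open>n\<close>-th angular mode
  \<open>\<phi>p = x H\<^sub>|\<^sub>n\<^sub>|(kp r) exp (i n \<theta>)\<close>, \<open>\<phi>s = y H\<^sub>|\<^sub>n\<^sub>|(ks r) exp (i n \<theta>)\<close>.\<close>

definition mode_system ::
  "real \<Rightarrow> real \<Rightarrow> real \<Rightarrow> (real \<Rightarrow> complex^2) \<Rightarrow> int \<Rightarrow> complex \<Rightarrow> complex \<Rightarrow> bool" where
  "mode_system a kp ks g n x y \<longleftrightarrow>
     (let m = nat \<bar>n\<bar>;
          H = (\<lambda>k. hankel1 m (k * a));
          H' = (\<lambda>k. vector_derivative (hankel1 m) (at (k * a)))
      in of_real kp * H' kp * x + \<i> * of_int n / of_real a * H ks * y
           = fourier_coeff (\<lambda>\<theta>. rdot (e_r \<theta>) (g \<theta>)) n \<and>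
         \<i> * of_int n / of_real a * H kp * x - of_real ks * H' ks * y
           = fourier_coeff (\<lambda>\<theta>. rdot (e_\<theta> \<theta>) (g \<theta>)) n)"

text \<open>Since \<open>H\<^sub>m(z) = cos (m \<pi>/2) H\<^sub>0(z) + sin (m \<pi>/2) H\<^sub>1(z)\<close> up to terms carrying negative powers
  of \<open>z\<close>, the mode amplitudes \<open>c\<close> determine the leading coefficients as follows.\<close>

definition leading_coeffs ::
  "(int \<Rightarrow> complex) \<Rightarrow> (real \<Rightarrow> complex) \<Rightarrow> (real \<Rightarrow> complex) \<Rightarrow> bool" where
  "leading_coeffs c h0 q0 \<longleftrightarrow> (\<forall>\<theta>.
     ((\<lambda>n. c n * of_real (cos (of_int \<bar>n\<bar> * pi / 2)) * cis (of_int n * \<theta>)) has_sum h0 \<theta>) UNIV \<and>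
     ((\<lambda>n. c n * of_real (sin (of_int \<bar>n\<bar> * pi / 2)) * cis (of_int n * \<theta>)) has_sum q0 \<theta>) UNIV)"

text \<open>The leading coefficients are obtained from the boundary data by uniquely solvable linear
  systems; the leading coefficients of the vector series come from those of
  \<open>\<nabla>\<phi>p\<close> and of the curl of \<open>\<phi>s\<close>, and all higher ones from the recursion.\<close>

definition determined_by_data ::
  "real \<Rightarrow> real \<Rightarrow> real \<Rightarrow> (real \<Rightarrow> complex^2) \<Rightarrow>
   (nat \<Rightarrow> real \<Rightarrow> complex) \<Rightarrow> (nat \<Rightarrow> real \<Rightarrow> complex) \<Rightarrow>
   (nat \<Rightarrow> real \<Rightarrow> complex) \<Rightarrow> (nat \<Rightarrow> real \<Rightarrow> complex) \<Rightarrow>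
   (nat \<Rightarrow> real \<Rightarrow> complex^2) \<Rightarrow> (nat \<Rightarrow> real \<Rightarrow> complex^2) \<Rightarrow>
   (nat \<Rightarrow> real \<Rightarrow> complex^2) \<Rightarrow> (nat \<Rightarrow> real \<Rightarrow> complex^2) \<Rightarrow> bool" where
  "determined_by_data a kp ks g hp qp hs qs Fp Gp Fs Gs \<longleftrightarrow>
     (\<exists>cp cs. (\<forall>n x y. mode_system a kp ks g n x y \<longleftrightarrow> x = cp n \<and> y = cs n) \<and>
        leading_coeffs cp (hp 0) (qp 0) \<and> leading_coeffs cs (hs 0) (qs 0)) \<and>
     (\<forall>\<theta>. Fp 0 \<theta> = (of_real kp * qp 0 \<theta>) *s cvec (e_r \<theta>) \<and>
           Gp 0 \<theta> = - (of_real kp * hp 0 \<theta>) *s cvec (e_r \<theta>) \<and>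
           Fs 0 \<theta> = - (of_real ks * qs 0 \<theta>) *s cvec (e_\<theta> \<theta>) \<and>
           Gs 0 \<theta> = (of_real ks * hs 0 \<theta>) *s cvec (e_\<theta> \<theta>)) \<and>
     karp_recursion hp qp \<and> karp_recursion hs qs \<and>
     karp_recursion Fp Gp \<and> karp_recursion Fs Gs"

end

theory Submission
  imports Defs "HOL-Real_Asymp.Real_Asymp"
begin

text \<open>
  Expand everything in angular modes \<open>exp (i n \<theta>)\<close>. A potential that solves the Helmholtz equation
  has Fourier coefficients that solve Bessel's equation in \<open>k r\<close>, and the radiation condition
  forces them to be \<open>c n H\<^sub>|\<^sub>n\<^sub>|(k r)\<close> with constants \<open>c n\<close> (\<open>radiating_mode\<close>, \<open>has_modes_exists\<close>).
  The three-term recurrence writes \<open>H\<^sub>m(x)\<close> as \<open>P\<^sub>m(1/x) H\<^sub>0(x) + Q\<^sub>m(1/x) H\<^sub>1(x)\<close> with Lommel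
  polynomials \<open>P\<^sub>m\<close> and \<open>Q\<^sub>m\<close>. Inserting this into the mode expansion and collecting powers of
  \<open>1/x\<close> gives the two series of the theorem, with coefficients that are Fourier series in \<open>\<theta>\<close>
  (\<open>karp_expansion\<close>).

  All analytic claims come from one estimate. The coefficients on any circle \<open>r > a\<close> are bounded,
  and since \<open>H\<^sub>m(x)\<close> grows with \<open>m\<close> like \<open>m! (2/x)\<^sup>m\<close>, this makes the amplitudes decay like
  \<open>(k r/2)\<^sup>|\<^sup>n\<^sup>| / |n|!\<close> (\<open>admissible_from_bounds\<close>). The Lommel polynomials obey a bound of the
  reciprocal kind (\<open>lommel_val_bound\<close>), so that the double series over modes and powers converges
  absolutely for \<open>r > a\<close> (\<open>karp_array_summable\<close>). Derivatives in \<open>r\<close> and \<open>\<theta>\<close> only multiply the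
  double array by polynomials in the indices or lower the powers of \<open>r\<close>. A family of series closed
  under both derivatives therefore converges uniformly with all its members
  (\<open>karp_family_termwise_smooth\<close>).

  To use the radiation condition one must know that \<open>H\<^sub>m\<close> is outgoing, starting from the ascending
  series that defines \<open>Y\<^sub>m\<close>. For \<open>m = 0\<close> this follows from the representation of \<open>H\<^sub>0\<close> as a Laplace
  integral (\<open>hankel1_0_eq_F0\<close>), which is identified by its logarithmic behaviour at the origin;
  the recurrence gives the other orders (\<open>hankel1_radiating\<close>).

  For the Navier solution, \<open>-div u / k\<^sub>p\<^sup>2\<close> and \<open>curl u / k\<^sub>s\<^sup>2\<close> are potentials from which \<open>u\<close> is
  recovered (\<open>navier_potentials\<close>), and the Kupradze condition makes their modes outgoing
  (\<open>kupradze_mode_radiating\<close>). They need not be the given potentials a priori. Both pairs, however,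
  have the same boundary traces, hence amplitudes that solve the same two-by-two system for each
  mode. This system is uniquely solvable because the flux \<open>Im (cnj H H')\<close> is positive
  (\<open>mode_system_unique\<close>), so the two pairs agree, and the Cartesian components of \<open>u\<close> are again mode
  sums, with amplitudes \<open>grad_x\<close> and \<open>grad_y\<close>. The recursion for the coefficients is a recursion for
  the coefficients of the Lommel polynomials (\<open>lommel_recursion\<close>).
\<close>

section \<open>Ascending series of the Bessel functions\<close>

definition bessel_coeff :: "nat \<Rightarrow> nat \<Rightarrow> real" where
  "bessel_coeff n k = (-1) ^ k / (fact k * fact (n + k))"

definition digamma_coeff :: "nat \<Rightarrow> nat \<Rightarrow> real" where
  "digamma_coeff n k = (Digamma (of_nat (k + 1)) + Digamma (of_nat (n + k + 1))) * bessel_coeff n k"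

text \<open>Powers of \<open>x/2\<close> are split off so that, in \<open>t = (x/2)\<^sup>2\<close>, differentiation raises the order: \<open>f\<^sub>n' = - f\<^sub>n\<^sub>+\<^sub>1\<close>. The same
  rule holds for the three pieces of \<open>Y\<^sub>n\<close> combined into \<open>Y_red\<close>.\<close>

definition J_red :: "nat \<Rightarrow> real \<Rightarrow> real" where
  "J_red n t = (\<Sum>k. bessel_coeff n k * t ^ k)"

definition Y_tail :: "nat \<Rightarrow> real \<Rightarrow> real" where
  "Y_tail n t = (\<Sum>k. digamma_coeff n k * t ^ k)"

definition Y_polar :: "nat \<Rightarrow> real \<Rightarrow> real" where
  "Y_polar n t = (\<Sum>k<n. fact (n - k - 1) / fact k * t powi (int k - int n))"

definition Y_red :: "nat \<Rightarrow> real \<Rightarrow> real" where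
  "Y_red n t = ln t * J_red n t - Y_polar n t - Y_tail n t"

lemma abs_bessel_coeff_le: "\<bar>bessel_coeff n k\<bar> \<le> 1 / fact k / fact n"
proof -
  have "fact n \<le> (fact (n + k) :: real)" by (intro fact_mono) auto
  thus ?thesis by (simp add: bessel_coeff_def abs_mult field_simps)
qed

lemma summable_bessel_coeff: "summable (\<lambda>k. bessel_coeff n k * t ^ k)"
proof (rule summable_comparison_test')
  show "summable (\<lambda>k. \<bar>t\<bar> ^ k /\<^sub>R fact k)" by (rule summable_exp_generic[where x = "\<bar>t\<bar>"])
  fix k :: nat
  have "\<bar>bessel_coeff n k\<bar> \<le> 1 / fact k / fact n" by (rule abs_bessel_coeff_le)
  also have "\<dots> \<le> 1 / fact k" by (simp add: field_simps)
  finally have "\<bar>bessel_coeff n k\<bar> * \<bar>t\<bar>^k \<le> 1 / fact k * \<bar>t\<bar>^k" by (rule mult_right_mono) simp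
  thus "norm (bessel_coeff n k * t ^ k) \<le> \<bar>t\<bar> ^ k /\<^sub>R fact k"
    by (simp add: abs_mult power_abs field_simps)
qed

lemma abs_Digamma_Suc_le: "\<bar>Digamma (of_nat (Suc k) :: real)\<bar> \<le> real k + 1"
proof -
  have 1: "Digamma (of_nat (Suc k) :: real) = harm k - euler_mascheroni"
    by (rule Digamma_of_nat)
  have 2: "harm k \<le> real k"
  proof (induction k)
    case (Suc k)
    have "inverse (real (Suc k)) \<le> 1" by (simp add: field_simps)
    thus ?case using Suc by (simp add: harm_Suc)
  qed (simp add: harm_def)
  have 3: "harm k \<ge> (0::real)" by (simp add: harm_nonneg)
  have 4: "euler_mascheroni \<le> (1::real)" "euler_mascheroni \<ge> (0::real)"
    using euler_mascheroni_less_13_over_22 euler_mascheroni_pos by simp_all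
  show ?thesis using 1 2 3 4 by linarith
qed

lemma summable_digamma_coeff: "summable (\<lambda>k. digamma_coeff n k * t ^ k)"
proof (rule summable_comparison_test')
  have s: "summable (\<lambda>k. norm (\<bar>2*t\<bar> ^ k /\<^sub>R fact k))" by (rule summable_norm_exp)
  show "summable (\<lambda>k. (n + 2) * norm (\<bar>2*t\<bar> ^ k /\<^sub>R fact k))"
    by (rule summable_mult[OF s])
  fix k :: nat
  have "\<bar>Digamma (of_nat (k + 1)) + Digamma (of_nat (n + k + 1)) :: real\<bar> \<le> (real k + 1) + (real (n + k) + 1)"
    using abs_Digamma_Suc_le[of k] abs_Digamma_Suc_le[of "n+k"] by simp
  also have "\<dots> \<le> (n + 2) * (real k + 1)" by (simp add: algebra_simps)
  also have "\<dots> \<le> (real n + 2) * 2 ^ k"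
    unfolding of_nat_add of_nat_numeral
    using Bernoulli_inequality[of "1::real" k] by (intro mult_left_mono) auto
  finally have 1: "\<bar>Digamma (of_nat (k + 1)) + Digamma (of_nat (n + k + 1)) :: real\<bar> \<le> (n + 2) * 2 ^ k"
    by (simp add: algebra_simps)
  have "\<bar>bessel_coeff n k\<bar> \<le> 1 / fact k / fact n" by (rule abs_bessel_coeff_le)
  also have "\<dots> \<le> 1 / fact k" by (simp add: field_simps)
  finally have 2: "\<bar>bessel_coeff n k\<bar> \<le> 1 / fact k" .
  have "\<bar>digamma_coeff n k\<bar> \<le> ((n + 2) * 2 ^ k) * (1 / fact k)"
    unfolding digamma_coeff_def abs_mult by (intro mult_mono 1 2) auto
  hence "\<bar>digamma_coeff n k\<bar> * \<bar>t\<bar>^k \<le> ((n + 2) * 2 ^ k) * (1 / fact k) * \<bar>t\<bar>^k"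
    by (rule mult_right_mono) simp
  thus "norm (digamma_coeff n k * t ^ k) \<le> (n + 2) * norm (\<bar>2*t\<bar> ^ k /\<^sub>R fact k)"
    by (simp add: abs_mult power_abs power_mult_distrib field_simps)
qed

lemma bessel_coeff_Suc: "real (Suc k) * bessel_coeff n (Suc k) = - bessel_coeff (Suc n) k"
proof -
  have "fact (Suc k) = real (Suc k) * fact k" by simp
  thus ?thesis by (simp add: bessel_coeff_def divide_simps del: of_nat_Suc fact_Suc)
qed

lemma DERIV_J_red: "(J_red n has_real_derivative - J_red (Suc n) t) (at t)"
proof -
  have "DERIV (\<lambda>t. \<Sum>k. bessel_coeff n k * t ^ k) t :> (\<Sum>k. diffs (bessel_coeff n) k * t ^ k)"
    by (rule termdiffs_strong_converges_everywhere) (rule summable_bessel_coeff)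
  also have "(\<lambda>k. diffs (bessel_coeff n) k * t ^ k) = (\<lambda>k. - (bessel_coeff (Suc n) k * t ^ k))"
    by (simp add: diffs_def bessel_coeff_Suc del: of_nat_Suc)
  also have "(\<Sum>k. - (bessel_coeff (Suc n) k * t ^ k)) = - J_red (Suc n) t"
    unfolding J_red_def by (rule suminf_minus[OF summable_bessel_coeff])
  finally show ?thesis unfolding J_red_def[abs_def] .
qed

lemma Digamma_Suc: "Digamma (real (Suc k) + 1) = Digamma (real k + 1) + 1 / (real k + 1)"
  using Digamma_plus1[of "real k + 1"] by (simp add: add_ac)

lemma DERIV_Y_tail:
  assumes "t > 0"
  shows "(Y_tail n has_real_derivative - Y_tail (Suc n) t + (J_red n t - 1 / fact n) / t) (at t)"
proof -
  have "DERIV (\<lambda>t. \<Sum>k. digamma_coeff n k * t ^ k) t :> (\<Sum>k. diffs (digamma_coeff n) k * t ^ k)"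
    by (rule termdiffs_strong_converges_everywhere) (rule summable_digamma_coeff)
  also have "(\<lambda>k. diffs (digamma_coeff n) k * t ^ k) =
     (\<lambda>k. - (digamma_coeff (Suc n) k * t ^ k) + (bessel_coeff n (Suc k) * t ^ Suc k) / t)" (is "?l = ?r")
  proof
    fix k
    have "diffs (digamma_coeff n) k =
       (Digamma (real (Suc k) + 1) + Digamma (real n + real k + 2)) * (real (Suc k) * bessel_coeff n (Suc k))"
      by (simp add: diffs_def digamma_coeff_def add_ac mult_ac)
    also have "\<dots> = - (Digamma (real (Suc k) + 1) + Digamma (real n + real k + 2)) * bessel_coeff (Suc n) k"
      unfolding bessel_coeff_Suc by (simp add: algebra_simps)
    also have "\<dots> = - digamma_coeff (Suc n) k - bessel_coeff (Suc n) k / (real k + 1)"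
      unfolding Digamma_Suc by (simp add: digamma_coeff_def algebra_simps)
    also have "bessel_coeff (Suc n) k / (real k + 1) = - bessel_coeff n (Suc k)"
      using bessel_coeff_Suc[of k n] by (simp add: field_simps)
    finally have d: "diffs (digamma_coeff n) k = - digamma_coeff (Suc n) k + bessel_coeff n (Suc k)"
      by simp
    show "?l k = ?r k" unfolding d using \<open>t > 0\<close> by (simp add: algebra_simps)
  qed
  also have "suminf \<dots> = - Y_tail (Suc n) t + (J_red n t - 1 / fact n) / t"
  proof -
    have a: "(\<lambda>k. bessel_coeff n k * t ^ k) sums J_red n t"
      unfolding J_red_def by (rule summable_sums[OF summable_bessel_coeff])
    have "(\<lambda>k. bessel_coeff n (Suc k) * t ^ Suc k) sums (J_red n t - 1 / fact n)"
      using a by (subst sums_Suc_iff) (simp add: bessel_coeff_def)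
    moreover have "(\<lambda>k. digamma_coeff (Suc n) k * t ^ k) sums Y_tail (Suc n) t"
      unfolding Y_tail_def by (rule summable_sums[OF summable_digamma_coeff])
    ultimately show ?thesis
      by (intro sums_unique[symmetric] sums_add sums_minus sums_divide) auto
  qed
  finally show ?thesis unfolding Y_tail_def[abs_def] .
qed

lemma DERIV_Y_polar:
  assumes "t > 0"
  shows "(Y_polar n has_real_derivative - Y_polar (Suc n) t + 1 / (fact n * t)) (at t)"
proof -
  have pow: "((\<lambda>t. t powi m) has_real_derivative of_int m * t powi (m - 1)) (at t)" for m :: int
    using assms by (auto intro!: derivative_eq_intros)
  have "(Y_polar n has_real_derivative
     (\<Sum>k<n. fact (n - k - 1) / fact k * (of_int (int k - int n) * t powi (int k - int n - 1)))) (at t)"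
    unfolding Y_polar_def[abs_def] by (intro DERIV_sum DERIV_cmult pow)
  also have "(\<Sum>k<n. fact (n - k - 1) / fact k * (of_int (int k - int n) * t powi (int k - int n - 1)))
      = (\<Sum>k<n. - (fact (n - k) / fact k * t powi (int k - int (Suc n))))"
  proof (rule sum.cong)
    fix k assume "k \<in> {..<n}"
    then obtain j where "n = k + Suc j"
      using less_imp_Suc_add by (metis add_Suc_right lessThan_iff)
    thus "fact (n - k - 1) / fact k * (of_int (int k - int n) * t powi (int k - int n - 1)) =
      - (fact (n - k) / fact k * t powi (int k - int (Suc n)))"
      by (simp add: algebra_simps add_divide_distrib)
  qed simp
  also have "\<dots> = - Y_polar (Suc n) t + 1 / (fact n * t)"
    unfolding Y_polar_def using assms
    by (simp add: sum_negf power_int_minus field_simps)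
  finally show ?thesis .
qed

text \<open>Differentiating the logarithm produces \<open>J_red n t / t\<close>. Its pole is the last summand of the finite
  part of the next order, and its regular part accounts for the increments of the Digamma values.\<close>

lemma DERIV_Y_red:
  assumes "t > 0"
  shows "(Y_red n has_real_derivative - Y_red (Suc n) t) (at t)"
proof -
  have "(Y_red n has_real_derivative
     (1 / t * J_red n t + ln t * (- J_red (Suc n) t)) - (- Y_polar (Suc n) t + 1 / (fact n * t))
     - (- Y_tail (Suc n) t + (J_red n t - 1 / fact n) / t)) (at t)"
    unfolding Y_red_def[abs_def] using assms
    by (auto intro!: derivative_eq_intros DERIV_J_red DERIV_Y_polar DERIV_Y_tail simp: field_simps)
  thus ?thesis
    by (rule DERIV_cong) (use assms in \<open>simp add: Y_red_def field_simps\<close>)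
qed

lemma J_red_rec0: "J_red 1 t - t * J_red 2 t = J_red 0 t"
proof -
  have s: "(\<lambda>k. bessel_coeff n k * t ^ k) sums J_red n t" for n
    unfolding J_red_def by (rule summable_sums[OF summable_bessel_coeff])
  have "(\<lambda>k. t * (bessel_coeff 2 k * t ^ k)) sums (t * J_red 2 t)" by (intro sums_mult s)
  hence "(\<lambda>k. if k = 0 then 0 else t * (bessel_coeff 2 (k-1) * t ^ (k-1))) sums (t * J_red 2 t)"
    by - (rule sums_Suc_imp, simp_all)
  from sums_diff[OF s[of 1] this]
  have "(\<lambda>k. bessel_coeff 1 k * t ^ k - (if k = 0 then 0 else t * (bessel_coeff 2 (k-1) * t ^ (k-1))))
     sums (J_red 1 t - t * J_red 2 t)" .
  also have "(\<lambda>k. bessel_coeff 1 k * t ^ k - (if k = 0 then 0 else t * (bessel_coeff 2 (k-1) * t ^ (k-1))))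
     = (\<lambda>k. bessel_coeff 0 k * t ^ k)" (is "?l = ?r")
  proof
    fix k show "?l k = ?r k"
    proof (cases k)
      case (Suc j)
      have "bessel_coeff 1 (Suc j) - bessel_coeff 2 j = bessel_coeff 0 (Suc j)"
        by (simp add: bessel_coeff_def divide_simps) (simp add: algebra_simps)
      thus ?thesis using Suc by (simp add: algebra_simps flip: distrib_right)
    qed (simp add: bessel_coeff_def)
  qed
  finally show ?thesis using s[of 0] sums_unique2 by blast
qed

text \<open>The stray \<open>1\<close> compensates the recurrence of the finite part; it stems from the increment
  \<open>1 / (k + 1)\<close> of the Digamma function.\<close>

lemma Y_tail_rec0: "Y_tail 1 t - t * Y_tail 2 t = Y_tail 0 t + 1"
proof -
  have s: "(\<lambda>k. digamma_coeff n k * t ^ k) sums Y_tail n t" for n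
    unfolding Y_tail_def by (rule summable_sums[OF summable_digamma_coeff])
  have "(\<lambda>k. t * (digamma_coeff 2 k * t ^ k)) sums (t * Y_tail 2 t)" by (intro sums_mult s)
  hence "(\<lambda>k. if k = 0 then 0 else t * (digamma_coeff 2 (k-1) * t ^ (k-1))) sums (t * Y_tail 2 t)"
    by - (rule sums_Suc_imp, simp_all)
  from sums_diff[OF s[of 1] this]
  have "(\<lambda>k. digamma_coeff 1 k * t ^ k - (if k = 0 then 0 else t * (digamma_coeff 2 (k-1) * t ^ (k-1))))
     sums (Y_tail 1 t - t * Y_tail 2 t)" .
  also have "(\<lambda>k. digamma_coeff 1 k * t ^ k - (if k = 0 then 0 else t * (digamma_coeff 2 (k-1) * t ^ (k-1))))
     = (\<lambda>k. digamma_coeff 0 k * t ^ k + (if k = 0 then 1 else 0))" (is "?l = ?r")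
  proof
    fix k show "?l k = ?r k"
    proof (cases k)
      case 0
      thus ?thesis using Digamma_Suc[of 0] by (simp add: digamma_coeff_def bessel_coeff_def)
    next
      case (Suc j)
      define d where "d = Digamma (real j + 1)"
      have d1: "Digamma (real j + 2) = d + 1 / (real j + 1)"
        using Digamma_Suc[of j] by (simp add: d_def add_ac)
      have d2: "Digamma (real j + 3) = d + 1 / (real j + 1) + 1 / (real j + 2)"
        using Digamma_Suc[of "Suc j"] d1 by (simp add: add_ac)
      have "digamma_coeff 1 (Suc j) - digamma_coeff 2 j = digamma_coeff 0 (Suc j)"
        by (simp add: digamma_coeff_def bessel_coeff_def d1 d2 add_ac flip: d_def)
          (simp add: divide_simps, simp add: algebra_simps d_def)
      thus ?thesis using Suc by (simp add: algebra_simps flip: distrib_right)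
    qed
  qed
  finally have A: "(\<lambda>k. digamma_coeff 0 k * t ^ k + (if k = 0 then 1 else 0)) sums (Y_tail 1 t - t * Y_tail 2 t)" .
  have B: "(\<lambda>k. digamma_coeff 0 k * t ^ k + (if k = 0 then 1 else 0)) sums (Y_tail 0 t + 1)"
    by (intro sums_add s) (use sums_single[of 0 "\<lambda>_. 1::real"] in simp)
  from sums_unique2[OF A B] show ?thesis .
qed

lemma Y_red_rec0:
  assumes "t > 0"
  shows "Y_red 1 t - t * Y_red 2 t = Y_red 0 t"
proof -
  have p: "Y_polar 0 t = 0" "Y_polar 1 t = 1 / t" "t * Y_polar 2 t = 1 / t + 1"
    using assms by (simp_all add: Y_polar_def lessThan_nat_numeral lessThan_Suc power_int_minus field_simps
        eval_nat_numeral)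
  have "Y_red 1 t - t * Y_red 2 t = ln t * (J_red 1 t - t * J_red 2 t) - (Y_polar 1 t - t * Y_polar 2 t)
     - (Y_tail 1 t - t * Y_tail 2 t)"
    unfolding Y_red_def by (simp add: algebra_simps)
  thus ?thesis unfolding J_red_rec0 Y_tail_rec0 p(2,3) by (simp add: Y_red_def p(1))
qed

text \<open>Both families satisfy \<open>f\<^sub>n' = - f\<^sub>n\<^sub>+\<^sub>1\<close>, so differentiating the three-term relation for one
  index gives it for the next.\<close>

lemma red_recurrence:
  fixes f :: "nat \<Rightarrow> real \<Rightarrow> real"
  assumes d: "\<And>n t. t > 0 \<Longrightarrow> (f n has_real_derivative - f (Suc n) t) (at t)"
    and 0: "\<And>t. t > 0 \<Longrightarrow> f 1 t - t * f 2 t = f 0 t"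
    and "t > 0"
  shows "real (Suc n) * f (Suc n) t - t * f (Suc (Suc n)) t = f n t"
  using \<open>t > 0\<close>
proof (induction n arbitrary: t)
  case 0
  thus ?case using assms(2) by (simp add: eval_nat_numeral)
next
  case (Suc n)
  have "((\<lambda>t. real (Suc n) * f (Suc n) t - t * f (Suc (Suc n)) t) has_real_derivative
     real (Suc n) * (- f (Suc (Suc n)) t) - (1 * f (Suc (Suc n)) t + (- f (Suc (Suc (Suc n))) t) * t)) (at t)"
    by (intro DERIV_diff DERIV_cmult DERIV_mult d DERIV_ident Suc.prems)
  moreover have "((\<lambda>t. real (Suc n) * f (Suc n) t - t * f (Suc (Suc n)) t) has_real_derivative
      - f (Suc n) t) (at t)"
    by (rule has_field_derivative_transform_within_open[OF d[OF Suc.prems], of "{0<..}"]) (use Suc in auto) 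
  ultimately have "real (Suc n) * (- f (Suc (Suc n)) t) - (1 * f (Suc (Suc n)) t + (- f (Suc (Suc (Suc n))) t) * t) = - f (Suc n) t"
    by (rule DERIV_unique)
  thus ?case by (simp add: algebra_simps)
qed

section \<open>Hankel functions: derivatives, recurrence and Wronskian\<close>

lemma power_split: "(s::real) ^ (2 * k + n) = s ^ n * (s\<^sup>2) ^ k"
  by (simp add: power_add power_mult)

lemma bessel_J_red: "bessel_J n x = (x / 2) ^ n * J_red n ((x / 2)\<^sup>2)"
proof -
  have "bessel_J n x = (\<Sum>k. (x / 2) ^ n * (bessel_coeff n k * ((x / 2)\<^sup>2) ^ k))"
    unfolding bessel_J_def bessel_coeff_def power_split by (simp add: mult_ac)
  also have "\<dots> = (x / 2) ^ n * J_red n ((x / 2)\<^sup>2)"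
    unfolding J_red_def by (rule suminf_mult[OF summable_bessel_coeff])
  finally show ?thesis .
qed

lemma bessel_Y_red:
  assumes "x > 0"
  shows "bessel_Y n x = (x / 2) ^ n * (Y_red n ((x / 2)\<^sup>2) / pi)"
proof -
  define s where "s = x / 2"
  have s: "s > 0" using assms by (simp add: s_def)
  have a: "(\<Sum>k. (Digamma (of_nat (k + 1)) + Digamma (of_nat (n + k + 1)))
             * (-1) ^ k / (fact k * fact (n + k)) * s ^ (2 * k + n)) = s ^ n * Y_tail n (s\<^sup>2)"
  proof -
    have "(\<Sum>k. (Digamma (of_nat (k + 1)) + Digamma (of_nat (n + k + 1)))
             * (-1) ^ k / (fact k * fact (n + k)) * s ^ (2 * k + n))
        = (\<Sum>k. s ^ n * (digamma_coeff n k * (s\<^sup>2) ^ k))"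
      unfolding digamma_coeff_def bessel_coeff_def power_split by (simp add: mult_ac)
    also have "\<dots> = s ^ n * Y_tail n (s\<^sup>2)"
      unfolding Y_tail_def by (rule suminf_mult[OF summable_digamma_coeff])
    finally show ?thesis .
  qed
  have b: "(\<Sum>k<n. fact (n - k - 1) / fact k * s ^ (2 * k) / s ^ n) = s ^ n * Y_polar n (s\<^sup>2)"
    unfolding Y_polar_def sum_distrib_left
  proof (rule sum.cong)
    fix k
    have "(s\<^sup>2) powi (int k - int n) = s ^ (2 * k) / s ^ (2 * n)"
      using s by (simp add: power_int_diff power_mult)
    thus "fact (n - k - 1) / fact k * s ^ (2 * k) / s ^ n =
        s ^ n * (fact (n - k - 1) / fact k * (s\<^sup>2) powi (int k - int n))"
      using s by (simp add: field_simps power_mult power2_eq_square power_mult_distrib)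
  qed simp
  have c: "ln (s\<^sup>2) = 2 * ln s" using s by (simp add: ln_realpow)
  show ?thesis unfolding bessel_Y_def Y_red_def s_def[symmetric] a b c bessel_J_red
    by (simp add: algebra_simps diff_divide_distrib add_divide_distrib)
qed

lemma DERIV_from_red:
  fixes f :: "nat \<Rightarrow> real \<Rightarrow> real"
  assumes d: "\<And>n t. t > 0 \<Longrightarrow> (f n has_real_derivative - f (Suc n) t) (at t)" and "x > 0"
  shows "((\<lambda>x. (x / 2) ^ n * f n ((x / 2)\<^sup>2)) has_real_derivative
     n / x * ((x / 2) ^ n * f n ((x / 2)\<^sup>2)) - (x / 2) ^ Suc n * f (Suc n) ((x / 2)\<^sup>2)) (at x)"
proof -
  have 1: "((\<lambda>x. f n ((x / 2)\<^sup>2)) has_real_derivative - f (Suc n) ((x / 2)\<^sup>2) * (x / 2)) (at x)"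
    by (rule DERIV_chain2[OF d]) (use assms in \<open>auto intro!: derivative_eq_intros\<close>)
  have 2: "((\<lambda>x. (x / 2) ^ n) has_real_derivative n / x * (x / 2) ^ n) (at x)"
  proof (cases n)
    case (Suc m)
    have "((\<lambda>x. (x / 2) ^ Suc m) has_real_derivative of_nat (Suc m) * (1 / 2 * (x / 2) ^ (Suc m - Suc 0))) (at x)"
      by (intro DERIV_power DERIV_cdivide DERIV_ident)
    thus ?thesis unfolding Suc by (rule DERIV_cong) (use assms in simp)
  qed simp
  show ?thesis
    by (rule DERIV_cong[OF DERIV_mult[OF 2 1]]) (use assms in \<open>simp add: field_simps\<close>)
qed

lemma DERIV_bessel_J:
  assumes "x > 0"
  shows "(bessel_J n has_real_derivative n / x * bessel_J n x - bessel_J (Suc n) x) (at x)"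
  using DERIV_from_red[of J_red x n, OF DERIV_J_red assms]
  unfolding bessel_J_red[symmetric] .

lemma DERIV_bessel_Y:
  assumes "x > 0"
  shows "(bessel_Y n has_real_derivative n / x * bessel_Y n x - bessel_Y (Suc n) x) (at x)"
proof -
  have "((\<lambda>x. (x / 2) ^ n * (Y_red n ((x / 2)\<^sup>2) / pi)) has_real_derivative
     n / x * bessel_Y n x - bessel_Y (Suc n) x) (at x)"
    unfolding bessel_Y_red[OF assms]
    by (rule DERIV_from_red[of "\<lambda>n t. Y_red n t / pi" x n, OF _ assms])
       (auto intro!: derivative_eq_intros DERIV_Y_red)
  thus ?thesis
    by (rule has_field_derivative_transform_within_open[of _ _ _ "{0<..}"])
       (use assms in \<open>auto simp: bessel_Y_red\<close>)
qed

lemma rec_from_red: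
  fixes f :: "nat \<Rightarrow> real \<Rightarrow> real"
  assumes r: "\<And>n t. t > 0 \<Longrightarrow> real (Suc n) * f (Suc n) t - t * f (Suc (Suc n)) t = f n t" and "x > 0"
  shows "(x / 2) ^ Suc (Suc n) * f (Suc (Suc n)) ((x / 2)\<^sup>2) =
     2 * real (Suc n) / x * ((x / 2) ^ Suc n * f (Suc n) ((x / 2)\<^sup>2)) - (x / 2) ^ n * f n ((x / 2)\<^sup>2)"
  unfolding r[of "(x / 2)\<^sup>2" n, symmetric, OF zero_less_power[OF half_gt_zero[OF assms(2)]]]
  using assms(2) by (simp add: field_simps power2_eq_square)

lemma bessel_J_rec:
  assumes "x > 0"
  shows "bessel_J (Suc (Suc n)) x = 2 * real (Suc n) / x * bessel_J (Suc n) x - bessel_J n x"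
  unfolding bessel_J_red
  by (rule rec_from_red[OF _ assms], rule red_recurrence[of J_red]) (use DERIV_J_red J_red_rec0 in auto)

lemma bessel_Y_rec:
  assumes "x > 0"
  shows "bessel_Y (Suc (Suc n)) x = 2 * real (Suc n) / x * bessel_Y (Suc n) x - bessel_Y n x"
  unfolding bessel_Y_red[OF assms]
proof (rule rec_from_red[where f = "\<lambda>n t. Y_red n t / pi", OF _ assms])
  fix n and t :: real assume "t > 0"
  hence "real (Suc n) * Y_red (Suc n) t - t * Y_red (Suc (Suc n)) t = Y_red n t"
    by (intro red_recurrence[of Y_red]) (use DERIV_Y_red Y_red_rec0 in auto)
  from arg_cong[OF this, of "\<lambda>z. z / pi"]
  show "real (Suc n) * (Y_red (Suc n) t / pi) - t * (Y_red (Suc (Suc n)) t / pi) = Y_red n t / pi"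
    by (simp add: diff_divide_distrib)
qed

text \<open>The logarithms cancel in the Wronskian of order zero, which is therefore a continuous function
  up to the origin, where it can be read off.\<close>

lemma wronskian_0:
  assumes "x > 0"
  shows "bessel_J 1 x * bessel_Y 0 x - bessel_J 0 x * bessel_Y 1 x = 2 / (pi * x)"
proof -
  define W where "W t = J_red 0 t - t * J_red 1 t * Y_tail 0 t + t * J_red 0 t * Y_tail 1 t" for t
  have W: "W t = t * J_red 1 t * Y_red 0 t - J_red 0 t * (t * Y_red 1 t)" if "t > 0" for t
    using that by (simp add: W_def Y_red_def Y_polar_def power_int_minus algebra_simps)
  define t where "t = (x / 2)\<^sup>2"
  have t: "t > 0" using assms by (simp add: t_def)
  have cont: "isCont (Y_tail n) t" for n t
    unfolding Y_tail_def[abs_def]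
    by (rule DERIV_isCont, rule termdiffs_strong_converges_everywhere, rule summable_digamma_coeff)
  have contY: "continuous_on S (Y_tail n)" for n S
    by (intro continuous_at_imp_continuous_on ballI cont)
  have contJ: "continuous_on S (J_red n)" for n S
    by (intro continuous_at_imp_continuous_on ballI DERIV_isCont[OF DERIV_J_red])
  have "W t = W 0"
  proof (rule DERIV_isconst_end[where f = W])
    show "continuous_on {0..t} W" unfolding W_def[abs_def]
      by (intro continuous_intros contY contJ)
    fix z assume z: "0 < z" "z < t"
    have j: "z * J_red 2 z = J_red 1 z - J_red 0 z" using J_red_rec0[of z] by simp
    have y: "z * Y_red 2 z = Y_red 1 z - Y_red 0 z" using Y_red_rec0[of z] z by simp
    have s: "Suc 0 = 1" "Suc 1 = 2" by auto
    have "((\<lambda>t. t * J_red 1 t * Y_red 0 t - J_red 0 t * (t * Y_red 1 t)) has_real_derivative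
       (1 * J_red 1 z + (- J_red 2 z) * z) * Y_red 0 z + (- Y_red 1 z) * (z * J_red 1 z)
       - ((- J_red 1 z) * (z * Y_red 1 z) + (1 * Y_red 1 z + (- Y_red 2 z) * z) * J_red 0 z)) (at z)"
      using DERIV_J_red[of 0 z] DERIV_J_red[of 1 z] DERIV_Y_red[of z 0] DERIV_Y_red[of z 1] z
      unfolding s by (intro DERIV_diff DERIV_mult DERIV_ident) auto
    also have "(1 * J_red 1 z + (- J_red 2 z) * z) * Y_red 0 z + (- Y_red 1 z) * (z * J_red 1 z)
       - ((- J_red 1 z) * (z * Y_red 1 z) + (1 * Y_red 1 z + (- Y_red 2 z) * z) * J_red 0 z) = 0"
      using j y by algebra
    finally show "(W has_real_derivative 0) (at z)"
      by (rule has_field_derivative_transform_within_open[of _ _ _ "{0<..}"]) (use z W in auto)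
  qed (use t in auto)
  also have "W 0 = 1"
    unfolding W_def J_red_def powser_zero by (simp add: bessel_coeff_def)
  finally have "t * J_red 1 t * Y_red 0 t - J_red 0 t * (t * Y_red 1 t) = 1"
    using W[OF t] by simp
  moreover have "bessel_J 1 x * bessel_Y 0 x - bessel_J 0 x * bessel_Y 1 x =
      (t * J_red 1 t * Y_red 0 t - J_red 0 t * (t * Y_red 1 t)) * 2 / (pi * x)"
    unfolding bessel_J_red bessel_Y_red[OF assms] t_def using assms
    by (simp add: field_simps power2_eq_square)
  ultimately show ?thesis by simp
qed

lemma wronskian:
  assumes "x > 0"
  shows "bessel_J (Suc n) x * bessel_Y n x - bessel_J n x * bessel_Y (Suc n) x = 2 / (pi * x)"
proof (induction n)
  case 0
  thus ?case using wronskian_0[OF assms] by simp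
next
  case (Suc n)
  thus ?case unfolding bessel_J_rec[OF assms, of n] bessel_Y_rec[OF assms, of n]
    by (simp add: algebra_simps)
qed

lemma Re_hankel1 [simp]: "Re (hankel1 n x) = bessel_J n x"
  and Im_hankel1 [simp]: "Im (hankel1 n x) = bessel_Y n x"
  by (simp_all add: hankel1_def)

text \<open>Given by the derivative formula instead of as a limit, so that it is available as a closed
  expression.\<close>

definition hankel1' :: "nat \<Rightarrow> real \<Rightarrow> complex" where
  "hankel1' n x = of_real (n / x) * hankel1 n x - hankel1 (Suc n) x"

lemma hankel1_deriv:
  assumes "x > 0"
  shows "(hankel1 n has_vector_derivative hankel1' n x) (at x)"
  unfolding has_vector_derivative_complex_iff hankel1'_def
  using DERIV_bessel_J[OF assms, of n] DERIV_bessel_Y[OF assms, of n] by simp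

lemma hankel1_rec:
  assumes "x > 0"
  shows "hankel1 (Suc (Suc n)) x = of_real (2 * real (Suc n) / x) * hankel1 (Suc n) x - hankel1 n x"
  using bessel_J_rec[OF assms, of n] bessel_Y_rec[OF assms, of n] by (simp add: complex_eq_iff)

lemma hankel1'_Suc:
  assumes "x > 0"
  shows "hankel1' (Suc n) x = hankel1 n x - of_real (real (Suc n) / x) * hankel1 (Suc n) x"
  unfolding hankel1'_def hankel1_rec[OF assms] by (simp add: algebra_simps)

text \<open>The energy flux of an outgoing mode; its positivity yields both the uniqueness of outgoing
  solutions and the solvability of the boundary systems.\<close>

lemma Im_cnj_hankel1:
  assumes "x > 0"
  shows "Im (cnj (hankel1 n x) * hankel1' n x) = 2 / (pi * x)"
  using wronskian[OF assms, of n] by (simp add: hankel1'_def algebra_simps)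

section \<open>Solutions of Bessel's equation\<close>

lemma hankel1_'_deriv:
  assumes "x > 0"
  shows "(hankel1' n has_vector_derivative
     - hankel1' n x / x - (1 - of_real ((n / x)\<^sup>2)) * hankel1 n x) (at x)"
proof -
  have 1: "((\<lambda>x. complex_of_real (n / x)) has_vector_derivative of_real (- n / x\<^sup>2)) (at x)"
    by (rule has_vector_derivative_of_real)
      (use assms in \<open>auto intro!: derivative_eq_intros simp: power2_eq_square\<close>)
  have "((\<lambda>x. of_real (n / x) * hankel1 n x - hankel1 (Suc n) x) has_vector_derivative
     of_real (n / x) * hankel1' n x + of_real (- n / x\<^sup>2) * hankel1 n x - hankel1' (Suc n) x) (at x)"
    by (intro has_vector_derivative_diff has_vector_derivative_mult 1 hankel1_deriv assms)
  hence "(hankel1' n has_vector_derivative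
     of_real (n / x) * hankel1' n x + of_real (- n / x\<^sup>2) * hankel1 n x - hankel1' (Suc n) x) (at x)"
    by (simp add: hankel1'_def[abs_def])
  moreover have "of_real (n / x) * hankel1' n x + of_real (- n / x\<^sup>2) * hankel1 n x - hankel1' (Suc n) x
      = - hankel1' n x / x - (1 - of_real ((n / x)\<^sup>2)) * hankel1 n x"
    unfolding hankel1'_Suc[OF assms] unfolding hankel1'_def using assms
    by (simp add: field_simps power2_eq_square)
  ultimately show ?thesis by simp
qed

text \<open>A solution together with its derivative, on the half-line to the right of \<open>a\<close>.\<close>

definition bessel_solution :: "nat \<Rightarrow> real \<Rightarrow> (real \<Rightarrow> complex) \<Rightarrow> (real \<Rightarrow> complex) \<Rightarrow> bool" where
  "bessel_solution n a f d \<longleftrightarrow> (\<forall>x>a. (f has_vector_derivative d x) (at x) \<and>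
     (d has_vector_derivative - d x / x - (1 - of_real ((n / x)\<^sup>2)) * f x) (at x))"

lemma bessel_solution_hankel1: "a \<ge> 0 \<Longrightarrow> bessel_solution n a (hankel1 n) (hankel1' n)"
  unfolding bessel_solution_def using hankel1_deriv hankel1_'_deriv by auto

lemma has_vector_derivative_cnj:
  "(f has_vector_derivative d) (at x) \<Longrightarrow> ((\<lambda>x. cnj (f x)) has_vector_derivative cnj d) (at x)"
  using bounded_linear.has_vector_derivative[OF bounded_linear_cnj] .

lemma bessel_solution_cnj:
  "bessel_solution n a f d \<Longrightarrow> bessel_solution n a (\<lambda>x. cnj (f x)) (\<lambda>x. cnj (d x))"
  unfolding bessel_solution_def
proof (intro allI impI conjI)
  fix x assume *: "\<forall>x>a. (f has_vector_derivative d x) (at x) \<and>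
     (d has_vector_derivative - d x / x - (1 - of_real ((n / x)\<^sup>2)) * f x) (at x)" and "x > a"
  show "((\<lambda>x. cnj (f x)) has_vector_derivative cnj (d x)) (at x)"
    using * \<open>x > a\<close> by (intro has_vector_derivative_cnj) auto
  have "((\<lambda>x. cnj (d x)) has_vector_derivative cnj (- d x / x - (1 - of_real ((n / x)\<^sup>2)) * f x)) (at x)"
    using * \<open>x > a\<close> by (intro has_vector_derivative_cnj) auto
  thus "((\<lambda>x. cnj (d x)) has_vector_derivative
      - cnj (d x) / x - (1 - of_real ((n / x)\<^sup>2)) * cnj (f x)) (at x)" by simp
qed

lemma bessel_solution_wronskian:
  assumes f: "bessel_solution n a f df" and g: "bessel_solution n a g dg" and "a \<ge> 0"
  obtains w where "\<And>x. x > a \<Longrightarrow> of_real x * (f x * dg x - df x * g x) = w"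
proof -
  have "\<exists>w. \<forall>x\<in>{a<..}. of_real x * (f x * dg x - df x * g x) = w"
  proof (rule has_vector_derivative_zero_constant)
    fix x assume "x \<in> {a<..}"
    hence x: "x > a" "x > 0" using \<open>a \<ge> 0\<close> by auto
    have i: "((\<lambda>x. complex_of_real x) has_vector_derivative 1) (at x)"
      using has_vector_derivative_of_real[OF DERIV_ident] by simp
    define f2 where "f2 = - df x / x - (1 - of_real ((n / x)\<^sup>2)) * f x"
    define g2 where "g2 = - dg x / x - (1 - of_real ((n / x)\<^sup>2)) * g x"
    have d: "(f has_vector_derivative df x) (at x)" "(df has_vector_derivative f2) (at x)"
      "(g has_vector_derivative dg x) (at x)" "(dg has_vector_derivative g2) (at x)"
      using f g x unfolding bessel_solution_def f2_def g2_def by auto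
    have "((\<lambda>x. of_real x * (f x * dg x - df x * g x)) has_vector_derivative
       of_real x * ((f x * g2 + df x * dg x) - (df x * dg x + f2 * g x)) + 1 * (f x * dg x - df x * g x)) (at x)"
      by (intro has_vector_derivative_diff has_vector_derivative_mult i d)
    also have "of_real x * ((f x * g2 + df x * dg x) - (df x * dg x + f2 * g x)) + 1 * (f x * dg x - df x * g x) = 0"
      unfolding f2_def g2_def using x by (simp add: field_simps)
    finally show "((\<lambda>x. of_real x * (f x * dg x - df x * g x)) has_vector_derivative 0) (at x within {a<..})"
      by (rule has_vector_derivative_at_within)
  qed (simp, blast)
  thus ?thesis using that by auto
qed

text \<open>The Hankel function and its conjugate form a fundamental system: their Wronskian does not vanish.\<close>

lemma bessel_solution_rep:
  assumes f: "bessel_solution n a f d" and "a \<ge> 0"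
  obtains \<alpha> \<beta> where
    "\<And>x. x > a \<Longrightarrow> f x = \<alpha> * hankel1 n x + \<beta> * cnj (hankel1 n x)"
    "\<And>x. x > a \<Longrightarrow> d x = \<alpha> * hankel1' n x + \<beta> * cnj (hankel1' n x)"
proof -
  note h = bessel_solution_hankel1[OF \<open>a \<ge> 0\<close>, of n]
  note c = bessel_solution_cnj[OF h]
  obtain w1 where w1: "\<And>x. x > a \<Longrightarrow> of_real x * (f x * cnj (hankel1' n x) - d x * cnj (hankel1 n x)) = w1"
    using bessel_solution_wronskian[OF f c \<open>a \<ge> 0\<close>] by auto
  obtain w2 where w2: "\<And>x. x > a \<Longrightarrow> of_real x * (hankel1 n x * d x - hankel1' n x * f x) = w2"
    using bessel_solution_wronskian[OF h f \<open>a \<ge> 0\<close>] by auto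
  define w where "w = - 4 * \<i> / of_real pi"
  have w0: "w \<noteq> 0" by (simp add: w_def)
  have w: "of_real x * (hankel1 n x * cnj (hankel1' n x) - hankel1' n x * cnj (hankel1 n x)) = w" if "x > a" for x
  proof -
    have "x > 0" using that \<open>a \<ge> 0\<close> by simp
    have "hankel1 n x * cnj (hankel1' n x) - hankel1' n x * cnj (hankel1 n x)
       = - (2 * \<i> * of_real (Im (cnj (hankel1 n x) * hankel1' n x)))"
      by (simp add: complex_eq_iff)
    thus ?thesis unfolding Im_cnj_hankel1[OF \<open>x > 0\<close>] w_def using \<open>x > 0\<close> by simp
  qed
  show ?thesis
  proof
    fix x assume x: "x > a"
    show "f x = w1 / w * hankel1 n x + w2 / w * cnj (hankel1 n x)"
    proof -
      have "f x * w = w1 * hankel1 n x + w2 * cnj (hankel1 n x)"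
        unfolding w[OF x, symmetric] w1[OF x, symmetric] w2[OF x, symmetric] by algebra
      thus ?thesis using w0 by (simp add: field_simps)
    qed
    show "d x = w1 / w * hankel1' n x + w2 / w * cnj (hankel1' n x)"
    proof -
      have "d x * w = w1 * hankel1' n x + w2 * cnj (hankel1' n x)"
        unfolding w[OF x, symmetric] w1[OF x, symmetric] w2[OF x, symmetric] by algebra
      thus ?thesis using w0 by (simp add: field_simps)
    qed
  qed
qed

text \<open>By \<open>H\<^sub>0' = - H\<^sub>1\<close> and \<open>H\<^sub>1' = H\<^sub>0 - H\<^sub>1/x\<close>, the derivative of the left-hand side is
  \<open>- 2 |H\<^sub>1|\<^sup>2 / x\<close>.\<close>

lemma hankel1_energy_mono:
  assumes "0 < x" "x \<le> y"
  shows "(cmod (hankel1 0 y))\<^sup>2 + (cmod (hankel1 1 y))\<^sup>2 \<le> (cmod (hankel1 0 x))\<^sup>2 + (cmod (hankel1 1 x))\<^sup>2"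
proof -
  define E where "E z = (bessel_J 0 z)\<^sup>2 + (bessel_Y 0 z)\<^sup>2 + (bessel_J 1 z)\<^sup>2 + (bessel_Y 1 z)\<^sup>2" for z
  have "E y \<le> E x"
  proof (rule DERIV_nonpos_imp_nonincreasing[OF assms(2)])
    fix z assume z: "x \<le> z" "z \<le> y"
    hence z0: "z > 0" using assms by simp
    have 0: "(bessel_J 0 has_real_derivative - bessel_J 1 z) (at z)"
            "(bessel_Y 0 has_real_derivative - bessel_Y 1 z) (at z)"
      using DERIV_bessel_J[OF z0, of 0] DERIV_bessel_Y[OF z0, of 0] by simp_all
    have 1: "(bessel_J 1 has_real_derivative bessel_J 0 z - bessel_J 1 z / z) (at z)"
            "(bessel_Y 1 has_real_derivative bessel_Y 0 z - bessel_Y 1 z / z) (at z)"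
      using DERIV_bessel_J[OF z0, of 1] DERIV_bessel_Y[OF z0, of 1]
        bessel_J_rec[OF z0, of 0] bessel_Y_rec[OF z0, of 0] by (simp_all add: algebra_simps)
    have "(E has_real_derivative - 2 * ((bessel_J 1 z)\<^sup>2 + (bessel_Y 1 z)\<^sup>2) / z) (at z)"
      unfolding E_def[abs_def] using z0
      by (auto intro!: derivative_eq_intros 0[unfolded One_nat_def] 1[unfolded One_nat_def] simp: field_simps power2_eq_square)
    thus "\<exists>d. (E has_real_derivative d) (at z) \<and> d \<le> 0"
      using z0 by (intro exI conjI) (auto simp: field_simps)
  qed
  thus ?thesis by (simp add: E_def cmod_power2)
qed

text \<open>Orders zero and one are bounded by the monotone energy, higher ones by the recurrence.\<close>

lemma hankel1_bounded:
  assumes "\<delta> > 0"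
  obtains B where "B > 0" "\<And>x. x \<ge> \<delta> \<Longrightarrow> cmod (hankel1 n x) \<le> B"
proof -
  define B0 where "B0 = sqrt ((cmod (hankel1 0 \<delta>))\<^sup>2 + (cmod (hankel1 1 \<delta>))\<^sup>2)"
  have b: "cmod (hankel1 0 x) \<le> B0" "cmod (hankel1 1 x) \<le> B0" if "x \<ge> \<delta>" for x
    using hankel1_energy_mono[OF assms that] unfolding B0_def
    by (auto intro!: real_le_rsqrt intro: order_trans[rotated])
  have "\<exists>B. \<forall>x\<ge>\<delta>. cmod (hankel1 n x) \<le> B \<and> cmod (hankel1 (Suc n) x) \<le> B"
  proof (induction n)
    case 0
    thus ?case using b by auto
  next
    case (Suc n)
    then obtain B where B: "\<And>x. x \<ge> \<delta> \<Longrightarrow> cmod (hankel1 n x) \<le> B \<and> cmod (hankel1 (Suc n) x) \<le> B" by auto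
    have B0: "B \<ge> 0" using B[of \<delta>] norm_ge_zero order_trans by blast
    have "cmod (hankel1 (Suc (Suc n)) x) \<le> 2 * real (Suc n) / \<delta> * B + B" if x: "x \<ge> \<delta>" for x
    proof -
      have x0: "x > 0" using x assms by simp
      have "cmod (hankel1 (Suc (Suc n)) x) \<le> 2 * real (Suc n) / x * cmod (hankel1 (Suc n) x) + cmod (hankel1 n x)"
        unfolding hankel1_rec[OF x0] using x0
        by (intro order_trans[OF norm_triangle_ineq4]) (simp add: norm_mult norm_divide del: of_nat_Suc)
      also have "\<dots> \<le> 2 * real (Suc n) / \<delta> * B + B"
        using B[OF x] x assms B0 by (intro add_mono mult_mono divide_left_mono) auto
      finally show ?thesis .
    qed
    moreover have "B \<le> 2 * real (Suc n) / \<delta> * B + B" using assms B0 by simp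
    ultimately show ?case using B by (intro exI[of _ "2 * real (Suc n) / \<delta> * B + B"]) (meson order_trans)
  qed
  then obtain B where B: "\<forall>x\<ge>\<delta>. cmod (hankel1 n x) \<le> B" by blast
  show ?thesis by (rule that[of "max B 1"]) (use B in \<open>auto simp: le_max_iff_disj\<close>)
qed

lemma has_vector_derivative_quadratic:
  fixes f :: "real \<Rightarrow> 'b::real_normed_vector"
  assumes "\<delta> > 0" and q: "\<And>h. \<bar>h\<bar> < \<delta> \<Longrightarrow> norm (f (x + h) - f x - h *\<^sub>R d) \<le> C * h\<^sup>2"
  shows "(f has_vector_derivative d) (at x)"
  unfolding has_vector_derivative_def has_derivative_at
proof (intro conjI bounded_linear_scaleR_left)
  show "(\<lambda>h. norm (f (x + h) - f x - h *\<^sub>R d) / norm h) \<midarrow>0\<rightarrow> 0"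
  proof (rule Lim_null_comparison)
    show "\<forall>\<^sub>F h in at 0. norm (norm (f (x + h) - f x - h *\<^sub>R d) / norm h) \<le> C * \<bar>h\<bar>"
      unfolding eventually_at
    proof (intro exI[of _ \<delta>] conjI ballI impI)
      fix h :: real assume "h \<noteq> 0 \<and> dist h 0 < \<delta>"
      thus "norm (norm (f (x + h) - f x - h *\<^sub>R d) / norm h) \<le> C * \<bar>h\<bar>"
        using q[of h] by (simp add: divide_le_eq power2_eq_square abs_mult_self_eq mult.assoc)
    qed (use assms in auto)
    show "(\<lambda>h::real. C * \<bar>h\<bar>) \<midarrow>0\<rightarrow> 0" by (auto intro!: tendsto_eq_intros)
  qed
qed

section \<open>Integration on the half-line\<close>

lemma integrable_powr_exp:
  assumes "a > -1" "x > 0"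
  shows "set_integrable lborel {0<..} (\<lambda>s::real. s powr a * exp (- (x * s)))"
proof -
  have "set_integrable lebesgue {0<..} (\<lambda>t. complex_of_real t powr (of_real (a + 1) - 1) / of_real (exp (x * t)))"
    using absolutely_integrable_Gamma_integral[of "of_real (a + 1)" x] assms by simp
  from set_integrable_norm[OF this]
  have "integrable lebesgue (\<lambda>t. indicator {0<..} t *\<^sub>R norm (complex_of_real t powr (of_real (a + 1) - 1) / of_real (exp (x * t))))"
    by (simp add: set_integrable_def)
  also have "(\<lambda>t. indicator {0<..} t *\<^sub>R norm (complex_of_real t powr (of_real (a + 1) - 1) / of_real (exp (x * t))))
     = (\<lambda>t. indicator {0<..} t *\<^sub>R (t powr a * exp (- (x * t))))"
    by (auto simp: indicator_def norm_divide norm_powr_real_powr exp_minus field_simps fun_eq_iff)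
  finally show ?thesis unfolding set_integrable_def
    by (subst (asm) integrable_completion) auto
qed

lemma integrable_dominated_cont:
  fixes f :: "real \<Rightarrow> complex" and g :: "real \<Rightarrow> real"
  assumes "continuous_on {0<..} f" "set_integrable lborel {0<..} g"
    and "\<And>s. s > 0 \<Longrightarrow> norm (f s) \<le> g s"
  shows "set_integrable lborel {0<..} f"
proof (rule set_integrable_bound[OF assms(2)])
  show "set_borel_measurable lborel {0<..} f"
    unfolding set_borel_measurable_def
    using borel_measurable_continuous_on_indicator[OF _ assms(1)] by simp
  show "AE x in lborel. x \<in> {0<..} \<longrightarrow> norm (f x) \<le> norm (g x)"
    using assms(3) by (auto intro: order_trans[OF _ abs_ge_self])
qed

lemma norm_set_integral_le:
  fixes f :: "real \<Rightarrow> complex" and g :: "real \<Rightarrow> real"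
  assumes "set_integrable lborel {0<..} f" "set_integrable lborel {0<..} g"
    and "\<And>s. s > 0 \<Longrightarrow> norm (f s) \<le> g s"
  shows "norm (LBINT s:{0<..}. f s) \<le> (LBINT s:{0<..}. g s)"
  unfolding set_lebesgue_integral_def
  by (rule Bochner_Integration.integral_norm_bound_integral)
     (use assms in \<open>auto simp: set_integrable_def indicator_def\<close>)

lemma half_line_FTC:
  fixes f F :: "real \<Rightarrow> complex"
  assumes "\<And>s. s > 0 \<Longrightarrow> (F has_vector_derivative f s) (at s)" "continuous_on {0<..} f"
    and "set_integrable lborel {0<..} f"
    and "(F \<longlongrightarrow> A) (at_right 0)" "(F \<longlongrightarrow> B) at_top"
  shows "(LBINT s:{0<..}. f s) = B - A"
proof -
  have "(LBINT s=0..\<infinity>. f s) = B - A"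
  proof (rule interval_integral_FTC_integrable)
    fix x :: real assume "(0::ereal) < ereal x"
    hence x: "x > 0" by (simp flip: zero_ereal_def)
    show "(F has_vector_derivative f x) (at x)" by (rule assms(1)[OF x])
    show "isCont f x" using assms(2) x by (simp add: continuous_on_eq_continuous_at)
  next
    have e: "einterval 0 \<infinity> = {0<..}" by (auto simp: einterval_def simp flip: zero_ereal_def)
    show "set_integrable lborel (einterval 0 \<infinity>) f" unfolding e by fact
    show "((F \<circ> real_of_ereal) \<longlongrightarrow> A) (at_right 0)" using assms(4)
      by (simp add: comp_def zero_ereal_def filterlim_def filtermap_filtermap at_right_ereal)
    show "((F \<circ> real_of_ereal) \<longlongrightarrow> B) (at_left \<infinity>)" using assms(5)
      by (simp add: comp_def filterlim_def filtermap_filtermap at_left_PInf)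
  qed auto
  thus ?thesis unfolding zero_ereal_def interval_integral_to_infinity_eq .
qed

section \<open>The kernel of the Laplace integral\<close>

text \<open>Substituting \<open>t = 1 + i s\<close> in the integral of \<open>exp (i x t) (t\<^sup>2 - 1)\<^sup>-\<^sup>1\<^sup>/\<^sup>2\<close> over \<open>t \<ge> 1\<close> and
  rotating the contour turns \<open>H\<^sub>0(x)\<close> into
  \<open>2/\<pi> exp (i x)\<close> times the Laplace transform of \<open>(2 i s - s\<^sup>2)\<^sup>-\<^sup>1\<^sup>/\<^sup>2\<close>. The kernel is \<open>Ds\<close>, and
  \<open>Ls\<close> is a primitive of \<open>i Ds\<close>.\<close>

definition Qs :: "real \<Rightarrow> complex" where "Qs s = csqrt (Complex (- (s\<^sup>2)) (2 * s))"
definition Ds :: "real \<Rightarrow> complex" where "Ds s = 1 / Qs s"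
definition Ls :: "real \<Rightarrow> complex" where "Ls s = Ln (1 + \<i> * s + Qs s)"

lemma Qs_square: "(Qs s)\<^sup>2 = Complex (- (s\<^sup>2)) (2 * s)"
  by (simp add: Qs_def)

lemma Re_Qs: "Re (Qs s) \<ge> 0"
  unfolding Qs_def by (rule Re_csqrt)

lemma Im_Qs: "s > 0 \<Longrightarrow> Im (Qs s) \<ge> 0"
  by (simp add: Qs_def)

lemma cmod_Qs_square: "s > 0 \<Longrightarrow> (cmod (Qs s))\<^sup>2 = s * sqrt (s\<^sup>2 + 4)"
proof -
  assume s: "s > 0"
  have "(cmod (Qs s))\<^sup>2 = cmod (Complex (- (s\<^sup>2)) (2 * s))"
    by (simp add: Qs_def)
  also have "\<dots> = sqrt (s\<^sup>2 * (s\<^sup>2 + 4))"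
    by (simp add: complex_norm power_mult_distrib algebra_simps power2_eq_square)
  also have "\<dots> = s * sqrt (s\<^sup>2 + 4)" using s by (simp add: real_sqrt_mult)
  finally show ?thesis .
qed

lemma cmod_Qs_ge: assumes "s > 0" shows "cmod (Qs s) \<ge> sqrt s"
proof -
  have "sqrt (s\<^sup>2 + 4) \<ge> 1" by simp
  hence "s * sqrt (s\<^sup>2 + 4) \<ge> s * 1" using assms by (intro mult_left_mono) auto
  hence "s \<le> (cmod (Qs s))\<^sup>2" using cmod_Qs_square[OF assms] by simp
  thus ?thesis by (intro real_le_lsqrt) auto
qed

lemma cmod_Qs_le: assumes "s > 0" shows "(cmod (Qs s))\<^sup>2 \<le> s * (s + 2)"
proof -
  have "sqrt (s\<^sup>2 + 4) \<le> s + 2" using assms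
    by (intro real_le_lsqrt) (auto simp: power2_eq_square algebra_simps)
  thus ?thesis unfolding cmod_Qs_square[OF assms] using assms by (intro mult_left_mono) auto
qed

lemma cmod_Qs_le': assumes "s > 0" shows "cmod (Qs s) \<le> s + 1"
  by (rule power2_le_imp_le) (use cmod_Qs_le[OF assms] assms in \<open>auto simp: power2_eq_square algebra_simps\<close>)

lemma Qs_nz: "s > 0 \<Longrightarrow> Qs s \<noteq> 0"
  using cmod_Qs_ge[of s] by force

lemma Qs_deriv:
  assumes "s > 0"
  shows "(Qs has_vector_derivative (\<i> - of_real s) * Ds s) (at s)"
proof -
  define w where "w = Complex (- (s\<^sup>2)) (2 * s)"
  have "w \<notin> \<real>\<^sub>\<le>\<^sub>0" using assms by (auto simp: w_def complex_nonpos_Reals_iff)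
  hence "(csqrt has_field_derivative inverse (2 * csqrt w)) (at w)"
    by (rule has_field_derivative_csqrt)
  moreover have "((\<lambda>s. Complex (- (s\<^sup>2)) (2 * s)) has_vector_derivative Complex (- (2 * s)) 2) (at s)"
    unfolding has_vector_derivative_complex_iff by (auto intro!: derivative_eq_intros)
  ultimately have "(csqrt \<circ> (\<lambda>s. Complex (- (s\<^sup>2)) (2 * s)) has_vector_derivative
     Complex (- (2 * s)) 2 * inverse (2 * csqrt w)) (at s)"
    unfolding w_def by (intro field_vector_diff_chain_at)
  moreover have "Complex (- (2 * s)) 2 * inverse (2 * csqrt w) = (\<i> - of_real s) * Ds s"
  proof -
    have "Complex (- (2 * s)) 2 = 2 * (\<i> - of_real s)" by (simp add: complex_eq_iff)
    thus ?thesis by (simp add: Ds_def Qs_def flip: w_def) (simp add: field_simps)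
  qed
  ultimately show ?thesis by (simp add: comp_def Qs_def[abs_def])
qed

lemma cont_Qs: "continuous_on {0<..} Qs"
  by (rule continuous_on_vector_derivative) (use Qs_deriv in \<open>auto intro: has_vector_derivative_at_within\<close>)

lemma cont_Ds: "continuous_on {0<..} Ds"
  unfolding Ds_def[abs_def] by (intro continuous_intros cont_Qs) (use Qs_nz in auto)

lemma cmod_Ds_le: assumes "s > 0" shows "cmod (Ds s) \<le> s powr (-1/2)"
proof -
  have "cmod (Ds s) \<le> 1 / sqrt s"
    unfolding Ds_def norm_divide norm_one using cmod_Qs_ge[OF assms] assms
    by (intro divide_left_mono) (use Qs_nz[OF assms] in auto)
  thus ?thesis using assms by (simp add: powr_minus powr_half_sqrt divide_simps)
qed

lemma Re_Ls_arg: "Re (1 + \<i> * of_real s + Qs s) \<ge> 1"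
  using Re_Qs[of s] by simp

lemma Ls_arg_nonpos: "1 + \<i> * of_real s + Qs s \<notin> \<real>\<^sub>\<le>\<^sub>0"
  using Re_Ls_arg[of s] by (auto simp: complex_nonpos_Reals_iff)

lemma Ls_deriv:
  assumes "s > 0"
  shows "(Ls has_vector_derivative \<i> * Ds s) (at s)"
proof -
  have i: "((\<lambda>s. complex_of_real s) has_vector_derivative 1) (at s)"
    using has_vector_derivative_of_real[OF DERIV_ident] by simp
  have "((\<lambda>s. 1 + \<i> * of_real s + Qs s) has_vector_derivative (0 + \<i> * 1 + (\<i> - of_real s) * Ds s)) (at s)"
    by (intro has_vector_derivative_add has_vector_derivative_const Qs_deriv assms
        bounded_linear.has_vector_derivative[OF bounded_linear_mult_right] i)
  moreover have "(Ln has_field_derivative inverse (1 + \<i> * of_real s + Qs s)) (at (1 + \<i> * of_real s + Qs s))"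
    by (rule has_field_derivative_Ln[OF Ls_arg_nonpos])
  ultimately have "(Ln \<circ> (\<lambda>s. 1 + \<i> * of_real s + Qs s) has_vector_derivative
     (0 + \<i> * 1 + (\<i> - of_real s) * Ds s) * inverse (1 + \<i> * of_real s + Qs s)) (at s)"
    by (rule field_vector_diff_chain_at)
  moreover have "(0 + \<i> * 1 + (\<i> - of_real s) * Ds s) * inverse (1 + \<i> * of_real s + Qs s) = \<i> * Ds s"
  proof -
    have nz: "1 + \<i> * of_real s + Qs s \<noteq> 0" using Ls_arg_nonpos[of s] by auto
    have "0 + \<i> * 1 + (\<i> - of_real s) * Ds s = \<i> * Ds s * (1 + \<i> * of_real s + Qs s)"
      unfolding Ds_def using Qs_nz[OF assms] by (simp add: field_simps)
    thus ?thesis using nz by (simp add: field_simps)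
  qed
  ultimately show ?thesis by (simp add: comp_def Ls_def[abs_def])
qed

lemma cont_Ls: "continuous_on {0<..} Ls"
  by (rule continuous_on_vector_derivative) (use Ls_deriv in \<open>auto intro: has_vector_derivative_at_within\<close>)

lemma cmod_Ln_le: "z \<noteq> 0 \<Longrightarrow> cmod (Ln z) \<le> \<bar>ln (cmod z)\<bar> + pi"
  using cmod_le[of "Ln z"] mpi_less_Im_Ln[of z] Im_Ln_le_pi[of z] Re_Ln[of z] by simp

lemma cmod_Ls_le:
  assumes "s > 0" shows "cmod (Ls s) \<le> 2 * s + 2 + pi"
proof -
  define z where "z = 1 + \<i> * of_real s + Qs s"
  have 1: "cmod z \<ge> 1" using Re_Ls_arg[of s] complex_Re_le_cmod[of z] by (simp add: z_def)
  have "cmod z \<le> cmod (1 + \<i> * of_real s) + cmod (Qs s)" unfolding z_def by (rule norm_triangle_ineq)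
  also have "cmod (1 + \<i> * of_real s) \<le> 1 + s" using assms
    by (intro order_trans[OF norm_triangle_ineq]) (simp add: norm_mult)
  finally have 2: "cmod z \<le> 2 * s + 2" using cmod_Qs_le'[OF assms] by simp
  have z0: "z \<noteq> 0" using 1 by auto
  have "cmod (Ln z) \<le> \<bar>ln (cmod z)\<bar> + pi" using z0 by (rule cmod_Ln_le)
  also have "\<bar>ln (cmod z)\<bar> \<le> 2 * s + 2" using 1 2 z0 ln_le_minus_one[of "cmod z"] by simp
  finally show ?thesis by (simp add: Ls_def z_def)
qed

text \<open>For large \<open>s\<close> the argument of the logarithm is \<open>2 i s\<close> up to a bounded error.\<close>

lemma Qs_approx: assumes "s > 0" shows "cmod (Qs s - \<i> * s) \<le> 2"
proof -
  have "(Qs s - \<i> * s) * (Qs s + \<i> * s) = (Qs s)\<^sup>2 + (of_real s)\<^sup>2"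
    by (simp add: algebra_simps power2_eq_square)
  also have "\<dots> = \<i> * of_real (2 * s)"
    unfolding Qs_square by (simp add: complex_eq_iff power2_eq_square)
  finally have e: "(Qs s - \<i> * s) * (Qs s + \<i> * s) = \<i> * of_real (2 * s)" .
  have "cmod (Qs s - \<i> * s) * cmod (Qs s + \<i> * s) = 2 * s"
    using arg_cong[OF e, of cmod] assms unfolding norm_mult by simp
  moreover have "s \<le> cmod (Qs s + \<i> * s)"
    using abs_Im_le_cmod[of "Qs s + \<i> * s"] Im_Qs[OF assms] assms by simp
  ultimately have "cmod (Qs s - \<i> * s) * s \<le> 2 * s"
    by (metis mult_left_mono norm_ge_zero)
  thus ?thesis using assms by simp
qed

section \<open>The Laplace integrals\<close>

definition Mlap :: "nat \<Rightarrow> real \<Rightarrow> complex" where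
  "Mlap j x = (LBINT s:{0<..}. of_real (s ^ j * exp (- (x * s))) * Ds s)"

lemma powr_minus_half: "s > 0 \<Longrightarrow> s powr (real j - 1/2) = s ^ j * s powr (-1/2)"
  using powr_add[of s "real j" "-1/2"] by (simp add: powr_realpow)

lemma Mlap_integrand_bound:
  assumes "s > 0"
  shows "cmod (of_real (s ^ j * exp (- (x * s))) * Ds s) \<le> s powr (real j - 1/2) * exp (- (x * s))"
proof -
  have "cmod (of_real (s ^ j * exp (- (x * s))) * Ds s) \<le> s ^ j * exp (- (x * s)) * s powr (-1/2)"
    using cmod_Ds_le[OF assms] assms by (simp add: norm_mult norm_power)
  also have "\<dots> = s powr (real j - 1/2) * exp (- (x * s))"
    unfolding powr_minus_half[OF assms] by simp
  finally show ?thesis .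
qed

lemma Mlap_integrable:
  assumes "x > 0"
  shows "set_integrable lborel {0<..} (\<lambda>s. of_real (s ^ j * exp (- (x * s))) * Ds s)"
  by (rule integrable_dominated_cont[OF _ integrable_powr_exp[OF _ assms] Mlap_integrand_bound])
     (auto intro!: continuous_intros cont_Ds)

lemma exp_quadratic: "\<bar>exp (-t) - 1 + t\<bar> \<le> t\<^sup>2 * exp \<bar>t\<bar>" for t :: real
  using Taylor_exp_field[of "-t" 1] by (simp add: mult_ac power2_eq_square)

text \<open>Differentiation under the integral sign, by a quadratic remainder estimate.\<close>

lemma Mlap_deriv:
  assumes "x > 0"
  shows "(Mlap j has_vector_derivative - Mlap (Suc j) x) (at x)"
proof (rule has_vector_derivative_quadratic)
  show "x / 2 > 0" using assms by simp
  define C where "C = (LBINT s:{0<..}. s powr (real (j + 2) - 1/2) * exp (- (x / 2 * s)))"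
  fix h assume h: "\<bar>h\<bar> < x / 2"
  hence xh: "x + h > 0" by linarith
  let ?f = "\<lambda>j x s. of_real (s ^ j * exp (- (x * s))) * Ds s"
  have i: "set_integrable lborel {0<..} (\<lambda>s. ?f j (x + h) s - ?f j x s + of_real h * ?f (Suc j) x s)"
    by (intro set_integral_add(1) set_integral_diff(1) Mlap_integrable xh assms set_integrable_mult_right impI)
  have eq: "Mlap j (x + h) - Mlap j x - h *\<^sub>R - Mlap (Suc j) x =
     (LBINT s:{0<..}. ?f j (x + h) s - ?f j x s + of_real h * ?f (Suc j) x s)"
  proof -
    note I = Mlap_integrable[OF xh, of j] Mlap_integrable[OF assms, of j] Mlap_integrable[OF assms, of "Suc j"]
    have "(LBINT s:{0<..}. ?f j (x + h) s - ?f j x s + of_real h * ?f (Suc j) x s)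
      = (LBINT s:{0<..}. ?f j (x + h) s - ?f j x s) + (LBINT s:{0<..}. of_real h * ?f (Suc j) x s)"
      by (rule set_integral_add(2)[OF set_integral_diff(1)[OF I(1,2)] set_integrable_mult_right]) (use I(3) in simp)
    also have "(LBINT s:{0<..}. ?f j (x + h) s - ?f j x s) = Mlap j (x + h) - Mlap j x"
      unfolding Mlap_def by (rule set_integral_diff(2)[OF I(1,2)])
    also have "(LBINT s:{0<..}. of_real h * ?f (Suc j) x s) = of_real h * Mlap (Suc j) x"
      unfolding Mlap_def by (rule set_integral_mult_right)
    finally show ?thesis by (simp add: scaleR_conv_of_real)
  qed
  have "cmod (LBINT s:{0<..}. ?f j (x + h) s - ?f j x s + of_real h * ?f (Suc j) x s)
     \<le> (LBINT s:{0<..}. h\<^sup>2 * (s powr (real (j + 2) - 1/2) * exp (- (x / 2 * s))))"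
  proof (rule norm_set_integral_le[OF i])
    show "set_integrable lborel {0<..} (\<lambda>s. h\<^sup>2 * (s powr (real (j + 2) - 1/2) * exp (- (x / 2 * s))))"
      using assms by (intro set_integrable_mult_right integrable_powr_exp) auto
    fix s :: real assume s: "s > 0"
    have e: "exp (- ((x + h) * s)) = exp (- (x * s)) * exp (- (h * s))"
      unfolding exp_add[symmetric] by (simp add: distrib_right)
    have "?f j (x + h) s - ?f j x s + of_real h * ?f (Suc j) x s =
       of_real (s ^ j * exp (- (x * s)) * (exp (- (h * s)) - 1 + h * s)) * Ds s"
      unfolding e by (simp add: algebra_simps)
    also have "cmod \<dots> \<le> (s ^ j * exp (- (x * s)) * ((h * s)\<^sup>2 * exp \<bar>h * s\<bar>)) * s powr (-1/2)"
      unfolding norm_mult norm_of_real abs_mult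
      using exp_quadratic[of "h * s"] cmod_Ds_le[OF s] s
      by (intro mult_mono) (auto simp: abs_mult)
    also have "\<dots> = h\<^sup>2 * s powr (real (j + 2) - 1/2) * (exp (- (x * s)) * exp \<bar>h * s\<bar>)"
      unfolding powr_minus_half[OF s] by (simp add: power_add power2_eq_square)
    also have "\<dots> \<le> h\<^sup>2 * s powr (real (j + 2) - 1/2) * exp (- (x / 2 * s))"
    proof (rule mult_left_mono)
      have "0 \<le> (x / 2 - \<bar>h\<bar>) * s" using h s by (intro mult_nonneg_nonneg) auto
      hence "- (x * s) + \<bar>h * s\<bar> \<le> - (x / 2 * s)"
        unfolding abs_mult abs_of_pos[OF s] left_diff_distrib by simp
      thus "exp (- (x * s)) * exp \<bar>h * s\<bar> \<le> exp (- (x / 2 * s))"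
        unfolding exp_add[symmetric] exp_le_cancel_iff .
    qed simp
    finally show "cmod (?f j (x + h) s - ?f j x s + of_real h * ?f (Suc j) x s)
       \<le> h\<^sup>2 * (s powr (real (j + 2) - 1/2) * exp (- (x / 2 * s)))"
      by (simp only: mult.assoc)
  qed
  also have "\<dots> = C * h\<^sup>2" by (simp add: C_def)
  finally show "norm (Mlap j (x + h) - Mlap j x - h *\<^sub>R - Mlap (Suc j) x) \<le> C * h\<^sup>2"
    unfolding eq .
qed

text \<open>The integrand of the combination is an exact derivative. This relation between the moments is
  what makes the Laplace integral solve the equation of Bessel.\<close>

lemma integral_by_parts_bessel:
  assumes x: "x > 0"
  shows "of_real x * (Mlap 2 x - 2 * \<i> * Mlap 1 x) = Mlap 1 x - \<i> * Mlap 0 x"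
proof -
  let ?f = "\<lambda>j s. of_real (s ^ j * exp (- (x * s))) * Ds s"
  define g where "g s = of_real x * ?f 2 s + (- 2 * \<i> * of_real x - 1) * ?f 1 s + \<i> * ?f 0 s" for s
  note I = Mlap_integrable[OF x, of 2] Mlap_integrable[OF x, of 1] Mlap_integrable[OF x, of 0]
  have I2: "set_integrable lborel {0<..} (\<lambda>s. of_real x * ?f 2 s)"
    "set_integrable lborel {0<..} (\<lambda>s. (- 2 * \<i> * of_real x - 1) * ?f 1 s)"
    "set_integrable lborel {0<..} (\<lambda>s. \<i> * ?f 0 s)"
    using I by simp_all
  have "(LBINT s:{0<..}. g s) = of_real x * Mlap 2 x + (- 2 * \<i> * of_real x - 1) * Mlap 1 x + \<i> * Mlap 0 x"
    unfolding g_def Mlap_def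
    by (subst set_integral_add(2)[OF set_integral_add(1)[OF I2(1,2)] I2(3)],
        subst set_integral_add(2)[OF I2(1,2)]) simp
  moreover have "(LBINT s:{0<..}. g s) = 0 - 0"
  proof (rule half_line_FTC[where F = "\<lambda>s. of_real (exp (- (x * s))) * Qs s"])
    show "set_integrable lborel {0<..} g" unfolding g_def[abs_def]
      by (intro set_integral_add(1) I2)
    show "continuous_on {0<..} g" unfolding g_def[abs_def]
      by (intro continuous_intros cont_Ds)
    have b: "norm (of_real (exp (- (x * s))) * Qs s) \<le> exp (- (x * s)) * sqrt (s * (s + 2))" if "s > 0" for s
    proof -
      have "cmod (Qs s) \<le> sqrt (s * (s + 2))" using cmod_Qs_le[OF that] by (rule real_le_rsqrt)
      thus ?thesis by (simp add: norm_mult)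
    qed
    show "((\<lambda>s. of_real (exp (- (x * s))) * Qs s) \<longlongrightarrow> 0) (at_right 0)"
    proof (rule Lim_null_comparison)
      show "\<forall>\<^sub>F s in at_right 0. norm (of_real (exp (- (x * s))) * Qs s) \<le> exp (- (x * s)) * sqrt (s * (s + 2))"
        using eventually_at_right_less[of 0] by eventually_elim (rule b)
      have "((\<lambda>s::real. exp (- (x * s)) * sqrt (s * (s + 2))) \<longlongrightarrow> exp (- (x * 0)) * sqrt (0 * (0 + 2))) (at_right 0)"
        by (intro tendsto_intros)
      thus "((\<lambda>s::real. exp (- (x * s)) * sqrt (s * (s + 2))) \<longlongrightarrow> 0) (at_right 0)" by simp
    qed
    show "((\<lambda>s. of_real (exp (- (x * s))) * Qs s) \<longlongrightarrow> 0) at_top"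
    proof (rule Lim_null_comparison)
      show "\<forall>\<^sub>F s in at_top. norm (of_real (exp (- (x * s))) * Qs s) \<le> exp (- (x * s)) * sqrt (s * (s + 2))"
        using eventually_gt_at_top[of 0] by eventually_elim (rule b)
      show "((\<lambda>s::real. exp (- (x * s)) * sqrt (s * (s + 2))) \<longlongrightarrow> 0) at_top"
        using x by real_asymp
    qed
    fix s :: real assume s: "s > 0"
    have e: "((\<lambda>s. complex_of_real (exp (- (x * s)))) has_vector_derivative of_real (- x * exp (- (x * s)))) (at s)"
      by (rule has_vector_derivative_of_real) (auto intro!: derivative_eq_intros)
    have "((\<lambda>s. of_real (exp (- (x * s))) * Qs s) has_vector_derivative
       of_real (exp (- (x * s))) * ((\<i> - of_real s) * Ds s) + of_real (- x * exp (- (x * s))) * Qs s) (at s)"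
      by (intro has_vector_derivative_mult e Qs_deriv s)
    also have "Qs s = (2 * \<i> * of_real s - (of_real s)\<^sup>2) * Ds s"
    proof -
      have "2 * \<i> * of_real s - (of_real s)\<^sup>2 = (Qs s)\<^sup>2" unfolding Qs_square
        by (simp add: complex_eq_iff power2_eq_square)
      thus ?thesis using Qs_nz[OF s] by (simp add: Ds_def power2_eq_square)
    qed
    finally show "((\<lambda>s. of_real (exp (- (x * s))) * Qs s) has_vector_derivative g s) (at s)"
      by (simp add: g_def algebra_simps power2_eq_square)
  qed
  ultimately show ?thesis by (simp add: algebra_simps)
qed

definition F0 :: "real \<Rightarrow> complex" where "F0 x = 2 / pi * (cis x * Mlap 0 x)"
definition F0' :: "real \<Rightarrow> complex" where "F0' x = 2 / pi * (cis x * (\<i> * Mlap 0 x - Mlap 1 x))"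

lemma has_vector_derivative_cis: "(cis has_vector_derivative \<i> * cis x) (at x)"
  unfolding has_vector_derivative_complex_iff by (auto intro!: derivative_eq_intros)

lemma bessel_solution_F0: "bessel_solution 0 0 F0 F0'"
  unfolding bessel_solution_def
proof (intro allI impI conjI)
  fix x :: real assume x: "x > 0"
  have M: "(Mlap j has_vector_derivative - Mlap (Suc j) x) (at x)" for j by (rule Mlap_deriv[OF x])
  note lin = bounded_linear.has_vector_derivative[OF bounded_linear_mult_right]
  have "((\<lambda>x. 2 / pi * (cis x * Mlap 0 x)) has_vector_derivative
      2 / pi * (cis x * (- Mlap (Suc 0) x) + \<i> * cis x * Mlap 0 x)) (at x)"
    by (intro lin has_vector_derivative_mult has_vector_derivative_cis M)
  thus "(F0 has_vector_derivative F0' x) (at x)"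
    by (simp add: F0_def[abs_def] F0'_def algebra_simps)
  have "((\<lambda>x. 2 / pi * (cis x * (\<i> * Mlap 0 x - Mlap 1 x))) has_vector_derivative
      2 / pi * (cis x * (\<i> * (- Mlap (Suc 0) x) - (- Mlap (Suc 1) x)) + \<i> * cis x * (\<i> * Mlap 0 x - Mlap 1 x))) (at x)"
    by (intro lin has_vector_derivative_mult has_vector_derivative_diff has_vector_derivative_cis M)
  moreover have "2 / pi * (cis x * (\<i> * (- Mlap (Suc 0) x) - (- Mlap (Suc 1) x)) + \<i> * cis x * (\<i> * Mlap 0 x - Mlap 1 x))
     = - F0' x / x - (1 - of_real ((0 / x)\<^sup>2)) * F0 x"
  proof -
    have m: "Mlap 2 x = 2 * \<i> * Mlap 1 x + (Mlap 1 x - \<i> * Mlap 0 x) / x"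
      using integral_by_parts_bessel[OF x] x by (simp add: field_simps)
    have s: "Suc 0 = 1" "Suc 1 = 2" by auto
    show ?thesis unfolding F0_def F0'_def s m by (simp add: algebra_simps diff_divide_distrib add_divide_distrib)
  qed
  ultimately show "(F0' has_vector_derivative - F0' x / x - (1 - of_real ((real 0 / x)\<^sup>2)) * F0 x) (at x)"
    by (simp add: F0'_def[abs_def])
qed

text \<open>The leading exponential cancels in \<open>F0' - i F0\<close>, leaving the first moment, which decays like
  \<open>x\<^sup>-\<^sup>3\<^sup>/\<^sup>2\<close>.\<close>

lemma F0_radiating: "((\<lambda>x. of_real (sqrt x) * (F0' x - \<i> * F0 x)) \<longlongrightarrow> 0) at_top"
proof (rule Lim_null_comparison)
  define C :: real where "C = (LBINT s:{0<..}. s powr (-1/2) * exp (- (1 / 2 * s)))"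
  have *: "norm (of_real (sqrt x) * (F0' x - \<i> * F0 x)) \<le> sqrt x * (2 / pi * (2 / x * C))" if x: "x > 1" for x
  proof -
    have x0: "x > 0" using x by simp
    have "cmod (Mlap 1 x) \<le> (LBINT s:{0<..}. 2 / x * (s powr (-1/2) * exp (- (1 / 2 * s))))"
      unfolding Mlap_def
    proof (rule norm_set_integral_le[OF Mlap_integrable[OF x0]])
      show "set_integrable lborel {0<..} (\<lambda>s. 2 / x * (s powr (-1/2) * exp (- (1 / 2 * s))))"
        by (intro set_integrable_mult_right integrable_powr_exp) auto
      fix s :: real assume s: "s > 0"
      have a: "cmod (of_real (s ^ 1 * exp (- (x * s))) * Ds s) \<le> s ^ 1 * s powr (-1/2) * exp (- (x * s))"
        using Mlap_integrand_bound[OF s, of 1 x] unfolding powr_minus_half[OF s] .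
      have e: "exp (- (x * s)) = exp (- (x / 2 * s)) * exp (- (x / 2 * s))"
        unfolding exp_add[symmetric] by simp
      have "s ^ 1 * s powr (-1/2) * exp (- (x * s))
         = (x / 2 * s * exp (- (x / 2 * s))) * (2 / x * (s powr (-1/2) * exp (- (x / 2 * s))))"
        unfolding e using x0 by simp
      also have "\<dots> \<le> 1 * (2 / x * (s powr (-1/2) * exp (- (1 / 2 * s))))"
      proof (intro mult_mono)
        have "x / 2 * s \<le> exp (x / 2 * s)" using exp_ge_add_one_self[of "x / 2 * s"] by linarith
        thus "x / 2 * s * exp (- (x / 2 * s)) \<le> 1" by (simp add: exp_minus field_simps)
      qed (use s x in auto)
      finally show "cmod (of_real (s ^ 1 * exp (- (x * s))) * Ds s) \<le> 2 / x * (s powr (-1/2) * exp (- (1 / 2 * s)))"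
        using a by simp
    qed
    also have "\<dots> = 2 / x * C" by (simp add: C_def)
    finally have "cmod (Mlap 1 x) \<le> 2 / x * C" .
    moreover have "F0' x - \<i> * F0 x = - (2 / pi * (cis x * Mlap 1 x))"
      by (simp add: F0_def F0'_def algebra_simps)
    moreover from this have "norm (of_real (sqrt x) * (F0' x - \<i> * F0 x)) = sqrt x * (2 / pi * cmod (Mlap 1 x))"
      using x by (simp add: norm_mult norm_divide)
    ultimately show ?thesis using x by (simp only:) (intro mult_left_mono; simp)
  qed
  show "\<forall>\<^sub>F x in at_top. norm (of_real (sqrt x) * (F0' x - \<i> * F0 x)) \<le> sqrt x * (2 / pi * (2 / x * C))"
    using eventually_gt_at_top[of 1] by eventually_elim (rule *)
  show "((\<lambda>x. sqrt x * (2 / pi * (2 / x * C))) \<longlongrightarrow> 0) at_top"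
    by real_asymp
qed

text \<open>Integration by parts moves the singularity of the kernel into a logarithm, whose behaviour as
  \<open>x \<longrightarrow> 0\<close> can be read off after rescaling.\<close>

lemma integral_by_parts_log:
  assumes x: "x > 0"
  shows "set_integrable lborel {0<..} (\<lambda>s. of_real (exp (- (x * s))) * Ls s)"
    and "\<i> * Mlap 0 x = of_real x * (LBINT s:{0<..}. of_real (exp (- (x * s))) * Ls s)"
proof -
  have b: "norm (of_real (exp (- (x * s))) * Ls s) \<le> 2 * (s powr 1 * exp (- (x * s))) + (2 + pi) * (s powr 0 * exp (- (x * s)))"
    if "s > 0" for s
    using mult_right_mono[OF cmod_Ls_le[OF that], of "exp (- (x * s))"] that
    by (simp add: norm_mult algebra_simps)
  show I: "set_integrable lborel {0<..} (\<lambda>s. of_real (exp (- (x * s))) * Ls s)"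
    by (rule integrable_dominated_cont[OF _ _ b])
       (intro continuous_intros cont_Ls set_integral_add(1) set_integrable_mult_right integrable_powr_exp x; simp)+
  have I2: "set_integrable lborel {0<..} (\<lambda>s. of_real (- x) * (of_real (exp (- (x * s))) * Ls s))"
    by (intro set_integrable_mult_right impI I)
  have I3: "set_integrable lborel {0<..} (\<lambda>s. \<i> * (of_real (s ^ 0 * exp (- (x * s))) * Ds s))"
    using Mlap_integrable[OF x, of 0] by simp
  have "(LBINT s:{0<..}. of_real (- x) * (of_real (exp (- (x * s))) * Ls s) + \<i> * (of_real (s ^ 0 * exp (- (x * s))) * Ds s)) = 0 - 0"
  proof (rule half_line_FTC[where F = "\<lambda>s. of_real (exp (- (x * s))) * Ls s"])
    show "set_integrable lborel {0<..} (\<lambda>s. of_real (- x) * (of_real (exp (- (x * s))) * Ls s) + \<i> * (of_real (s ^ 0 * exp (- (x * s))) * Ds s))"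
      by (intro set_integral_add(1) I2 I3)
    show "continuous_on {0<..} (\<lambda>s. of_real (- x) * (of_real (exp (- (x * s))) * Ls s) + \<i> * (of_real (s ^ 0 * exp (- (x * s))) * Ds s))"
      by (intro continuous_intros cont_Ds cont_Ls)
    show "((\<lambda>s. of_real (exp (- (x * s))) * Ls s) \<longlongrightarrow> 0) (at_right 0)"
    proof -
      have "(Qs \<longlongrightarrow> 0) (at_right 0)"
      proof (rule Lim_null_comparison)
        show "\<forall>\<^sub>F s in at_right 0. norm (Qs s) \<le> sqrt (s * (s + 2))"
          using eventually_at_right_less[of 0] by eventually_elim (intro real_le_rsqrt cmod_Qs_le)
        have "((\<lambda>s::real. sqrt (s * (s + 2))) \<longlongrightarrow> sqrt (0 * (0 + 2))) (at_right 0)"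
          by (intro tendsto_intros)
        thus "((\<lambda>s::real. sqrt (s * (s + 2))) \<longlongrightarrow> 0) (at_right 0)" by simp
      qed
      hence "((\<lambda>s. of_real (exp (- (x * s))) * Ls s) \<longlongrightarrow> of_real (exp (- (x * 0))) * Ln (1 + \<i> * of_real 0 + 0)) (at_right 0)"
        unfolding Ls_def[abs_def] by (intro tendsto_intros) auto
      thus ?thesis by simp
    qed
    show "((\<lambda>s. of_real (exp (- (x * s))) * Ls s) \<longlongrightarrow> 0) at_top"
    proof (rule Lim_null_comparison)
      show "\<forall>\<^sub>F s in at_top. norm (of_real (exp (- (x * s))) * Ls s) \<le> 2 * (s powr 1 * exp (- (x * s))) + (2 + pi) * (s powr 0 * exp (- (x * s)))"
        using eventually_gt_at_top[of 0] by eventually_elim (rule b)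
      show "((\<lambda>s. 2 * (s powr 1 * exp (- (x * s))) + (2 + pi) * (s powr 0 * exp (- (x * s)))) \<longlongrightarrow> 0) at_top"
        using x by real_asymp
    qed
    fix s :: real assume s: "s > 0"
    have e: "((\<lambda>s. complex_of_real (exp (- (x * s)))) has_vector_derivative of_real (- x * exp (- (x * s)))) (at s)"
      by (rule has_vector_derivative_of_real) (auto intro!: derivative_eq_intros)
    have "((\<lambda>s. of_real (exp (- (x * s))) * Ls s) has_vector_derivative
       of_real (exp (- (x * s))) * (\<i> * Ds s) + of_real (- x * exp (- (x * s))) * Ls s) (at s)"
      by (intro has_vector_derivative_mult e Ls_deriv s)
    thus "((\<lambda>s. of_real (exp (- (x * s))) * Ls s) has_vector_derivative
       of_real (- x) * (of_real (exp (- (x * s))) * Ls s) + \<i> * (of_real (s ^ 0 * exp (- (x * s))) * Ds s)) (at s)"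
      by (simp add: algebra_simps)
  qed
  also have "(LBINT s:{0<..}. of_real (- x) * (of_real (exp (- (x * s))) * Ls s) + \<i> * (of_real (s ^ 0 * exp (- (x * s))) * Ds s))
     = of_real (- x) * (LBINT s:{0<..}. of_real (exp (- (x * s))) * Ls s) + \<i> * Mlap 0 x"
    unfolding Mlap_def by (subst set_integral_add(2)[OF I2 I3]) (simp only: set_integral_mult_right)
  finally show "\<i> * Mlap 0 x = of_real x * (LBINT s:{0<..}. of_real (exp (- (x * s))) * Ls s)"
    by (simp add: algebra_simps)
qed

section \<open>The Laplace integral near the origin\<close>

lemma Gamma_integral_lborel:
  fixes a :: real
  assumes "a > 0"
  shows "(LBINT v:{0<..}. v powr (a - 1) * exp (- v :: real)) = Gamma a"
proof -
  have i: "set_integrable lborel {0<..} (\<lambda>v. v powr (a - 1) * exp (- v))"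
    using integrable_powr_exp[of "a - 1" 1] assms by simp
  have "(LBINT v:{0<..}. v powr (a - 1) * exp (- v)) = integral {0<..} (\<lambda>v. v powr (a - 1) * exp (- v))"
    by (rule set_borel_integral_eq_integral(2)[OF i])
  also have "\<dots> = integral {0..} (\<lambda>v. v powr (a - 1) * exp (- v))"
    by (rule integral_spike_set; rule negligible_subset[of "{0}"]) auto
  also have "\<dots> = Gamma a"
    using Gamma_integral_real[OF assms] by (auto intro!: integral_unique simp: exp_minus field_simps)
  finally show ?thesis .
qed

lemma abs_ln_le:
  fixes v :: real
  assumes "v > 0" shows "- ln v \<le> 2 * v powr (-1/2)" "ln v \<le> v"
proof -
  have "ln (v powr (-1/2)) \<le> v powr (-1/2) - 1" using assms by (intro ln_le_minus_one) auto
  thus "- ln v \<le> 2 * v powr (-1/2)" using assms by (simp add: ln_powr)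
  show "ln v \<le> v" using ln_le_minus_one[OF assms] by simp
qed

lemma integrable_ln_exp: "set_integrable lborel {0<..} (\<lambda>v::real. ln v * exp (- v))"
proof -
  have main: "set_integrable lborel {0<..} (\<lambda>v::real. 2 * (v powr (-1/2) * exp (- (1 * v))) + v powr 1 * exp (- (1 * v)))"
    by (intro set_integral_add(1) set_integrable_mult_right integrable_powr_exp impI) auto
  show ?thesis
  proof (rule set_integrable_bound[OF main])
  show "AE v :: real in lborel. v \<in> {0<..} \<longrightarrow> norm (ln v * exp (- v)) \<le>
     norm (2 * (v powr (-1/2) * exp (- (1 * v))) + v powr 1 * exp (- (1 * v)))"
  proof (intro AE_I2 impI)
    fix v :: real assume "v \<in> {0<..}"
    hence v: "v > 0" by simp
    have "\<bar>ln v\<bar> \<le> 2 * v powr (-1/2) + v" using abs_ln_le[OF v] v powr_ge_zero[of v "-1/2"] by linarith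
    from mult_right_mono[OF this, of "exp (- v)"] v
    show "norm (ln v * exp (- v)) \<le>
     norm (2 * (v powr (-1/2) * exp (- (1 * v))) + v powr 1 * exp (- (1 * v)))"
      by (simp add: abs_mult algebra_simps)
  qed
  qed (simp add: set_borel_measurable_def)
qed

text \<open>Squeezing \<open>ln v\<close> between the difference quotients of \<open>\<epsilon> \<mapsto> v\<^sup>\<epsilon>\<close> on both sides of
  \<open>0\<close> turns Euler's integral into the derivative of Gamma at \<open>1\<close>.\<close>

lemma ln_exp_integral: "(LBINT v:{0<..}. ln v * exp (- v :: real)) = - euler_mascheroni"
proof -
  define I :: real where "I = (LBINT v:{0<..}. ln v * exp (- v :: real))"
  have one: "(LBINT v:{0<..}. exp (- v)) = (1::real)" "set_integrable lborel {0<..} (\<lambda>v::real. exp (- v))"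
  proof -
    have "(LBINT v:{0<..}. exp (- v)) = (LBINT v:{0<..}. v powr (1 - 1) * exp (- v::real))"
      by (rule set_lebesgue_integral_cong) auto
    thus "(LBINT v:{0<..}. exp (- v)) = (1::real)" using Gamma_integral_lborel[of 1] by simp
    have "set_integrable lborel {0<..} (\<lambda>v::real. v powr 0 * exp (- (1 * v)))"
      by (rule integrable_powr_exp) auto
    thus "set_integrable lborel {0<..} (\<lambda>v::real. exp (- v))"
      by (rule set_integrable_cong[THEN iffD1, rotated -1]) auto
  qed
  have q: "e * I \<le> Gamma (1 + e) - 1" if e: "\<bar>e\<bar> < 1" for e :: real
  proof -
    have p: "set_integrable lborel {0<..} (\<lambda>v. v powr e * exp (- v))"
      using integrable_powr_exp[of e 1] e by simp
    have "(LBINT v:{0<..}. e * (ln v * exp (- v))) \<le> (LBINT v:{0<..}. v powr e * exp (- v) - exp (- v))"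
    proof (rule set_integral_mono)
      fix v :: real assume "v \<in> {0<..}"
      hence v: "v > 0" by simp
      have "e * ln v \<le> v powr e - 1" using ln_le_minus_one[of "v powr e"] v by (simp add: ln_powr)
      from mult_right_mono[OF this, of "exp (- v)"]
      show "e * (ln v * exp (- v)) \<le> v powr e * exp (- v) - exp (- v)" by (simp add: algebra_simps)
    qed (intro set_integral_diff(1) set_integrable_mult_right integrable_ln_exp p one impI)+
    also have "\<dots> = Gamma (1 + e) - 1"
      using set_integral_diff(2)[OF p one(2)] Gamma_integral_lborel[of "1 + e"] e one(1) by simp
    finally show ?thesis by (simp add: I_def)
  qed
  have "DERIV Gamma 1 :> Gamma 1 * Digamma (1::real)"
    by (rule has_field_derivative_Gamma) auto
  hence D: "((\<lambda>h. (Gamma (1 + h) - 1) / h) \<longlongrightarrow> - euler_mascheroni) (at (0::real))"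
    unfolding DERIV_def by simp
  have Dr: "((\<lambda>h. (Gamma (1 + h) - 1) / h) \<longlongrightarrow> - euler_mascheroni) (at_right (0::real))"
    and Dl: "((\<lambda>h. (Gamma (1 + h) - 1) / h) \<longlongrightarrow> - euler_mascheroni) (at_left (0::real))"
    by (rule tendsto_mono[OF _ D]; simp add: at_le)+
  have "I \<le> - euler_mascheroni"
  proof (rule tendsto_le[OF _ Dr tendsto_const])
    have "eventually (\<lambda>h::real. h \<in> {0<..<1}) (at_right 0)"
      by (rule eventually_at_right_real) auto
    thus "\<forall>\<^sub>F h in at_right 0. I \<le> (Gamma (1 + h) - 1) / h"
      by eventually_elim (use q in \<open>auto simp: field_simps\<close>)
  qed auto
  moreover have "- euler_mascheroni \<le> I"
  proof (rule tendsto_le[OF _ tendsto_const Dl])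
    have "eventually (\<lambda>h::real. h \<in> {-1<..<0}) (at_left 0)"
      by (rule eventually_at_left_real) auto
    thus "\<forall>\<^sub>F h in at_left 0. (Gamma (1 + h) - 1) / h \<le> I"
      by eventually_elim (use q in \<open>auto simp: field_simps\<close>)
  qed auto
  ultimately show ?thesis unfolding I_def by simp
qed

lemma exp_integral: "(LBINT v:{0<..}. complex_of_real (exp (- v))) = 1"
  "set_integrable lborel {0<..} (\<lambda>v. complex_of_real (exp (- v)))"
proof -
  have p: "set_integrable lborel {0<..} (\<lambda>v::real. v powr 0 * exp (- (1 * v)))"
    by (rule integrable_powr_exp) auto
  hence i: "set_integrable lborel {0<..} (\<lambda>v::real. exp (- v))"
    by (rule set_integrable_cong[THEN iffD1, rotated -1]) auto
  have "(LBINT v:{0<..}. exp (- v)) = (LBINT v:{0<..}. v powr (1 - 1) * exp (- v::real))"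
    by (rule set_lebesgue_integral_cong) auto
  thus "(LBINT v:{0<..}. complex_of_real (exp (- v))) = 1"
    using Gamma_integral_lborel[of 1] by (simp add: set_integral_complex_of_real)
  show "set_integrable lborel {0<..} (\<lambda>v. complex_of_real (exp (- v)))"
    using integrable_of_real[OF i[unfolded set_integrable_def]]
    by (simp add: set_integrable_def scaleR_conv_of_real)
qed

text \<open>With \<open>s = v/x\<close> the argument of the logarithm becomes \<open>2 i v\<close> up to \<open>O(x)\<close>, at the expense of the
  summand \<open>ln x\<close>.\<close>

lemma scaled_log:
  assumes x: "x > 0" "x \<le> 1" and v: "v > 0"
  defines "z \<equiv> of_real x * (1 + \<i> * of_real (v / x) + Qs (v / x))"
  shows "Ls (v / x) + of_real (ln x) = Ln z" "cmod (z - 2 * \<i> * v) \<le> 3 * x"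
    "cmod (Ls (v / x) + of_real (ln x)) \<le> 2 * v powr (-1/2) + 2 * v + 3 + pi"
proof -
  have vx: "v / x > 0" using x v by simp
  have nz: "1 + \<i> * of_real (v / x) + Qs (v / x) \<noteq> 0" using Ls_arg_nonpos[of "v / x"] by auto
  show e: "Ls (v / x) + of_real (ln x) = Ln z"
    unfolding z_def Ln_times_of_real[OF x(1) nz] Ls_def using Ln_of_real[OF x(1)] by simp
  have "z - 2 * \<i> * v = of_real x * (1 + (Qs (v / x) - \<i> * of_real (v / x)))"
    using x by (simp add: z_def algebra_simps)
  also have "cmod \<dots> \<le> x * (1 + 2)"
    unfolding norm_mult norm_of_real using x Qs_approx[OF vx]
    by (intro mult_mono order_trans[OF norm_triangle_ineq]) auto
  finally show c: "cmod (z - 2 * \<i> * v) \<le> 3 * x" by simp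
  have "cmod z \<le> cmod (z - 2 * \<i> * v) + cmod (2 * \<i> * v)" using norm_triangle_ineq[of "z - 2 * \<i> * v" "2 * \<i> * v"] by simp
  hence up: "cmod z \<le> 2 * v + 3" using c x v by (simp add: norm_mult)
  have "Im z = v + x * Im (Qs (v / x))" using x by (simp add: z_def algebra_simps)
  hence lo: "v \<le> cmod z" using Im_Qs[OF vx] x abs_Im_le_cmod[of z] by (smt (verit) mult_nonneg_nonneg)
  hence zn: "z \<noteq> 0" using v by auto
  have "ln (cmod z) \<le> 2 * v + 3" using ln_le_minus_one[of "cmod z"] zn up by simp
  moreover have "ln v \<le> ln (cmod z)" using lo v zn by simp
  ultimately have "\<bar>ln (cmod z)\<bar> \<le> 2 * v powr (-1/2) + 2 * v + 3"
    using abs_ln_le(1)[OF v] v by (smt (verit) powr_ge_zero)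
  thus "cmod (Ls (v / x) + of_real (ln x)) \<le> 2 * v powr (-1/2) + 2 * v + 3 + pi"
    unfolding e using cmod_Ln_le[OF zn] by simp
qed

lemma Mlap_0_substitution:
  assumes x: "x > 0"
  shows "set_integrable lborel {0<..} (\<lambda>v. of_real (exp (- v)) * (Ls (v / x) + of_real (ln x)))"
    and "\<i> * Mlap 0 x + of_real (ln x) = (LBINT v:{0<..}. of_real (exp (- v)) * (Ls (v / x) + of_real (ln x)))"
proof -
  define g where "g s = indicator {0<..} s *\<^sub>R (of_real (exp (- (x * s))) * Ls s)" for s
  have g: "integrable lborel g"
    using integral_by_parts_log(1)[OF x] unfolding set_integrable_def g_def[abs_def] .
  have gx: "g (0 + 1 / x * v) = indicator {0<..} v *\<^sub>R (of_real (exp (- v)) * Ls (v / x))" for v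
    using x by (auto simp: g_def indicator_def zero_less_divide_iff)
  have i: "set_integrable lborel {0<..} (\<lambda>v. of_real (exp (- v)) * Ls (v / x))"
    using lborel_integrable_real_affine[OF g, of "1 / x" 0] x unfolding gx set_integrable_def by simp
  have "\<i> * Mlap 0 x = of_real x * integral\<^sup>L lborel g"
    using integral_by_parts_log(2)[OF x] unfolding set_lebesgue_integral_def g_def[abs_def] .
  moreover have nz: "1 / x \<noteq> 0" using x by simp
  ultimately have e: "\<i> * Mlap 0 x = (LBINT v:{0<..}. of_real (exp (- v)) * Ls (v / x))"
    unfolding lborel_integral_real_affine[of "1 / x" g 0, OF nz] gx
    using x by (simp add: set_lebesgue_integral_def scaleR_conv_of_real)
  have j: "set_integrable lborel {0<..} (\<lambda>v. complex_of_real (exp (- v)) * of_real (ln x))"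
    by (intro set_integrable_mult_left impI exp_integral)
  show "set_integrable lborel {0<..} (\<lambda>v. of_real (exp (- v)) * (Ls (v / x) + of_real (ln x)))"
    using set_integral_add(1)[OF i j] by (simp add: distrib_left)
  show "\<i> * Mlap 0 x + of_real (ln x) = (LBINT v:{0<..}. of_real (exp (- v)) * (Ls (v / x) + of_real (ln x)))"
    unfolding distrib_left set_integral_add(2)[OF i j] e using exp_integral(1) by simp
qed

text \<open>Dominated convergence in the rescaled integral leaves \<open>ln (2 i v)\<close> against \<open>exp (- v)\<close>, whose
  integral involves the constant of Euler and Mascheroni. It is stated along the
  sequence at which it is compared with \<open>Y\<^sub>0\<close>.\<close>

lemma Mlap_0_asymp:
  "(\<lambda>n. \<i> * Mlap 0 (1 / real (Suc n)) + of_real (ln (1 / real (Suc n))))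
     \<longlonglongrightarrow> of_real (ln 2 - euler_mascheroni) + \<i> * pi / 2"
proof -
  define X where "X n = 1 / real (Suc n)" for n
  have X: "X n > 0" "X n \<le> 1" for n by (auto simp: X_def)
  have X0: "X \<longlonglongrightarrow> 0" unfolding X_def[abs_def] by (rule LIMSEQ_Suc[OF lim_1_over_n])
  define w :: "real \<Rightarrow> real" where "w v = exp (- v) * (2 * v powr (-1/2) + 2 * v + 3 + pi)" for v
  have wi: "set_integrable lborel {0<..} w"
  proof -
    have "set_integrable lborel {0<..} (\<lambda>v::real. 2 * (v powr (-1/2) * exp (- (1 * v))) + 2 * (v powr 1 * exp (- (1 * v)))
        + (3 + pi) * (v powr 0 * exp (- (1 * v))))"
      by (intro set_integral_add(1) set_integrable_mult_right integrable_powr_exp impI) auto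
    thus ?thesis
      by (rule set_integrable_cong[THEN iffD1, rotated -1]) (auto simp: w_def algebra_simps)
  qed
  have A: "(\<lambda>n. LBINT v. indicator {0<..} v *\<^sub>R (complex_of_real (exp (- v)) * (Ls (v / X n) + of_real (ln (X n)))))
     \<longlonglongrightarrow> (LBINT v. indicator {0<..} v *\<^sub>R (complex_of_real (exp (- v)) * Ln (2 * \<i> * v)))"
  proof (rule integral_dominated_convergence)
    show "integrable lborel (\<lambda>v. indicator {0<..} v *\<^sub>R w v)" using wi by (simp add: set_integrable_def)
    show "(\<lambda>v. indicator {0<..} v *\<^sub>R (complex_of_real (exp (- v)) * (Ls (v / X n) + of_real (ln (X n)))))
        \<in> borel_measurable lborel" for n
      using Mlap_0_substitution(1)[OF X(1), of n] unfolding set_integrable_def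
      by (rule borel_measurable_integrable)
    have "continuous_on {0<..} (\<lambda>v. complex_of_real (exp (- v)) * Ln (2 * \<i> * of_real v))"
      by (intro continuous_intros) (auto simp: complex_nonpos_Reals_iff)
    hence "(\<lambda>v. indicator {0<..} v *\<^sub>R (complex_of_real (exp (- v)) * Ln (2 * \<i> * v))) \<in> borel_measurable borel"
      by (rule borel_measurable_continuous_on_indicator[rotated]) simp
    thus "(\<lambda>v. indicator {0<..} v *\<^sub>R (complex_of_real (exp (- v)) * Ln (2 * \<i> * v))) \<in> borel_measurable lborel"
      by simp
    show "AE v in lborel. norm (indicator {0<..} v *\<^sub>R (complex_of_real (exp (- v)) * (Ls (v / X n) + of_real (ln (X n)))))
        \<le> indicator {0<..} v *\<^sub>R w v" for n
      by (intro AE_I2) (use scaled_log(3)[OF X] in \<open>auto simp: indicator_def w_def norm_mult intro!: mult_left_mono\<close>)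
    show "AE v in lborel. (\<lambda>n. indicator {0<..} v *\<^sub>R (complex_of_real (exp (- v)) * (Ls (v / X n) + of_real (ln (X n)))))
        \<longlonglongrightarrow> indicator {0<..} v *\<^sub>R (complex_of_real (exp (- v)) * Ln (2 * \<i> * v))"
    proof (intro AE_I2)
      fix v :: real
      show "(\<lambda>n. indicator {0<..} v *\<^sub>R (complex_of_real (exp (- v)) * (Ls (v / X n) + of_real (ln (X n)))))
        \<longlonglongrightarrow> indicator {0<..} v *\<^sub>R (complex_of_real (exp (- v)) * Ln (2 * \<i> * v))"
      proof (cases "v > 0")
        case True
        define z where "z n = of_real (X n) * (1 + \<i> * of_real (v / X n) + Qs (v / X n))" for n
        have "(\<lambda>n. z n - 2 * \<i> * v) \<longlonglongrightarrow> 0"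
        proof (rule Lim_null_comparison)
          show "\<forall>\<^sub>F n in sequentially. norm (z n - 2 * \<i> * v) \<le> 3 * X n"
            unfolding z_def using scaled_log(2)[OF X True] by simp
          show "(\<lambda>n. 3 * X n) \<longlonglongrightarrow> 0" using tendsto_mult[OF tendsto_const X0, of 3] by simp
        qed
        hence "z \<longlonglongrightarrow> 2 * \<i> * v" by (simp add: LIM_zero_iff)
        hence "(\<lambda>n. Ln (z n)) \<longlonglongrightarrow> Ln (2 * \<i> * v)"
          by (intro tendsto_Ln) (use True in \<open>auto simp: complex_nonpos_Reals_iff\<close>)
        moreover have "Ln (z n) = Ls (v / X n) + of_real (ln (X n))" for n
          unfolding z_def using scaled_log(1)[OF X True] by simp
        ultimately have "(\<lambda>n. Ls (v / X n) + of_real (ln (X n))) \<longlonglongrightarrow> Ln (2 * \<i> * v)" by simp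
        thus ?thesis by (intro tendsto_intros)
      qed simp
    qed
  qed
  have e1: "(\<lambda>n. LBINT v. indicator {0<..} v *\<^sub>R (complex_of_real (exp (- v)) * (Ls (v / X n) + of_real (ln (X n)))))
     = (\<lambda>n. \<i> * Mlap 0 (X n) + of_real (ln (X n)))"
    using Mlap_0_substitution(2)[OF X(1)] by (simp add: set_lebesgue_integral_def)
  have e2: "(LBINT v. indicator {0<..} v *\<^sub>R (complex_of_real (exp (- v)) * Ln (2 * \<i> * v)))
     = (LBINT v:{0<..}. complex_of_real (ln v * exp (- v)) + complex_of_real (exp (- v)) * (of_real (ln 2) + \<i> * pi / 2))"
    unfolding set_lebesgue_integral_def
  proof (rule Bochner_Integration.integral_cong[OF refl])
    fix v :: real
    show "indicator {0<..} v *\<^sub>R (complex_of_real (exp (- v)) * Ln (2 * \<i> * v)) =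
       indicator {0<..} v *\<^sub>R (complex_of_real (ln v * exp (- v)) + complex_of_real (exp (- v)) * (of_real (ln 2) + \<i> * pi / 2))"
    proof (cases "v > 0")
      case True
      have "Ln (of_real (2 * v) * \<i>) = of_real (ln (2 * v)) + Ln \<i>"
        using True Ln_of_real[of "2 * v"] by (subst Ln_times_of_real) auto
      also have "\<dots> = of_real (ln v) + (of_real (ln 2) + \<i> * pi / 2)"
        using True by (simp add: ln_mult)
      finally have "Ln (2 * \<i> * v) = of_real (ln v) + (of_real (ln 2) + \<i> * pi / 2)"
        by (simp add: mult_ac)
      thus ?thesis by (simp add: algebra_simps)
    qed simp
  qed
  have e3: "(LBINT v:{0<..}. complex_of_real (ln v * exp (- v)) + complex_of_real (exp (- v)) * (of_real (ln 2) + \<i> * pi / 2))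
     = of_real (- euler_mascheroni) + (of_real (ln 2) + \<i> * pi / 2)"
  proof -
    have i1: "set_integrable lborel {0<..} (\<lambda>v. complex_of_real (ln v * exp (- v)))"
      using integrable_of_real[OF integrable_ln_exp[unfolded set_integrable_def]]
      by (simp add: set_integrable_def scaleR_conv_of_real)
    have i2: "set_integrable lborel {0<..} (\<lambda>v. complex_of_real (exp (- v)) * (of_real (ln 2) + \<i> * pi / 2))"
      by (intro set_integrable_mult_left impI exp_integral)
    show ?thesis unfolding set_integral_add(2)[OF i1 i2] set_integral_complex_of_real ln_exp_integral
      using exp_integral(1) by simp
  qed
  show ?thesis using A unfolding e1 e2 e3 by (simp add: X_def algebra_simps)
qed

section \<open>The radiation condition for Hankel functions\<close>

lemma hankel1_0_small:
  "(\<lambda>n. bessel_J 0 (1 / real (Suc n))) \<longlonglongrightarrow> 1"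
  "(\<lambda>n. bessel_Y 0 (1 / real (Suc n)) - 2 / pi * (ln (1 / real (Suc n)) + euler_mascheroni - ln 2)) \<longlonglongrightarrow> 0"
proof -
  define T where "T n = (1 / real (Suc n) / 2)\<^sup>2" for n
  have T: "T n > 0" for n by (simp add: T_def)
  have T0: "T \<longlonglongrightarrow> 0"
    unfolding T_def[abs_def] by real_asymp
  have J0: "J_red 0 0 = 1" "J_red 1 0 = 1" and Y0: "Y_tail 0 0 = - 2 * euler_mascheroni"
    unfolding J_red_def Y_tail_def powser_zero by (simp_all add: bessel_coeff_def digamma_coeff_def)
  have cJ: "isCont (J_red 0) 0" by (rule DERIV_isCont[OF DERIV_J_red])
  have cY: "isCont (Y_tail 0) 0" unfolding Y_tail_def[abs_def]
    by (rule DERIV_isCont, rule termdiffs_strong_converges_everywhere, rule summable_digamma_coeff)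
  have J: "(\<lambda>n. J_red 0 (T n)) \<longlonglongrightarrow> 1"
    using isCont_tendsto_compose[OF cJ T0] by (simp add: J0)
  have Y: "(\<lambda>n. Y_tail 0 (T n)) \<longlonglongrightarrow> - 2 * euler_mascheroni"
    using isCont_tendsto_compose[OF cY T0] by (simp add: Y0)
  show "(\<lambda>n. bessel_J 0 (1 / real (Suc n))) \<longlonglongrightarrow> 1"
    using J unfolding bessel_J_red T_def by simp
  have D: "((\<lambda>h. (J_red 0 h - 1) / h) \<longlongrightarrow> - 1) (at 0)"
    using DERIV_J_red[of 0 0] J0 unfolding DERIV_def by simp
  have D': "(\<lambda>n. (J_red 0 (T n) - 1) / T n) \<longlonglongrightarrow> - 1"
    by (rule filterlim_compose[OF D]) (use T T0 in \<open>auto simp: filterlim_at less_imp_neq intro!: always_eventually\<close>, metis less_irrefl)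
  have tl: "(\<lambda>n. T n * ln (T n)) \<longlonglongrightarrow> 0"
    unfolding T_def by real_asymp
  have L: "(\<lambda>n. ln (T n) * (J_red 0 (T n) - 1)) \<longlonglongrightarrow> 0"
  proof -
    have "(\<lambda>n. (T n * ln (T n)) * ((J_red 0 (T n) - 1) / T n)) \<longlonglongrightarrow> 0 * (- 1)"
      by (intro tendsto_mult tl D')
    moreover have "(T n * ln (T n)) * ((J_red 0 (T n) - 1) / T n) = ln (T n) * (J_red 0 (T n) - 1)" for n
      using T[of n] by simp
    ultimately show ?thesis by simp
  qed
  have "(\<lambda>n. (ln (T n) * (J_red 0 (T n) - 1) - (Y_tail 0 (T n) + 2 * euler_mascheroni)) / pi) \<longlonglongrightarrow> (0 - (- 2 * euler_mascheroni + 2 * euler_mascheroni)) / pi"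
    by (intro tendsto_intros L Y) simp
  moreover have "(ln (T n) * (J_red 0 (T n) - 1) - (Y_tail 0 (T n) + 2 * euler_mascheroni)) / pi
     = bessel_Y 0 (1 / real (Suc n)) - 2 / pi * (ln (1 / real (Suc n)) + euler_mascheroni - ln 2)" for n
  proof -
    have "ln (1 / real (Suc n) / 2) = ln (1 / real (Suc n)) - ln 2" by (subst ln_divide_pos) auto
    hence "ln (T n) = 2 * (ln (1 / real (Suc n)) - ln 2)"
      unfolding T_def by (subst ln_realpow) simp_all
    moreover have "bessel_Y 0 (1 / real (Suc n)) = (ln (T n) * J_red 0 (T n) - Y_tail 0 (T n)) / pi"
      by (subst bessel_Y_red) (simp_all add: Y_red_def Y_polar_def T_def)
    ultimately show ?thesis by (simp add: field_simps)
  qed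
  ultimately show "(\<lambda>n. bessel_Y 0 (1 / real (Suc n)) - 2 / pi * (ln (1 / real (Suc n)) + euler_mascheroni - ln 2)) \<longlonglongrightarrow> 0"
    by simp
qed

text \<open>Both sides solve Bessel's equation and differ by \<open>o(1)\<close> at the origin; the only solution that
  vanishes there is zero, since \<open>Y\<^sub>0\<close> is unbounded and \<open>J\<^sub>0\<close> tends to \<open>1\<close>.\<close>

lemma hankel1_0_eq_F0:
  assumes "x > 0"
  shows "hankel1 0 x = F0 x" "hankel1' 0 x = F0' x"
proof -
  obtain \<alpha> \<beta> where ab: "\<And>x. x > 0 \<Longrightarrow> F0 x = \<alpha> * hankel1 0 x + \<beta> * cnj (hankel1 0 x)"
    and ab': "\<And>x. x > 0 \<Longrightarrow> F0' x = \<alpha> * hankel1' 0 x + \<beta> * cnj (hankel1' 0 x)"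
    using bessel_solution_rep[OF bessel_solution_F0] by blast
  define X where "X n = 1 / real (Suc n)" for n
  have X: "X n > 0" for n by (simp add: X_def)
  define l where "l n = ln (X n)" for n
  define E where "E n = \<i> * Mlap 0 (X n) + of_real (l n) - (of_real (ln 2 - euler_mascheroni) + \<i> * pi / 2)" for n
  have E: "E \<longlonglongrightarrow> 0" using Mlap_0_asymp unfolding E_def l_def X_def by (simp add: LIM_zero)
  define R where "R n = bessel_Y 0 (X n) - 2 / pi * (l n + euler_mascheroni - ln 2)" for n
  have R: "R \<longlonglongrightarrow> 0" using hankel1_0_small(2) unfolding R_def l_def X_def .
  have J: "(\<lambda>n. bessel_J 0 (X n)) \<longlonglongrightarrow> 1" using hankel1_0_small(1) unfolding X_def .
  have M: "Mlap 0 (X n) = \<i> * (of_real (l n) + of_real (euler_mascheroni - ln 2)) + pi / 2 - \<i> * E n" for n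
    unfolding E_def by (simp add: algebra_simps)
  have H: "hankel1 0 (X n) = 2 / pi * (\<i> * (of_real (l n) + of_real (euler_mascheroni - ln 2)) + pi / 2)
      + of_real (bessel_J 0 (X n) - 1) + \<i> * of_real (R n)" for n
    by (simp add: complex_eq_iff R_def) (simp add: field_simps)
  have cl: "(\<lambda>n. (cis (X n) - 1) * (of_real (l n) * \<i>)) \<longlonglongrightarrow> 0"
  proof (rule Lim_null_comparison)
    have c: "cmod (cis t - 1) \<le> \<bar>t\<bar>" for t :: real
    proof (rule power2_le_imp_le)
      have "(cmod (cis t - 1))\<^sup>2 = 2 - 2 * cos (2 * (t / 2))"
        unfolding cmod_power2 using sin_cos_squared_add[of t] by (simp add: power2_eq_square algebra_simps)
      also have "\<dots> = (2 * \<bar>sin (t / 2)\<bar>)\<^sup>2" unfolding cos_double_sin by (simp add: power_mult_distrib)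
      also have "\<dots> \<le> \<bar>t\<bar>\<^sup>2" using abs_sin_x_le_abs_x[of "t / 2"] by (intro power_mono) auto
      finally show "(cmod (cis t - 1))\<^sup>2 \<le> \<bar>t\<bar>\<^sup>2" .
    qed simp
    show "\<forall>\<^sub>F n in sequentially. norm ((cis (X n) - 1) * (of_real (l n) * \<i>)) \<le> \<bar>X n\<bar> * \<bar>l n\<bar>"
      using c by (auto simp: norm_mult intro!: mult_right_mono always_eventually)
    show "(\<lambda>n. \<bar>X n\<bar> * \<bar>l n\<bar>) \<longlonglongrightarrow> 0" unfolding X_def l_def by real_asymp
  qed
  have X0: "X \<longlonglongrightarrow> 0" unfolding X_def by real_asymp
  have cis0: "(\<lambda>n. cis (X n)) \<longlonglongrightarrow> 1"
  proof -
    have "isCont cis 0" by (rule has_vector_derivative_continuous[OF has_vector_derivative_cis])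
    from isCont_tendsto_compose[OF this X0] show ?thesis by simp
  qed
  have FH: "(\<lambda>n. F0 (X n) - hankel1 0 (X n)) \<longlonglongrightarrow> 0"
  proof -
    have "(\<lambda>n. 2 / pi * ((cis (X n) - 1) * (of_real (l n) * \<i>)
       + (cis (X n) - 1) * (\<i> * of_real (euler_mascheroni - ln 2) + pi / 2) - cis (X n) * (\<i> * E n))
       - of_real (bessel_J 0 (X n) - 1) - \<i> * of_real (R n))
       \<longlonglongrightarrow> 2 / pi * (0 + (1 - 1) * (\<i> * of_real (euler_mascheroni - ln 2) + pi / 2) - 1 * (\<i> * 0)) - of_real (1 - 1) - \<i> * of_real 0"
      by (intro tendsto_intros cl cis0 E R J)
    moreover have "2 / pi * ((cis (X n) - 1) * (of_real (l n) * \<i>)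
       + (cis (X n) - 1) * (\<i> * of_real (euler_mascheroni - ln 2) + pi / 2) - cis (X n) * (\<i> * E n))
       - of_real (bessel_J 0 (X n) - 1) - \<i> * of_real (R n) = F0 (X n) - hankel1 0 (X n)" for n
      unfolding F0_def M H by (simp add: algebra_simps add_divide_distrib diff_divide_distrib)
    ultimately show ?thesis by simp
  qed
  define p where "p = \<alpha> - 1"
  have P: "(\<lambda>n. (p + \<beta>) * of_real (bessel_J 0 (X n)) + \<i> * (p - \<beta>) * of_real (bessel_Y 0 (X n))) \<longlonglongrightarrow> 0"
  proof -
    have "F0 (X n) - hankel1 0 (X n) = (p + \<beta>) * of_real (bessel_J 0 (X n)) + \<i> * (p - \<beta>) * of_real (bessel_Y 0 (X n))" for n
    proof -
      have "hankel1 0 (X n) = of_real (bessel_J 0 (X n)) + \<i> * of_real (bessel_Y 0 (X n))"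
        "cnj (hankel1 0 (X n)) = of_real (bessel_J 0 (X n)) - \<i> * of_real (bessel_Y 0 (X n))"
        by (simp_all add: complex_eq_iff)
      thus ?thesis unfolding ab[OF X] p_def by (simp add: algebra_simps)
    qed
    with FH show ?thesis by simp
  qed
  have Yinf: "filterlim (\<lambda>n. bessel_Y 0 (X n)) at_bot sequentially"
  proof -
    have "filterlim (\<lambda>n. - (2 / pi * (l n + euler_mascheroni - ln 2))) at_top sequentially"
      unfolding l_def X_def by real_asymp
    from filterlim_tendsto_add_at_top[OF tendsto_minus[OF R] this] show ?thesis
      unfolding filterlim_uminus_at_bot by (simp add: R_def)
  qed
  have "(\<lambda>n. inverse (complex_of_real (bessel_Y 0 (X n)))) \<longlonglongrightarrow> 0"
    using tendsto_of_real[OF tendsto_minus[OF tendsto_inverse_0_at_top[OF Yinf[unfolded filterlim_uminus_at_bot]]], where 'a = complex]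
    by simp
  from tendsto_mult[OF this tendsto_diff[OF P tendsto_mult[OF tendsto_const[of "p + \<beta>"] tendsto_of_real[OF J]]]]
  have "(\<lambda>n. inverse (complex_of_real (bessel_Y 0 (X n))) * (\<i> * (p - \<beta>) * of_real (bessel_Y 0 (X n)))) \<longlonglongrightarrow> 0"
    by simp
  moreover have "\<forall>\<^sub>F n in sequentially. inverse (complex_of_real (bessel_Y 0 (X n))) * (\<i> * (p - \<beta>) * of_real (bessel_Y 0 (X n))) = \<i> * (p - \<beta>)"
    using filterlim_at_bot_dense[THEN iffD1, OF Yinf, rule_format, of 0] by eventually_elim simp
  ultimately have "(\<lambda>n. \<i> * (p - \<beta>)) \<longlonglongrightarrow> 0" by (rule Lim_transform_eventually)
  hence pb: "p = \<beta>" by (simp add: tendsto_const_iff)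
  from tendsto_mult[OF tendsto_const[of "p + \<beta>"] tendsto_of_real[OF J]] P
  have "p + \<beta> = 0" unfolding pb by simp (metis LIMSEQ_unique mult_eq_0_iff zero_neq_numeral)
  hence "\<alpha> = 1" "\<beta> = 0" using pb by (auto simp: p_def)
  thus "hankel1 0 x = F0 x" "hankel1' 0 x = F0' x" using ab[OF assms] ab'[OF assms] by auto
qed

text \<open>Since all orders are bounded, the recurrence gives \<open>H\<^sub>n\<^sub>+\<^sub>2 + i H\<^sub>n\<^sub>+\<^sub>1 = i (H\<^sub>n\<^sub>+\<^sub>1 + i H\<^sub>n) + O(1/x)\<close>.\<close>

lemma hankel1_radiating_step:
  "((\<lambda>x. of_real (sqrt x) * (hankel1 (Suc n) x + \<i> * hankel1 n x)) \<longlongrightarrow> 0) at_top"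
proof (induction n)
  case 0
  have "((\<lambda>x. - (of_real (sqrt x) * (F0' x - \<i> * F0 x))) \<longlongrightarrow> - 0) at_top"
    by (intro tendsto_minus F0_radiating)
  moreover have "\<forall>\<^sub>F x in at_top. - (of_real (sqrt x) * (F0' x - \<i> * F0 x))
      = of_real (sqrt x) * (hankel1 (Suc 0) x + \<i> * hankel1 0 x)"
    using eventually_gt_at_top[of 0]
  proof eventually_elim
    case (elim x)
    show ?case unfolding hankel1_0_eq_F0[OF elim, symmetric] by (simp add: hankel1'_def algebra_simps)
  qed
  ultimately show ?case using Lim_transform_eventually by fastforce
next
  case (Suc n)
  obtain B where B: "\<And>x. x \<ge> 1 \<Longrightarrow> cmod (hankel1 (Suc n) x) \<le> B"
    using hankel1_bounded[of 1 "Suc n"] by auto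
  have small: "((\<lambda>x. of_real (sqrt x) * (of_real (2 * real (Suc n) / x) * hankel1 (Suc n) x)) \<longlongrightarrow> 0) at_top"
  proof (rule Lim_null_comparison)
    show "\<forall>\<^sub>F x in at_top. norm (of_real (sqrt x) * (of_real (2 * real (Suc n) / x) * hankel1 (Suc n) x))
       \<le> sqrt x * (2 * real (Suc n) / x * B)"
      using eventually_ge_at_top[of 1]
    proof eventually_elim
      case (elim x)
      thus ?case unfolding norm_mult norm_of_real using B[OF elim] by (intro mult_mono) auto
    qed
    show "((\<lambda>x. sqrt x * (2 * real (Suc n) / x * B)) \<longlongrightarrow> 0) at_top" by real_asymp
  qed
  have "((\<lambda>x. of_real (sqrt x) * (of_real (2 * real (Suc n) / x) * hankel1 (Suc n) x)
      + \<i> * (of_real (sqrt x) * (hankel1 (Suc n) x + \<i> * hankel1 n x))) \<longlongrightarrow> 0 + \<i> * 0) at_top"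
    by (intro tendsto_intros small Suc.IH)
  moreover have "\<forall>\<^sub>F x in at_top. of_real (sqrt x) * (of_real (2 * real (Suc n) / x) * hankel1 (Suc n) x)
      + \<i> * (of_real (sqrt x) * (hankel1 (Suc n) x + \<i> * hankel1 n x))
      = of_real (sqrt x) * (hankel1 (Suc (Suc n)) x + \<i> * hankel1 (Suc n) x)"
    using eventually_gt_at_top[of 0]
  proof eventually_elim
    case (elim x)
    show ?case unfolding hankel1_rec[OF elim] by (simp add: algebra_simps)
  qed
  ultimately show ?case using Lim_transform_eventually by fastforce
qed

lemma hankel1_radiating:
  "((\<lambda>x. of_real (sqrt x) * (hankel1' n x - \<i> * hankel1 n x)) \<longlongrightarrow> 0) at_top"
proof -
  obtain B where B: "\<And>x. x \<ge> 1 \<Longrightarrow> cmod (hankel1 n x) \<le> B"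
    using hankel1_bounded[of 1 n] by auto
  have small: "((\<lambda>x. of_real (sqrt x) * (of_real (real n / x) * hankel1 n x)) \<longlongrightarrow> 0) at_top"
  proof (rule Lim_null_comparison)
    show "\<forall>\<^sub>F x in at_top. norm (of_real (sqrt x) * (of_real (real n / x) * hankel1 n x)) \<le> sqrt x * (real n / x * B)"
      using eventually_ge_at_top[of 1]
    proof eventually_elim
      case (elim x)
      thus ?case unfolding norm_mult norm_of_real using B[OF elim] by (intro mult_mono) auto
    qed
    show "((\<lambda>x. sqrt x * (real n / x * B)) \<longlongrightarrow> 0) at_top" by real_asymp
  qed
  have "((\<lambda>x. of_real (sqrt x) * (of_real (real n / x) * hankel1 n x)
      - of_real (sqrt x) * (hankel1 (Suc n) x + \<i> * hankel1 n x)) \<longlongrightarrow> 0 - 0) at_top"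
    by (intro tendsto_intros small hankel1_radiating_step)
  thus ?thesis by (simp add: hankel1'_def algebra_simps)
qed

section \<open>Lommel polynomials\<close>

text \<open>\<open>lommel \<sigma> p q m l\<close> is the coefficient of \<open>w\<^sup>l\<close> in the polynomial that satisfies the recurrence of
  the Hankel functions in \<open>w = 1/x\<close> with initial values \<open>p\<close> and \<open>q\<close>. The genuine polynomials have
  \<open>\<sigma> = -1\<close>; those with \<open>\<sigma> = 1\<close> have positive coefficients and serve as majorants.\<close>

fun lommel :: "real \<Rightarrow> real \<Rightarrow> real \<Rightarrow> nat \<Rightarrow> nat \<Rightarrow> real" where
  "lommel \<sigma> p q 0 l = (if l = 0 then p else 0)"
| "lommel \<sigma> p q (Suc 0) l = (if l = 0 then q else 0)"
| "lommel \<sigma> p q (Suc (Suc m)) l =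
     (case l of 0 \<Rightarrow> 0 | Suc k \<Rightarrow> 2 * real (Suc m) * lommel \<sigma> p q (Suc m) k) + \<sigma> * lommel \<sigma> p q m l"

fun lommel_val :: "real \<Rightarrow> real \<Rightarrow> real \<Rightarrow> nat \<Rightarrow> real \<Rightarrow> real" where
  "lommel_val \<sigma> p q 0 w = p"
| "lommel_val \<sigma> p q (Suc 0) w = q"
| "lommel_val \<sigma> p q (Suc (Suc m)) w = 2 * real (Suc m) * w * lommel_val \<sigma> p q (Suc m) w + \<sigma> * lommel_val \<sigma> p q m w"

lemma lommel_sums: "(\<lambda>l. lommel \<sigma> p q m l * w ^ l) sums lommel_val \<sigma> p q m w"
proof (induction m rule: induct_nat_012)
  case 0
  have "(\<lambda>l. lommel \<sigma> p q 0 l * w ^ l) = (\<lambda>l. if l = 0 then p else 0)" by auto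
  thus ?case using sums_single[of 0 "\<lambda>_. p"] by simp
next
  case 1
  have "(\<lambda>l. lommel \<sigma> p q (Suc 0) l * w ^ l) = (\<lambda>l. if l = 0 then q else 0)" by auto
  thus ?case using sums_single[of 0 "\<lambda>_. q"] by simp
next
  case (ge2 m)
  have "(\<lambda>l. 2 * real (Suc m) * w * (lommel \<sigma> p q (Suc m) l * w ^ l)) sums (2 * real (Suc m) * w * lommel_val \<sigma> p q (Suc m) w)"
    by (intro sums_mult ge2)
  hence "(\<lambda>l. case l of 0 \<Rightarrow> 0 | Suc l \<Rightarrow> 2 * real (Suc m) * w * (lommel \<sigma> p q (Suc m) l * w ^ l)) sums (2 * real (Suc m) * w * lommel_val \<sigma> p q (Suc m) w)"
    by - (rule sums_Suc_imp, simp_all)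
  note * = sums_add[OF this sums_mult[OF ge2(1), of \<sigma>]]
  have eq: "(\<lambda>l. lommel \<sigma> p q (Suc (Suc m)) l * w ^ l) =
     (\<lambda>l. (case l of 0 \<Rightarrow> 0 | Suc l \<Rightarrow> 2 * real (Suc m) * w * (lommel \<sigma> p q (Suc m) l * w ^ l))
        + \<sigma> * (lommel \<sigma> p q m l * w ^ l))"
    by (auto simp: fun_eq_iff algebra_simps split: nat.splits)
  show ?case unfolding eq lommel_val.simps(3) by (rule *)
qed

lemma hankel1_lommel:
  assumes "x > 0"
  shows "hankel1 m x = of_real (lommel_val (-1) 1 0 m (1 / x)) * hankel1 0 x
    + of_real (lommel_val (-1) 0 1 m (1 / x)) * hankel1 1 x"
proof (induction m rule: induct_nat_012)
  case (ge2 m)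
  show ?case unfolding hankel1_rec[OF assms] ge2 by (simp add: algebra_simps add_divide_distrib)
qed simp_all

lemma abs_lommel_le: "\<bar>lommel (-1) p q m l\<bar> \<le> lommel 1 \<bar>p\<bar> \<bar>q\<bar> m l"
proof (induction m arbitrary: l rule: induct_nat_012)
  case (ge2 m)
  show ?case
  proof (cases l)
    case 0
    thus ?thesis using ge2(1)[of 0] by simp
  next
    case (Suc k)
    have "\<bar>lommel (-1) p q (Suc (Suc m)) l\<bar> \<le> 2 * real (Suc m) * \<bar>lommel (-1) p q (Suc m) k\<bar> + \<bar>lommel (-1) p q m l\<bar>"
      using Suc abs_triangle_ineq4[of "2 * real (Suc m) * lommel (-1) p q (Suc m) k" "lommel (-1) p q m l"]
      by (simp add: abs_mult del: of_nat_Suc)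
    also have "\<dots> \<le> 2 * real (Suc m) * lommel 1 \<bar>p\<bar> \<bar>q\<bar> (Suc m) k + lommel 1 \<bar>p\<bar> \<bar>q\<bar> m l"
      by (intro add_mono mult_left_mono ge2) auto
    finally show ?thesis using Suc by simp
  qed
qed auto

lemma lommel_val_nonneg: "p \<ge> 0 \<Longrightarrow> q \<ge> 0 \<Longrightarrow> w \<ge> 0 \<Longrightarrow> lommel_val 1 p q m w \<ge> 0"
  by (induction m rule: induct_nat_012) auto

text \<open>The ratio of the majorant to \<open>m! (2 w)\<^sup>m\<close> decreases from the index on where
  \<open>(m + 1) (2 w)\<^sup>2 \<ge> 1\<close>.\<close>

lemma lommel_val_bound:
  assumes "w > 0" "p \<ge> 0" "q \<ge> 0"
  obtains C where "C \<ge> 0" "\<And>m. lommel_val 1 p q m w \<le> C * (fact m * (2 * w) ^ m)"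
proof -
  define t where "t = 2 * w"
  have t: "t > 0" using assms by (simp add: t_def)
  define T where "T m = lommel_val 1 p q m w" for m
  have T0: "T m \<ge> 0" for m unfolding T_def using assms by (intro lommel_val_nonneg) auto
  obtain N :: nat where N: "real N > 1 / t\<^sup>2" using reals_Archimedean2 by blast
  define C where "C = Max ((\<lambda>m. T m / (fact m * t ^ m)) ` {..Suc N})"
  have C: "T m \<le> C * (fact m * t ^ m)" if "m \<le> Suc N" for m
  proof -
    have "T m / (fact m * t ^ m) \<le> C" unfolding C_def by (rule Max_ge) (use that in auto)
    thus ?thesis using t by (simp add: divide_le_eq)
  qed
  have C0: "C \<ge> 0" using C[of 0] T0[of 0] by simp
  have "T m \<le> C * (fact m * t ^ m)" for m
  proof (induction m rule: less_induct)
    case (less m)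
    show ?case
    proof (cases "m \<le> Suc N")
      case False
      then obtain n where m: "m = Suc (Suc n)" and n: "n \<ge> N" by (metis Suc_le_D Suc_le_mono not_less_eq_eq)
      have nt: "1 \<le> real (Suc n) * t\<^sup>2"
      proof -
        have "1 / t\<^sup>2 \<le> real (Suc n)" using N n by simp
        thus ?thesis using t by (simp add: divide_le_eq)
      qed
      have "T m = real (Suc n) * t * T (Suc n) + T n" unfolding m T_def by (simp add: t_def)
      also have "\<dots> \<le> real (Suc n) * t * (C * (fact (Suc n) * t ^ Suc n)) + C * (fact n * t ^ n)"
        using t by (intro add_mono mult_left_mono less) (auto simp: m)
      also have "\<dots> \<le> real (Suc n) * t * (C * (fact (Suc n) * t ^ Suc n)) + C * (fact n * t ^ n) * (real (Suc n) * t\<^sup>2)"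
        using mult_left_mono[OF nt, of "C * (fact n * t ^ n)"] C0 t by simp
      also have "\<dots> = C * (fact m * t ^ m)"
        unfolding m by (simp add: power2_eq_square algebra_simps)
      finally show ?thesis .
    qed (use C in auto)
  qed
  thus ?thesis using that C0 unfolding T_def t_def by blast
qed

text \<open>The induction on \<open>m\<close> carries along the relations between the coefficients of consecutive orders that
  express the derivative formula of the Hankel functions.\<close>

lemma lommel_recursion:
  defines "p \<equiv> lommel (-1) 1 0" and "q \<equiv> lommel (-1) 0 1"
  shows "2 * (real l + 1) * p m (Suc l) = ((real m)\<^sup>2 - (real l + 1)\<^sup>2) * q m l"
    and "2 * (real l + 1) * q m (Suc l) = ((real l)\<^sup>2 - (real m)\<^sup>2) * p m l"
proof -
  have "(\<forall>l. 2 * (real l + 1) * p m (Suc l) = ((real m)\<^sup>2 - (real l + 1)\<^sup>2) * q m l) \<and>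
        (\<forall>l. 2 * (real l + 1) * q m (Suc l) = ((real l)\<^sup>2 - (real m)\<^sup>2) * p m l) \<and>
        (\<forall>l. p (Suc m) (Suc l) = (real m + real l) * p m l - q m (Suc l)) \<and>
        (\<forall>l. q (Suc m) (Suc l) = (real m + real l + 1) * q m l + p m (Suc l)) \<and>
        p (Suc m) 0 = - q m 0 \<and> q (Suc m) 0 = p m 0"
  proof (induction m)
    case 0
    show ?case by (auto simp: p_def q_def)
  next
    case (Suc m)
    note Kp = Suc.IH[THEN conjunct1, rule_format]
      and Kq = Suc.IH[THEN conjunct2, THEN conjunct1, rule_format]
      and Ap = Suc.IH[THEN conjunct2, THEN conjunct2, THEN conjunct1, rule_format]
      and Aq = Suc.IH[THEN conjunct2, THEN conjunct2, THEN conjunct2, THEN conjunct1, rule_format]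
    have A0: "p (Suc m) 0 = - q m 0" "q (Suc m) 0 = p m 0" using Suc.IH by auto
    have rp: "p (Suc (Suc m)) (Suc l) = 2 * (real m + 1) * p (Suc m) l - p m (Suc l)"
      and rq: "q (Suc (Suc m)) (Suc l) = 2 * (real m + 1) * q (Suc m) l - q m (Suc l)"
      and r0: "p (Suc (Suc m)) 0 = - p m 0" "q (Suc (Suc m)) 0 = - q m 0" for l
      by (simp_all add: p_def q_def)
    have Bp: "(real m + real l) * p m l = (real m - real l) * q (Suc m) l" for l
    proof (cases l)
      case 0
      thus ?thesis using A0 by simp
    next
      case (Suc k)
      show ?thesis unfolding Suc Aq[of k] using Kp[of k]
        by (simp add: power2_eq_square algebra_simps)
    qed
    have Bq: "(real m + real l + 1) * q m l = (real l - real m - 1) * p (Suc m) l" for l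
    proof (cases l)
      case 0
      thus ?thesis using A0 by (simp add: algebra_simps)
    next
      case (Suc k)
      show ?thesis unfolding Suc Ap[of k] using Kq[of k]
        by (simp add: power2_eq_square algebra_simps)
    qed
    have "2 * (real l + 1) * p (Suc m) (Suc l) = ((real (Suc m))\<^sup>2 - (real l + 1)\<^sup>2) * q (Suc m) l" for l
    proof -
      have "2 * (real l + 1) * p (Suc m) (Suc l) = (real m + real l) * p m l * (real m + real l + 2)"
        unfolding Ap using Kq[of l] by (simp add: power2_eq_square algebra_simps)
      also have "\<dots> = ((real (Suc m))\<^sup>2 - (real l + 1)\<^sup>2) * q (Suc m) l"
        unfolding Bp by (simp add: power2_eq_square algebra_simps)
      finally show ?thesis .
    qed
    moreover have "2 * (real l + 1) * q (Suc m) (Suc l) = ((real l)\<^sup>2 - (real (Suc m))\<^sup>2) * p (Suc m) l" for l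
    proof -
      have "2 * (real l + 1) * q (Suc m) (Suc l) = (real m + real l + 1) * q m l * (real m + real l + 1)"
        unfolding Aq using Kp[of l] by (simp add: power2_eq_square algebra_simps)
      also have "\<dots> = ((real l)\<^sup>2 - (real (Suc m))\<^sup>2) * p (Suc m) l"
        unfolding Bq by (simp add: power2_eq_square algebra_simps)
      finally show ?thesis .
    qed
    moreover have "p (Suc (Suc m)) (Suc l) = (real (Suc m) + real l) * p (Suc m) l - q (Suc m) (Suc l)" for l
      unfolding rp Aq using Bq[of l] by (simp add: algebra_simps)
    moreover have "q (Suc (Suc m)) (Suc l) = (real (Suc m) + real l + 1) * q (Suc m) l + p (Suc m) (Suc l)" for l
      unfolding rq Ap using Bp[of l] by (simp add: algebra_simps)
    ultimately show ?case using r0 A0 by auto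
  qed
  thus "2 * (real l + 1) * p m (Suc l) = ((real m)\<^sup>2 - (real l + 1)\<^sup>2) * q m l"
    and "2 * (real l + 1) * q m (Suc l) = ((real l)\<^sup>2 - (real m)\<^sup>2) * p m l" by auto
qed

text \<open>The constant terms satisfy \<open>x\<^sub>m\<^sub>+\<^sub>2 = - x\<^sub>m\<close>.\<close>

lemma lommel_leading:
  "lommel (-1) 1 0 m 0 = cos (real m * pi / 2)" "lommel (-1) 0 1 m 0 = sin (real m * pi / 2)"
proof -
  have "lommel (-1) 1 0 m 0 = cos (real m * pi / 2) \<and> lommel (-1) 0 1 m 0 = sin (real m * pi / 2)"
  proof (induction m rule: induct_nat_012)
    case (ge2 m)
    have "real (Suc (Suc m)) * pi / 2 = real m * pi / 2 + pi" by (simp add: field_simps)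
    hence "cos (real (Suc (Suc m)) * pi / 2) = - cos (real m * pi / 2)"
      "sin (real (Suc (Suc m)) * pi / 2) = - sin (real m * pi / 2)" by (simp_all only: cos_periodic_pi sin_periodic_pi)
    thus ?case using ge2 by (simp del: of_nat_Suc)
  qed auto
  thus "lommel (-1) 1 0 m 0 = cos (real m * pi / 2)" "lommel (-1) 0 1 m 0 = sin (real m * pi / 2)" by auto
qed

section \<open>Admissible amplitudes\<close>

text \<open>The decay of amplitudes \<open>c\<close> for which the outgoing mode sum converges outside the circle of radius
  \<open>\<kappa>\<close>; the open condition \<open>x > \<kappa>\<close> absorbs factors that are polynomial in \<open>n\<close>.\<close>

definition admissible :: "real \<Rightarrow> (int \<Rightarrow> complex) \<Rightarrow> bool" where
  "admissible \<kappa> c \<longleftrightarrow> (\<forall>x>\<kappa>. \<exists>C. \<forall>n. cmod (c n) * fact (nat \<bar>n\<bar>) \<le> C * (x / 2) ^ nat \<bar>n\<bar>)"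

lemma summable_int_geometric:
  assumes "0 \<le> z" "z < 1"
  shows "(\<lambda>n::int. \<bar>of_int n\<bar> ^ j * z ^ nat \<bar>n\<bar> :: real) summable_on UNIV"
proof -
  define y where "y = (z + 1) / 2"
  have y: "0 < y" "y < 1" "z < y" using assms by (auto simp: y_def)
  have s: "summable (\<lambda>m. real m ^ j * z ^ m)"
  proof -
    have zy: "0 \<le> z / y" "z / y < 1" using assms y by (auto simp: divide_simps)
    have "(\<lambda>m. real m ^ j * (z / y) ^ m) \<longlonglongrightarrow> 0"
    proof -
      define s where "s = root (Suc j) (z / y)"
      have s: "0 \<le> s" "s < 1" "s ^ Suc j = z / y"
        using zy unfolding s_def by (auto simp: real_root_lt_1_iff real_root_pow_pos2 simp del: power_Suc)
      have "(\<lambda>m. (real m * s ^ m) ^ j * s ^ m) \<longlonglongrightarrow> 0 ^ j * 0"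
        using s powser_times_n_limit_0[of s] by (intro tendsto_mult tendsto_power LIMSEQ_power_zero) auto
      moreover have "(real m * s ^ m) ^ j * s ^ m = real m ^ j * (z / y) ^ m" for m
      proof -
        have "(s ^ Suc j) ^ m = (s ^ m) ^ Suc j" by (simp only: power_mult[symmetric] mult.commute)
        thus ?thesis unfolding s(3)[symmetric] power_mult_distrib by (simp only: power_Suc mult_ac)
      qed
      ultimately show ?thesis by simp
    qed
    hence "Bseq (\<lambda>m. real m ^ j * (z / y) ^ m)" using convergentI convergent_imp_Bseq by blast
    then obtain C where C: "\<And>m. norm (real m ^ j * (z / y) ^ m) \<le> C" by (auto simp: Bseq_def)
    show ?thesis
    proof (rule summable_comparison_test')
      show "summable (\<lambda>m. C * y ^ m)" using y by (intro summable_mult summable_geometric) auto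
      fix m
      have "real m ^ j * z ^ m = (real m ^ j * (z / y) ^ m) * y ^ m" using y by (simp add: power_divide)
      also have "\<dots> \<le> C * y ^ m" using C[of m] y by (intro mult_right_mono) auto
      finally show "norm (real m ^ j * z ^ m) \<le> C * y ^ m" using assms by simp
    qed
  qed
  define f where "f = (\<lambda>n::int. \<bar>of_int n\<bar> ^ j * z ^ nat \<bar>n\<bar> :: real)"
  have "(f \<circ> int) summable_on UNIV"
    using s assms by (simp add: f_def comp_def summable_on_UNIV_nonneg_real_iff)
  hence 1: "f summable_on range int" by (subst summable_on_reindex) auto
  have "(f \<circ> (\<lambda>m. - int (Suc m))) summable_on UNIV"
    using summable_Suc_iff[THEN iffD2, OF s] assms
    by (simp add: f_def comp_def summable_on_UNIV_nonneg_real_iff nat_add_distrib add.commute)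
  hence 2: "f summable_on range (\<lambda>m. - int (Suc m))"
    by (subst summable_on_reindex) (auto simp: inj_def)
  have "n \<in> range int \<union> range (\<lambda>m. - int (Suc m))" for n :: int
  proof (cases "n \<ge> 0")
    case True
    thus ?thesis by (intro UnI1 image_eqI[of _ _ "nat n"]) auto
  next
    case False
    thus ?thesis by (intro UnI2 image_eqI[of _ _ "nat (- n - 1)"]) auto
  qed
  hence "(UNIV :: int set) = range int \<union> range (\<lambda>m. - int (Suc m))" by blast
  moreover have "range int \<inter> range (\<lambda>m. - int (Suc m)) = {}" by auto
  ultimately show ?thesis using summable_on_Un_disjoint[OF 1 2] by (simp add: f_def)
qed

section \<open>Double series over modes and powers\<close>

text \<open>The weight \<open>|n|\<^sup>j\<close> makes the condition stable under differentiation in the angle, and the strict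
  inequality \<open>x > \<kappa>\<close> makes it stable under differentiation in the radius.\<close>

definition array_summable :: "real \<Rightarrow> (int \<Rightarrow> nat \<Rightarrow> complex) \<Rightarrow> bool" where
  "array_summable \<kappa> b \<longleftrightarrow>
     (\<forall>x>\<kappa>. \<forall>j. (\<lambda>(n, l). cmod (b n l) * \<bar>of_int n\<bar> ^ j / x ^ l) summable_on UNIV)"

definition fser :: "(int \<Rightarrow> nat \<Rightarrow> complex) \<Rightarrow> nat \<Rightarrow> real \<Rightarrow> complex" where
  "fser b l \<theta> = (\<Sum>\<^sub>\<infinity>n. b n l * cis (of_int n * \<theta>))"

lemma summable_on_real_comparison:
  fixes f g :: "'a \<Rightarrow> real"
  assumes "g summable_on A" "\<And>x. x \<in> A \<Longrightarrow> 0 \<le> f x" "\<And>x. x \<in> A \<Longrightarrow> f x \<le> g x"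
  shows "f summable_on A"
proof -
  have "(\<lambda>x. norm (f x)) summable_on A"
  proof (rule Infinite_Sum.abs_summable_on_comparison_test)
    have "g x = norm (g x)" if "x \<in> A" for x using assms(2,3)[OF that] by simp
    thus "(\<lambda>x. norm (g x)) summable_on A" using assms(1) summable_on_cong[of A g "\<lambda>x. norm (g x)"] by simp
  qed (use assms(2,3) in force)
  thus ?thesis by (rule Infinite_Sum.abs_summable_summable)
qed

lemma array_summable_cmult:
  assumes "array_summable \<kappa> b" shows "array_summable \<kappa> (\<lambda>n l. z * b n l)"
  unfolding array_summable_def
proof (intro allI impI)
  fix x j assume "x > \<kappa>"
  hence "(\<lambda>(n, l). cmod (b n l) * \<bar>of_int n\<bar> ^ j / x ^ l) summable_on UNIV"
    using assms unfolding array_summable_def by blast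
  from summable_on_cmult_right[OF this, of "cmod z"]
  show "(\<lambda>(n, l). cmod (z * b n l) * \<bar>of_int n\<bar> ^ j / x ^ l) summable_on UNIV"
    by (simp add: case_prod_unfold norm_mult mult_ac)
qed

lemma array_summable_n:
  assumes "array_summable \<kappa> b" shows "array_summable \<kappa> (\<lambda>n l. of_int n * b n l)"
  unfolding array_summable_def
proof (intro allI impI)
  fix x j assume "x > \<kappa>"
  hence "(\<lambda>(n, l). cmod (b n l) * \<bar>of_int n\<bar> ^ Suc j / x ^ l) summable_on UNIV"
    using assms unfolding array_summable_def by blast
  thus "(\<lambda>(n, l). cmod (of_int n * b n l) * \<bar>of_int n\<bar> ^ j / x ^ l) summable_on UNIV"
    by (simp add: case_prod_unfold norm_mult mult_ac)
qed

lemma array_summable_l: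
  assumes "array_summable \<kappa> b" "\<kappa> > 0" shows "array_summable \<kappa> (\<lambda>n l. of_nat l * b n l)"
  unfolding array_summable_def
proof (intro allI impI)
  fix x j assume x: "x > \<kappa>"
  define y where "y = (\<kappa> + x) / 2"
  have y: "\<kappa> < y" "y < x" "0 < y" using x assms by (auto simp: y_def)
  have "Bseq (\<lambda>l. real l * (y / x) ^ l)"
    using powser_times_n_limit_0[of "y / x"] y
    by (intro convergent_imp_Bseq convergentI[of _ 0]) auto
  then obtain C where C: "\<And>l. norm (real l * (y / x) ^ l) \<le> C" by (auto simp: Bseq_def)
  have "(\<lambda>(n, l). cmod (b n l) * \<bar>of_int n\<bar> ^ j / y ^ l) summable_on UNIV"
    using assms y unfolding array_summable_def by blast
  from summable_on_cmult_right[OF this, of C]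
  show "(\<lambda>(n, l). cmod (of_nat l * b n l) * \<bar>of_int n\<bar> ^ j / x ^ l) summable_on UNIV"
  proof (rule summable_on_real_comparison)
    fix z :: "int \<times> nat"
    obtain n l where z: "z = (n, l)" by (cases z)
    have "cmod (of_nat l * b n l) * \<bar>of_int n\<bar> ^ j / x ^ l = (real l * (y / x) ^ l) * (cmod (b n l) * \<bar>of_int n\<bar> ^ j / y ^ l)"
      using y by (simp add: norm_mult power_divide)
    also have "\<dots> \<le> C * (cmod (b n l) * \<bar>of_int n\<bar> ^ j / y ^ l)"
      using C[of l] y by (intro mult_right_mono) auto
    finally show "(case z of (n, l) \<Rightarrow> cmod (of_nat l * b n l) * \<bar>of_int n\<bar> ^ j / x ^ l)
      \<le> C * (case z of (n, l) \<Rightarrow> cmod (b n l) * \<bar>of_int n\<bar> ^ j / y ^ l)" by (simp add: z)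
  qed (use x assms in auto)
qed

lemma array_summable_row:
  assumes "array_summable \<kappa> b" "\<kappa> > 0"
  shows "(\<lambda>n. cmod (b n l) * \<bar>of_int n\<bar> ^ j) summable_on UNIV"
proof -
  define x where "x = \<kappa> + 1"
  have x: "x > \<kappa>" "x > 0" using assms by (auto simp: x_def)
  define g where "g = (\<lambda>(n, l). cmod (b n l) * \<bar>of_int n\<bar> ^ j / x ^ l)"
  have "g summable_on UNIV"
    using assms(1) x unfolding array_summable_def g_def by blast
  hence "g summable_on range (\<lambda>n::int. (n, l))"
    by (rule summable_on_subset_banach) simp
  hence "(g \<circ> (\<lambda>n::int. (n, l))) summable_on UNIV"
    by (subst (asm) summable_on_reindex) (auto simp: inj_def)
  hence "(\<lambda>n. cmod (b n l) * \<bar>of_int n\<bar> ^ j / x ^ l) summable_on UNIV"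
    by (simp add: g_def comp_def)
  from summable_on_cmult_left[OF this, of "x ^ l"] show ?thesis using x by simp
qed

lemma array_summable_row0:
  assumes "array_summable \<kappa> b" "\<kappa> > 0"
  shows "(\<lambda>n. cmod (b n l)) summable_on UNIV"
  using array_summable_row[OF assms, of l 0] by simp

lemma fser_summable:
  assumes "array_summable \<kappa> b" "\<kappa> > 0"
  shows "(\<lambda>n. b n l * cis (of_int n * \<theta>)) summable_on UNIV"
  by (rule Infinite_Sum.abs_summable_summable) (use array_summable_row0[OF assms] in \<open>simp add: norm_mult\<close>)

lemma fser_has_sum:
  assumes "array_summable \<kappa> b" "\<kappa> > 0"
  shows "((\<lambda>n. b n l * cis (of_int n * \<theta>)) has_sum fser b l \<theta>) UNIV"
  unfolding fser_def by (rule has_sum_infsum[OF fser_summable[OF assms]])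

lemma cmod_fser_le:
  assumes "array_summable \<kappa> b" "\<kappa> > 0"
  shows "cmod (fser b l \<theta>) \<le> (\<Sum>\<^sub>\<infinity>n. cmod (b n l))"
proof -
  have "cmod (fser b l \<theta>) \<le> (\<Sum>\<^sub>\<infinity>n. cmod (b n l * cis (of_int n * \<theta>)))"
    unfolding fser_def by (rule norm_infsum_bound) (use array_summable_row0[OF assms] in \<open>simp add: norm_mult\<close>)
  thus ?thesis by (simp add: norm_mult)
qed

lemma summable_on_swap_UNIV:
  assumes "(\<lambda>(n, l). g n l) summable_on UNIV \<times> UNIV"
  shows "(\<lambda>(l, n). g n l) summable_on UNIV \<times> UNIV"
  using iffD1[OF summable_on_swap assms] by simp

lemma summable_fser_bound:
  assumes "array_summable \<kappa> b" "\<kappa> > 0" "x > \<kappa>"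
  shows "summable (\<lambda>l. (\<Sum>\<^sub>\<infinity>n. cmod (b n l)) / x ^ l)"
proof -
  have "(\<lambda>(n, l). cmod (b n l) * \<bar>of_int n\<bar> ^ 0 / x ^ l) summable_on UNIV"
    using assms unfolding array_summable_def by blast
  hence "(\<lambda>(n, l). cmod (b n l) / x ^ l) summable_on (UNIV \<times> UNIV)" by simp
  hence "(\<lambda>(l, n). cmod (b n l) / x ^ l) summable_on (UNIV \<times> UNIV)"
    by (rule summable_on_swap_UNIV)
  hence "(\<lambda>l. \<Sum>\<^sub>\<infinity>n. cmod (b n l) / x ^ l) summable_on UNIV"
    by (intro summable_on_Sigma_banach) auto
  hence "summable (\<lambda>l. \<Sum>\<^sub>\<infinity>n. cmod (b n l) / x ^ l)" by (rule summable_on_imp_summable)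
  thus ?thesis by (simp add: divide_inverse infsum_cmult_left')
qed

lemma cis_quadratic: "cmod (cis t - 1 - \<i> * of_real t) \<le> t\<^sup>2"
proof -
  have "(\<Sum>k\<le>1. (\<i> * complex_of_real t) ^ k / fact k) = 1 + \<i> * of_real t" by simp
  with Taylor_exp[of "\<i> * of_real t" 1] have "cmod (exp (\<i> * of_real t) - (1 + \<i> * of_real t)) \<le> \<bar>t\<bar> ^ 2"
    by (simp add: norm_mult power2_eq_square)
  thus ?thesis by (simp add: cis_conv_exp diff_diff_eq)
qed

lemma has_sum_diff_complex:
  fixes f g :: "'a \<Rightarrow> complex"
  assumes "(f has_sum a) A" "(g has_sum b) A"
  shows "((\<lambda>x. f x - g x) has_sum (a - b)) A"
  using has_sum_add[OF assms(1) has_sum_cmult_right[OF assms(2), of "-1"]] by simp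

lemma fser_deriv:
  assumes b: "array_summable \<kappa> b" "\<kappa> > 0"
  shows "(fser b l has_vector_derivative fser (\<lambda>n l. \<i> * (of_int n * b n l)) l \<theta>) (at \<theta>)"
proof (rule has_vector_derivative_quadratic[of 1])
  fix h :: real
  note b' = array_summable_cmult[OF array_summable_n[OF b(1)], of "\<i>"]
  have s: "((\<lambda>n. b n l * cis (of_int n * (\<theta> + h)) - b n l * cis (of_int n * \<theta>)
      - of_real h * (\<i> * (of_int n * b n l) * cis (of_int n * \<theta>))) has_sum
      (fser b l (\<theta> + h) - fser b l \<theta> - of_real h * fser (\<lambda>n l. \<i> * (of_int n * b n l)) l \<theta>)) UNIV"
    by (intro has_sum_diff_complex has_sum_cmult_right fser_has_sum[OF b] fser_has_sum[OF b' b(2)])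
  have le: "cmod (b n l * cis (of_int n * (\<theta> + h)) - b n l * cis (of_int n * \<theta>)
      - of_real h * (\<i> * (of_int n * b n l) * cis (of_int n * \<theta>))) \<le> cmod (b n l) * \<bar>of_int n\<bar> ^ 2 * h\<^sup>2" for n
  proof -
    have "b n l * cis (of_int n * (\<theta> + h)) - b n l * cis (of_int n * \<theta>)
      - of_real h * (\<i> * (of_int n * b n l) * cis (of_int n * \<theta>))
      = b n l * cis (of_int n * \<theta>) * (cis (of_int n * h) - 1 - \<i> * of_real (of_int n * h))"
      by (simp add: distrib_left cis_mult[symmetric]) (simp add: algebra_simps)
    also have "cmod \<dots> \<le> cmod (b n l) * (of_int n * h)\<^sup>2"
      unfolding norm_mult using cis_quadratic[of "of_int n * h"] by (simp add: mult_left_mono)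
    finally show ?thesis by (simp add: power_mult_distrib mult.assoc)
  qed
  have sb: "(\<lambda>n. cmod (b n l) * \<bar>of_int n\<bar> ^ 2 * h\<^sup>2) summable_on UNIV"
    by (intro summable_on_cmult_left array_summable_row[OF b])
  have "cmod (fser b l (\<theta> + h) - fser b l \<theta> - of_real h * fser (\<lambda>n l. \<i> * (of_int n * b n l)) l \<theta>)
     \<le> (\<Sum>\<^sub>\<infinity>n. cmod (b n l) * \<bar>of_int n\<bar> ^ 2 * h\<^sup>2)"
    by (rule norm_infsum_le[OF s has_sum_infsum[OF sb]]) (use le in auto)
  also have "\<dots> = (\<Sum>\<^sub>\<infinity>n. cmod (b n l) * \<bar>of_int n\<bar> ^ 2) * h\<^sup>2"
    by (rule infsum_cmult_left')
  finally show "norm (fser b l (\<theta> + h) - fser b l \<theta> - h *\<^sub>R fser (\<lambda>n l. \<i> * (of_int n * b n l)) l \<theta>)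
     \<le> (\<Sum>\<^sub>\<infinity>n. cmod (b n l) * \<bar>of_int n\<bar> ^ 2) * h\<^sup>2"
    by (simp add: scaleR_conv_of_real)
qed simp

text \<open>Absolute convergence of the double series permits summing over the modes first.\<close>

lemma array_rearrange:
  assumes b: "array_summable \<kappa> b" "\<kappa> > 0" and x: "x > \<kappa>"
    and v: "\<And>n. (\<lambda>l. b n l / of_real x ^ l) sums v n"
  shows "((\<lambda>n. v n * cis (of_int n * \<theta>)) has_sum (\<Sum>l. fser b l \<theta> / of_real x ^ l)) UNIV"
proof -
  have x0: "x > 0" using b x by simp
  define g where "g n l = b n l * cis (of_int n * \<theta>) / of_real x ^ l" for n l
  have "(\<lambda>(n, l). cmod (b n l) * \<bar>of_int n\<bar> ^ 0 / x ^ l) summable_on UNIV"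
    using b x unfolding array_summable_def by blast
  hence ga: "(\<lambda>(n, l). cmod (g n l)) summable_on UNIV \<times> UNIV"
    using x0 by (simp add: g_def norm_mult norm_divide norm_power)
  hence "(\<lambda>z. norm (case z of (n, l) \<Rightarrow> g n l)) summable_on UNIV \<times> UNIV"
    by (simp add: case_prod_unfold)
  hence gs: "(\<lambda>(n, l). g n l) summable_on UNIV \<times> UNIV"
    by (rule Infinite_Sum.abs_summable_summable)
  have inner: "(\<Sum>\<^sub>\<infinity>l. g n l) = v n * cis (of_int n * \<theta>)" for n
  proof -
    have "(\<lambda>(n, l). g n l) summable_on range (Pair n)"
      using gs by (rule summable_on_subset_banach) auto
    hence "((\<lambda>(n, l). g n l) \<circ> Pair n) summable_on UNIV"
      by (subst (asm) summable_on_reindex) (auto simp: inj_def)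
    hence "(\<lambda>l. g n l) summable_on UNIV" by (simp add: comp_def)
    hence "(\<lambda>l. g n l) sums (\<Sum>\<^sub>\<infinity>l. g n l)" by (intro has_sum_imp_sums has_sum_infsum)
    moreover have "(\<lambda>l. g n l) sums (v n * cis (of_int n * \<theta>))"
      using sums_mult2[OF v[of n], of "cis (of_int n * \<theta>)"] by (simp add: g_def)
    ultimately show ?thesis by (rule sums_unique2)
  qed
  have outer: "(\<Sum>\<^sub>\<infinity>n. g n l) = fser b l \<theta> / of_real x ^ l" for l
    unfolding g_def fser_def divide_inverse by (rule infsum_cmult_left')
  have gs': "(\<lambda>(l, n). g n l) summable_on (UNIV \<times> UNIV)"
    using gs by (rule summable_on_swap_UNIV)
  have "(\<lambda>l. fser b l \<theta> / of_real x ^ l) sums (\<Sum>\<^sub>\<infinity>l. \<Sum>\<^sub>\<infinity>n. g n l)"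
    unfolding outer[symmetric]
    by (intro has_sum_imp_sums has_sum_infsum summable_on_Sigma_banach) (use gs' in auto)
  hence "(\<Sum>l. fser b l \<theta> / of_real x ^ l) = (\<Sum>\<^sub>\<infinity>l. \<Sum>\<^sub>\<infinity>n. g n l)" by (rule sums_unique[symmetric])
  also have "\<dots> = (\<Sum>\<^sub>\<infinity>n. \<Sum>\<^sub>\<infinity>l. g n l)" by (rule infsum_swap_banach[OF gs'])
  finally have e: "(\<Sum>l. fser b l \<theta> / of_real x ^ l) = (\<Sum>\<^sub>\<infinity>n. v n * cis (of_int n * \<theta>))" unfolding inner .
  have "(\<lambda>n. \<Sum>\<^sub>\<infinity>l. g n l) summable_on UNIV"
    by (intro summable_on_Sigma_banach) (use gs in auto)
  thus ?thesis unfolding e inner by (rule has_sum_infsum)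
qed

definition karp_array :: "real \<Rightarrow> real \<Rightarrow> (int \<Rightarrow> complex) \<Rightarrow> int \<Rightarrow> nat \<Rightarrow> complex" where
  "karp_array p q c n l = c n * of_real (lommel (-1) p q (nat \<bar>n\<bar>) l)"

text \<open>The factorial growth of the Lommel majorant, \<open>m! (2/x)\<^sup>m\<close>, is exactly compensated by the decay of
  the amplitudes; choosing \<open>y\<close> between \<open>\<kappa>\<close> and \<open>x\<close> leaves a geometric factor \<open>(y/x)\<^sup>m\<close>.\<close>

lemma karp_array_summable:
  assumes c: "admissible \<kappa> c" and k: "\<kappa> > 0"
  shows "array_summable \<kappa> (karp_array p q c)"
  unfolding array_summable_def
proof (intro allI impI)
  fix x j assume x: "x > \<kappa>"
  define y where "y = (\<kappa> + x) / 2"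
  have y: "\<kappa> < y" "y < x" "0 < y" "0 < x" using x k by (auto simp: y_def)
  obtain C where C: "\<And>n. cmod (c n) * fact (nat \<bar>n\<bar>) \<le> C * (y / 2) ^ nat \<bar>n\<bar>"
    using c y unfolding admissible_def by blast
  obtain D where D: "D \<ge> 0" "\<And>m. lommel_val 1 \<bar>p\<bar> \<bar>q\<bar> m (1 / x) \<le> D * (fact m * (2 * (1 / x)) ^ m)"
    using lommel_val_bound[of "1 / x" "\<bar>p\<bar>" "\<bar>q\<bar>"] y by auto
  define g where "g n l = cmod (c n) * \<bar>of_int n\<bar> ^ j * (lommel 1 \<bar>p\<bar> \<bar>q\<bar> (nat \<bar>n\<bar>) l * (1 / x) ^ l)" for n l
  have lnn: "lommel 1 \<bar>p\<bar> \<bar>q\<bar> m l \<ge> 0" for m l using abs_lommel_le[of p q m l] by (rule order_trans[rotated]) simp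
  have g0: "g n l \<ge> 0" for n l using lnn y by (simp add: g_def)
  have gs: "(g n has_sum (cmod (c n) * \<bar>of_int n\<bar> ^ j * lommel_val 1 \<bar>p\<bar> \<bar>q\<bar> (nat \<bar>n\<bar>) (1 / x))) UNIV" for n
  proof (rule sums_nonneg_imp_has_sum)
    show "g n sums (cmod (c n) * \<bar>of_int n\<bar> ^ j * lommel_val 1 \<bar>p\<bar> \<bar>q\<bar> (nat \<bar>n\<bar>) (1 / x))"
      unfolding g_def by (intro sums_mult lommel_sums)
  qed (rule g0)
  have "(\<lambda>z. norm (case z of (n, l) \<Rightarrow> g n l)) summable_on Sigma UNIV (\<lambda>_. UNIV)"
    unfolding Infinite_Sum.abs_summable_on_Sigma_iff
  proof (intro conjI ballI)
    fix n :: int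
    show "(\<lambda>l. norm (case (n, l) of (n, l) \<Rightarrow> g n l)) summable_on UNIV"
      using has_sum_imp_summable[OF gs[of n]] g0 by simp
  next
    have e: "(\<Sum>\<^sub>\<infinity>l. norm (case (n, l) of (n, l) \<Rightarrow> g n l)) = cmod (c n) * \<bar>of_int n\<bar> ^ j * lommel_val 1 \<bar>p\<bar> \<bar>q\<bar> (nat \<bar>n\<bar>) (1 / x)" for n
      using infsumI[OF gs[of n]] g0 by simp
    have "(\<lambda>n::int. (C * D) * (\<bar>of_int n\<bar> ^ j * (y / x) ^ nat \<bar>n\<bar>)) summable_on UNIV"
      by (intro summable_on_cmult_right summable_int_geometric) (use y in auto)
    hence "(\<lambda>n. \<Sum>\<^sub>\<infinity>l. norm (case (n, l) of (n, l) \<Rightarrow> g n l)) summable_on UNIV"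
    proof (rule summable_on_real_comparison)
      fix n :: int
      show "0 \<le> (\<Sum>\<^sub>\<infinity>l. norm (case (n, l) of (n, l) \<Rightarrow> g n l))" by (intro infsum_nonneg) auto
      have "cmod (c n) * \<bar>of_int n\<bar> ^ j * lommel_val 1 \<bar>p\<bar> \<bar>q\<bar> (nat \<bar>n\<bar>) (1 / x)
         \<le> cmod (c n) * \<bar>of_int n\<bar> ^ j * (D * (fact (nat \<bar>n\<bar>) * (2 * (1 / x)) ^ nat \<bar>n\<bar>))"
        by (intro mult_left_mono D) auto
      also have "\<dots> = (cmod (c n) * fact (nat \<bar>n\<bar>)) * (\<bar>of_int n\<bar> ^ j * D * (2 / x) ^ nat \<bar>n\<bar>)" by simp
      also have "\<dots> \<le> (C * (y / 2) ^ nat \<bar>n\<bar>) * (\<bar>of_int n\<bar> ^ j * D * (2 / x) ^ nat \<bar>n\<bar>)"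
        by (intro mult_right_mono C) (use D y in auto)
      also have "\<dots> = C * D * (\<bar>of_int n\<bar> ^ j * (y / x) ^ nat \<bar>n\<bar>)"
        by (simp add: power_divide)
      finally show "(\<Sum>\<^sub>\<infinity>l. norm (case (n, l) of (n, l) \<Rightarrow> g n l)) \<le> C * D * (\<bar>of_int n\<bar> ^ j * (y / x) ^ nat \<bar>n\<bar>)"
        unfolding e .
    qed
    moreover have "norm (\<Sum>\<^sub>\<infinity>l. norm (case (n, l) of (n, l) \<Rightarrow> g n l)) = (\<Sum>\<^sub>\<infinity>l. norm (case (n, l) of (n, l) \<Rightarrow> g n l))" for n
      by (simp add: infsum_nonneg)
    ultimately show "(\<lambda>n. norm (\<Sum>\<^sub>\<infinity>l. norm (case (n, l) of (n, l) \<Rightarrow> g n l))) summable_on UNIV"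
      by presburger
  qed
  hence "(\<lambda>z. norm (case z of (n, l) \<Rightarrow> g n l)) summable_on UNIV" by simp
  thus "(\<lambda>(n, l). cmod (karp_array p q c n l) * \<bar>of_int n\<bar> ^ j / x ^ l) summable_on UNIV"
  proof (rule summable_on_real_comparison)
    fix z :: "int \<times> nat"
    obtain n l where z: "z = (n, l)" by (cases z)
    have "cmod (karp_array p q c n l) * \<bar>of_int n\<bar> ^ j / x ^ l = cmod (c n) * \<bar>of_int n\<bar> ^ j * (\<bar>lommel (-1) p q (nat \<bar>n\<bar>) l\<bar> * (1 / x) ^ l)"
      by (simp add: karp_array_def norm_mult power_divide)
    also have "\<dots> \<le> g n l" unfolding g_def
      by (intro mult_left_mono mult_right_mono abs_lommel_le) (use y in auto)
    finally show "(case z of (n, l) \<Rightarrow> cmod (karp_array p q c n l) * \<bar>of_int n\<bar> ^ j / x ^ l) \<le> norm (case z of (n, l) \<Rightarrow> g n l)"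
      using g0[of n l] by (simp add: z)
  qed (use y in auto)
qed

lemma karp_expansion:
  assumes c: "admissible \<kappa> c" and k: "\<kappa> > 0" and x: "x > \<kappa>"
  shows "((\<lambda>n. c n * hankel1 (nat \<bar>n\<bar>) x * cis (of_int n * \<theta>)) has_sum
     (hankel1 0 x * (\<Sum>l. fser (karp_array 1 0 c) l \<theta> / of_real x ^ l)
      + hankel1 1 x * (\<Sum>l. fser (karp_array 0 1 c) l \<theta> / of_real x ^ l))) UNIV"
proof -
  have v: "(\<lambda>l. karp_array p q c n l / of_real x ^ l) sums (c n * of_real (lommel_val (-1) p q (nat \<bar>n\<bar>) (1 / x)))" for p q n
  proof -
    have "(\<lambda>l. complex_of_real (lommel (-1) p q (nat \<bar>n\<bar>) l * (1 / x) ^ l)) sums of_real (lommel_val (-1) p q (nat \<bar>n\<bar>) (1 / x))"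
      by (intro sums_of_real lommel_sums)
    from sums_mult[OF this, of "c n"] show ?thesis by (simp add: karp_array_def power_divide)
  qed
  note r = array_rearrange[OF karp_array_summable[OF c k] k x v]
  have "((\<lambda>n. hankel1 0 x * (c n * of_real (lommel_val (-1) 1 0 (nat \<bar>n\<bar>) (1 / x)) * cis (of_int n * \<theta>))
     + hankel1 1 x * (c n * of_real (lommel_val (-1) 0 1 (nat \<bar>n\<bar>) (1 / x)) * cis (of_int n * \<theta>))) has_sum
     (hankel1 0 x * (\<Sum>l. fser (karp_array 1 0 c) l \<theta> / of_real x ^ l)
      + hankel1 1 x * (\<Sum>l. fser (karp_array 0 1 c) l \<theta> / of_real x ^ l))) UNIV"
    by (intro has_sum_add has_sum_cmult_right r)
  moreover have "hankel1 0 x * (c n * of_real (lommel_val (-1) 1 0 (nat \<bar>n\<bar>) (1 / x)) * cis (of_int n * \<theta>))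
     + hankel1 1 x * (c n * of_real (lommel_val (-1) 0 1 (nat \<bar>n\<bar>) (1 / x)) * cis (of_int n * \<theta>))
     = c n * hankel1 (nat \<bar>n\<bar>) x * cis (of_int n * \<theta>)" for n
    using x k by (subst hankel1_lommel[of x "nat \<bar>n\<bar>"]) (auto simp: algebra_simps)
  ultimately show ?thesis by simp
qed

lemma fser_cong_array: "(\<And>n. b n l = b' n l') \<Longrightarrow> fser b l \<theta> = fser b' l' \<theta>"
  by (simp add: fser_def)

lemma karp_leading:
  assumes c: "admissible \<kappa> c" and k: "\<kappa> > 0"
  shows "leading_coeffs c (fser (karp_array 1 0 c) 0) (fser (karp_array 0 1 c) 0)"
proof -
  have m: "real (nat \<bar>n\<bar>) = of_int \<bar>n\<bar>" for n by simp
  show ?thesis unfolding leading_coeffs_def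
    using fser_has_sum[OF karp_array_summable[OF c k, of 1 0] k, of 0]
      fser_has_sum[OF karp_array_summable[OF c k, of 0 1] k, of 0]
    unfolding karp_array_def lommel_leading m by blast
qed

section \<open>Termwise differentiation\<close>

lemma has_vector_derivative_suminf:
  fixes f :: "nat \<Rightarrow> real \<Rightarrow> 'b::banach"
  assumes S: "open S" "convex S" and d: "\<And>l x. x \<in> S \<Longrightarrow> (f l has_vector_derivative f' l x) (at x)"
    and M: "\<And>l x. x \<in> S \<Longrightarrow> norm (f' l x) \<le> M l" "summable M"
    and s: "\<And>x. x \<in> S \<Longrightarrow> summable (\<lambda>l. f l x)" and x: "x \<in> S"
  shows "((\<lambda>x. \<Sum>l. f l x) has_vector_derivative (\<Sum>l. f' l x)) (at x)"
proof -
  have ul: "uniform_limit S (\<lambda>n x. \<Sum>l<n. f' l x) (\<lambda>x. \<Sum>l. f' l x) sequentially"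
    by (rule Weierstrass_m_test[OF M])
  have "\<exists>g. \<forall>x\<in>S. (\<lambda>l. f l x) sums g x \<and> (g has_derivative (\<lambda>h. h *\<^sub>R (\<Sum>l. f' l x))) (at x within S)"
  proof (rule has_derivative_series[where f = f and f' = "\<lambda>l x h. h *\<^sub>R f' l x" and S = S and x = x])
    show "convex S" by (rule S)
    show "x \<in> S" by (rule x)
    show "(\<lambda>l. f l x) sums (\<Sum>l. f l x)" by (rule summable_sums[OF s[OF x]])
    show "(f l has_derivative (\<lambda>h. h *\<^sub>R f' l x)) (at x within S)" if "x \<in> S" for l x
      using d[OF that, of l] unfolding has_vector_derivative_def by (rule has_derivative_at_withinI)
    fix e :: real assume "e > 0"
    from uniform_limitD[OF ul this]
    show "\<forall>\<^sub>F n in sequentially. \<forall>x\<in>S. \<forall>h. norm ((\<Sum>l<n. h *\<^sub>R f' l x) - h *\<^sub>R (\<Sum>l. f' l x)) \<le> e * norm h"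
    proof eventually_elim
      case (elim n)
      show ?case
      proof (intro ballI allI)
        fix x h assume "x \<in> S"
        hence "norm ((\<Sum>l<n. f' l x) - (\<Sum>l. f' l x)) \<le> e" using elim by (auto simp: dist_norm less_imp_le)
        hence "\<bar>h\<bar> * norm ((\<Sum>l<n. f' l x) - (\<Sum>l. f' l x)) \<le> \<bar>h\<bar> * e" by (intro mult_left_mono) auto
        thus "norm ((\<Sum>l<n. h *\<^sub>R f' l x) - h *\<^sub>R (\<Sum>l. f' l x)) \<le> e * norm h"
          by (simp add: mult.commute flip: scaleR_sum_right scaleR_diff_right)
      qed
    qed
  qed
  then obtain g where g0: "\<forall>x\<in>S. (\<lambda>l. f l x) sums g x \<and> (g has_derivative (\<lambda>h. h *\<^sub>R (\<Sum>l. f' l x))) (at x within S)" ..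
  have g: "(\<lambda>l. f l x) sums g x" "(g has_derivative (\<lambda>h. h *\<^sub>R (\<Sum>l. f' l x))) (at x within S)" if "x \<in> S" for x
    using bspec[OF g0 that] by simp_all
  have D: "(g has_vector_derivative (\<Sum>l. f' l x)) (at x)"
    using g(2)[OF x] unfolding has_vector_derivative_def at_within_open[OF x S(1)] .
  have eq: "g y = (\<Sum>l. f l y)" if "y \<in> S" for y
    by (rule sums_unique[OF g(1)[OF that]])
  show ?thesis by (rule has_vector_derivative_transform_within_open[OF D S(1) x eq])
qed

text \<open>The index \<open>0\<close> stands for the absence of a Hankel factor, so that both kinds of series can be
  treated at once.\<close>

definition karp_factor :: "nat \<Rightarrow> real \<Rightarrow> complex" where
  "karp_factor e x = (if e = 0 then 1 else hankel1 (e - 1) x)"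

definition karp_term :: "real \<Rightarrow> nat \<Rightarrow> nat \<Rightarrow> (int \<Rightarrow> nat \<Rightarrow> complex) \<Rightarrow> nat \<Rightarrow> real \<Rightarrow> real \<Rightarrow> complex" where
  "karp_term k e i b l r \<theta> = karp_factor e (k * r) * (fser b l \<theta> / of_real (k * r) ^ (l + i))"

text \<open>A class of series that contains the expansions and is closed under both partial derivatives.
  Derivatives in \<open>r\<close> produce higher Hankel factors and higher powers of \<open>1/r\<close>. The bounded linear
  map accounts for vector-valued series.\<close>

inductive karp_family :: "real \<Rightarrow> real \<Rightarrow> (nat \<Rightarrow> real \<Rightarrow> real \<Rightarrow> 'b::banach) \<Rightarrow> bool" for a k where
  base: "array_summable (k * a) b \<Longrightarrow> bounded_linear L \<Longrightarrow> karp_family a k (\<lambda>l r \<theta>. L (karp_term k e i b l r \<theta>))"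
| add: "karp_family a k S \<Longrightarrow> karp_family a k T \<Longrightarrow> karp_family a k (\<lambda>l r \<theta>. S l r \<theta> + T l r \<theta>)"

lemma karp_factor_deriv:
  assumes "k > 0" "r > 0"
  shows "((\<lambda>r. karp_factor e (k * r)) has_vector_derivative
     of_real k * (if e = 0 then 0 else of_real (real (e - 1) / (k * r)) * karp_factor e (k * r) - karp_factor (Suc e) (k * r))) (at r)"
proof (cases e)
  case (Suc m)
  have i: "((\<lambda>r. k * r) has_real_derivative k) (at r)" by (auto intro!: derivative_eq_intros)
  have "(hankel1 m \<circ> (\<lambda>r. k * r) has_vector_derivative k *\<^sub>R hankel1' m (k * r)) (at r)"
    by (rule vector_diff_chain_at) (use i assms hankel1_deriv in \<open>auto simp: has_real_derivative_iff_has_vector_derivative\<close>)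
  thus ?thesis using Suc by (simp add: karp_factor_def comp_def hankel1'_def scaleR_conv_of_real)
qed (simp add: karp_factor_def)

lemma fser_scale: "fser (\<lambda>n l. z l * b n l) l \<theta> = z l * fser b l \<theta>"
  unfolding fser_def by (simp add: mult.assoc infsum_cmult_right')

text \<open>The three summands come from the power \<open>(k r)\<^sup>-\<^sup>l\<close>, from the shift \<open>i\<close> together with the term
  \<open>m/x H\<^sub>m\<close> of the derivative of the Hankel function, and from the remaining term \<open>- H\<^sub>m\<^sub>+\<^sub>1\<close>.\<close>

lemma karp_term_deriv_r:
  assumes "k > 0" "r > 0"
  shows "((\<lambda>r. karp_term k e i b l r \<theta>) has_vector_derivative
     (karp_term k e (Suc i) (\<lambda>n l. - of_real k * (of_nat l * b n l)) l r \<theta>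
    + karp_term k e (Suc i) (\<lambda>n l. of_real (k * (real (e - 1) - real i)) * b n l) l r \<theta>)
    + karp_term k (Suc e) i (\<lambda>n l. (if e = 0 then 0 else - of_real k) * b n l) l r \<theta>) (at r)"
proof -
  have u: "((\<lambda>r. inverse (k * r)) has_real_derivative - k * (inverse (k * r))\<^sup>2) (at r)"
    using assms by (auto intro!: derivative_eq_intros simp: power2_eq_square field_simps)
  have p: "((\<lambda>r. inverse (k * r) ^ (l + i)) has_real_derivative - real (l + i) * k * inverse (k * r) ^ Suc (l + i)) (at r)"
  proof -
    have "real m * (- k * y\<^sup>2 * y ^ (m - Suc 0)) = - real m * k * y ^ Suc m" for y m
      by (cases m) (auto simp: power2_eq_square algebra_simps)
    thus ?thesis by (intro DERIV_cong[OF DERIV_power[OF u]])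
  qed
  have p': "((\<lambda>r. fser b l \<theta> * of_real (inverse (k * r) ^ (l + i))) has_vector_derivative
     fser b l \<theta> * of_real (- real (l + i) * k * inverse (k * r) ^ Suc (l + i))) (at r)"
    by (rule bounded_linear.has_vector_derivative[OF bounded_linear_mult_right has_vector_derivative_of_real[OF p]])
  have t: "karp_term k e i b l r \<theta> = karp_factor e (k * r) * (fser b l \<theta> * of_real (inverse (k * r) ^ (l + i)))" for e i b l r
    by (simp only: karp_term_def divide_inverse power_inverse of_real_power of_real_inverse)
  have s1: "fser (\<lambda>n l. - of_real k * (of_nat l * b n l)) l \<theta> = - of_real k * of_nat l * fser b l \<theta>"
    using fser_scale[of "\<lambda>l. - of_real k * of_nat l" b l \<theta>] by (simp add: mult.assoc)
  note s2 = fser_scale[of "\<lambda>_. of_real (k * (real (e - 1) - real i))" b l \<theta>]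
  note s3 = fser_scale[of "\<lambda>_. if e = 0 then 0 else - of_real k" b l \<theta>]
  define y where "y = inverse (k * r)"
  define K where "K = karp_factor e (k * r)"
  define K1 where "K1 = karp_factor (Suc e) (k * r)"
  define f where "f = fser b l \<theta>"
  have e: "real (e - 1) / (k * r) = real (e - 1) * y" by (simp add: y_def divide_inverse)
  have D: "((\<lambda>r. karp_factor e (k * r) * (fser b l \<theta> * of_real (inverse (k * r) ^ (l + i)))) has_vector_derivative
      K * (f * of_real (- real (l + i) * k * y ^ Suc (l + i)))
    + of_real k * (if e = 0 then 0 else of_real (real (e - 1) * y) * K - K1) * (f * of_real (y ^ (l + i)))) (at r)"
    using has_vector_derivative_mult[OF karp_factor_deriv[OF assms, of e] p']
    unfolding e K_def[symmetric] K1_def[symmetric] f_def[symmetric] y_def[symmetric] .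
  have eq: "K * (f * of_real (- real (l + i) * k * y ^ Suc (l + i)))
    + of_real k * (if e = 0 then 0 else of_real (real (e - 1) * y) * K - K1) * (f * of_real (y ^ (l + i)))
    = K * (- of_real k * of_nat l * f * of_real (y ^ (l + Suc i)))
    + K * (of_real (k * (real (e - 1) - real i)) * f * of_real (y ^ (l + Suc i)))
    + K1 * ((if e = 0 then 0 else - of_real k) * f * of_real (y ^ (l + i)))"
    by (cases "e = 0") (simp_all add: algebra_simps)
  show ?thesis
    unfolding t s1 s2 s3 using D[unfolded eq] unfolding K_def K1_def f_def y_def .
qed

lemma karp_term_deriv_\<theta>:
  assumes "array_summable \<kappa> b" "\<kappa> > 0"
  shows "((\<lambda>\<theta>. karp_term k e i b l r \<theta>) has_vector_derivative
     karp_term k e i (\<lambda>n l. \<i> * (of_int n * b n l)) l r \<theta>) (at \<theta>)"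
  unfolding karp_term_def
  by (intro bounded_linear.has_vector_derivative[OF bounded_linear_mult_right]
      bounded_linear.has_vector_derivative[OF bounded_linear_divide] fser_deriv[OF assms])

context
  fixes a k :: real assumes ak: "a > 0" "k > 0"
begin

lemma ka: "k * a > 0" using ak by simp

lemma karp_family_deriv_r:
  assumes "karp_family a k T"
  shows "\<exists>T'. karp_family a k T' \<and> (\<forall>l \<theta>. \<forall>r>a. ((\<lambda>s. T l s \<theta>) has_vector_derivative T' l r \<theta>) (at r))"
  using assms
proof induction
  case (base b L e i)
  let ?D = "\<lambda>l r \<theta>. (L (karp_term k e (Suc i) (\<lambda>n l. - of_real k * (of_nat l * b n l)) l r \<theta>)
    + L (karp_term k e (Suc i) (\<lambda>n l. of_real (k * (real (e - 1) - real i)) * b n l) l r \<theta>))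
    + L (karp_term k (Suc e) i (\<lambda>n l. (if e = 0 then 0 else - of_real k) * b n l) l r \<theta>)"
  have "karp_family a k ?D"
    by (intro karp_family.intros base(2) array_summable_cmult array_summable_l base(1) ka)
  moreover have "((\<lambda>s. L (karp_term k e i b l s \<theta>)) has_vector_derivative ?D l r \<theta>) (at r)" if "r > a" for l r \<theta>
    using bounded_linear.has_vector_derivative[OF base(2) karp_term_deriv_r[of k r e i b l \<theta>]] that ak
    by (simp add: linear_add[OF bounded_linear.linear[OF base(2)]])
  ultimately show ?case by blast
next
  case (add S T)
  then obtain S' T' where "karp_family a k S'" "\<forall>l \<theta>. \<forall>r>a. ((\<lambda>s. S l s \<theta>) has_vector_derivative S' l r \<theta>) (at r)"
    "karp_family a k T'" "\<forall>l \<theta>. \<forall>r>a. ((\<lambda>s. T l s \<theta>) has_vector_derivative T' l r \<theta>) (at r)" by blast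
  thus ?case
    by (intro exI[of _ "\<lambda>l r \<theta>. S' l r \<theta> + T' l r \<theta>"] conjI karp_family.add) (auto intro: has_vector_derivative_add)
qed

lemma karp_family_deriv_\<theta>:
  assumes "karp_family a k T"
  shows "\<exists>T'. karp_family a k T' \<and> (\<forall>l \<theta> r. ((\<lambda>t. T l r t) has_vector_derivative T' l r \<theta>) (at \<theta>))"
  using assms
proof induction
  case (base b L e i)
  have "karp_family a k (\<lambda>l r \<theta>. L (karp_term k e i (\<lambda>n l. \<i> * (of_int n * b n l)) l r \<theta>))"
    by (intro karp_family.intros base(2) array_summable_cmult array_summable_n base(1))
  moreover have "((\<lambda>t. L (karp_term k e i b l r t)) has_vector_derivative
      L (karp_term k e i (\<lambda>n l. \<i> * (of_int n * b n l)) l r \<theta>)) (at \<theta>)" for l r \<theta>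
    by (rule bounded_linear.has_vector_derivative[OF base(2) karp_term_deriv_\<theta>[OF base(1) ka]])
  ultimately show ?case by blast
next
  case (add S T)
  then obtain S' T' where "karp_family a k S'" "\<forall>l \<theta> r. ((\<lambda>t. S l r t) has_vector_derivative S' l r \<theta>) (at \<theta>)"
    "karp_family a k T'" "\<forall>l \<theta> r. ((\<lambda>t. T l r t) has_vector_derivative T' l r \<theta>) (at \<theta>)" by blast
  thus ?case
    by (intro exI[of _ "\<lambda>l r \<theta>. S' l r \<theta> + T' l r \<theta>"] conjI karp_family.add) (auto intro: has_vector_derivative_add)
qed

lemma karp_family_continuous:
  assumes "karp_family a k T"
  shows "continuous_on ({a<..} \<times> UNIV) (\<lambda>(r, \<theta>). T l r \<theta>)"
  using assms
proof induction
  case (base b L e i)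
  have 1: "continuous_on UNIV (fser b l)"
    by (rule continuous_on_vector_derivative) (use fser_deriv[OF base(1) ka] in auto)
  have 2: "continuous_on {a<..} (\<lambda>r. karp_factor e (k * r))"
    by (rule continuous_on_vector_derivative, rule has_vector_derivative_at_within, rule karp_factor_deriv)
       (use ak in auto)
  show ?case unfolding karp_term_def case_prod_unfold
    by (intro bounded_linear.continuous_on[OF base(2)] continuous_intros
        continuous_on_compose2[OF 1, of _ snd] continuous_on_compose2[OF 2, of _ fst])
       (use ak in auto)
next
  case (add S T)
  thus ?case unfolding case_prod_unfold by (intro continuous_intros)
qed

lemma karp_family_bound:
  assumes "karp_family a k T" and "\<epsilon> > 0"
  shows "\<exists>M. summable M \<and> (\<forall>l r \<theta>. r \<ge> a + \<epsilon> \<longrightarrow> norm (T l r \<theta>) \<le> M l)"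
  using assms(1)
proof induction
  case (base b L e i)
  define x where "x = k * (a + \<epsilon>)"
  have x: "x > k * a" "x > 0" using ak assms(2) by (auto simp: x_def algebra_simps add_pos_pos)
  obtain B where B: "B > 0" "\<And>y. y \<ge> x \<Longrightarrow> cmod (karp_factor e y) \<le> B"
  proof (cases e)
    case 0 thus ?thesis using that[of 1] by (simp add: karp_factor_def)
  next
    case (Suc m) thus ?thesis using hankel1_bounded[OF x(2), of m] that by (auto simp: karp_factor_def)
  qed
  obtain K where K: "\<And>z. norm (L z) \<le> norm z * K" "K > 0"
    using bounded_linear.pos_bounded[OF base(2)] by blast
  define M where "M l = (B * K / x ^ i) * ((\<Sum>\<^sub>\<infinity>n. cmod (b n l)) / x ^ l)" for l
  have "summable M" unfolding M_def[abs_def]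
    by (intro summable_mult summable_fser_bound[OF base(1) ka x(1)])
  moreover have "norm (L (karp_term k e i b l r \<theta>)) \<le> M l" if r: "r \<ge> a + \<epsilon>" for l r \<theta>
  proof -
    have kr: "k * r \<ge> x" unfolding x_def using r ak by (intro mult_left_mono) auto
    have "norm (L (karp_term k e i b l r \<theta>)) \<le> cmod (karp_factor e (k * r)) * (cmod (fser b l \<theta>) / (k * r) ^ (l + i)) * K"
      using K(1)[of "karp_term k e i b l r \<theta>"] kr x unfolding karp_term_def norm_mult norm_divide norm_power norm_of_real by simp
    also have "\<dots> \<le> B * ((\<Sum>\<^sub>\<infinity>n. cmod (b n l)) / x ^ (l + i)) * K"
      using kr x B K(2) cmod_fser_le[OF base(1) ka, of l \<theta>]
      by (intro mult_right_mono mult_mono frac_le power_mono B(2)) (auto intro: infsum_nonneg)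
    also have "\<dots> = M l" by (simp add: M_def power_add mult_ac)
    finally show ?thesis .
  qed
  ultimately show ?case by blast
next
  case (add S T)
  then obtain M N where "summable M" "summable N" "\<forall>l r \<theta>. r \<ge> a + \<epsilon> \<longrightarrow> norm (S l r \<theta>) \<le> M l"
    "\<forall>l r \<theta>. r \<ge> a + \<epsilon> \<longrightarrow> norm (T l r \<theta>) \<le> N l" by blast
  thus ?case
    by (intro exI[of _ "\<lambda>l. M l + N l"] conjI summable_add) (auto intro!: norm_triangle_mono)
qed

lemma karp_family_summable:
  assumes "karp_family a k T" "r > a"
  shows "summable (\<lambda>l. norm (T l r \<theta>))"
proof -
  have ra: "r - a > 0" using assms(2) by simp
  obtain M where M: "summable M" "\<forall>l r' \<theta>. r' \<ge> a + (r - a) \<longrightarrow> norm (T l r' \<theta>) \<le> M l"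
    using karp_family_bound[OF assms(1) ra] by metis
  show ?thesis
  proof (rule summable_comparison_test'[OF M(1)])
    fix l :: nat
    show "norm (norm (T l r \<theta>)) \<le> M l" using M(2)[rule_format, of r l \<theta>] by simp
  qed
qed

lemma karp_family_sum_deriv_r:
  assumes T: "karp_family a k T" "karp_family a k T'" and r: "r > a"
    and d: "\<forall>l \<theta>. \<forall>r>a. ((\<lambda>s. T l s \<theta>) has_vector_derivative T' l r \<theta>) (at r)"
  shows "((\<lambda>s. \<Sum>l. T l s \<theta>) has_vector_derivative (\<Sum>l. T' l r \<theta>)) (at r)"
proof -
  define \<epsilon> where "\<epsilon> = (r - a) / 2"
  have e: "\<epsilon> > 0" using r by (simp add: \<epsilon>_def)
  obtain M where M: "summable M" "\<forall>l r \<theta>. r \<ge> a + \<epsilon> \<longrightarrow> norm (T' l r \<theta>) \<le> M l"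
    using karp_family_bound[OF T(2) e] by metis
  show ?thesis
  proof (rule has_vector_derivative_suminf[where S = "{a + \<epsilon><..}"])
    show "norm (T' l s \<theta>) \<le> M l" if "s \<in> {a + \<epsilon><..}" for l s
      using M(2)[rule_format, of s l \<theta>] that by simp
    show "((\<lambda>s. T l s \<theta>) has_vector_derivative T' l s \<theta>) (at s)" if "s \<in> {a + \<epsilon><..}" for l s
      using d that e by simp
    show "r \<in> {a + \<epsilon><..}" using r by (simp add: \<epsilon>_def field_simps)
    show "summable (\<lambda>l. T l s \<theta>)" if "s \<in> {a + \<epsilon><..}" for s
      by (rule summable_norm_cancel[OF karp_family_summable[OF T(1)]]) (use that e in auto)
  qed (use M(1) in simp_all)
qed

lemma karp_family_sum_deriv_\<theta>:
  assumes T: "karp_family a k T" "karp_family a k T'" and r: "r > a"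
    and d: "\<forall>l \<theta> r. ((\<lambda>t. T l r t) has_vector_derivative T' l r \<theta>) (at \<theta>)"
  shows "((\<lambda>t. \<Sum>l. T l r t) has_vector_derivative (\<Sum>l. T' l r \<theta>)) (at \<theta>)"
proof -
  have ra: "r - a > 0" using r by simp
  obtain M where M: "summable M" "\<forall>l r' \<theta>. r' \<ge> a + (r - a) \<longrightarrow> norm (T' l r' \<theta>) \<le> M l"
    using karp_family_bound[OF T(2) ra] by metis
  show ?thesis
  proof (rule has_vector_derivative_suminf[where S = UNIV and M = M])
    show "norm (T' l r t) \<le> M l" for l t using M(2)[rule_format, of r l t] by simp
    show "summable (\<lambda>l. T l r t)" for t
      by (rule summable_norm_cancel[OF karp_family_summable[OF T(1) r]])
    show "((\<lambda>t. T l r t) has_vector_derivative T' l r t) (at t)" for l t using d by blast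
  qed (use M(1) in simp_all)
qed

text \<open>Each derivative of the sum is the sum of the derivatives and again a member of the family.\<close>

lemma karp_family_mixed:
  assumes "karp_family a k T" "set ds \<subseteq> {d_r, d_\<theta>}"
  shows "\<exists>T'. karp_family a k T' \<and> (\<forall>l \<theta>. \<forall>r>a. mixed_deriv ds (T l) r \<theta> = T' l r \<theta>)
     \<and> (\<forall>\<theta>. \<forall>r>a. mixed_deriv ds (\<lambda>r \<theta>. \<Sum>l. T l r \<theta>) r \<theta> = (\<Sum>l. T' l r \<theta>))"
  using assms(2)
proof (induction ds)
  case Nil
  thus ?case using assms(1) by auto
next
  case (Cons d ds)
  then obtain T' where T': "karp_family a k T'" "\<forall>l \<theta>. \<forall>r>a. mixed_deriv ds (T l) r \<theta> = T' l r \<theta>"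
    "\<forall>\<theta>. \<forall>r>a. mixed_deriv ds (\<lambda>r \<theta>. \<Sum>l. T l r \<theta>) r \<theta> = (\<Sum>l. T' l r \<theta>)" by auto
  from Cons.prems consider "d = d_r" | "d = d_\<theta>" by auto
  thus ?case
  proof cases
    case 1
    obtain T'' where T'': "karp_family a k T''" "\<forall>l \<theta>. \<forall>r>a. ((\<lambda>s. T' l s \<theta>) has_vector_derivative T'' l r \<theta>) (at r)"
      using karp_family_deriv_r[OF T'(1)] by auto
    have "mixed_deriv (d # ds) (T l) r \<theta> = T'' l r \<theta>" if "r > a" for l r \<theta>
    proof -
      have "((\<lambda>s. mixed_deriv ds (T l) s \<theta>) has_vector_derivative T'' l r \<theta>) (at r)"
        by (rule has_vector_derivative_transform_within_open[OF T''(2)[rule_format, OF that], of "{a<..}"])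
           (use that T'(2) in auto)
      thus ?thesis by (simp add: 1 d_r_def vector_derivative_at)
    qed
    moreover have "mixed_deriv (d # ds) (\<lambda>r \<theta>. \<Sum>l. T l r \<theta>) r \<theta> = (\<Sum>l. T'' l r \<theta>)" if "r > a" for r \<theta>
    proof -
      have "((\<lambda>s. mixed_deriv ds (\<lambda>r \<theta>. \<Sum>l. T l r \<theta>) s \<theta>) has_vector_derivative (\<Sum>l. T'' l r \<theta>)) (at r)"
        by (rule has_vector_derivative_transform_within_open[OF karp_family_sum_deriv_r[OF T'(1) T''(1) that T''(2)], of "{a<..}"])
           (use that T'(3) in auto)
      thus ?thesis by (simp add: 1 d_r_def vector_derivative_at)
    qed
    ultimately show ?thesis using T''(1) by blast
  next
    case 2
    obtain T'' where T'': "karp_family a k T''" "\<forall>l \<theta> r. ((\<lambda>t. T' l r t) has_vector_derivative T'' l r \<theta>) (at \<theta>)"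
      using karp_family_deriv_\<theta>[OF T'(1)] by auto
    have "mixed_deriv (d # ds) (T l) r \<theta> = T'' l r \<theta>" if "r > a" for l r \<theta>
    proof -
      have "((\<lambda>t. mixed_deriv ds (T l) r t) has_vector_derivative T'' l r \<theta>) (at \<theta>)"
        using T''(2) T'(2) that by simp
      thus ?thesis by (simp add: 2 d_\<theta>_def vector_derivative_at)
    qed
    moreover have "mixed_deriv (d # ds) (\<lambda>r \<theta>. \<Sum>l. T l r \<theta>) r \<theta> = (\<Sum>l. T'' l r \<theta>)" if "r > a" for r \<theta>
    proof -
      have "((\<lambda>t. mixed_deriv ds (\<lambda>r \<theta>. \<Sum>l. T l r \<theta>) r t) has_vector_derivative (\<Sum>l. T'' l r \<theta>)) (at \<theta>)"
        using karp_family_sum_deriv_\<theta>[OF T'(1) T''(1) that T''(2)] T'(3) that by simp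
      thus ?thesis by (simp add: 2 d_\<theta>_def vector_derivative_at)
    qed
    ultimately show ?thesis using T''(1) by blast
  qed
qed

lemma karp_family_sum_continuous:
  assumes T: "karp_family a k T"
  shows "continuous_on ({a<..} \<times> UNIV) (\<lambda>(r, \<theta>). \<Sum>l. T l r \<theta>)"
proof -
  have c: "continuous_on ({a + \<epsilon><..} \<times> UNIV) (\<lambda>(r, \<theta>). \<Sum>l. T l r \<theta>)" if e: "\<epsilon> > 0" for \<epsilon>
  proof -
    obtain M where M: "summable M" "\<forall>l r \<theta>. r \<ge> a + \<epsilon> \<longrightarrow> norm (T l r \<theta>) \<le> M l"
      using karp_family_bound[OF T e] by metis
    have "uniform_limit ({a + \<epsilon><..} \<times> UNIV) (\<lambda>n z. \<Sum>l<n. (\<lambda>(r, \<theta>). T l r \<theta>) z) (\<lambda>z. \<Sum>l. (\<lambda>(r, \<theta>). T l r \<theta>) z) sequentially"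
    proof (rule Weierstrass_m_test[OF _ M(1)])
      fix l and z :: "real \<times> real" assume "z \<in> {a + \<epsilon><..} \<times> UNIV"
      thus "norm (case z of (r, \<theta>) \<Rightarrow> T l r \<theta>) \<le> M l"
        using M(2)[rule_format, of "fst z" l "snd z"] by (simp add: case_prod_unfold mem_Times_iff)
    qed
    moreover have "continuous_on ({a + \<epsilon><..} \<times> UNIV) (\<lambda>z. \<Sum>l<n. (\<lambda>(r, \<theta>). T l r \<theta>) z)" for n
      by (intro continuous_on_sum continuous_on_subset[OF karp_family_continuous[OF T]]) (use e in auto)
    ultimately have "continuous_on ({a + \<epsilon><..} \<times> UNIV) (\<lambda>z. \<Sum>l. (\<lambda>(r, \<theta>). T l r \<theta>) z)"
      by (intro uniform_limit_theorem[of _ _ sequentially]) auto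
    thus ?thesis by (simp add: case_prod_unfold)
  qed
  have "isCont (\<lambda>(r, \<theta>). \<Sum>l. T l r \<theta>) (r, \<theta>)" if r: "r > a" for r \<theta>
  proof -
    define \<epsilon> where "\<epsilon> = (r - a) / 2"
    have e: "\<epsilon> > 0" "r > a + \<epsilon>" using r by (simp_all add: \<epsilon>_def field_simps)
    have o: "open ({a + \<epsilon><..} \<times> (UNIV :: real set))" by (intro open_Times) auto
    show ?thesis using c[OF e(1)] e(2) by (subst (asm) continuous_on_eq_continuous_at[OF o]) auto
  qed
  thus ?thesis by (intro continuous_at_imp_continuous_on ballI) auto
qed

lemma karp_family_termwise_smooth:
  assumes T: "karp_family a k T"
  shows "termwise_smooth a T"
proof -
  have m: "(\<lambda>(r, \<theta>). mixed_deriv ds F r \<theta>) = (\<lambda>z. mixed_deriv ds F (fst z) (snd z))" for ds and F :: "real \<Rightarrow> real \<Rightarrow> 'a"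
    by (simp add: case_prod_unfold)
  show ?thesis
    unfolding termwise_smooth_def polar_smooth_def
  proof (intro conjI allI impI)
    fix ds :: "((real \<Rightarrow> real \<Rightarrow> 'a) \<Rightarrow> real \<Rightarrow> real \<Rightarrow> 'a) list" assume ds: "set ds \<subseteq> {d_r, d_\<theta>}"
    obtain T' where T': "karp_family a k T'" "\<And>l \<theta> r. r > a \<Longrightarrow> mixed_deriv ds (T l) r \<theta> = T' l r \<theta>"
      "\<And>\<theta> r. r > a \<Longrightarrow> mixed_deriv ds (\<lambda>r \<theta>. \<Sum>l. T l r \<theta>) r \<theta> = (\<Sum>l. T' l r \<theta>)"
      using karp_family_mixed[OF T ds] by blast
    obtain Tr where Tr: "karp_family a k Tr" "\<forall>l \<theta>. \<forall>r>a. ((\<lambda>s. T' l s \<theta>) has_vector_derivative Tr l r \<theta>) (at r)"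
      using karp_family_deriv_r[OF T'(1)] by auto
    obtain Tt where Tt: "karp_family a k Tt" "\<forall>l \<theta> r. ((\<lambda>t. T' l r t) has_vector_derivative Tt l r \<theta>) (at \<theta>)"
      using karp_family_deriv_\<theta>[OF T'(1)] by auto
    show "continuous_on ({a<..} \<times> UNIV) (\<lambda>(r, \<theta>). mixed_deriv ds (T l) r \<theta>)" for l
      by (rule continuous_on_eq[OF karp_family_continuous[OF T'(1), of l]]) (auto simp: T'(2))
    show "continuous_on ({a<..} \<times> UNIV) (\<lambda>(r, \<theta>). mixed_deriv ds (\<lambda>r \<theta>. \<Sum>l. T l r \<theta>) r \<theta>)"
      by (rule continuous_on_eq[OF karp_family_sum_continuous[OF T'(1)]]) (auto simp: T'(3))
    fix r \<theta> :: real assume r: "r > a"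
    show "(\<lambda>s. mixed_deriv ds (T l) s \<theta>) differentiable (at r)" for l
      by (rule differentiableI_vector, rule has_vector_derivative_transform_within_open[OF Tr(2)[rule_format, OF r], of "{a<..}"])
         (use r T'(2) in auto)
    show "(\<lambda>t. mixed_deriv ds (T l) r t) differentiable (at \<theta>)" for l
      using differentiableI_vector[OF Tt(2)[rule_format, of l r \<theta>]] by (simp add: T'(2)[OF r])
    show "(\<lambda>s. mixed_deriv ds (\<lambda>r \<theta>. \<Sum>l. T l r \<theta>) s \<theta>) differentiable (at r)"
      by (rule differentiableI_vector, rule has_vector_derivative_transform_within_open[OF karp_family_sum_deriv_r[OF T'(1) Tr(1) r Tr(2)], of "{a<..}"])
         (use r T'(3) in auto)
    show "(\<lambda>t. mixed_deriv ds (\<lambda>r \<theta>. \<Sum>l. T l r \<theta>) r t) differentiable (at \<theta>)"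
      using differentiableI_vector[OF karp_family_sum_deriv_\<theta>[OF T'(1) Tt(1) r Tt(2)], of \<theta>]
      by (simp add: T'(3)[OF r])
    show "mixed_deriv ds (\<lambda>r \<theta>. \<Sum>l. T l r \<theta>) r \<theta> = (\<Sum>l. mixed_deriv ds (T l) r \<theta>)"
      by (simp add: T'(2)[OF r] T'(3)[OF r])
  next
    fix ds :: "((real \<Rightarrow> real \<Rightarrow> 'a) \<Rightarrow> real \<Rightarrow> real \<Rightarrow> 'a) list" and \<epsilon> :: real
    assume ds: "set ds \<subseteq> {d_r, d_\<theta>}" and e: "\<epsilon> > 0"
    obtain T' where T': "karp_family a k T'" "\<And>l \<theta> r. r > a \<Longrightarrow> mixed_deriv ds (T l) r \<theta> = T' l r \<theta>"
      using karp_family_mixed[OF T ds] by blast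
    obtain M where M: "summable M" "\<forall>l r \<theta>. r \<ge> a + \<epsilon> \<longrightarrow> norm (T' l r \<theta>) \<le> M l"
      using karp_family_bound[OF T'(1) e] by metis
    have le: "norm (mixed_deriv ds (T l) r \<theta>) \<le> M l" if "r \<ge> a + \<epsilon>" for l r \<theta>
      using M(2)[rule_format, OF that, of l \<theta>] that e by (simp add: T'(2))
    show "conv_abs_unif (\<lambda>(r, \<theta>). r \<ge> a + \<epsilon>) (\<lambda>l (r, \<theta>). mixed_deriv ds (T l) r \<theta>)"
      unfolding conv_abs_unif_def
    proof (intro conjI allI impI)
      fix z :: "real \<times> real" assume z: "case z of (r, \<theta>) \<Rightarrow> r \<ge> a + \<epsilon>"
      show "summable (\<lambda>l. norm (case z of (r, \<theta>) \<Rightarrow> mixed_deriv ds (T l) r \<theta>))"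
      proof (rule summable_comparison_test'[OF M(1)])
        fix l :: nat
        show "norm (norm (case z of (r, \<theta>) \<Rightarrow> mixed_deriv ds (T l) r \<theta>)) \<le> M l"
          using le[of "fst z" l "snd z"] z by (simp add: case_prod_unfold)
      qed
    next
      show "uniformly_convergent_on {z. case z of (r, \<theta>) \<Rightarrow> r \<ge> a + \<epsilon>}
         (\<lambda>N z. \<Sum>l<N. case z of (r, \<theta>) \<Rightarrow> mixed_deriv ds (T l) r \<theta>)"
      proof (rule Weierstrass_m_test'[OF _ M(1)])
        fix l and z :: "real \<times> real" assume "z \<in> {z. case z of (r, \<theta>) \<Rightarrow> r \<ge> a + \<epsilon>}"
        thus "norm (case z of (r, \<theta>) \<Rightarrow> mixed_deriv ds (T l) r \<theta>) \<le> M l"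
          using le[of "fst z" l "snd z"] by (simp add: case_prod_unfold)
      qed
    qed
  qed
qed

end

section \<open>Scalar series\<close>

lemma karp_family_id:
  "array_summable (k * a) b \<Longrightarrow> karp_family a k (\<lambda>l r \<theta>. karp_term k e i b l r \<theta>)"
  using karp_family.base[of k a b "\<lambda>z. z" e i] bounded_linear_ident by simp

text \<open>The coefficients of the series multiplying \<open>H\<^sub>0\<close> and \<open>H\<^sub>1\<close> in a mode sum with amplitudes \<open>c\<close>.\<close>

abbreviation karp_h :: "(int \<Rightarrow> complex) \<Rightarrow> nat \<Rightarrow> real \<Rightarrow> complex" where
  "karp_h c \<equiv> fser (karp_array 1 0 c)"

abbreviation karp_q :: "(int \<Rightarrow> complex) \<Rightarrow> nat \<Rightarrow> real \<Rightarrow> complex" where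
  "karp_q c \<equiv> fser (karp_array 0 1 c)"

definition mode_sum :: "(int \<Rightarrow> complex) \<Rightarrow> real \<Rightarrow> real \<Rightarrow> complex" where
  "mode_sum c x \<theta> = (\<Sum>\<^sub>\<infinity>n. c n * hankel1 (nat \<bar>n\<bar>) x * cis (of_int n * \<theta>))"

lemma inv_term_fser: "inv_term k (fser b) l r \<theta> = fser b l \<theta> / of_real (k * r) ^ l"
  by (simp add: inv_term_def scaleR_conv_of_real divide_inverse)

lemma inv_term_karp_term: "inv_term k (fser b) = karp_term k 0 0 b"
  by (simp add: fun_eq_iff inv_term_fser karp_term_def karp_factor_def)

lemma hankel_inv_term_karp_term:
  "hankel1 m (k * r) * inv_term k (fser b) l r \<theta> = karp_term k (Suc m) 0 b l r \<theta>"
  by (simp add: inv_term_fser karp_term_def karp_factor_def)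

context
  fixes a k :: real and c :: "int \<Rightarrow> complex"
  assumes a: "a > 0" and k: "k > 0" and c: "admissible (k * a) c"
begin

lemma ka_pos: "k * a > 0" using a k by simp

lemma mode_sum_karp:
  assumes "r > a"
  shows "mode_sum c (k * r) \<theta> = hankel1 0 (k * r) * (\<Sum>l. inv_term k (karp_h c) l r \<theta>)
       + hankel1 1 (k * r) * (\<Sum>l. inv_term k (karp_q c) l r \<theta>)"
  unfolding mode_sum_def inv_term_fser
  by (rule infsumI[OF karp_expansion[OF c ka_pos]]) (use assms k in simp)

lemma karp_scalar_smooth: "scalar_series_smooth a k (karp_h c) (karp_q c)"
  unfolding scalar_series_smooth_def hankel_inv_term_karp_term unfolding inv_term_karp_term
  by (intro conjI karp_family_termwise_smooth[OF a k] karp_family_id karp_array_summable[OF c ka_pos])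

lemma karp_h_deriv2: "deriv2 (karp_h c l) \<theta> = fser (\<lambda>n l. - (of_int n ^ 2) * karp_array 1 0 c n l) l \<theta>"
  and karp_q_deriv2: "deriv2 (karp_q c l) \<theta> = fser (\<lambda>n l. - (of_int n ^ 2) * karp_array 0 1 c n l) l \<theta>"
proof -
  have *: "((\<lambda>t. vector_derivative (fser b l) (at t)) has_vector_derivative
      fser (\<lambda>n l. - (of_int n ^ 2) * b n l) l \<theta>) (at \<theta>) \<and> (\<forall>t. (fser b l) differentiable (at t))"
    if b: "array_summable (k * a) b" for b l \<theta>
  proof -
    let ?b' = "\<lambda>n l. \<i> * (of_int n * b n l)"
    have b': "array_summable (k * a) ?b'" by (intro array_summable_cmult array_summable_n b)
    have 1: "vector_derivative (fser b l) (at t) = fser ?b' l t" for t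
      by (rule vector_derivative_at[OF fser_deriv[OF b ka_pos]])
    have 2: "fser (\<lambda>n l. \<i> * (of_int n * ?b' n l)) l \<theta> = fser (\<lambda>n l. - (of_int n ^ 2) * b n l) l \<theta>"
      by (rule fser_cong_array) (simp add: power2_eq_square algebra_simps)
    show ?thesis unfolding 1 using fser_deriv[OF b' ka_pos, of l \<theta>] fser_deriv[OF b ka_pos, of l]
      unfolding 2 by (auto intro: differentiableI_vector)
  qed
  show "deriv2 (karp_h c l) \<theta> = fser (\<lambda>n l. - (of_int n ^ 2) * karp_array 1 0 c n l) l \<theta>"
    "deriv2 (karp_q c l) \<theta> = fser (\<lambda>n l. - (of_int n ^ 2) * karp_array 0 1 c n l) l \<theta>"
    unfolding deriv2_def
    by (intro vector_derivative_at *[THEN conjunct1] karp_array_summable[OF c ka_pos])+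
qed

lemma karp_h_deriv: "(karp_h c l has_vector_derivative fser (\<lambda>n l. \<i> * (of_int n * karp_array 1 0 c n l)) l \<theta>) (at \<theta>)"
  and karp_q_deriv: "(karp_q c l has_vector_derivative fser (\<lambda>n l. \<i> * (of_int n * karp_array 0 1 c n l)) l \<theta>) (at \<theta>)"
  and karp_h_deriv': "(fser (\<lambda>n l. \<i> * (of_int n * karp_array 1 0 c n l)) l has_vector_derivative deriv2 (karp_h c l) \<theta>) (at \<theta>)"
  and karp_q_deriv': "(fser (\<lambda>n l. \<i> * (of_int n * karp_array 0 1 c n l)) l has_vector_derivative deriv2 (karp_q c l) \<theta>) (at \<theta>)"
proof -
  have b: "array_summable (k * a) (karp_array p q c)" for p q by (rule karp_array_summable[OF c ka_pos])
  have b': "array_summable (k * a) (\<lambda>n l. \<i> * (of_int n * karp_array p q c n l))" for p q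
    by (intro array_summable_cmult array_summable_n b)
  show h: "(karp_h c l has_vector_derivative fser (\<lambda>n l. \<i> * (of_int n * karp_array 1 0 c n l)) l \<theta>) (at \<theta>)" for \<theta>
    by (rule fser_deriv[OF b ka_pos])
  show q: "(karp_q c l has_vector_derivative fser (\<lambda>n l. \<i> * (of_int n * karp_array 0 1 c n l)) l \<theta>) (at \<theta>)" for \<theta>
    by (rule fser_deriv[OF b ka_pos])
  have h1: "(\<lambda>t. vector_derivative (karp_h c l) (at t)) = fser (\<lambda>n l. \<i> * (of_int n * karp_array 1 0 c n l)) l"
    using vector_derivative_at[OF h] by (rule ext)
  have q1: "(\<lambda>t. vector_derivative (karp_q c l) (at t)) = fser (\<lambda>n l. \<i> * (of_int n * karp_array 0 1 c n l)) l"
    using vector_derivative_at[OF q] by (rule ext)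
  show "(fser (\<lambda>n l. \<i> * (of_int n * karp_array 1 0 c n l)) l has_vector_derivative deriv2 (karp_h c l) \<theta>) (at \<theta>)"
    unfolding deriv2_def h1
    by (rule vector_derivative_works[THEN iffD1, OF differentiableI_vector[OF fser_deriv[OF b' ka_pos]]])
  show "(fser (\<lambda>n l. \<i> * (of_int n * karp_array 0 1 c n l)) l has_vector_derivative deriv2 (karp_q c l) \<theta>) (at \<theta>)"
    unfolding deriv2_def q1
    by (rule vector_derivative_works[THEN iffD1, OF differentiableI_vector[OF fser_deriv[OF b' ka_pos]]])
qed

text \<open>Two derivatives in the angle multiply the \<open>n\<close>-th mode by \<open>- n\<^sup>2\<close>, which turns the claim into the
  recursion for the coefficients of the Lommel polynomials.\<close>

lemma karp_scalar_recursion: "karp_recursion (karp_h c) (karp_q c)"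
  unfolding karp_recursion_def
proof (intro allI conjI)
  fix l \<theta>
  note b = karp_array_summable[OF c ka_pos]
  have m: "complex_of_int n ^ 2 = of_real ((real (nat \<bar>n\<bar>))\<^sup>2)" for n
  proof -
    have e: "(real (nat \<bar>n\<bar>))\<^sup>2 = (real_of_int n)\<^sup>2" by simp
    show ?thesis unfolding e by simp
  qed
  have P: "2 * (real l + 1) * lommel (-1) 1 0 (nat \<bar>n\<bar>) (Suc l) = ((real (nat \<bar>n\<bar>))\<^sup>2 - (real l + 1)\<^sup>2) * lommel (-1) 0 1 (nat \<bar>n\<bar>) l"
    and Q: "2 * (real l + 1) * lommel (-1) 0 1 (nat \<bar>n\<bar>) (Suc l) = ((real l)\<^sup>2 - (real (nat \<bar>n\<bar>))\<^sup>2) * lommel (-1) 1 0 (nat \<bar>n\<bar>) l" for n :: int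
    by (rule lommel_recursion)+
  have h: "of_real (2 * (real l + 1)) * karp_array 1 0 c n (Suc l) = - of_real ((real l + 1)\<^sup>2) * karp_array 0 1 c n l - (- (of_int n ^ 2) * karp_array 0 1 c n l)" for n
    using arg_cong[OF P[of n], of "\<lambda>z. c n * complex_of_real z"] unfolding karp_array_def m
    by (simp add: algebra_simps)
  have q: "of_real (2 * (real l + 1)) * karp_array 0 1 c n (Suc l) = of_real ((real l)\<^sup>2) * karp_array 1 0 c n l - (- (- (of_int n ^ 2) * karp_array 1 0 c n l))" for n
    using arg_cong[OF Q[of n], of "\<lambda>z. c n * complex_of_real z"] unfolding karp_array_def m
    by (simp add: algebra_simps)
  have n2: "array_summable (k * a) (\<lambda>n l. - (of_int n ^ 2) * karp_array p q c n l)" for p q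
    using array_summable_cmult[OF array_summable_n[OF array_summable_n[OF b]], of "-1"]
    by (simp add: power2_eq_square mult_ac)
  have sc: "((\<lambda>n. z * b n l * cis (of_int n * \<theta>)) has_sum (z * fser b l \<theta>)) UNIV"
    if "array_summable (k * a) b" for b l and z :: complex
    using has_sum_cmult_right[OF fser_has_sum[OF that ka_pos], of z] by (simp add: mult.assoc)
  have "of_real (2 * (real l + 1)) * karp_h c (Suc l) \<theta> = - of_real ((real l + 1)\<^sup>2) * karp_q c l \<theta> - fser (\<lambda>n l. - (of_int n ^ 2) * karp_array 0 1 c n l) l \<theta>"
  proof (rule has_sum_unique[OF sc[OF b]])
    show "((\<lambda>n. of_real (2 * (real l + 1)) * karp_array 1 0 c n (Suc l) * cis (of_int n * \<theta>)) has_sum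
       (- of_real ((real l + 1)\<^sup>2) * karp_q c l \<theta> - fser (\<lambda>n l. - (of_int n ^ 2) * karp_array 0 1 c n l) l \<theta>)) UNIV"
      unfolding h left_diff_distrib by (intro has_sum_diff_complex sc b fser_has_sum[OF n2 ka_pos])
  qed
  thus "(2 * real (Suc l)) *\<^sub>R karp_h c (Suc l) \<theta> = - ((real (Suc l))\<^sup>2 *\<^sub>R karp_q c l \<theta> + deriv2 (karp_q c l) \<theta>)"
    unfolding karp_q_deriv2 by (simp add: scaleR_conv_of_real add.commute)
  have "of_real (2 * (real l + 1)) * karp_q c (Suc l) \<theta> = of_real ((real l)\<^sup>2) * karp_h c l \<theta> - (- 1) * fser (\<lambda>n l. - (of_int n ^ 2) * karp_array 1 0 c n l) l \<theta>"
  proof (rule has_sum_unique[OF sc[OF b]])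
    show "((\<lambda>n. of_real (2 * (real l + 1)) * karp_array 0 1 c n (Suc l) * cis (of_int n * \<theta>)) has_sum
       (of_real ((real l)\<^sup>2) * karp_h c l \<theta> - (- 1) * fser (\<lambda>n l. - (of_int n ^ 2) * karp_array 1 0 c n l) l \<theta>)) UNIV"
      unfolding q left_diff_distrib mult_minus1[symmetric, of "- _ * _"]
      by (intro has_sum_diff_complex sc b n2)
  qed
  thus "(2 * real (Suc l)) *\<^sub>R karp_q c (Suc l) \<theta> = (real l)\<^sup>2 *\<^sub>R karp_h c l \<theta> + deriv2 (karp_h c l) \<theta>"
    unfolding karp_h_deriv2 by (simp add: scaleR_conv_of_real add.commute)
qed

end

section \<open>Vector series\<close>

definition vec2 :: "(nat \<Rightarrow> real \<Rightarrow> complex) \<Rightarrow> (nat \<Rightarrow> real \<Rightarrow> complex) \<Rightarrow> nat \<Rightarrow> real \<Rightarrow> complex^2" where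
  "vec2 f g l \<theta> = axis 1 (f l \<theta>) + axis 2 (g l \<theta>)"

lemma bounded_linear_axis: "bounded_linear (axis j :: complex \<Rightarrow> complex^2)"
  by (auto simp: linear_iff axis_def vec_eq_iff simp flip: linear_conv_bounded_linear)

lemma vec2_nth [simp]: "vec2 f g l \<theta> $ 1 = f l \<theta>" "vec2 f g l \<theta> $ 2 = g l \<theta>"
  by (simp_all add: vec2_def axis_def)

lemma karp_vector_smooth:
  assumes a: "a > 0" and k: "k > 0" and c: "admissible (k * a) c" and d: "admissible (k * a) d"
  shows "vector_series_smooth a k (vec2 (karp_h c) (karp_h d)) (vec2 (karp_q c) (karp_q d))"
proof -
  have ka: "k * a > 0" using a k by simp
  have t: "termwise_smooth a (\<lambda>l r \<theta>. axis 1 (karp_term k e 0 b l r \<theta>) + axis 2 (karp_term k e 0 b' l r \<theta>) :: complex^2)"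
    if "array_summable (k * a) b" "array_summable (k * a) b'" for e b b'
    by (intro karp_family_termwise_smooth[OF a k] karp_family.intros bounded_linear_axis that)
  have i: "inv_term k (vec2 (fser b) (fser b')) = (\<lambda>l r \<theta>. axis 1 (karp_term k 0 0 b l r \<theta>) + axis 2 (karp_term k 0 0 b' l r \<theta>))" for b b'
    unfolding inv_term_karp_term[symmetric]
    by (auto simp: fun_eq_iff inv_term_def vec2_def vec_eq_iff axis_def forall_2)
  have h: "hankel1 m (k * r) *s (axis 1 (karp_term k 0 0 b l r \<theta>) + axis 2 (karp_term k 0 0 b' l r \<theta>))
     = axis 1 (karp_term k (Suc m) 0 b l r \<theta>) + axis 2 (karp_term k (Suc m) 0 b' l r \<theta>)" for m b b' l r \<theta>
    by (simp add: vec_eq_iff axis_def forall_2 karp_term_def karp_factor_def)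
  show ?thesis unfolding vector_series_smooth_def i h
    by (intro conjI t karp_array_summable[OF c ka] karp_array_summable[OF d ka])
qed

lemma has_vector_derivative_axis:
  assumes "(f has_vector_derivative f') F" "(g has_vector_derivative g') F"
  shows "((\<lambda>t. axis 1 (f t) + axis 2 (g t) :: complex^2) has_vector_derivative (axis 1 f' + axis 2 g')) F"
  by (intro has_vector_derivative_add bounded_linear.has_vector_derivative[OF bounded_linear_axis] assms)

lemma karp_vector_recursion:
  assumes a: "a > 0" and k: "k > 0" and c: "admissible (k * a) c" and d: "admissible (k * a) d"
  shows "karp_recursion (vec2 (karp_h c) (karp_h d)) (vec2 (karp_q c) (karp_q d))"
proof -
  have d2: "deriv2 (vec2 (fser b) (fser b') l) \<theta> = axis 1 (deriv2 (fser b l) \<theta>) + axis 2 (deriv2 (fser b' l) \<theta>)"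
    if "\<And>t. (fser b l has_vector_derivative f t) (at t)" "\<And>t. (fser b' l has_vector_derivative g t) (at t)"
      "(f has_vector_derivative deriv2 (fser b l) \<theta>) (at \<theta>)" "(g has_vector_derivative deriv2 (fser b' l) \<theta>) (at \<theta>)"
    for b b' l \<theta> and f g :: "real \<Rightarrow> complex"
  proof -
    have "vector_derivative (vec2 (fser b) (fser b') l) (at t) = axis 1 (f t) + axis 2 (g t)" for t
      using has_vector_derivative_axis[OF that(1) that(2)] unfolding vec2_def[abs_def] by (rule vector_derivative_at)
    thus ?thesis unfolding deriv2_def[of "vec2 (fser b) (fser b') l"]
      using vector_derivative_at[OF has_vector_derivative_axis[OF that(3,4)]] by simp
  qed
  note rc = karp_scalar_recursion[OF a k c, unfolded karp_recursion_def, rule_format]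
  note rd = karp_scalar_recursion[OF a k d, unfolded karp_recursion_def, rule_format]
  have dh: "deriv2 (vec2 (karp_h c) (karp_h d) l) \<theta> = axis 1 (deriv2 (karp_h c l) \<theta>) + axis 2 (deriv2 (karp_h d l) \<theta>)" for l \<theta>
    by (rule d2[OF karp_h_deriv[OF a k c] karp_h_deriv[OF a k d] karp_h_deriv'[OF a k c] karp_h_deriv'[OF a k d]])
  have dq: "deriv2 (vec2 (karp_q c) (karp_q d) l) \<theta> = axis 1 (deriv2 (karp_q c l) \<theta>) + axis 2 (deriv2 (karp_q d l) \<theta>)" for l \<theta>
    by (rule d2[OF karp_q_deriv[OF a k c] karp_q_deriv[OF a k d] karp_q_deriv'[OF a k c] karp_q_deriv'[OF a k d]])
  show ?thesis unfolding karp_recursion_def dh dq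
    using rc rd by (auto simp: vec_eq_iff forall_2 axis_def simp del: of_nat_Suc)
qed

section \<open>Fourier coefficients\<close>

text \<open>Fourier coefficients through the gauge integral, which suits differentiation under the integral
  sign and agrees with the Lebesgue integral on continuous functions.\<close>

definition fc :: "(real \<Rightarrow> complex) \<Rightarrow> int \<Rightarrow> complex" where
  "fc f n = integral {0..2*pi} (\<lambda>\<theta>. f \<theta> * cis (- of_int n * \<theta>)) / (2 * pi)"

lemma continuous_on_cis_mult [continuous_intros]:
  "continuous_on S f \<Longrightarrow> continuous_on S (\<lambda>x. cis (f x))" for f :: "'a::topological_space \<Rightarrow> real"
  unfolding cis_conv_exp by (intro continuous_intros)

lemma fc_integrable:
  assumes "continuous_on {0..2*pi} f"
  shows "(\<lambda>\<theta>. f \<theta> * cis (- of_int n * \<theta>)) integrable_on {0..2*pi}"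
  by (intro integrable_continuous_interval continuous_intros assms)

lemma fc_add: "continuous_on {0..2*pi} f \<Longrightarrow> continuous_on {0..2*pi} g \<Longrightarrow> fc (\<lambda>\<theta>. f \<theta> + g \<theta>) n = fc f n + fc g n"
  unfolding fc_def distrib_right
  using Henstock_Kurzweil_Integration.integral_add[OF fc_integrable[of f n] fc_integrable[of g n]]
  by (simp only: add_divide_distrib)

lemma fc_cmult: "fc (\<lambda>\<theta>. z * f \<theta>) n = z * fc f n"
  unfolding fc_def mult.assoc by (simp add: mult.assoc)

lemma fc_diff: "continuous_on {0..2*pi} f \<Longrightarrow> continuous_on {0..2*pi} g \<Longrightarrow> fc (\<lambda>\<theta>. f \<theta> - g \<theta>) n = fc f n - fc g n"
  using fc_add[of f "\<lambda>\<theta>. (-1) * g \<theta>" n] fc_cmult[of "-1" g n] by (auto intro: continuous_intros)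

lemma fc_cong: "(\<And>\<theta>. \<theta> \<in> {0..2*pi} \<Longrightarrow> f \<theta> = g \<theta>) \<Longrightarrow> fc f n = fc g n"
  unfolding fc_def
  by (rule arg_cong[where f = "\<lambda>z. z / complex_of_real (2 * pi)"], rule Henstock_Kurzweil_Integration.integral_cong) simp

lemma fc_bound:
  assumes "continuous_on {0..2*pi} f" "\<And>\<theta>. \<theta> \<in> {0..2*pi} \<Longrightarrow> cmod (f \<theta>) \<le> B"
  shows "cmod (fc f n) \<le> B"
proof -
  have "norm (integral {0..2*pi} (\<lambda>\<theta>. f \<theta> * cis (- of_int n * \<theta>))) \<le> B * (2 * pi - 0)"
    by (rule integral_bound) (use assms in \<open>auto intro!: continuous_intros simp: norm_mult\<close>)
  thus ?thesis by (simp add: fc_def norm_divide divide_le_eq)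
qed

lemma fc_cis_shift: "fc (\<lambda>\<theta>. f \<theta> * cis (of_int m * \<theta>)) n = fc f (n - m)"
proof -
  have e: "f \<theta> * cis (of_int m * \<theta>) * cis (- of_int n * \<theta>) = f \<theta> * cis (- of_int (n - m) * \<theta>)" for \<theta>
    by (simp add: cis_mult mult.assoc algebra_simps)
  show ?thesis unfolding fc_def e ..
qed

lemma cos_cis: "complex_of_real (cos \<theta>) = (cis (of_int 1 * \<theta>) + cis (of_int (-1) * \<theta>)) / 2"
  and sin_cis: "complex_of_real (sin \<theta>) = (cis (of_int 1 * \<theta>) - cis (of_int (-1) * \<theta>)) / (2 * \<i>)"
  by (simp_all add: complex_eq_iff Re_divide Im_divide power2_eq_square)

lemma fc_cos:
  assumes "continuous_on {0..2*pi} f"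
  shows "fc (\<lambda>\<theta>. of_real (cos \<theta>) * f \<theta>) n = (fc f (n - 1) + fc f (n + 1)) / 2"
proof -
  have "fc (\<lambda>\<theta>. of_real (cos \<theta>) * f \<theta>) n = fc (\<lambda>\<theta>. (1/2) * (f \<theta> * cis (of_int 1 * \<theta>) + f \<theta> * cis (of_int (-1) * \<theta>))) n"
    by (rule fc_cong) (simp only: cos_cis, simp add: algebra_simps)
  also have "\<dots> = (1/2) * (fc f (n - 1) + fc f (n - (-1)))"
    unfolding fc_cmult by (subst fc_add) (auto simp only: fc_cis_shift intro!: continuous_intros assms)
  finally show ?thesis by simp
qed

lemma fc_sin:
  assumes "continuous_on {0..2*pi} f"
  shows "fc (\<lambda>\<theta>. of_real (sin \<theta>) * f \<theta>) n = (fc f (n - 1) - fc f (n + 1)) / (2 * \<i>)"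
proof -
  have "fc (\<lambda>\<theta>. of_real (sin \<theta>) * f \<theta>) n = fc (\<lambda>\<theta>. (1/(2*\<i>)) * (f \<theta> * cis (of_int 1 * \<theta>) - f \<theta> * cis (of_int (-1) * \<theta>))) n"
    by (rule fc_cong) (simp only: sin_cis, simp add: algebra_simps diff_divide_distrib)
  also have "\<dots> = (1/(2*\<i>)) * (fc f (n - 1) - fc f (n - (-1)))"
    unfolding fc_cmult by (subst fc_diff) (auto simp only: fc_cis_shift intro!: continuous_intros assms)
  finally show ?thesis by simp
qed

lemma fc_cis: "fc (\<lambda>\<theta>. cis (of_int m * \<theta>)) n = (if m = n then 1 else 0)"
proof (cases "m = n")
  case True
  have "fc (\<lambda>\<theta>. cis (of_int m * \<theta>)) n = fc (\<lambda>\<theta>. 1 * cis (of_int m * \<theta>)) n" by simp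
  also have "\<dots> = 1" unfolding fc_cis_shift using True by (simp add: fc_def scaleR_conv_of_real)
  finally show ?thesis using True by simp
next
  case False
  define j :: real where "j = of_int (m - n)"
  have j: "j \<noteq> 0" using False by (simp add: j_def)
  have d: "((\<lambda>\<theta>. cis (j * \<theta>) / (\<i> * j)) has_vector_derivative cis (j * \<theta>)) (at \<theta> within S)" for \<theta> S
  proof -
    have "((\<lambda>\<theta>. j * \<theta>) has_real_derivative j) (at \<theta>)" by (auto intro!: derivative_eq_intros)
    hence "((\<lambda>\<theta>. j * \<theta>) has_vector_derivative j) (at \<theta>)"
      unfolding has_real_derivative_iff_has_vector_derivative .
    from vector_diff_chain_at[OF this has_vector_derivative_cis]
    have D: "((\<lambda>\<theta>. cis (j * \<theta>)) has_vector_derivative j *\<^sub>R (\<i> * cis (j * \<theta>))) (at \<theta>)" by (simp add: comp_def)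
    have E: "(j *\<^sub>R (\<i> * cis (j * \<theta>))) / (\<i> * of_real j) = cis (j * \<theta>)" using j by (simp add: scaleR_conv_of_real)
    show ?thesis
      using has_vector_derivative_at_within[OF bounded_linear.has_vector_derivative[OF bounded_linear_divide D, of "\<i> * of_real j"]]
      unfolding E .
  qed
  have "((\<lambda>\<theta>. cis (j * \<theta>)) has_integral (cis (j * (2 * pi)) / (\<i> * j) - cis (j * 0) / (\<i> * j))) {0..2*pi}"
    by (rule fundamental_theorem_of_calculus[where f = "\<lambda>\<theta>. cis (j * \<theta>) / (\<i> * j)"], simp) (rule d)
  moreover have "cis (j * (2 * pi)) = 1" unfolding mult.commute[of j]
    by (rule cis_multiple_2pi) (simp add: j_def)
  ultimately have "((\<lambda>\<theta>. cis (j * \<theta>)) has_integral 0) {0..2*pi}" by simp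
  hence "integral {0..2*pi} (\<lambda>\<theta>. cis (j * \<theta>)) = 0" by (rule integral_unique)
  moreover have "cis (of_int m * \<theta>) * cis (- of_int n * \<theta>) = cis (j * \<theta>)" for \<theta>
    by (simp add: cis_mult j_def algebra_simps)
  ultimately show ?thesis using False by (simp add: fc_def)
qed

lemma fc_deriv:
  assumes d: "\<And>\<theta>. (G has_vector_derivative G' \<theta>) (at \<theta>)" and c: "continuous_on UNIV G'"
    and p: "G (2 * pi) = G 0"
  shows "fc G' n = \<i> * of_int n * fc G n"
proof -
  have cG: "continuous_on UNIV G"
    by (rule continuous_on_vector_derivative, rule has_vector_derivative_at_within, rule d)
  define e where "e \<theta> = cis (- of_int n * \<theta>)" for \<theta>
  have de: "(e has_vector_derivative (- \<i> * of_int n) * e \<theta>) (at \<theta>)" for \<theta>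
  proof -
    have "((\<lambda>\<theta>. - of_int n * \<theta>) has_real_derivative - of_int n) (at \<theta>)" by (auto intro!: derivative_eq_intros)
    hence "((\<lambda>\<theta>. - of_int n * \<theta>) has_vector_derivative - of_int n) (at \<theta>)"
      unfolding has_real_derivative_iff_has_vector_derivative .
    from vector_diff_chain_at[OF this has_vector_derivative_cis]
    show ?thesis by (simp add: comp_def e_def[abs_def] scaleR_conv_of_real mult_ac)
  qed
  have "((\<lambda>\<theta>. G \<theta> * ((- \<i> * of_int n) * e \<theta>) + G' \<theta> * e \<theta>) has_integral (G (2*pi) * e (2*pi) - G 0 * e 0)) {0..2*pi}"
    by (rule fundamental_theorem_of_calculus[where f = "\<lambda>\<theta>. G \<theta> * e \<theta>"], simp)
       (rule has_vector_derivative_at_within[OF has_vector_derivative_mult[OF d de]])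
  moreover have "e (2 * pi) = e 0"
  proof -
    have "- of_int n * (2 * pi) = 2 * pi * of_int (- n)" by simp
    hence "e (2 * pi) = 1" unfolding e_def by (simp only: cis_multiple_2pi Ints_of_int)
    thus ?thesis by (simp add: e_def)
  qed
  ultimately have "((\<lambda>\<theta>. G \<theta> * ((- \<i> * of_int n) * e \<theta>) + G' \<theta> * e \<theta>) has_integral 0) {0..2*pi}"
    using p by simp
  hence "integral {0..2*pi} (\<lambda>\<theta>. G \<theta> * ((- \<i> * of_int n) * e \<theta>) + G' \<theta> * e \<theta>) = 0"
    by (rule integral_unique)
  hence "fc (\<lambda>\<theta>. (- \<i> * of_int n) * G \<theta> + G' \<theta>) n = 0"
    unfolding fc_def e_def by (simp add: algebra_simps)
  moreover have "fc (\<lambda>\<theta>. (- \<i> * of_int n) * G \<theta> + G' \<theta>) n = (- \<i> * of_int n) * fc G n + fc G' n"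
    by (subst fc_add) (auto simp only: fc_cmult intro!: continuous_intros continuous_on_subset[OF cG] continuous_on_subset[OF c])
  ultimately show ?thesis by simp
qed

section \<open>Uniqueness of Fourier coefficients\<close>

lemma e_r_nth [simp]: "e_r \<theta> $ 1 = cos \<theta>" "e_r \<theta> $ 2 = sin \<theta>"
  and e_\<theta>_nth [simp]: "e_\<theta> \<theta> $ 1 = - sin \<theta>" "e_\<theta> \<theta> $ 2 = cos \<theta>"
  by (simp_all add: e_r_def e_\<theta>_def)

lemma norm_e_r [simp]: "norm (e_r \<theta>) = 1" and norm_e_\<theta> [simp]: "norm (e_\<theta> \<theta>) = 1"
  by (simp_all add: norm_vec_def L2_set_def UNIV_2)

lemma vec_eq_axis: "(v :: real^2) = v $ 1 *\<^sub>R axis 1 1 + v $ 2 *\<^sub>R axis 2 1"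
  by (simp add: vec_eq_iff forall_2 axis_def)

lemma e_r_axis: "e_r \<theta> = cos \<theta> *\<^sub>R axis 1 1 + sin \<theta> *\<^sub>R axis 2 1"
  and e_\<theta>_axis: "e_\<theta> \<theta> = (- sin \<theta>) *\<^sub>R axis 1 1 + cos \<theta> *\<^sub>R axis 2 1"
  by (simp_all add: vec_eq_iff forall_2 axis_def)

lemma continuous_e_r: "continuous_on S e_r"
proof -
  have e: "e_r = (\<lambda>\<theta>. cos \<theta> *\<^sub>R axis 1 1 + sin \<theta> *\<^sub>R axis 2 1)"
    by (rule ext) (rule e_r_axis)
  show ?thesis unfolding e by (intro continuous_intros)
qed

text \<open>Multiplication by the coordinate functions \<open>cos\<close> and \<open>sin\<close> only shifts Fourier coefficients. Hence
  polynomials on the circle are orthogonal to a function without Fourier coefficients.\<close>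

lemma fc_zero_polynomial:
  assumes "real_polynomial_function p" and "continuous_on {0..2*pi} f" "\<And>n. fc f n = 0"
  shows "continuous_on {0..2*pi} (\<lambda>\<theta>. f \<theta> * of_real (p (e_r \<theta>))) \<and> (\<forall>n. fc (\<lambda>\<theta>. f \<theta> * of_real (p (e_r \<theta>))) n = 0)"
  using assms
proof (induction arbitrary: f)
  case (linear p)
  define \<alpha> \<beta> where "\<alpha> = p (axis 1 1)" and "\<beta> = p (axis 2 1)"
  have p: "p (e_r \<theta>) = cos \<theta> * \<alpha> + sin \<theta> * \<beta>" for \<theta>
    unfolding e_r_axis using bounded_linear.linear[OF linear(1)]
    by (simp add: linear_add linear_scale \<alpha>_def \<beta>_def)
  have e: "f \<theta> * of_real (p (e_r \<theta>)) = of_real \<alpha> * (of_real (cos \<theta>) * f \<theta>) + of_real \<beta> * (of_real (sin \<theta>) * f \<theta>)" for \<theta>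
    unfolding p by (simp add: algebra_simps)
  have c1: "continuous_on {0..2*pi} (\<lambda>\<theta>. of_real \<alpha> * (of_real (cos \<theta>) * f \<theta>))"
    and c2: "continuous_on {0..2*pi} (\<lambda>\<theta>. of_real \<beta> * (of_real (sin \<theta>) * f \<theta>))"
    by (intro continuous_intros linear.prems)+
  show ?case unfolding e
  proof (intro conjI allI)
    show "fc (\<lambda>\<theta>. of_real \<alpha> * (of_real (cos \<theta>) * f \<theta>) + of_real \<beta> * (of_real (sin \<theta>) * f \<theta>)) n = 0" for n
      unfolding fc_add[OF c1 c2] fc_cmult fc_cos[OF linear.prems(1)] fc_sin[OF linear.prems(1)] linear.prems(2) by simp
  qed (intro continuous_intros c1 c2)
next
  case (const c)
  have e: "f \<theta> * of_real c = of_real c * f \<theta>" for \<theta> by simp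
  show ?case unfolding e fc_cmult const(2) by (auto intro!: continuous_intros const)
next
  case (add p q)
  note P = add.IH(1)[OF add.prems] and Q = add.IH(2)[OF add.prems]
  have e: "f \<theta> * of_real (p (e_r \<theta>) + q (e_r \<theta>)) = f \<theta> * of_real (p (e_r \<theta>)) + f \<theta> * of_real (q (e_r \<theta>))" for \<theta>
    by (simp add: algebra_simps)
  show ?case unfolding e
    using P Q fc_add[OF P[THEN conjunct1] Q[THEN conjunct1]] by (auto intro: continuous_on_add)
next
  case (mult p q)
  note P = mult.IH(1)[OF mult.prems]
  note Q = mult.IH(2)[OF P[THEN conjunct1] P[THEN conjunct2, rule_format]]
  have e: "f \<theta> * of_real (p (e_r \<theta>) * q (e_r \<theta>)) = f \<theta> * of_real (p (e_r \<theta>)) * of_real (q (e_r \<theta>))" for \<theta>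
    by simp
  show ?case unfolding e by (rule Q)
qed

text \<open>The theorem of Stone and Weierstrass extends orthogonality from polynomials to continuous
  functions on the circle.\<close>

lemma fc_zero_orthogonal:
  fixes F :: "real^2 \<Rightarrow> real"
  assumes f: "continuous_on {0..2*pi} f" "\<And>n. fc f n = 0" and F: "continuous_on (sphere 0 1) F"
  shows "integral {0..2*pi} (\<lambda>\<theta>. f \<theta> * of_real (F (e_r \<theta>))) = 0"
proof (rule ccontr)
  let ?I = "integral {0..2*pi} (\<lambda>\<theta>. f \<theta> * of_real (F (e_r \<theta>)))"
  assume "?I \<noteq> 0"
  obtain B where B: "B > 0" "\<And>\<theta>. \<theta> \<in> {0..2*pi} \<Longrightarrow> cmod (f \<theta>) \<le> B"
    using compact_imp_bounded[OF compact_continuous_image[OF f(1) compact_Icc]] unfolding bounded_pos by auto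
  define e where "e = cmod ?I / (B * 4 * pi)"
  have e: "e > 0" using \<open>?I \<noteq> 0\<close> B by (simp add: e_def)
  obtain p where p: "real_polynomial_function p" "\<And>x. x \<in> sphere 0 1 \<Longrightarrow> \<bar>F x - p x\<bar> < e"
    using Stone_Weierstrass_real_polynomial_function[OF compact_sphere F e] by blast
  note P = fc_zero_polynomial[OF p(1) f]
  have cF: "continuous_on {0..2*pi} (\<lambda>\<theta>. F (e_r \<theta>))"
    by (rule continuous_on_compose2[OF F continuous_e_r]) auto
  have 0: "integral {0..2*pi} (\<lambda>\<theta>. f \<theta> * of_real (p (e_r \<theta>))) = 0"
    using P[THEN conjunct2, rule_format, of 0] by (simp add: fc_def)
  have i1: "(\<lambda>\<theta>. f \<theta> * of_real (F (e_r \<theta>))) integrable_on {0..2*pi}"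
    by (intro integrable_continuous_interval continuous_intros f cF)
  have i2: "(\<lambda>\<theta>. f \<theta> * of_real (p (e_r \<theta>))) integrable_on {0..2*pi}"
    by (intro integrable_continuous_interval P[THEN conjunct1])
  have "?I = integral {0..2*pi} (\<lambda>\<theta>. f \<theta> * of_real (F (e_r \<theta>)) - f \<theta> * of_real (p (e_r \<theta>)))"
    using Henstock_Kurzweil_Integration.integral_diff[OF i1 i2] 0 by simp
  moreover have "norm (integral {0..2*pi} (\<lambda>\<theta>. f \<theta> * of_real (F (e_r \<theta>)) - f \<theta> * of_real (p (e_r \<theta>)))) \<le> (B * e) * (2 * pi - 0)"
  proof (rule integral_bound)
    show "continuous_on {0..2*pi} (\<lambda>\<theta>. f \<theta> * of_real (F (e_r \<theta>)) - f \<theta> * of_real (p (e_r \<theta>)))"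
      by (intro continuous_intros f cF P[THEN conjunct1])
    fix \<theta> :: real assume t: "\<theta> \<in> {0..2*pi}"
    have "f \<theta> * of_real (F (e_r \<theta>)) - f \<theta> * of_real (p (e_r \<theta>)) = f \<theta> * of_real (F (e_r \<theta>) - p (e_r \<theta>))"
      by (simp add: algebra_simps)
    also have "cmod \<dots> \<le> B * e"
      unfolding norm_mult norm_of_real
      by (intro mult_mono B(2) t less_imp_le[OF p(2)]) (use B in auto)
    finally show "cmod (f \<theta> * of_real (F (e_r \<theta>)) - f \<theta> * of_real (p (e_r \<theta>))) \<le> B * e" .
  qed simp
  ultimately have "cmod ?I \<le> B * e * (2 * pi)" by simp
  also have "B * e * (2 * pi) = cmod ?I / 2" using B by (simp add: e_def)
  finally show False using \<open>?I \<noteq> 0\<close> by simp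
qed

lemma fc_zero_imp_zero:
  fixes F :: "real^2 \<Rightarrow> complex"
  assumes F: "continuous_on (sphere 0 1) F" and z: "\<And>n. fc (\<lambda>\<theta>. F (e_r \<theta>)) n = 0" and t: "\<theta> \<in> {0..2*pi}"
  shows "F (e_r \<theta>) = 0"
proof -
  have c: "continuous_on {0..2*pi} (\<lambda>\<theta>. F (e_r \<theta>))"
    by (rule continuous_on_compose2[OF F continuous_e_r]) auto
  have cR: "continuous_on (sphere 0 1) (\<lambda>x. Re (F x))" and cI: "continuous_on (sphere 0 1) (\<lambda>x. Im (F x))"
    by (intro continuous_intros F)+
  have cR': "continuous_on {0..2*pi} (\<lambda>\<theta>. Re (F (e_r \<theta>)))" and cI': "continuous_on {0..2*pi} (\<lambda>\<theta>. Im (F (e_r \<theta>)))"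
    by (intro continuous_intros c)+
  have "F (e_r \<theta>) * of_real (Re (F (e_r \<theta>))) - \<i> * (F (e_r \<theta>) * of_real (Im (F (e_r \<theta>)))) = of_real ((cmod (F (e_r \<theta>)))\<^sup>2)" for \<theta>
    unfolding complex_norm_square by (simp add: complex_eq_iff algebra_simps)
  moreover have "integral {0..2*pi} (\<lambda>\<theta>. F (e_r \<theta>) * of_real (Re (F (e_r \<theta>))) - \<i> * (F (e_r \<theta>) * of_real (Im (F (e_r \<theta>))))) = 0"
    by (subst Henstock_Kurzweil_Integration.integral_diff)
       (auto simp: fc_zero_orthogonal[OF c z cR] fc_zero_orthogonal[OF c z cI]
         intro!: integrable_continuous_interval continuous_intros c cR' cI')
  ultimately have "integral {0..2*pi} (\<lambda>\<theta>. complex_of_real ((cmod (F (e_r \<theta>)))\<^sup>2)) = 0" by simp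
  moreover have i: "(\<lambda>\<theta>. (cmod (F (e_r \<theta>)))\<^sup>2) integrable_on {0..2*pi}"
    by (intro integrable_continuous_interval continuous_intros c)
  hence "integral {0..2*pi} (\<lambda>\<theta>. complex_of_real ((cmod (F (e_r \<theta>)))\<^sup>2)) = of_real (integral {0..2*pi} (\<lambda>\<theta>. (cmod (F (e_r \<theta>)))\<^sup>2))"
    using integral_linear[OF i bounded_linear_of_real] by (simp add: comp_def)
  ultimately have "integral {0..2*pi} (\<lambda>\<theta>. (cmod (F (e_r \<theta>)))\<^sup>2) = 0" by simp
  moreover have "continuous_on {0..2*pi} (\<lambda>\<theta>. (cmod (F (e_r \<theta>)))\<^sup>2)"
    by (intro continuous_intros c)
  ultimately have "\<forall>\<theta>\<in>{0..2*pi}. (cmod (F (e_r \<theta>)))\<^sup>2 = 0"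
    using integral_eq_0_iff[of 0 "2*pi" "\<lambda>\<theta>. (cmod (F (e_r \<theta>)))\<^sup>2"] by simp
  thus ?thesis using t by simp
qed

lemma cis_powi: "cis t powi n = cis (of_int n * t)"
proof (cases "n \<ge> 0")
  case True
  thus ?thesis by (simp add: power_int_def Complex.DeMoivre)
next
  case False
  have "cis (of_int n * t) = inverse (cis (real (nat (- n)) * t))"
    using False by (simp add: cis_inverse)
  thus ?thesis using False by (simp add: power_int_def Complex.DeMoivre power_inverse)
qed

text \<open>A Fourier series as a function of the point on the circle instead of the angle, so that
  uniqueness can be applied to it.\<close>

definition circle_series :: "(int \<Rightarrow> complex) \<Rightarrow> real^2 \<Rightarrow> complex" where
  "circle_series s x = (\<Sum>\<^sub>\<infinity>n. s n * Complex (x $ 1) (x $ 2) powi n)"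

lemma circle_series:
  assumes s: "(\<lambda>n. cmod (s n)) summable_on UNIV"
  shows "continuous_on (sphere 0 1) (circle_series s)"
    "circle_series s (e_r \<theta>) = (\<Sum>\<^sub>\<infinity>n. s n * cis (of_int n * \<theta>))"
    "fc (\<lambda>\<theta>. circle_series s (e_r \<theta>)) m = s m"
proof -
  have e: "Complex (e_r \<theta> $ 1) (e_r \<theta> $ 2) = cis \<theta>" for \<theta> by (simp add: complex_eq_iff)
  show e2: "circle_series s (e_r \<theta>) = (\<Sum>\<^sub>\<infinity>n. s n * cis (of_int n * \<theta>))" for \<theta>
    unfolding circle_series_def e cis_powi ..
  have n1: "cmod (Complex (x $ 1) (x $ 2)) = 1" if "x \<in> sphere 0 1" for x :: "real^2"
    using that by (simp add: norm_vec_def L2_set_def UNIV_2 complex_norm)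
  have cnz: "Complex (x $ 1) (x $ 2) \<noteq> 0" if "x \<in> sphere 0 1" for x :: "real^2"
    using n1[OF that] by (metis norm_zero zero_neq_one)
  have ul: "uniform_limit (sphere 0 1) (\<lambda>X (x::real^2). \<Sum>n\<in>X. s n * Complex (x $ 1) (x $ 2) powi n) (circle_series s) (finite_subsets_at_top UNIV)"
    unfolding circle_series_def[abs_def]
    by (rule Weierstrass_m_test_general[OF _ s]) (use n1 in \<open>simp add: norm_mult norm_power_int\<close>)
  have cC: "continuous_on (sphere 0 1) (\<lambda>x::real^2. Complex (x $ 1) (x $ 2))"
    unfolding Complex_eq by (intro continuous_intros)
  show c: "continuous_on (sphere 0 1) (circle_series s)"
  proof (rule uniform_limit_theorem[OF _ ul])
    show "\<forall>\<^sub>F X in finite_subsets_at_top UNIV. continuous_on (sphere 0 1) (\<lambda>x::real^2. \<Sum>n\<in>X. s n * Complex (x $ 1) (x $ 2) powi n)"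
      by (intro always_eventually allI continuous_intros cC) (use cnz in auto)
  qed simp
  have ul2: "uniform_limit {0..2*pi} (\<lambda>X \<theta>. (\<Sum>n\<in>X. s n * cis (of_int n * \<theta>))) (\<lambda>\<theta>. circle_series s (e_r \<theta>)) (finite_subsets_at_top UNIV)"
    unfolding e2 by (rule Weierstrass_m_test_general[OF _ s]) (simp add: norm_mult)
  have fin: "fc (\<lambda>\<theta>. \<Sum>n\<in>X. s n * cis (of_int n * \<theta>)) m = (\<Sum>n\<in>X. s n * (if n = m then 1 else 0))" if "finite X" for X
    using that
  proof (induction X rule: finite_induct)
    case empty
    show ?case by (simp add: fc_def)
  next
    case (insert n X)
    have "fc (\<lambda>\<theta>. s n * cis (of_int n * \<theta>) + (\<Sum>n\<in>X. s n * cis (of_int n * \<theta>))) m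
      = s n * (if n = m then 1 else 0) + (\<Sum>n\<in>X. s n * (if n = m then 1 else 0))"
      by (subst fc_add) (auto simp only: fc_cmult fc_cis insert.IH intro!: continuous_intros)
    thus ?case using insert by simp
  qed
  have cE: "continuous_on {0..2*pi} (\<lambda>\<theta>. circle_series s (e_r \<theta>))"
    by (rule continuous_on_compose2[OF c continuous_e_r]) auto
  have "((\<lambda>X. fc (\<lambda>\<theta>. \<Sum>n\<in>X. s n * cis (of_int n * \<theta>)) m) \<longlongrightarrow> fc (\<lambda>\<theta>. circle_series s (e_r \<theta>)) m) (finite_subsets_at_top UNIV)"
  proof (rule tendstoI)
    fix \<epsilon> :: real assume eps: "\<epsilon> > 0"
    have "\<forall>\<^sub>F X in finite_subsets_at_top UNIV. \<forall>\<theta>\<in>{0..2*pi}. dist (\<Sum>n\<in>X. s n * cis (of_int n * \<theta>)) (circle_series s (e_r \<theta>)) < \<epsilon> / 2"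
      using uniform_limitD[OF ul2, of "\<epsilon> / 2"] eps by simp
    thus "\<forall>\<^sub>F X in finite_subsets_at_top UNIV. dist (fc (\<lambda>\<theta>. \<Sum>n\<in>X. s n * cis (of_int n * \<theta>)) m) (fc (\<lambda>\<theta>. circle_series s (e_r \<theta>)) m) < \<epsilon>"
    proof eventually_elim
      case (elim X)
      have cX: "continuous_on {0..2*pi} (\<lambda>\<theta>. \<Sum>n\<in>X. s n * cis (of_int n * \<theta>))" by (intro continuous_intros)
      have "cmod (fc (\<lambda>\<theta>. (\<Sum>n\<in>X. s n * cis (of_int n * \<theta>)) - circle_series s (e_r \<theta>)) m) \<le> \<epsilon> / 2"
        by (rule fc_bound) (use elim in \<open>auto intro!: continuous_intros cE simp: dist_norm less_imp_le\<close>)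
      thus ?case unfolding fc_diff[OF cX cE] dist_norm using eps by simp
    qed
  qed
  moreover have "\<forall>\<^sub>F X in finite_subsets_at_top UNIV. fc (\<lambda>\<theta>. \<Sum>n\<in>X. s n * cis (of_int n * \<theta>)) m = s m"
    unfolding eventually_finite_subsets_at_top
  proof (intro exI[of _ "{m}"] conjI allI impI)
    fix Y :: "int set" assume Y: "finite Y \<and> {m} \<subseteq> Y \<and> Y \<subseteq> UNIV"
    have "(\<Sum>n\<in>Y. s n * (if n = m then 1 else 0)) = (\<Sum>n\<in>{m}. s n * (if n = m then 1 else 0))"
      by (rule sum.mono_neutral_right) (use Y in auto)
    thus "fc (\<lambda>\<theta>. \<Sum>n\<in>Y. s n * cis (of_int n * \<theta>)) m = s m" using fin[of Y] Y by simp
  qed auto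
  hence "((\<lambda>X. fc (\<lambda>\<theta>. \<Sum>n\<in>X. s n * cis (of_int n * \<theta>)) m) \<longlongrightarrow> s m) (finite_subsets_at_top UNIV)"
    by (rule tendsto_eventually)
  ultimately show "fc (\<lambda>\<theta>. circle_series s (e_r \<theta>)) m = s m"
    by (rule tendsto_unique[rotated]) simp
qed

text \<open>A continuous function on the circle is determined by its Fourier coefficients.\<close>

lemma fourier_representation:
  fixes F :: "real^2 \<Rightarrow> complex"
  assumes F: "continuous_on (sphere 0 1) F" and s: "(\<lambda>n. cmod (s n)) summable_on UNIV"
    and e: "\<And>n. fc (\<lambda>\<theta>. F (e_r \<theta>)) n = s n"
  shows "F (e_r \<theta>) = (\<Sum>\<^sub>\<infinity>n. s n * cis (of_int n * \<theta>))"
proof -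
  have cF: "continuous_on {0..2*pi} (\<lambda>\<theta>. F (e_r \<theta>))"
    by (rule continuous_on_compose2[OF F continuous_e_r]) auto
  have cS: "continuous_on {0..2*pi} (\<lambda>\<theta>. circle_series s (e_r \<theta>))"
    by (rule continuous_on_compose2[OF circle_series(1)[OF s] continuous_e_r]) auto
  define t where "t = \<theta> - 2 * pi * of_int \<lfloor>\<theta> / (2 * pi)\<rfloor>"
  have t: "t \<in> {0..2*pi}"
    using floor_divide_lower[of "2 * pi" \<theta>] floor_divide_upper[of "2 * pi" \<theta>] by (simp add: t_def algebra_simps)
  define k where "k = \<lfloor>\<theta> / (2 * pi)\<rfloor>"
  have th: "\<theta> = t + 2 * pi * of_int k" by (simp add: t_def k_def)
  have c: "cos (t + 2 * pi * of_int k) = cos t" unfolding cos_add cos_int_2pin sin_int_2pin by simp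
  have sn: "sin (t + 2 * pi * of_int k) = sin t" unfolding sin_add cos_int_2pin sin_int_2pin by simp
  have "cos \<theta> = cos t" by (rule trans[OF arg_cong[OF th, of cos] c])
  moreover have "sin \<theta> = sin t" by (rule trans[OF arg_cong[OF th, of sin] sn])
  ultimately have er: "e_r \<theta> = e_r t" by (simp add: vec_eq_iff forall_2)
  have "F (e_r t) - circle_series s (e_r t) = 0"
  proof (rule fc_zero_imp_zero[of "\<lambda>x. F x - circle_series s x", OF _ _ t])
    show "continuous_on (sphere 0 1) (\<lambda>x. F x - circle_series s x)"
      by (intro continuous_intros F circle_series(1)[OF s])
    show "fc (\<lambda>\<theta>. F (e_r \<theta>) - circle_series s (e_r \<theta>)) n = 0" for n
      unfolding fc_diff[OF cF cS] e circle_series(3)[OF s] by simp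
  qed
  thus ?thesis unfolding er[symmetric] circle_series(2)[OF s] by simp
qed

section \<open>Polar coordinates\<close>

lemma open_exterior: "open (exterior a)"
  unfolding exterior_def by (intro open_Collect_less continuous_intros)

lemma polar_exterior: "r > a \<Longrightarrow> a \<ge> 0 \<Longrightarrow> polar r \<theta> \<in> exterior a"
  by (simp add: exterior_def)

lemma frechet_at:
  "f differentiable_on exterior a \<Longrightarrow> x \<in> exterior a \<Longrightarrow> (f has_derivative frechet_derivative f (at x)) (at x)"
  using open_exterior[of a] by (simp add: differentiable_on_eq_differentiable_at frechet_derivative_works)

lemma frechet_partial:
  assumes "f differentiable_on exterior a" "x \<in> exterior a"
  shows "frechet_derivative f (at x) v = v $ 1 *\<^sub>R partial 1 f x + v $ 2 *\<^sub>R partial 2 f x"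
proof -
  have l: "linear (frechet_derivative f (at x))" using has_derivative_linear[OF frechet_at[OF assms]] .
  show ?thesis by (subst vec_eq_axis[of v]) (simp only: linear_add[OF l] linear_scale[OF l] partial_def)
qed

text \<open>The radial and angular components of the gradient, as functions of the polar coordinates.\<close>

definition Dr :: "(real^2 \<Rightarrow> 'b::real_normed_vector) \<Rightarrow> real \<Rightarrow> real \<Rightarrow> 'b" where
  "Dr f r \<theta> = cos \<theta> *\<^sub>R partial 1 f (polar r \<theta>) + sin \<theta> *\<^sub>R partial 2 f (polar r \<theta>)"

definition Dt :: "(real^2 \<Rightarrow> 'b::real_normed_vector) \<Rightarrow> real \<Rightarrow> real \<Rightarrow> 'b" where
  "Dt f r \<theta> = (- sin \<theta>) *\<^sub>R partial 1 f (polar r \<theta>) + cos \<theta> *\<^sub>R partial 2 f (polar r \<theta>)"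

definition Drr :: "(real^2 \<Rightarrow> 'b::real_normed_vector) \<Rightarrow> real \<Rightarrow> real \<Rightarrow> 'b" where
  "Drr f r \<theta> = cos \<theta> *\<^sub>R Dr (partial 1 f) r \<theta> + sin \<theta> *\<^sub>R Dr (partial 2 f) r \<theta>"

lemma e_r_deriv: "(e_r has_vector_derivative e_\<theta> \<theta>) (at \<theta>)"
proof -
  have c: "(cos has_vector_derivative - sin \<theta>) (at \<theta>)" "(sin has_vector_derivative cos \<theta>) (at \<theta>)"
    unfolding has_real_derivative_iff_has_vector_derivative[symmetric] by (auto intro!: derivative_eq_intros)
  have e: "e_r = (\<lambda>\<theta>. cos \<theta> *\<^sub>R axis 1 1 + sin \<theta> *\<^sub>R axis 2 1)" by (rule ext) (rule e_r_axis)
  show ?thesis unfolding e e_\<theta>_axis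
    by (intro has_vector_derivative_add bounded_linear.has_vector_derivative[OF bounded_linear_scaleR_left] c)
qed

context
  fixes a :: real and f :: "real^2 \<Rightarrow> 'b::real_normed_vector"
  assumes a: "a \<ge> 0" and f: "f differentiable_on exterior a"
begin

lemma dir_deriv_Dr: "r > a \<Longrightarrow> dir_deriv (e_r \<theta>) f (polar r \<theta>) = Dr f r \<theta>"
  and dir_deriv_Dt: "r > a \<Longrightarrow> dir_deriv (e_\<theta> \<theta>) f (polar r \<theta>) = Dt f r \<theta>"
  using frechet_partial[OF f polar_exterior[OF _ a]] by (simp_all add: dir_deriv_def Dr_def Dt_def)

lemma polar_deriv_r: "r > a \<Longrightarrow> ((\<lambda>s. f (polar s \<theta>)) has_vector_derivative Dr f r \<theta>) (at r)"
proof -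
  assume r: "r > a"
  have "((\<lambda>s. polar s \<theta>) has_vector_derivative e_r \<theta>) (at r)"
    using bounded_linear.has_vector_derivative[OF bounded_linear_scaleR_left has_vector_derivative_id] by simp
  from vector_derivative_diff_chain_within[OF this has_derivative_at_withinI[OF frechet_at[OF f polar_exterior[OF r a]]]]
  show ?thesis using dir_deriv_Dr[OF r, of \<theta>] by (simp add: comp_def dir_deriv_def)
qed

lemma polar_deriv_\<theta>: "r > a \<Longrightarrow> ((\<lambda>t. f (polar r t)) has_vector_derivative r *\<^sub>R Dt f r \<theta>) (at \<theta>)"
proof -
  assume r: "r > a"
  have "((\<lambda>t. polar r t) has_vector_derivative r *\<^sub>R e_\<theta> \<theta>) (at \<theta>)"
    by (rule bounded_linear.has_vector_derivative[OF bounded_linear_scaleR_right e_r_deriv])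
  from vector_derivative_diff_chain_within[OF this has_derivative_at_withinI[OF frechet_at[OF f polar_exterior[OF r a]]]]
  show ?thesis using dir_deriv_Dt[OF r, of \<theta>]
    by (simp add: comp_def dir_deriv_def linear_scale[OF has_derivative_linear[OF frechet_at[OF f polar_exterior[OF r a]]]])
qed

end

lemma radial_deriv_polar:
  assumes "a \<ge> 0" "r > a"
  shows "radial_deriv f (polar r \<theta>) = dir_deriv (e_r \<theta>) f (polar r \<theta>)"
  using assms by (simp add: radial_deriv_def)

lemma polar_continuous:
  assumes "a \<ge> 0" "continuous_on (exterior a) g"
  shows "continuous_on ({a<..} \<times> UNIV) (\<lambda>z. g (polar (fst z) (snd z)))"
proof (rule continuous_on_compose2[OF assms(2)])
  show "continuous_on ({a<..} \<times> UNIV) (\<lambda>z. polar (fst z) (snd z))"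
    by (intro continuous_intros continuous_on_compose2[OF continuous_e_r[of UNIV]]) auto
qed (use polar_exterior[OF _ assms(1)] in auto)

lemma polar_continuous_circle:
  assumes "a \<ge> 0" "continuous_on (exterior a) g" "r > a"
  shows "continuous_on S (\<lambda>\<theta>. g (polar r \<theta>))"
  by (rule continuous_on_compose2[OF assms(2)])
     (use polar_exterior[OF assms(3,1)] in \<open>auto intro!: continuous_intros continuous_e_r\<close>)

lemma sphere_continuous:
  assumes "a \<ge> 0" "continuous_on (exterior a) g" "r > a"
  shows "continuous_on (sphere 0 1) (\<lambda>x. g (r *\<^sub>R x))"
  by (rule continuous_on_compose2[OF assms(2)])
     (use assms in \<open>auto intro!: continuous_intros simp: exterior_def\<close>)

lemma fc_deriv_r:
  assumes a: "a \<ge> 0" and r: "r > a"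
    and d: "\<And>s \<theta>. s > a \<Longrightarrow> ((\<lambda>s. G s \<theta>) has_vector_derivative G' s \<theta>) (at s)"
    and c: "continuous_on ({a<..} \<times> UNIV) (\<lambda>z. G' (fst z) (snd z))"
    and c0: "\<And>s. s > a \<Longrightarrow> continuous_on {0..2*pi} (G s)"
  shows "((\<lambda>s. fc (G s) n) has_vector_derivative fc (G' r) n) (at r)"
proof -
  define e where "e \<theta> = cis (- of_int n * \<theta>)" for \<theta>
  have ce: "continuous_on S e" for S unfolding e_def by (intro continuous_intros)
  have "((\<lambda>s. integral (cbox 0 (2*pi)) (\<lambda>\<theta>. G s \<theta> * e \<theta>)) has_vector_derivative integral (cbox 0 (2*pi)) (\<lambda>\<theta>. G' r \<theta> * e \<theta>)) (at r within {a<..})"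
  proof (rule leibniz_rule_vector_derivative)
    fix s \<theta> :: real assume "s \<in> {a<..}"
    hence s: "s > a" by simp
    show "((\<lambda>s. G s \<theta> * e \<theta>) has_vector_derivative G' s \<theta> * e \<theta>) (at s within {a<..})"
      by (rule has_vector_derivative_at_within[OF bounded_linear.has_vector_derivative[OF bounded_linear_mult_left d[OF s]]])
  next
    fix s assume "s \<in> {a<..}"
    hence s: "s > a" by simp
    show "(\<lambda>\<theta>. G s \<theta> * e \<theta>) integrable_on cbox 0 (2*pi)"
      unfolding cbox_interval by (intro integrable_continuous_interval continuous_intros c0 s ce)
  next
    have "continuous_on ({a<..} \<times> cbox 0 (2*pi)) (\<lambda>z. G' (fst z) (snd z) * e (snd z))"
      by (intro continuous_on_mult continuous_on_subset[OF c] continuous_on_compose2[OF ce[of UNIV]] continuous_intros) auto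
    thus "continuous_on ({a<..} \<times> cbox 0 (2*pi)) (\<lambda>(s, \<theta>). G' s \<theta> * e \<theta>)" by (simp add: case_prod_unfold)
  qed (use r in auto)
  hence "((\<lambda>s. integral {0..2*pi} (\<lambda>\<theta>. G s \<theta> * e \<theta>)) has_vector_derivative integral {0..2*pi} (\<lambda>\<theta>. G' r \<theta> * e \<theta>)) (at r)"
    using r by (simp add: at_within_open[of r "{a<..}"])
  from bounded_linear.has_vector_derivative[OF bounded_linear_divide this, of "2 * pi"]
  show ?thesis by (simp add: fc_def e_def)
qed

section \<open>Angular modes of Helmholtz solutions\<close>

context
  fixes a k :: real and \<phi> :: "real^2 \<Rightarrow> complex"
  assumes a: "a \<ge> 0" and C2: "C_on 2 (exterior a) \<phi>"
begin

lemma C2_facts: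
  "\<phi> differentiable_on exterior a" "partial j \<phi> differentiable_on exterior a"
  "continuous_on (exterior a) \<phi>" "continuous_on (exterior a) (partial j \<phi>)"
  "continuous_on (exterior a) (partial i (partial j \<phi>))"
  using C2 by (auto simp: eval_nat_numeral differentiable_imp_continuous_on)

lemma continuous_Dr: "r > a \<Longrightarrow> continuous_on S (Dr \<phi> r)" and continuous_Dt: "r > a \<Longrightarrow> continuous_on S (Dt \<phi> r)"
  unfolding Dr_def[abs_def] Dt_def[abs_def]
  by (intro continuous_intros polar_continuous_circle[OF a C2_facts(4)]; assumption)+

lemma continuous_polar: "r > a \<Longrightarrow> continuous_on S (\<lambda>\<theta>. \<phi> (polar r \<theta>))"
  by (rule polar_continuous_circle[OF a C2_facts(3)])

lemma mode_deriv:
  assumes r: "r > a"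
  shows "((\<lambda>r. fc (\<lambda>\<theta>. \<phi> (polar r \<theta>)) n) has_vector_derivative fc (Dr \<phi> r) n) (at r)"
proof (rule fc_deriv_r[OF a r])
  show "((\<lambda>s. \<phi> (polar s \<theta>)) has_vector_derivative Dr \<phi> s \<theta>) (at s)" if "s > a" for s \<theta>
    by (rule polar_deriv_r[OF a C2_facts(1) that])
  show "continuous_on ({a<..} \<times> UNIV) (\<lambda>z. Dr \<phi> (fst z) (snd z))"
    unfolding Dr_def by (intro continuous_intros polar_continuous[OF a C2_facts(4)])
qed (rule continuous_polar)

text \<open>Integration by parts over the full circle.\<close>

lemma fc_Dt:
  assumes r: "r > a"
  shows "of_real r * fc (Dt \<phi> r) n = \<i> * of_int n * fc (\<lambda>\<theta>. \<phi> (polar r \<theta>)) n"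
proof -
  have "fc (\<lambda>\<theta>. r *\<^sub>R Dt \<phi> r \<theta>) n = \<i> * of_int n * fc (\<lambda>\<theta>. \<phi> (polar r \<theta>)) n"
  proof (rule fc_deriv)
    show "((\<lambda>t. \<phi> (polar r t)) has_vector_derivative r *\<^sub>R Dt \<phi> r \<theta>) (at \<theta>)" for \<theta>
      by (rule polar_deriv_\<theta>[OF a C2_facts(1) r])
    show "continuous_on UNIV (\<lambda>\<theta>. r *\<^sub>R Dt \<phi> r \<theta>)" by (intro continuous_intros continuous_Dt r)
  qed (simp add: e_r_def)
  thus ?thesis by (simp add: scaleR_conv_of_real fc_cmult)
qed

lemma continuous_Drr: "continuous_on ({a<..} \<times> UNIV) (\<lambda>z. Drr \<phi> (fst z) (snd z))"
  unfolding Drr_def Dr_def by (intro continuous_intros polar_continuous[OF a C2_facts(5)])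

lemma mode_deriv_Dr:
  assumes r: "r > a"
  shows "((\<lambda>r. fc (Dr \<phi> r) n) has_vector_derivative fc (Drr \<phi> r) n) (at r)"
proof (rule fc_deriv_r[OF a r _ continuous_Drr])
  show "((\<lambda>s. Dr \<phi> s \<theta>) has_vector_derivative Drr \<phi> s \<theta>) (at s)" if "s > a" for s \<theta>
    unfolding Dr_def[of \<phi>] Drr_def
    by (intro has_vector_derivative_add bounded_linear.has_vector_derivative[OF bounded_linear_scaleR_right]
        polar_deriv_r[OF a C2_facts(2) that])
qed (rule continuous_Dr)

text \<open>The trace of the Hessian in the rotating frame is the Laplacian. Its angular part is
  integrated by parts twice, which brings in \<open>n\<^sup>2 / r\<^sup>2\<close>.\<close>

lemma mode_deriv2:
  assumes r: "r > a" and H: "\<And>x. x \<in> exterior a \<Longrightarrow> laplacian \<phi> x + of_real (k\<^sup>2) * \<phi> x = 0"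
  shows "((\<lambda>r. fc (Dr \<phi> r) n) has_vector_derivative
     - fc (Dr \<phi> r) n / r - (of_real (k\<^sup>2) - of_real ((of_int n / r)\<^sup>2)) * fc (\<lambda>\<theta>. \<phi> (polar r \<theta>)) n) (at r)"
proof -
  define \<psi> where "\<psi> = fc (\<lambda>\<theta>. \<phi> (polar r \<theta>)) n"
  have r0: "r > 0" using r a by simp
  define T where "T \<theta> = (- sin \<theta>) *\<^sub>R Dt (partial 1 \<phi>) r \<theta> + cos \<theta> *\<^sub>R Dt (partial 2 \<phi>) r \<theta>" for \<theta>
  have cT: "continuous_on S T" for S
    unfolding T_def[abs_def] Dt_def by (intro continuous_intros polar_continuous_circle[OF a C2_facts(5) r])
  note d = mode_deriv_Dr[OF r, of n]
  have T: "of_real (r\<^sup>2) * fc T n - of_real r * fc (Dr \<phi> r) n = - (of_int n)\<^sup>2 * \<psi>"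
  proof -
    have dd: "((\<lambda>t. r *\<^sub>R Dt \<phi> r t) has_vector_derivative r *\<^sub>R (r *\<^sub>R T \<theta> - Dr \<phi> r \<theta>)) (at \<theta>)" for \<theta>
    proof -
      have c: "((\<lambda>\<theta>. - sin \<theta>) has_real_derivative - cos \<theta>) (at \<theta>)" "(cos has_real_derivative - sin \<theta>) (at \<theta>)"
        by (auto intro!: derivative_eq_intros)
      have D: "((\<lambda>t. r *\<^sub>R Dt \<phi> r t) has_vector_derivative
         r *\<^sub>R (((- sin \<theta>) *\<^sub>R (r *\<^sub>R Dt (partial 1 \<phi>) r \<theta>) + (- cos \<theta>) *\<^sub>R partial 1 \<phi> (polar r \<theta>))
          + (cos \<theta> *\<^sub>R (r *\<^sub>R Dt (partial 2 \<phi>) r \<theta>) + (- sin \<theta>) *\<^sub>R partial 2 \<phi> (polar r \<theta>)))) (at \<theta>)"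
        unfolding Dt_def[of \<phi>]
        by (intro bounded_linear.has_vector_derivative[OF bounded_linear_scaleR_right] has_vector_derivative_add
            has_vector_derivative_scaleR c polar_deriv_\<theta>[OF a C2_facts(2) r])
      have E: "r *\<^sub>R (((- sin \<theta>) *\<^sub>R (r *\<^sub>R Dt (partial 1 \<phi>) r \<theta>) + (- cos \<theta>) *\<^sub>R partial 1 \<phi> (polar r \<theta>))
          + (cos \<theta> *\<^sub>R (r *\<^sub>R Dt (partial 2 \<phi>) r \<theta>) + (- sin \<theta>) *\<^sub>R partial 2 \<phi> (polar r \<theta>)))
         = r *\<^sub>R (r *\<^sub>R T \<theta> - Dr \<phi> r \<theta>)"
        by (simp add: T_def Dr_def scaleR_conv_of_real algebra_simps)
      show ?thesis using D unfolding E .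
    qed
    have "fc (\<lambda>\<theta>. r *\<^sub>R (r *\<^sub>R T \<theta> - Dr \<phi> r \<theta>)) n = \<i> * of_int n * fc (\<lambda>\<theta>. r *\<^sub>R Dt \<phi> r \<theta>) n"
      by (rule fc_deriv[OF dd]) (auto intro!: continuous_intros cT continuous_Dr r simp: Dt_def e_r_def)
    moreover have "fc (\<lambda>\<theta>. r *\<^sub>R (r *\<^sub>R T \<theta> - Dr \<phi> r \<theta>)) n = of_real r * (of_real r * fc T n - fc (Dr \<phi> r) n)"
      unfolding scaleR_conv_of_real fc_cmult
      by (subst fc_diff) (auto simp only: fc_cmult intro!: continuous_intros cT continuous_Dr r)
    moreover have "fc (\<lambda>\<theta>. r *\<^sub>R Dt \<phi> r \<theta>) n = \<i> * of_int n * \<psi>"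
      unfolding scaleR_conv_of_real fc_cmult fc_Dt[OF r] \<psi>_def ..
    ultimately show ?thesis by (simp add: power2_eq_square algebra_simps)
  qed
  have RT: "Drr \<phi> r \<theta> = - of_real (k\<^sup>2) * \<phi> (polar r \<theta>) - T \<theta>" for \<theta>
  proof -
    have g: "c *\<^sub>R (c *\<^sub>R A11 + s *\<^sub>R A21) + s *\<^sub>R (c *\<^sub>R A12 + s *\<^sub>R A22)
        + ((- s) *\<^sub>R ((- s) *\<^sub>R A11 + c *\<^sub>R A21) + c *\<^sub>R ((- s) *\<^sub>R A12 + c *\<^sub>R A22))
       = (c * c + s * s) *\<^sub>R (A11 + A22)" for c s :: real and A11 A12 A21 A22 :: complex
      by (simp add: algebra_simps)
    have "Drr \<phi> r \<theta> + T \<theta> = (cos \<theta> * cos \<theta> + sin \<theta> * sin \<theta>) *\<^sub>R laplacian \<phi> (polar r \<theta>)"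
      unfolding Drr_def T_def Dr_def Dt_def g by (simp add: laplacian_def UNIV_2)
    hence "Drr \<phi> r \<theta> + T \<theta> = laplacian \<phi> (polar r \<theta>)" by simp
    moreover have "laplacian \<phi> (polar r \<theta>) = - of_real (k\<^sup>2) * \<phi> (polar r \<theta>)"
      using H[OF polar_exterior[OF r a]] by (simp add: add_eq_0_iff)
    ultimately show ?thesis by (simp add: eq_diff_eq)
  qed
  have "fc (Drr \<phi> r) n = fc (\<lambda>\<theta>. - of_real (k\<^sup>2) * \<phi> (polar r \<theta>) - T \<theta>) n"
    by (rule fc_cong) (rule RT)
  also have "\<dots> = - of_real (k\<^sup>2) * \<psi> - fc T n"
    unfolding \<psi>_def by (subst fc_diff) (auto simp only: fc_cmult intro!: continuous_intros cT continuous_polar r)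
  also have "fc T n = (of_real r * fc (Dr \<phi> r) n - (of_int n)\<^sup>2 * \<psi>) / of_real (r\<^sup>2)"
    using T r0 by (simp add: field_simps)
  also have "- of_real (k\<^sup>2) * \<psi> - (of_real r * fc (Dr \<phi> r) n - (of_int n)\<^sup>2 * \<psi>) / of_real (r\<^sup>2)
     = - fc (Dr \<phi> r) n / r - (of_real (k\<^sup>2) - of_real ((of_int n / r)\<^sup>2)) * \<psi>"
    using r0 by (simp add: field_simps power2_eq_square)
  finally show ?thesis using d unfolding \<psi>_def by simp
qed

end

lemma Im_of_real_mult: "Im (of_real t * z) = t * Im z" by simp

lemma bessel_rescale:
  fixes \<psi> \<psi>' :: "real \<Rightarrow> complex" and m :: nat
  assumes a: "a \<ge> 0" and k: "k > 0"
    and d1: "\<And>r. r > a \<Longrightarrow> (\<psi> has_vector_derivative \<psi>' r) (at r)"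
    and d2: "\<And>r. r > a \<Longrightarrow> (\<psi>' has_vector_derivative - \<psi>' r / r - (of_real (k\<^sup>2) - of_real ((real m / r)\<^sup>2)) * \<psi> r) (at r)"
  shows "bessel_solution m (k * a) (\<lambda>x. \<psi> (x / k)) (\<lambda>x. \<psi>' (x / k) / k)"
proof -
  define f where "f x = \<psi> (x / k)" for x
  define d where "d x = \<psi>' (x / k) / k" for x
  have sc: "((\<lambda>x. x / k) has_vector_derivative 1 / k) (at x)" for x
    unfolding has_real_derivative_iff_has_vector_derivative[symmetric] using k by (auto intro!: derivative_eq_intros)
  have "bessel_solution m (k * a) f d"
    unfolding bessel_solution_def
  proof (intro allI impI conjI)
    fix x assume x: "x > k * a"
    hence xa: "x / k > a" using k by (simp add: field_simps)
    have x0: "x > 0" using x a k by (smt (verit) mult_nonneg_nonneg)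
    show "(f has_vector_derivative d x) (at x)"
      using vector_diff_chain_at[OF sc d1[OF xa]] k
      by (simp add: comp_def f_def[abs_def] d_def scaleR_conv_of_real divide_inverse mult.commute)
    define E where "E = - \<psi>' (x / k) / (x / k) - (of_real (k\<^sup>2) - of_real ((real m / (x / k))\<^sup>2)) * \<psi> (x / k)"
    have "((\<lambda>x. \<psi>' (x / k)) has_vector_derivative (1 / k) *\<^sub>R E) (at x)"
      using vector_diff_chain_at[OF sc d2[OF xa]] by (simp add: comp_def E_def)
    from bounded_linear.has_vector_derivative[OF bounded_linear_divide this, of "of_real k"]
    have "(d has_vector_derivative ((1 / k) *\<^sub>R E) / of_real k) (at x)" by (simp add: d_def[abs_def])
    moreover have "((1 / k) *\<^sub>R E) / of_real k = - d x / x - (1 - of_real ((m / x)\<^sup>2)) * f x"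
      unfolding E_def d_def f_def scaleR_conv_of_real using k x0 by (simp add: field_simps power2_eq_square)
    ultimately show "(d has_vector_derivative - d x / x - (1 - of_real ((m / x)\<^sup>2)) * f x) (at x)" by simp
  qed
  thus ?thesis unfolding f_def[abs_def] d_def[abs_def] .
qed

text \<open>A solution is a combination of the Hankel function and its conjugate. If the conjugate occurred,
  it would be outgoing as well as incoming, so both \<open>sqrt x H\<close> and \<open>sqrt x H'\<close> would tend to zero,
  against the constant flux.\<close>

lemma radiating_mode:
  fixes \<psi> \<psi>' :: "real \<Rightarrow> complex" and m :: nat
  assumes a: "a \<ge> 0" and k: "k > 0"
    and d1: "\<And>r. r > a \<Longrightarrow> (\<psi> has_vector_derivative \<psi>' r) (at r)"
    and d2: "\<And>r. r > a \<Longrightarrow> (\<psi>' has_vector_derivative - \<psi>' r / r - (of_real (k\<^sup>2) - of_real ((real m / r)\<^sup>2)) * \<psi> r) (at r)"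
    and rad: "((\<lambda>r. of_real (sqrt r) * (\<psi>' r - \<i> * k * \<psi> r)) \<longlongrightarrow> 0) at_top"
  shows "\<exists>c. \<forall>r>a. \<psi> r = c * hankel1 m (k * r) \<and> \<psi>' r = of_real k * c * hankel1' m (k * r)"
proof -
  define f where "f x = \<psi> (x / k)" for x
  define d where "d x = \<psi>' (x / k) / k" for x
  have "bessel_solution m (k * a) f d" unfolding f_def[abs_def] d_def[abs_def] by (rule bessel_rescale[OF a k d1 d2])
  then obtain \<alpha> \<beta> where ab: "\<And>x. x > k * a \<Longrightarrow> f x = \<alpha> * hankel1 m x + \<beta> * cnj (hankel1 m x)"
    "\<And>x. x > k * a \<Longrightarrow> d x = \<alpha> * hankel1' m x + \<beta> * cnj (hankel1' m x)"
    using bessel_solution_rep[of m "k * a" f d] a k by (metis mult_nonneg_nonneg less_imp_le)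
  have "\<beta> = 0"
  proof (rule ccontr)
    assume b: "\<beta> \<noteq> 0"
    have fl: "filterlim (\<lambda>x. x / k) at_top at_top" using k by real_asymp
    have "((\<lambda>x. of_real (sqrt (x / k)) * (\<psi>' (x / k) - \<i> * k * \<psi> (x / k))) \<longlongrightarrow> 0) at_top"
      using filterlim_compose[OF rad fl] by simp
    from tendsto_mult[OF tendsto_const[of "of_real (1 / sqrt k)"] this]
    have 1: "((\<lambda>x. of_real (1 / sqrt k) * (of_real (sqrt (x / k)) * (\<psi>' (x / k) - \<i> * k * \<psi> (x / k)))) \<longlongrightarrow> 0) at_top" by simp
    have e1: "of_real (1 / sqrt k) * (of_real (sqrt (x / k)) * (\<psi>' (x / k) - \<i> * k * \<psi> (x / k))) = of_real (sqrt x) * (d x - \<i> * f x)" for x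
    proof -
      have "(1 / sqrt k) * sqrt (x / k) = sqrt x / k" using k by (simp add: real_sqrt_divide)
      hence "complex_of_real (1 / sqrt k) * of_real (sqrt (x / k)) = of_real (sqrt x) / of_real k"
        by (simp flip: of_real_mult of_real_divide)
      thus ?thesis using k by (simp only: mult.assoc[symmetric]) (simp add: d_def f_def field_simps)
    qed
    have 2: "((\<lambda>x. of_real (sqrt x) * (d x - \<i> * f x)) \<longlongrightarrow> 0) at_top" using 1 unfolding e1 .
    let ?A = "\<lambda>x. of_real (sqrt x) * (hankel1' m x - \<i> * hankel1 m x)"
    let ?B = "\<lambda>x. of_real (sqrt x) * (cnj (hankel1' m x) - \<i> * cnj (hankel1 m x))"
    have "((\<lambda>x. inverse \<beta> * (of_real (sqrt x) * (d x - \<i> * f x) - \<alpha> * ?A x)) \<longlongrightarrow> inverse \<beta> * (0 - \<alpha> * 0)) at_top"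
      by (intro tendsto_intros 2 hankel1_radiating)
    moreover have "\<forall>\<^sub>F x in at_top. inverse \<beta> * (of_real (sqrt x) * (d x - \<i> * f x) - \<alpha> * ?A x) = ?B x"
      using eventually_gt_at_top[of "k * a"]
    proof eventually_elim
      case (elim x)
      show ?case unfolding ab[OF elim] using b by (simp add: field_simps)
    qed
    ultimately have B: "(?B \<longlongrightarrow> 0) at_top" using Lim_transform_eventually by fastforce
    have cB: "((\<lambda>x. of_real (sqrt x) * (hankel1' m x + \<i> * hankel1 m x)) \<longlongrightarrow> 0) at_top"
      using tendsto_cnj[OF B] by simp
    have H': "((\<lambda>x. of_real (sqrt x) * hankel1' m x) \<longlongrightarrow> 0) at_top"
      using tendsto_mult[OF tendsto_const[of "1/2"] tendsto_add[OF cB hankel1_radiating[of m]]] by (simp add: algebra_simps)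
    have "((\<lambda>x. (1 / (2 * \<i>)) * (of_real (sqrt x) * (hankel1' m x + \<i> * hankel1 m x) - ?A x)) \<longlongrightarrow> (1 / (2 * \<i>)) * (0 - 0)) at_top"
      by (intro tendsto_intros cB hankel1_radiating)
    hence H: "((\<lambda>x. of_real (sqrt x) * hankel1 m x) \<longlongrightarrow> 0) at_top" by (simp add: field_simps)
    have "((\<lambda>x. Im (cnj (of_real (sqrt x) * hankel1 m x) * (of_real (sqrt x) * hankel1' m x))) \<longlongrightarrow> Im (cnj 0 * 0)) at_top"
      by (intro tendsto_intros H H')
    moreover have "\<forall>\<^sub>F x in at_top. Im (cnj (of_real (sqrt x) * hankel1 m x) * (of_real (sqrt x) * hankel1' m x)) = 2 / pi"
      using eventually_gt_at_top[of 0]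
    proof eventually_elim
      case (elim x)
      have "cnj (of_real (sqrt x) * hankel1 m x) * (of_real (sqrt x) * hankel1' m x) = of_real (sqrt x * sqrt x) * (cnj (hankel1 m x) * hankel1' m x)"
        by (simp only: complex_cnj_mult complex_cnj_complex_of_real of_real_mult mult_ac)
      hence "Im (cnj (of_real (sqrt x) * hankel1 m x) * (of_real (sqrt x) * hankel1' m x)) = sqrt x * sqrt x * (2 / (pi * x))"
        using Im_cnj_hankel1[OF elim, of m] by (simp only: Im_of_real_mult)
      thus ?case using elim by simp
    qed
    ultimately have "((\<lambda>x::real. 2 / pi) \<longlongrightarrow> 0) at_top" using Lim_transform_eventually by fastforce
    thus False by (simp add: tendsto_const_iff)
  qed
  show ?thesis
  proof (intro exI[of _ \<alpha>] allI impI)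
    fix r assume r: "r > a"
    hence "k * r > k * a" using k by simp
    from ab[OF this] k \<open>\<beta> = 0\<close>
    show "\<psi> r = \<alpha> * hankel1 m (k * r) \<and> \<psi>' r = of_real k * \<alpha> * hankel1' m (k * r)"
      by (auto simp: f_def d_def field_simps)
  qed
qed

section \<open>Growth of the mode amplitudes\<close>

lemma bessel_J_bound:
  assumes "x > 0"
  shows "\<bar>bessel_J n x\<bar> \<le> (x / 2) ^ n / fact n * exp ((x / 2)\<^sup>2)"
proof -
  define t where "t = (x / 2)\<^sup>2"
  have t: "t \<ge> 0" by (simp add: t_def)
  have e: "(\<lambda>k. t ^ k /\<^sub>R fact k / fact n) sums (exp t / fact n)"
    by (intro sums_divide exp_converges)
  have "norm (\<Sum>k. bessel_coeff n k * t ^ k) \<le> (\<Sum>k. t ^ k /\<^sub>R fact k / fact n)"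
  proof (rule norm_suminf_le[OF _ sums_summable[OF e]])
    fix k
    have "\<bar>bessel_coeff n k\<bar> * t ^ k \<le> 1 / fact k / fact n * t ^ k"
      by (intro mult_right_mono abs_bessel_coeff_le) (use t in auto)
    thus "norm (bessel_coeff n k * t ^ k) \<le> t ^ k /\<^sub>R fact k / fact n"
      using t by (simp add: abs_mult field_simps)
  qed
  also have "\<dots> = exp t / fact n" by (rule sums_unique[OF e, symmetric])
  finally have "\<bar>J_red n t\<bar> \<le> exp t / fact n" by (simp add: J_red_def)
  hence "(x / 2) ^ n * \<bar>J_red n t\<bar> \<le> (x / 2) ^ n * (exp t / fact n)"
    using assms by (intro mult_left_mono) auto
  thus ?thesis using assms by (simp add: bessel_J_red abs_mult t_def)
qed

text \<open>A linear factor is absorbed by enlarging the base of the power.\<close>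

lemma absorb_linear:
  fixes x y :: real
  assumes "0 < y" "y < x"
  obtains C where "C \<ge> 0" "\<And>m::nat. (real m + 1) * (y / 2) ^ m \<le> C * (x / 2) ^ m"
proof -
  have "Bseq (\<lambda>m. real m * (y / x) ^ m)"
    using powser_times_n_limit_0[of "y / x"] assms
    by (intro convergent_imp_Bseq convergentI[of _ 0]) auto
  then obtain C where C: "\<And>m. norm (real m * (y / x) ^ m) \<le> C" by (auto simp: Bseq_def)
  show ?thesis
  proof (rule that)
    show "C + 1 \<ge> 0" using C[of 0] by simp
    fix m
    have "real m * (y / x) ^ m \<le> C" using C[of m] assms by simp
    moreover have "(y / x) ^ m \<le> 1" using assms by (intro power_le_one) auto
    ultimately have "(real m + 1) * (y / x) ^ m \<le> C + 1" by (simp add: distrib_right)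
    from mult_right_mono[OF this, of "(x / 2) ^ m"]
    have "(real m + 1) * ((y / x) ^ m * (x / 2) ^ m) \<le> (C + 1) * (x / 2) ^ m" using assms by simp
    also have "(y / x) ^ m * (x / 2) ^ m = (y / 2) ^ m" using assms by (simp flip: power_mult_distrib)
    finally show "(real m + 1) * (y / 2) ^ m \<le> (C + 1) * (x / 2) ^ m" .
  qed
qed

text \<open>The Wronskian with the regular solution \<open>J\<^sub>m\<close> recovers the amplitude without a lower bound for
  the Hankel function, and \<open>J\<^sub>m(y)\<close> is of size \<open>(y/2)\<^sup>m / m!\<close>.\<close>

lemma amplitude_bound:
  assumes y: "y > 0" and M: "cmod (c * hankel1 m y) \<le> M" "cmod (c * hankel1' m y) \<le> M"
  shows "cmod c * fact m \<le> (pi * y / 2 * exp ((y / 2)\<^sup>2) * M * (y / 2 + 1 / y + 1)) * ((real m + 1) * (y / 2) ^ m)"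
proof -
  define E where "E = (y / 2) ^ m / fact m * exp ((y / 2)\<^sup>2)"
  have E: "E \<ge> 0" using y by (simp add: E_def)
  have M0: "M \<ge> 0" using M(1) norm_ge_zero order_trans by blast
  have J: "\<bar>bessel_J m y\<bar> \<le> E" unfolding E_def by (rule bessel_J_bound[OF y])
  have J1: "\<bar>bessel_J (Suc m) y\<bar> \<le> (y / 2) * E"
  proof -
    have "\<bar>bessel_J (Suc m) y\<bar> \<le> (y / 2) ^ Suc m / fact (Suc m) * exp ((y / 2)\<^sup>2)" by (rule bessel_J_bound[OF y])
    also have "\<dots> \<le> (y / 2) ^ Suc m / fact m * exp ((y / 2)\<^sup>2)"
      using y by (intro mult_right_mono divide_left_mono fact_mono) auto
    finally show ?thesis by (simp add: E_def)
  qed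
  have h: "hankel1 (Suc m) y = of_real (m / y) * hankel1 m y - hankel1' m y" by (simp add: hankel1'_def)
  have H1: "cmod (c * hankel1 (Suc m) y) \<le> m / y * M + M"
  proof -
    have "c * hankel1 (Suc m) y = of_real (m / y) * (c * hankel1 m y) - c * hankel1' m y" unfolding h by (simp add: algebra_simps)
    also have "cmod \<dots> \<le> m / y * cmod (c * hankel1 m y) + cmod (c * hankel1' m y)"
      using y by (intro order_trans[OF norm_triangle_ineq4]) (simp add: norm_mult norm_divide)
    also have "\<dots> \<le> m / y * M + M" using y M by (intro add_mono mult_left_mono) auto
    finally show ?thesis .
  qed
  have w: "hankel1 m y * of_real (bessel_J (Suc m) y) - hankel1 (Suc m) y * of_real (bessel_J m y) = \<i> * of_real (2 / (pi * y))"
    unfolding wronskian[OF y, of m, symmetric] by (simp add: complex_eq_iff mult.commute)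
  have "cmod c * (2 / (pi * y)) = cmod (c * (hankel1 m y * of_real (bessel_J (Suc m) y) - hankel1 (Suc m) y * of_real (bessel_J m y)))"
    unfolding w using y by (simp add: norm_mult norm_divide)
  also have "\<dots> = cmod ((c * hankel1 m y) * of_real (bessel_J (Suc m) y) - (c * hankel1 (Suc m) y) * of_real (bessel_J m y))"
    by (simp add: algebra_simps)
  also have "\<dots> \<le> cmod (c * hankel1 m y) * \<bar>bessel_J (Suc m) y\<bar> + cmod (c * hankel1 (Suc m) y) * \<bar>bessel_J m y\<bar>"
    by (intro order_trans[OF norm_triangle_ineq4]) (simp add: norm_mult)
  also have "\<dots> \<le> M * ((y / 2) * E) + (m / y * M + M) * E"
    using y M0 by (intro add_mono mult_mono M J J1 H1) auto
  also have "\<dots> = (y / 2 + m / y + 1) * (M * E)" by (simp add: algebra_simps)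
  also have "\<dots> \<le> ((y / 2 + 1 / y + 1) * (real m + 1)) * (M * E)"
  proof (rule mult_right_mono)
    have "(y / 2 + 1 / y + 1) * (real m + 1) = y / 2 + m / y + 1 + (1 / y + real m * (y / 2 + 1))"
      using y by (simp add: field_simps)
    thus "y / 2 + m / y + 1 \<le> (y / 2 + 1 / y + 1) * (real m + 1)" using y by simp
  qed (use M0 E in auto)
  finally have "cmod c * (2 / (pi * y)) * (pi * y / 2 * fact m) \<le> ((y / 2 + 1 / y + 1) * (real m + 1)) * (M * E) * (pi * y / 2 * fact m)"
    using y by (intro mult_right_mono) auto
  moreover have "cmod c * (2 / (pi * y)) * (pi * y / 2 * fact m) = cmod c * fact m"
    using y by (simp add: field_simps)
  moreover have "((y / 2 + 1 / y + 1) * (real m + 1)) * (M * E) * (pi * y / 2 * fact m)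
     = (pi * y / 2 * exp ((y / 2)\<^sup>2) * M * (y / 2 + 1 / y + 1)) * ((real m + 1) * (y / 2) ^ m)"
    unfolding E_def by simp
  ultimately show ?thesis by (simp only:)
qed

text \<open>Values and derivatives of all modes on one circle bound the amplitudes, and the circle may be
  taken arbitrarily close to the boundary.\<close>

lemma admissible_from_bounds:
  assumes k: "k > 0" and a: "a \<ge> 0"
    and B: "\<And>r. r > a \<Longrightarrow> \<exists>M. \<forall>n. cmod (c n * hankel1 (nat \<bar>n\<bar>) (k * r)) \<le> M \<and> cmod (c n * hankel1' (nat \<bar>n\<bar>) (k * r)) \<le> M"
  shows "admissible (k * a) c"
  unfolding admissible_def
proof (intro allI impI)
  fix x assume x: "x > k * a"
  define y where "y = (k * a + x) / 2"
  have ka: "k * a \<ge> 0" using k a by simp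
  have mid: "\<kappa> < (\<kappa> + z) / 2" "(\<kappa> + z) / 2 < z" if "\<kappa> < z" for \<kappa> z :: real
    using that by simp_all
  note y1 = mid(1)[OF x, folded y_def] and y2 = mid(2)[OF x, folded y_def]
  have y3: "0 < y" using y1 ka by linarith
  note y = y1 y2 y3
  have "y / k > a" using y k by (simp add: field_simps)
  from B[OF this] obtain M where M: "\<forall>n. cmod (c n * hankel1 (nat \<bar>n\<bar>) y) \<le> M \<and> cmod (c n * hankel1' (nat \<bar>n\<bar>) y) \<le> M"
    using k by auto
  have M0: "M \<ge> 0" using M norm_ge_zero order_trans by blast
  define D where "D = pi * y / 2 * exp ((y / 2)\<^sup>2) * M * (y / 2 + 1 / y + 1)"
  have D: "D \<ge> 0" unfolding D_def using y M0 by simp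
  obtain C where C: "C \<ge> 0" "\<And>m::nat. (real m + 1) * (y / 2) ^ m \<le> C * (x / 2) ^ m"
    using absorb_linear[OF y(3,2)] by auto
  show "\<exists>C. \<forall>n. cmod (c n) * fact (nat \<bar>n\<bar>) \<le> C * (x / 2) ^ nat \<bar>n\<bar>"
  proof (intro exI[of _ "D * C"] allI)
    fix n
    have "cmod (c n) * fact (nat \<bar>n\<bar>) \<le> D * ((real (nat \<bar>n\<bar>) + 1) * (y / 2) ^ nat \<bar>n\<bar>)"
      unfolding D_def by (rule amplitude_bound[OF y(3)]) (use M in auto)
    also have "\<dots> \<le> D * (C * (x / 2) ^ nat \<bar>n\<bar>)" by (intro mult_left_mono C D)
    finally show "cmod (c n) * fact (nat \<bar>n\<bar>) \<le> D * C * (x / 2) ^ nat \<bar>n\<bar>" by simp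
  qed
qed

lemma admissible_mult:
  assumes "admissible \<kappa> c" "\<And>n. cmod (z n) \<le> B"
  shows "admissible \<kappa> (\<lambda>n. z n * c n)"
  unfolding admissible_def
proof (intro allI impI)
  fix x assume "x > \<kappa>"
  then obtain C where C: "\<And>n. cmod (c n) * fact (nat \<bar>n\<bar>) \<le> C * (x / 2) ^ nat \<bar>n\<bar>"
    using assms(1) unfolding admissible_def by blast
  have B: "B \<ge> 0" using assms(2) norm_ge_zero order_trans by blast
  show "\<exists>C. \<forall>n. cmod (z n * c n) * fact (nat \<bar>n\<bar>) \<le> C * (x / 2) ^ nat \<bar>n\<bar>"
  proof (intro exI[of _ "B * C"] allI)
    fix n
    have "cmod (z n) * (cmod (c n) * fact (nat \<bar>n\<bar>)) \<le> B * (C * (x / 2) ^ nat \<bar>n\<bar>)"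
      by (intro mult_mono assms(2) C B) auto
    thus "cmod (z n * c n) * fact (nat \<bar>n\<bar>) \<le> B * C * (x / 2) ^ nat \<bar>n\<bar>" by (simp add: norm_mult mult.assoc)
  qed
qed

lemma admissible_add:
  assumes "admissible \<kappa> c" "admissible \<kappa> d"
  shows "admissible \<kappa> (\<lambda>n. c n + d n)"
  unfolding admissible_def
proof (intro allI impI)
  fix x assume x: "x > \<kappa>"
  obtain C where C: "\<And>n. cmod (c n) * fact (nat \<bar>n\<bar>) \<le> C * (x / 2) ^ nat \<bar>n\<bar>"
    using assms(1) x unfolding admissible_def by blast
  obtain D where D: "\<And>n. cmod (d n) * fact (nat \<bar>n\<bar>) \<le> D * (x / 2) ^ nat \<bar>n\<bar>"
    using assms(2) x unfolding admissible_def by blast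
  show "\<exists>C. \<forall>n. cmod (c n + d n) * fact (nat \<bar>n\<bar>) \<le> C * (x / 2) ^ nat \<bar>n\<bar>"
  proof (intro exI[of _ "C + D"] allI)
    fix n
    have "cmod (c n + d n) * fact (nat \<bar>n\<bar>) \<le> (cmod (c n) + cmod (d n)) * fact (nat \<bar>n\<bar>)"
      by (intro mult_right_mono norm_triangle_ineq) auto
    also have "\<dots> \<le> (C + D) * (x / 2) ^ nat \<bar>n\<bar>" using C[of n] D[of n] by (simp add: distrib_right)
    finally show "cmod (c n + d n) * fact (nat \<bar>n\<bar>) \<le> (C + D) * (x / 2) ^ nat \<bar>n\<bar>" .
  qed
qed

lemma admissible_shift:
  assumes c: "admissible \<kappa> c" and k: "\<kappa> > 0" and s: "\<bar>s\<bar> = 1"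
  shows "admissible \<kappa> (\<lambda>n. c (n + s))"
  unfolding admissible_def
proof (intro allI impI)
  fix x assume x: "x > \<kappa>"
  define y where "y = (\<kappa> + x) / 2"
  have y: "\<kappa> < y" "y < x" "0 < y" using x k by (auto simp: y_def)
  obtain C where C: "\<And>n. cmod (c n) * fact (nat \<bar>n\<bar>) \<le> C * (y / 2) ^ nat \<bar>n\<bar>"
    using c y unfolding admissible_def by blast
  have C0: "C \<ge> 0" using C[of 0] by (simp add: order_trans[OF norm_ge_zero])
  obtain D where D: "D \<ge> 0" "\<And>m::nat. (real m + 1) * (y / 2) ^ m \<le> D * (x / 2) ^ m"
    using absorb_linear[OF y(3,2)] by auto
  define q where "q = x / 2"
  have q: "q > 0" using y by (simp add: q_def)
  define K where "K = 1 + q + 1 / q"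
  have K: "K \<ge> 0" using q by (simp add: K_def)
  show "\<exists>C. \<forall>n. cmod (c (n + s)) * fact (nat \<bar>n\<bar>) \<le> C * (x / 2) ^ nat \<bar>n\<bar>"
  proof (intro exI[of _ "C * D * K"] allI)
    fix n
    define M where "M = nat \<bar>n + s\<bar>"
    define N where "N = nat \<bar>n\<bar>"
    have MN: "N = M \<or> N = Suc M \<or> M = Suc N" unfolding M_def N_def using s by linarith
    have f: "fact N \<le> (real M + 1) * fact M"
    proof -
      have "fact N \<le> (fact (Suc M) :: real)" by (intro fact_mono) (use MN in auto)
      thus ?thesis by (simp add: algebra_simps)
    qed
    have p: "q ^ M \<le> K * q ^ N"
    proof -
      have "q ^ M * 1 \<le> q ^ M * (K * (q ^ N / q ^ M))"
      proof (rule mult_left_mono)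
        from MN consider "N = M" | "N = Suc M" | "M = Suc N" by blast
        thus "1 \<le> K * (q ^ N / q ^ M)"
        proof cases
          case 1 thus ?thesis using q by (simp add: K_def)
        next
          case 2
          have "K * q = q + q * q + 1" using q by (simp add: K_def algebra_simps)
          thus ?thesis using q 2 by simp
        next
          case 3
          have "q \<le> K" using q by (simp add: K_def)
          thus ?thesis using q 3 by (simp add: field_simps)
        qed
      qed (use q in auto)
      thus ?thesis using q by simp
    qed
    have "cmod (c (n + s)) * fact N \<le> cmod (c (n + s)) * ((real M + 1) * fact M)"
      by (intro mult_left_mono f) auto
    also have "\<dots> = (cmod (c (n + s)) * fact M) * (real M + 1)" by simp
    also have "\<dots> \<le> (C * (y / 2) ^ M) * (real M + 1)"
      unfolding M_def by (intro mult_right_mono C) auto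
    also have "\<dots> = C * ((real M + 1) * (y / 2) ^ M)" by simp
    also have "\<dots> \<le> C * (D * (x / 2) ^ M)" by (intro mult_left_mono D C0)
    also have "\<dots> \<le> C * (D * (K * q ^ N))" unfolding q_def[symmetric]
      by (intro mult_left_mono p D C0)
    finally show "cmod (c (n + s)) * fact (nat \<bar>n\<bar>) \<le> C * D * K * (x / 2) ^ nat \<bar>n\<bar>"
      by (simp add: N_def q_def mult.assoc)
  qed
qed

section \<open>Gradients in terms of modes\<close>

text \<open>With the sign of \<open>H\<^sub>-\<^sub>n = (-1)\<^sup>n H\<^sub>n\<close> built in, the formulas that raise and lower the order hold for all
  integers without case distinctions.\<close>

definition sg :: "int \<Rightarrow> complex" where "sg n = (if n < 0 \<and> odd n then -1 else 1)"
definition HZ :: "int \<Rightarrow> real \<Rightarrow> complex" where "HZ n x = sg n * hankel1 (nat \<bar>n\<bar>) x"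
definition HZ' :: "int \<Rightarrow> real \<Rightarrow> complex" where "HZ' n x = sg n * hankel1' (nat \<bar>n\<bar>) x"

lemma sg_square [simp]: "sg n * sg n = 1" "sg n * (sg n * z) = z" and cmod_sg [simp]: "cmod (sg n) = 1"
  by (auto simp: sg_def)

lemma HZ'_up: assumes "x > 0" shows "HZ' n x = of_real (of_int n / x) * HZ n x - HZ (n + 1) x"
proof (cases "n \<ge> 0")
  case True
  thus ?thesis by (simp add: HZ_def HZ'_def sg_def hankel1'_def nat_add_distrib)
next
  case False
  define m where "m = nat (- n - 1)"
  have n: "n = - int (Suc m)" using False by (simp add: m_def)
  show ?thesis unfolding HZ_def HZ'_def n using hankel1'_Suc[OF assms, of m]
    by (simp add: sg_def nat_add_distrib) (auto simp: algebra_simps add_divide_distrib diff_divide_distrib)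
qed

lemma HZ'_down: assumes "x > 0" shows "HZ' n x = HZ (n - 1) x - of_real (of_int n / x) * HZ n x"
proof (cases "n > 0")
  case True
  define m where "m = nat (n - 1)"
  have n: "n = int (Suc m)" using True by (simp add: m_def)
  show ?thesis unfolding HZ_def HZ'_def n using hankel1'_Suc[OF assms, of m]
    by (simp add: sg_def nat_add_distrib)
next
  case False
  define m where "m = nat (- n)"
  have n: "n = - int m" using False by (simp add: m_def)
  have nn: "nat \<bar>- int m - 1\<bar> = Suc m" by simp
  show ?thesis unfolding HZ_def HZ'_def n nn
    by (cases "m = 0") (auto simp: sg_def hankel1'_def algebra_simps)
qed

text \<open>The amplitudes of the two Cartesian derivatives of a mode sum with amplitudes \<open>c\<close>: multiplication
  by \<open>cos\<close> and \<open>sin\<close> couples neighbouring modes, and the formulas for the derivative of the Hankel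
  function leave only one term of each neighbour.\<close>

definition grad_x :: "real \<Rightarrow> (int \<Rightarrow> complex) \<Rightarrow> int \<Rightarrow> complex" where
  "grad_x k c n = of_real (k / 2) * sg n * (sg (n + 1) * c (n + 1) - sg (n - 1) * c (n - 1))"

definition grad_y :: "real \<Rightarrow> (int \<Rightarrow> complex) \<Rightarrow> int \<Rightarrow> complex" where
  "grad_y k c n = \<i> * of_real (k / 2) * sg n * (sg (n + 1) * c (n + 1) + sg (n - 1) * c (n - 1))"

lemma admissible_grad:
  assumes c: "admissible \<kappa> c" and k: "\<kappa> > 0"
  shows "admissible \<kappa> (grad_x k c)" "admissible \<kappa> (grad_y k c)"
proof -
  have s1: "admissible \<kappa> (\<lambda>n. c (n + 1))" and s2: "admissible \<kappa> (\<lambda>n. c (n + (-1)))"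
    by (rule admissible_shift[OF c k]; simp)+
  have z: "cmod (of_real (k / 2) * sg n * sg m) \<le> \<bar>k\<bar> / 2" "cmod (- of_real (k / 2) * sg n * sg m) \<le> \<bar>k\<bar> / 2"
    "cmod (\<i> * of_real (k / 2) * sg n * sg m) \<le> \<bar>k\<bar> / 2" for n m
    by (simp_all add: norm_mult norm_divide)
  have ex: "grad_x k c = (\<lambda>n. of_real (k / 2) * sg n * sg (n + 1) * c (n + 1) + - of_real (k / 2) * sg n * sg (n - 1) * c (n + (-1)))"
    by (auto simp: fun_eq_iff grad_x_def algebra_simps)
  have ey: "grad_y k c = (\<lambda>n. \<i> * of_real (k / 2) * sg n * sg (n + 1) * c (n + 1) + \<i> * of_real (k / 2) * sg n * sg (n - 1) * c (n + (-1)))"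
    by (auto simp: fun_eq_iff grad_y_def algebra_simps)
  show "admissible \<kappa> (grad_x k c)" unfolding ex
    by (rule admissible_add[OF admissible_mult[OF s1 z(1)] admissible_mult[OF s2 z(2)]])
  show "admissible \<kappa> (grad_y k c)" unfolding ey
    by (rule admissible_add[OF admissible_mult[OF s1 z(3)] admissible_mult[OF s2 z(3)]])
qed

lemma sg_cos: "c n * of_real (cos (of_int \<bar>n\<bar> * pi / 2)) = sg n * c n * of_real (cos (of_int n * pi / 2))"
  and sg_sin: "c n * of_real (sin (of_int \<bar>n\<bar> * pi / 2)) = sg n * c n * of_real (sin (of_int n * pi / 2))"
proof -
  have o: "cos (of_int n * pi / 2) = 0" if "odd n"
    using that cos_zero_iff_int[of "of_int n * pi / 2"] by auto
  have e: "sin (of_int n * pi / 2) = 0" if "even n"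
    using that sin_zero_iff_int[of "of_int n * pi / 2"] by auto
  have ca: "cos (of_int \<bar>n\<bar> * pi / 2) = cos (of_int n * pi / 2)"
    by (cases "n \<ge> 0") (simp_all add: abs_if)
  have sa: "sin (of_int \<bar>n\<bar> * pi / 2) = (if n < 0 then -1 else 1) * sin (of_int n * pi / 2)"
    by (cases "n \<ge> 0") (simp_all add: abs_if)
  show "c n * of_real (cos (of_int \<bar>n\<bar> * pi / 2)) = sg n * c n * of_real (cos (of_int n * pi / 2))"
    unfolding ca using o by (auto simp: sg_def)
  show "c n * of_real (sin (of_int \<bar>n\<bar> * pi / 2)) = sg n * c n * of_real (sin (of_int n * pi / 2))"
    unfolding sa using e by (auto simp: sg_def)
qed

lemma has_sum_shift_int:
  assumes "(f has_sum s) (UNIV :: int set)" shows "((\<lambda>n. f (n + m)) has_sum s) UNIV"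
  using assms by (subst has_sum_reindex_bij_betw[of "\<lambda>n. n + m" UNIV UNIV f]) (auto intro!: bij_betwI[of _ _ _ "\<lambda>n. n - m"])

text \<open>Shifting the mode number by one shifts the phase \<open>n \<pi>/2\<close> by a quarter turn, which exchanges the
  cosine and sine series, and multiplies by \<open>exp (\<plusminus> i \<theta>)\<close>, which recombines to \<open>cos \<theta>\<close> or \<open>sin \<theta>\<close>.\<close>

lemma grad_leading:
  assumes c: "admissible \<kappa> c" and k: "\<kappa> > 0"
  shows "karp_h (grad_x k c) 0 \<theta> = of_real (k * cos \<theta>) * karp_q c 0 \<theta>"
    "karp_q (grad_x k c) 0 \<theta> = - of_real (k * cos \<theta>) * karp_h c 0 \<theta>"
    "karp_h (grad_y k c) 0 \<theta> = of_real (k * sin \<theta>) * karp_q c 0 \<theta>"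
    "karp_q (grad_y k c) 0 \<theta> = - of_real (k * sin \<theta>) * karp_h c 0 \<theta>"
proof -
  define C where "C n = complex_of_real (cos (of_int n * pi / 2))" for n :: int
  define S where "S n = complex_of_real (sin (of_int n * pi / 2))" for n :: int
  define E where "E n = cis (of_int n * \<theta>)" for n :: int
  have lead: "((\<lambda>n. sg n * d n * C n * E n) has_sum karp_h d 0 \<theta>) UNIV"
    "((\<lambda>n. sg n * d n * S n * E n) has_sum karp_q d 0 \<theta>) UNIV" if "admissible \<kappa> d" for d
    using karp_leading[OF that k] unfolding leading_coeffs_def sg_cos sg_sin C_def S_def E_def by blast+
  note L = lead[OF c]
  have Cm: "C (n - 1) = S n" "S (n - 1) = - C n" "C (n + 1) = - S n" "S (n + 1) = C n" for n
  proof -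
    have m: "of_int (n - 1) * pi / 2 = of_int n * pi / 2 - pi / 2" by (simp add: field_simps)
    have p: "of_int (n + 1) * pi / 2 = of_int n * pi / 2 + pi / 2" by (simp add: field_simps)
    show "C (n - 1) = S n" "S (n - 1) = - C n" "C (n + 1) = - S n" "S (n + 1) = C n"
      unfolding C_def S_def m p cos_diff sin_diff cos_add sin_add by simp_all
  qed
  have Em: "E (n + 1) = E n * cis \<theta>" "E (n - 1) = E n * cis (- \<theta>)" for n
    by (simp_all add: E_def cis_mult algebra_simps)
  have cc: "cis \<theta> + cis (- \<theta>) = of_real (2 * cos \<theta>)" "cis (- \<theta>) - cis \<theta> = - 2 * \<i> * of_real (sin \<theta>)"
    by (simp_all add: complex_eq_iff)
  have up: "((\<lambda>n. sg (n + 1) * c (n + 1) * X n * E n) has_sum s * cis (- \<theta>)) UNIV"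
    if "((\<lambda>n. sg n * c n * X (n - 1) * E n) has_sum s) UNIV" for X s
  proof -
    have "((\<lambda>n. sg (n + 1) * c (n + 1) * X (n + 1 - 1) * E (n + 1) * cis (- \<theta>)) has_sum s * cis (- \<theta>)) UNIV"
      by (intro has_sum_cmult_left has_sum_shift_int[OF that])
    moreover have "E (n + 1) * cis (- \<theta>) = E n" for n by (simp add: E_def cis_mult algebra_simps)
    ultimately show ?thesis by (simp add: mult.assoc)
  qed
  have dn: "((\<lambda>n. sg (n - 1) * c (n - 1) * X n * E n) has_sum s * cis \<theta>) UNIV"
    if "((\<lambda>n. sg n * c n * X (n + 1) * E n) has_sum s) UNIV" for X s
  proof -
    have "((\<lambda>n. sg (n + - 1) * c (n + - 1) * X (n + - 1 + 1) * E (n + - 1) * cis \<theta>) has_sum s * cis \<theta>) UNIV"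
      by (intro has_sum_cmult_left has_sum_shift_int[OF that])
    moreover have "E (n - 1) * cis \<theta> = E n" for n by (simp add: E_def cis_mult algebra_simps)
    ultimately show ?thesis by (simp add: mult.assoc)
  qed
  have neg: "((\<lambda>n. - f n) has_sum - s) UNIV" if "(f has_sum s) UNIV" for f :: "int \<Rightarrow> complex" and s
    using has_sum_cmult_right[OF that, of "-1"] by simp
  have q1: "((\<lambda>n. sg (n + 1) * c (n + 1) * C n * E n) has_sum karp_q c 0 \<theta> * cis (- \<theta>)) UNIV"
    by (rule up) (use L(2) in \<open>simp add: Cm\<close>)
  have q2: "((\<lambda>n. sg (n - 1) * c (n - 1) * C n * E n) has_sum (- karp_q c 0 \<theta>) * cis \<theta>) UNIV"
    by (rule dn) (use neg[OF L(2)] in \<open>simp add: Cm\<close>)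
  have h1: "((\<lambda>n. sg (n + 1) * c (n + 1) * S n * E n) has_sum (- karp_h c 0 \<theta>) * cis (- \<theta>)) UNIV"
    by (rule up) (use neg[OF L(1)] in \<open>simp add: Cm\<close>)
  have h2: "((\<lambda>n. sg (n - 1) * c (n - 1) * S n * E n) has_sum karp_h c 0 \<theta> * cis \<theta>) UNIV"
    by (rule dn) (use L(1) in \<open>simp add: Cm\<close>)
  have gx: "((\<lambda>n. sg n * grad_x k c n * X n * E n) has_sum of_real (k / 2) * (s1 - s2)) UNIV"
    and gy: "((\<lambda>n. sg n * grad_y k c n * X n * E n) has_sum \<i> * of_real (k / 2) * (s1 + s2)) UNIV"
    if "((\<lambda>n. sg (n + 1) * c (n + 1) * X n * E n) has_sum s1) UNIV" "((\<lambda>n. sg (n - 1) * c (n - 1) * X n * E n) has_sum s2) UNIV"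
    for X s1 s2
  proof -
    have o: "sg n * grad_x k c n * X n * E n = of_real (k / 2) * (sg (n + 1) * c (n + 1) * X n * E n - sg (n - 1) * c (n - 1) * X n * E n)" for n
    proof -
      have e: "sg n * grad_x k c n = of_real (k / 2) * (sg n * sg n) * (sg (n + 1) * c (n + 1) - sg (n - 1) * c (n - 1))"
        unfolding grad_x_def by (simp only: mult_ac)
      show ?thesis unfolding e by (simp add: algebra_simps)
    qed
    show "((\<lambda>n. sg n * grad_x k c n * X n * E n) has_sum of_real (k / 2) * (s1 - s2)) UNIV"
      unfolding o by (rule has_sum_cmult_right[OF has_sum_diff_complex[OF that]])
    have o: "sg n * grad_y k c n * X n * E n = \<i> * of_real (k / 2) * (sg (n + 1) * c (n + 1) * X n * E n + sg (n - 1) * c (n - 1) * X n * E n)" for n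
    proof -
      have e: "sg n * grad_y k c n = \<i> * of_real (k / 2) * (sg n * sg n) * (sg (n + 1) * c (n + 1) + sg (n - 1) * c (n - 1))"
        unfolding grad_y_def by (simp only: mult_ac)
      show ?thesis unfolding e by (simp add: algebra_simps)
    qed
    show "((\<lambda>n. sg n * grad_y k c n * X n * E n) has_sum \<i> * of_real (k / 2) * (s1 + s2)) UNIV"
      unfolding o by (rule has_sum_cmult_right[OF has_sum_add[OF that]])
  qed
  note A = admissible_grad[OF c k]
  have "karp_h (grad_x k c) 0 \<theta> = of_real (k / 2) * (karp_q c 0 \<theta> * cis (- \<theta>) - (- karp_q c 0 \<theta>) * cis \<theta>)"
    by (rule has_sum_unique[OF lead(1)[OF A(1)] gx[OF q1 q2]])
  also have "\<dots> = of_real (k / 2) * karp_q c 0 \<theta> * (cis \<theta> + cis (- \<theta>))" by (simp add: algebra_simps)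
  finally show "karp_h (grad_x k c) 0 \<theta> = of_real (k * cos \<theta>) * karp_q c 0 \<theta>" unfolding cc by simp
  have "karp_q (grad_x k c) 0 \<theta> = of_real (k / 2) * ((- karp_h c 0 \<theta>) * cis (- \<theta>) - karp_h c 0 \<theta> * cis \<theta>)"
    by (rule has_sum_unique[OF lead(2)[OF A(1)] gx[OF h1 h2]])
  also have "\<dots> = - of_real (k / 2) * karp_h c 0 \<theta> * (cis \<theta> + cis (- \<theta>))" by (simp add: algebra_simps)
  finally show "karp_q (grad_x k c) 0 \<theta> = - of_real (k * cos \<theta>) * karp_h c 0 \<theta>" unfolding cc by simp
  have "karp_h (grad_y k c) 0 \<theta> = \<i> * of_real (k / 2) * (karp_q c 0 \<theta> * cis (- \<theta>) + (- karp_q c 0 \<theta>) * cis \<theta>)"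
    by (rule has_sum_unique[OF lead(1)[OF A(2)] gy[OF q1 q2]])
  also have "\<dots> = \<i> * of_real (k / 2) * karp_q c 0 \<theta> * (cis (- \<theta>) - cis \<theta>)" by (simp add: algebra_simps)
  finally have ey1: "karp_h (grad_y k c) 0 \<theta> = \<dots>" .
  show "karp_h (grad_y k c) 0 \<theta> = of_real (k * sin \<theta>) * karp_q c 0 \<theta>"
    unfolding ey1 cc by (simp add: complex_eq_iff)
  have "karp_q (grad_y k c) 0 \<theta> = \<i> * of_real (k / 2) * ((- karp_h c 0 \<theta>) * cis (- \<theta>) + karp_h c 0 \<theta> * cis \<theta>)"
    by (rule has_sum_unique[OF lead(2)[OF A(2)] gy[OF h1 h2]])
  also have "\<dots> = - (\<i> * of_real (k / 2) * karp_h c 0 \<theta> * (cis (- \<theta>) - cis \<theta>))" by (simp add: field_simps)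
  finally have ey2: "karp_q (grad_y k c) 0 \<theta> = \<dots>" .
  show "karp_q (grad_y k c) 0 \<theta> = - of_real (k * sin \<theta>) * karp_h c 0 \<theta>"
    unfolding ey2 cc by (simp add: complex_eq_iff)
qed

section \<open>Radiating solutions as Hankel series\<close>

lemma partial_polar:
  "partial 1 f (polar r \<theta>) = cos \<theta> *\<^sub>R Dr f r \<theta> - sin \<theta> *\<^sub>R Dt f r \<theta>"
  "partial 2 f (polar r \<theta>) = sin \<theta> *\<^sub>R Dr f r \<theta> + cos \<theta> *\<^sub>R Dt f r \<theta>"
proof -
  have "cos \<theta> *\<^sub>R Dr f r \<theta> - sin \<theta> *\<^sub>R Dt f r \<theta> = (cos \<theta> * cos \<theta> + sin \<theta> * sin \<theta>) *\<^sub>R partial 1 f (polar r \<theta>)"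
    unfolding Dr_def Dt_def by (simp add: algebra_simps del: sin_cos_squared_add3)
  thus "partial 1 f (polar r \<theta>) = cos \<theta> *\<^sub>R Dr f r \<theta> - sin \<theta> *\<^sub>R Dt f r \<theta>" by (simp only: sin_cos_squared_add3 scaleR_one)
  have "sin \<theta> *\<^sub>R Dr f r \<theta> + cos \<theta> *\<^sub>R Dt f r \<theta> = (cos \<theta> * cos \<theta> + sin \<theta> * sin \<theta>) *\<^sub>R partial 2 f (polar r \<theta>)"
    unfolding Dr_def Dt_def by (simp add: algebra_simps del: sin_cos_squared_add3)
  thus "partial 2 f (polar r \<theta>) = sin \<theta> *\<^sub>R Dr f r \<theta> + cos \<theta> *\<^sub>R Dt f r \<theta>" by (simp only: sin_cos_squared_add3 scaleR_one)
qed

text \<open>The condition of Sommerfeld mode by mode. It is the common consequence of the conditions of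
  Sommerfeld and Kupradze.\<close>

definition mode_radiating :: "real \<Rightarrow> (real^2 \<Rightarrow> complex) \<Rightarrow> bool" where
  "mode_radiating k \<phi> \<longleftrightarrow> (\<forall>n. ((\<lambda>r. of_real (sqrt r) *
     (fc (Dr \<phi> r) n - \<i> * k * fc (\<lambda>\<theta>. \<phi> (polar r \<theta>)) n)) \<longlongrightarrow> 0) at_top)"

definition has_modes :: "real \<Rightarrow> real \<Rightarrow> (real^2 \<Rightarrow> complex) \<Rightarrow> (int \<Rightarrow> complex) \<Rightarrow> bool" where
  "has_modes a k \<phi> c \<longleftrightarrow> (\<forall>n. \<forall>r>a. fc (\<lambda>\<theta>. \<phi> (polar r \<theta>)) n = c n * hankel1 (nat \<bar>n\<bar>) (k * r) \<and>
     fc (Dr \<phi> r) n = of_real k * c n * hankel1' (nat \<bar>n\<bar>) (k * r))"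

lemma fc_bounded:
  assumes "continuous_on {0..2*pi} f" shows "\<exists>M. \<forall>n. cmod (fc f n) \<le> M"
proof -
  have "bounded (f ` {0..2*pi})" by (intro compact_imp_bounded compact_continuous_image assms compact_Icc)
  then obtain B where "\<forall>x\<in>f ` {0..2*pi}. cmod x \<le> B" unfolding bounded_iff by blast
  hence "cmod (fc f n) \<le> B" for n by (intro fc_bound[OF assms]) auto
  thus ?thesis by blast
qed

text \<open>The bounds for the modes come from the continuity of the potential and its gradient on a circle.\<close>

lemma has_modes_exists:
  assumes a: "a > 0" and k: "k > 0" and C: "C_on 2 (exterior a) \<phi>"
    and H: "\<And>x. x \<in> exterior a \<Longrightarrow> laplacian \<phi> x + of_real (k\<^sup>2) * \<phi> x = 0"
    and rad: "mode_radiating k \<phi>"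
  obtains c where "admissible (k * a) c" "has_modes a k \<phi> c"
proof -
  have a0: "a \<ge> 0" using a by simp
  have ex: "\<forall>n. \<exists>c. \<forall>r>a. fc (\<lambda>\<theta>. \<phi> (polar r \<theta>)) n = c * hankel1 (nat \<bar>n\<bar>) (k * r) \<and>
     fc (Dr \<phi> r) n = of_real k * c * hankel1' (nat \<bar>n\<bar>) (k * r)"
  proof
    fix n
    have e: "(real (nat \<bar>n\<bar>) / r)\<^sup>2 = (of_int n / r)\<^sup>2" for r by (simp add: power_divide)
    show "\<exists>c. \<forall>r>a. fc (\<lambda>\<theta>. \<phi> (polar r \<theta>)) n = c * hankel1 (nat \<bar>n\<bar>) (k * r) \<and>
     fc (Dr \<phi> r) n = of_real k * c * hankel1' (nat \<bar>n\<bar>) (k * r)"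
    proof (rule radiating_mode[OF a0 k])
      show "((\<lambda>r. of_real (sqrt r) * (fc (Dr \<phi> r) n - \<i> * k * fc (\<lambda>\<theta>. \<phi> (polar r \<theta>)) n)) \<longlongrightarrow> 0) at_top"
        using rad unfolding mode_radiating_def by (rule spec)
    next
      fix r assume r: "r > a"
      show "((\<lambda>r. fc (\<lambda>\<theta>. \<phi> (polar r \<theta>)) n) has_vector_derivative fc (Dr \<phi> r) n) (at r)"
        by (rule mode_deriv[OF a0 C r])
      show "((\<lambda>r. fc (Dr \<phi> r) n) has_vector_derivative - fc (Dr \<phi> r) n / r -
         (of_real (k\<^sup>2) - of_real ((real (nat \<bar>n\<bar>) / r)\<^sup>2)) * fc (\<lambda>\<theta>. \<phi> (polar r \<theta>)) n) (at r)"
        unfolding e by (rule mode_deriv2[OF a0 C r H])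
    qed
  qed
  from choice[OF ex] obtain c where c: "has_modes a k \<phi> c" unfolding has_modes_def by blast
  have "admissible (k * a) c"
  proof (rule admissible_from_bounds[OF k a0])
    fix r assume r: "r > a"
    obtain M1 where M1: "\<forall>n. cmod (fc (\<lambda>\<theta>. \<phi> (polar r \<theta>)) n) \<le> M1"
      using fc_bounded[OF continuous_polar[OF a0 C r]] by blast
    obtain M2 where M2: "\<forall>n. cmod (fc (Dr \<phi> r) n) \<le> M2"
      using fc_bounded[OF continuous_Dr[OF a0 C r]] by blast
    show "\<exists>M. \<forall>n. cmod (c n * hankel1 (nat \<bar>n\<bar>) (k * r)) \<le> M \<and> cmod (c n * hankel1' (nat \<bar>n\<bar>) (k * r)) \<le> M"
    proof (intro exI[of _ "max M1 (M2 / k)"] allI conjI)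
      fix n
      show "cmod (c n * hankel1 (nat \<bar>n\<bar>) (k * r)) \<le> max M1 (M2 / k)"
        using M1[rule_format, of n] c r unfolding has_modes_def by auto
      have "fc (Dr \<phi> r) n = of_real k * (c n * hankel1' (nat \<bar>n\<bar>) (k * r))"
        using c r unfolding has_modes_def by (simp add: mult.assoc)
      hence "k * cmod (c n * hankel1' (nat \<bar>n\<bar>) (k * r)) \<le> M2"
        using M2[rule_format, of n] k by (simp add: norm_mult)
      hence "cmod (c n * hankel1' (nat \<bar>n\<bar>) (k * r)) \<le> M2 / k" using k by (simp add: field_simps)
      thus "cmod (c n * hankel1' (nat \<bar>n\<bar>) (k * r)) \<le> max M1 (M2 / k)" by simp
    qed
  qed
  thus ?thesis using c by (rule that)
qed

lemma mode_sum_representation: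
  assumes a: "a > 0" and k: "k > 0" and c: "admissible (k * a) c" and r: "r > a"
    and f: "continuous_on (exterior a) f"
    and e: "\<And>n. fc (\<lambda>\<theta>. f (polar r \<theta>)) n = c n * hankel1 (nat \<bar>n\<bar>) (k * r)"
  shows "f (polar r \<theta>) = mode_sum c (k * r) \<theta>"
  unfolding mode_sum_def
proof (rule fourier_representation[where F = "\<lambda>x. f (r *\<^sub>R x)"])
  show "continuous_on (sphere 0 1) (\<lambda>x. f (r *\<^sub>R x))" by (rule sphere_continuous[OF _ f r]) (use a in simp)
  have "k * a > 0" "k * r > k * a" using a k r by auto
  from has_sum_imp_summable[OF karp_expansion[OF c this, of 0]]
  have "(\<lambda>n. c n * hankel1 (nat \<bar>n\<bar>) (k * r)) summable_on UNIV" by simp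
  thus "(\<lambda>n. cmod (c n * hankel1 (nat \<bar>n\<bar>) (k * r))) summable_on UNIV"
    unfolding summable_on_iff_abs_summable_on_complex .
qed (rule e)

text \<open>The mode \<open>n - 1\<close> is raised and the mode \<open>n + 1\<close> is lowered; the terms with \<open>(n \<plusminus> 1) / x\<close> from the
  radial and the angular derivative cancel.\<close>

lemma fc_partial:
  assumes a: "a > 0" and k: "k > 0" and C: "C_on 2 (exterior a) \<phi>" and m: "has_modes a k \<phi> c" and r: "r > a"
  shows "fc (\<lambda>\<theta>. partial 1 \<phi> (polar r \<theta>)) n = grad_x k c n * hankel1 (nat \<bar>n\<bar>) (k * r)"
    "fc (\<lambda>\<theta>. partial 2 \<phi> (polar r \<theta>)) n = grad_y k c n * hankel1 (nat \<bar>n\<bar>) (k * r)"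
proof -
  define x where "x = k * r"
  define b where "b n = sg n * c n" for n
  have a0: "a \<ge> 0" using a by simp
  have x: "x > 0" using a k r by (simp add: x_def)
  have s: "sg n * p * (sg n * q) = p * q" for n p q by (simp add: sg_def)
  have R: "fc (Dr \<phi> r) n = of_real k * (b n * HZ' n x)" for n
    using m r unfolding has_modes_def b_def HZ'_def s x_def by (simp add: mult.assoc)
  have T: "fc (Dt \<phi> r) n = of_real k * (\<i> * (of_real (of_int n / x) * (b n * HZ n x)))" for n
  proof -
    have "of_real r * fc (Dt \<phi> r) n = \<i> * of_int n * (b n * HZ n x)"
      using fc_Dt[OF a0 C r, of n] m r unfolding has_modes_def b_def HZ_def s x_def by simp
    thus ?thesis using a r k unfolding x_def by (simp add: field_simps)
  qed
  note cr = continuous_Dr[OF a0 C r] and ct = continuous_Dt[OF a0 C r]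
  have cc: "continuous_on {0..2*pi} (\<lambda>\<theta>. of_real (cos \<theta>) * f \<theta>)" "continuous_on {0..2*pi} (\<lambda>\<theta>. of_real (sin \<theta>) * f \<theta>)"
    if "continuous_on {0..2*pi} f" for f :: "real \<Rightarrow> complex"
    using that by (auto intro!: continuous_intros)
  have up: "HZ' (n - 1) x = of_real (of_int (n - 1) / x) * HZ (n - 1) x - HZ n x"
    using HZ'_up[OF x, of "n - 1"] by simp
  have dn: "HZ' (n + 1) x = HZ n x - of_real (of_int (n + 1) / x) * HZ (n + 1) x"
    using HZ'_down[OF x, of "n + 1"] by simp
  have g: "\<i> * of_real (k / 2) * sg n * z * hankel1 (nat \<bar>n\<bar>) (k * r) = \<i> * of_real (k / 2) * z * HZ n x"
    "of_real (k / 2) * sg n * z * hankel1 (nat \<bar>n\<bar>) (k * r) = of_real (k / 2) * z * HZ n x" for z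
    by (simp_all add: HZ_def x_def)
  have "fc (\<lambda>\<theta>. partial 1 \<phi> (polar r \<theta>)) n = fc (\<lambda>\<theta>. of_real (cos \<theta>) * Dr \<phi> r \<theta> - of_real (sin \<theta>) * Dt \<phi> r \<theta>) n"
    unfolding partial_polar by (rule fc_cong) (simp only: scaleR_conv_of_real)
  also have "\<dots> = (fc (Dr \<phi> r) (n - 1) + fc (Dr \<phi> r) (n + 1)) / 2 - (fc (Dt \<phi> r) (n - 1) - fc (Dt \<phi> r) (n + 1)) / (2 * \<i>)"
    using fc_diff[OF cc(1)[OF cr] cc(2)[OF ct]] fc_cos[OF cr] fc_sin[OF ct] by simp
  finally have 1: "fc (\<lambda>\<theta>. partial 1 \<phi> (polar r \<theta>)) n = \<dots>" .
  have al1: "(K * (b1 * (p * h1 - h)) + K * (b2 * (h - q * h2))) / 2 - (K * (\<i> * (p * (b1 * h1))) - K * (\<i> * (q * (b2 * h2)))) / (2 * \<i>)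
     = K / 2 * (b2 - b1) * h" for K b1 b2 p q h1 h2 h :: complex
  proof -
    have "(K * (\<i> * (p * (b1 * h1))) - K * (\<i> * (q * (b2 * h2)))) / (2 * \<i>) = (K * (p * (b1 * h1)) - K * (q * (b2 * h2))) / 2"
      by (simp add: field_simps)
    thus ?thesis by (simp add: field_simps)
  qed
  show "fc (\<lambda>\<theta>. partial 1 \<phi> (polar r \<theta>)) n = grad_x k c n * hankel1 (nat \<bar>n\<bar>) (k * r)"
    unfolding 1 R T up dn al1 grad_x_def g by (simp add: b_def)
  have "fc (\<lambda>\<theta>. partial 2 \<phi> (polar r \<theta>)) n = fc (\<lambda>\<theta>. of_real (sin \<theta>) * Dr \<phi> r \<theta> + of_real (cos \<theta>) * Dt \<phi> r \<theta>) n"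
    unfolding partial_polar by (rule fc_cong) (simp only: scaleR_conv_of_real)
  also have "\<dots> = (fc (Dr \<phi> r) (n - 1) - fc (Dr \<phi> r) (n + 1)) / (2 * \<i>) + (fc (Dt \<phi> r) (n - 1) + fc (Dt \<phi> r) (n + 1)) / 2"
    using fc_add[OF cc(2)[OF cr] cc(1)[OF ct]] fc_cos[OF ct] fc_sin[OF cr] by simp
  finally have 2: "fc (\<lambda>\<theta>. partial 2 \<phi> (polar r \<theta>)) n = \<dots>" .
  have al2: "(K * (b1 * (p * h1 - h)) - K * (b2 * (h - q * h2))) / (2 * \<i>) + (K * (\<i> * (p * (b1 * h1))) + K * (\<i> * (q * (b2 * h2)))) / 2
     = \<i> * (K / 2) * (b2 + b1) * h" for K b1 b2 p q h1 h2 h :: complex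
  proof -
    have "z / (2 * \<i>) = - (\<i> * z) / 2" for z by (simp add: field_simps)
    thus ?thesis by (simp add: field_simps)
  qed
  show "fc (\<lambda>\<theta>. partial 2 \<phi> (polar r \<theta>)) n = grad_y k c n * hankel1 (nat \<bar>n\<bar>) (k * r)"
    unfolding 2 R T up dn al2 grad_y_def g by (simp add: b_def)
qed

lemma potential_mode_sums:
  assumes a: "a > 0" and k: "k > 0" and C: "C_on 2 (exterior a) \<phi>"
    and c: "admissible (k * a) c" and m: "has_modes a k \<phi> c" and r: "r > a"
  shows "\<phi> (polar r \<theta>) = mode_sum c (k * r) \<theta>"
    "partial 1 \<phi> (polar r \<theta>) = mode_sum (grad_x k c) (k * r) \<theta>"
    "partial 2 \<phi> (polar r \<theta>) = mode_sum (grad_y k c) (k * r) \<theta>"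
proof -
  have a0: "a \<ge> 0" and ka: "k * a > 0" using a k by auto
  note cont = C2_facts(3,4)[OF a0 C]
  show "\<phi> (polar r \<theta>) = mode_sum c (k * r) \<theta>"
    by (rule mode_sum_representation[OF a k c r cont(1)]) (use m r in \<open>simp add: has_modes_def\<close>)
  show "partial 1 \<phi> (polar r \<theta>) = mode_sum (grad_x k c) (k * r) \<theta>"
    by (rule mode_sum_representation[OF a k admissible_grad(1)[OF c ka] r cont(2)]) (rule fc_partial(1)[OF a k C m r])
  show "partial 2 \<phi> (polar r \<theta>) = mode_sum (grad_y k c) (k * r) \<theta>"
    by (rule mode_sum_representation[OF a k admissible_grad(2)[OF c ka] r cont(2)]) (rule fc_partial(2)[OF a k C m r])
qed

lemma fc_tendsto_at_top:
  fixes g :: "real^2 \<Rightarrow> 'b::real_normed_vector"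
  assumes g: "(g \<longlongrightarrow> 0) at_infinity" and a: "a \<ge> 0"
    and c: "\<And>r. r > a \<Longrightarrow> continuous_on {0..2*pi} (G r)"
    and b: "\<And>r \<theta>. r > a \<Longrightarrow> cmod (G r \<theta>) \<le> norm (g (polar r \<theta>))"
  shows "((\<lambda>r. fc (G r) n) \<longlongrightarrow> 0) at_top"
proof (rule tendstoI)
  fix e :: real assume e: "e > 0"
  have "\<forall>\<^sub>F x in at_infinity. dist (g x) 0 < e / 2" by (rule tendstoD[OF g]) (use e in simp)
  then obtain R where R: "\<And>x. norm x \<ge> R \<Longrightarrow> norm (g x) < e / 2" unfolding eventually_at_infinity by auto
  have "dist (fc (G r) n) 0 < e" if r: "r \<ge> max R (a + 1)" for r
  proof -
    have ra: "r > a" using r by simp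
    have "cmod (fc (G r) n) \<le> e / 2"
    proof (rule fc_bound[OF c[OF ra]])
      fix \<theta>
      have "norm (polar r \<theta>) \<ge> R" using r ra a by simp
      from R[OF this] b[OF ra, of \<theta>] show "cmod (G r \<theta>) \<le> e / 2" by linarith
    qed
    thus ?thesis using e by simp
  qed
  thus "\<forall>\<^sub>F r in at_top. dist (fc (G r) n) 0 < e" unfolding eventually_at_top_linorder by blast
qed

lemma sommerfeld_mode_radiating:
  assumes a: "a > 0" and C: "C_on 2 (exterior a) \<phi>" and s: "sommerfeld k \<phi>"
  shows "mode_radiating k \<phi>"
  unfolding mode_radiating_def
proof
  fix n
  have a0: "a \<ge> 0" using a by simp
  define G where "G r \<theta> = of_real (sqrt r) * (Dr \<phi> r \<theta> - \<i> * k * \<phi> (polar r \<theta>))" for r \<theta>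
  have cG: "continuous_on {0..2*pi} (G r)" if "r > a" for r
    unfolding G_def by (intro continuous_intros continuous_Dr[OF a0 C that] continuous_polar[OF a0 C that])
  have "((\<lambda>r. fc (G r) n) \<longlongrightarrow> 0) at_top"
  proof (rule fc_tendsto_at_top[OF s[unfolded sommerfeld_def] a0 cG])
    fix r \<theta> :: real assume r: "r > a"
    have e: "radial_deriv \<phi> (polar r \<theta>) = Dr \<phi> r \<theta>"
      using radial_deriv_polar[OF a0 r, of \<phi> \<theta>] dir_deriv_Dr[OF a0 C2_facts(1)[OF a0 C] r, of \<theta>] by simp
    have n: "norm (polar r \<theta>) = r" using r a by simp
    show "cmod (G r \<theta>) \<le> norm (sqrt (norm (polar r \<theta>)) *\<^sub>R (radial_deriv \<phi> (polar r \<theta>) - \<i> * k * \<phi> (polar r \<theta>)))"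
      unfolding e n G_def by (simp add: scaleR_conv_of_real)
  qed
  moreover have "fc (G r) n = of_real (sqrt r) * (fc (Dr \<phi> r) n - \<i> * k * fc (\<lambda>\<theta>. \<phi> (polar r \<theta>)) n)" if r: "r > a" for r
  proof -
    have c: "continuous_on {0..2*pi} (\<lambda>\<theta>. \<i> * k * \<phi> (polar r \<theta>))"
      by (intro continuous_intros continuous_polar[OF a0 C r])
    show ?thesis unfolding G_def fc_cmult fc_diff[OF continuous_Dr[OF a0 C r] c] ..
  qed
  hence "\<forall>\<^sub>F r in at_top. fc (G r) n = of_real (sqrt r) * (fc (Dr \<phi> r) n - \<i> * k * fc (\<lambda>\<theta>. \<phi> (polar r \<theta>)) n)"
    using eventually_gt_at_top[of a] by (rule eventually_mono[rotated])
  ultimately show "((\<lambda>r. of_real (sqrt r) * (fc (Dr \<phi> r) n - \<i> * k * fc (\<lambda>\<theta>. \<phi> (polar r \<theta>)) n)) \<longlongrightarrow> 0) at_top"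
    by (rule Lim_transform_eventually)
qed


section \<open>Boundary traces and the mode equations\<close>

lemma lebesgue_on_circle:
  "{0..2*pi} \<in> sets lebesgue" "finite_measure (lebesgue_on {0..2*pi})"
  by (auto intro!: finite_measure_lebesgue_on)

lemma continuous_circle_integrable:
  fixes f :: "real \<Rightarrow> 'b::euclidean_space"
  assumes "continuous_on {0..2*pi} f"
  shows "f \<in> borel_measurable (lebesgue_on {0..2*pi})" "integrable (lebesgue_on {0..2*pi}) f"
  using continuous_imp_measurable_on_sets_lebesgue[OF assms lebesgue_on_circle(1)]
    continuous_imp_integrable_real[OF assms] by auto

lemma fc_eq_fourier_coeff:
  assumes "continuous_on {0..2*pi} f" shows "fc f n = fourier_coeff f n"
proof -
  have "integrable (lebesgue_on {0..2*pi}) (\<lambda>\<theta>. f \<theta> * cis (- of_int n * \<theta>))"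
    by (rule continuous_circle_integrable) (intro continuous_intros assms)
  from lebesgue_integral_eq_integral[OF this lebesgue_on_circle(1)]
  show ?thesis unfolding fc_def fourier_coeff_def by simp
qed

lemma sq_integrable_diff:
  fixes f g :: "real \<Rightarrow> complex"
  assumes "f \<in> borel_measurable M" "g \<in> borel_measurable M"
    "integrable M (\<lambda>x. (cmod (f x))\<^sup>2)" "integrable M (\<lambda>x. (cmod (g x))\<^sup>2)"
  shows "integrable M (\<lambda>x. (cmod (f x - g x))\<^sup>2)"
proof (rule Bochner_Integration.integrable_bound)
  show "integrable M (\<lambda>x. 2 * (cmod (f x))\<^sup>2 + 2 * (cmod (g x))\<^sup>2)" using assms by simp
  show "(\<lambda>x. (cmod (f x - g x))\<^sup>2) \<in> borel_measurable M" using assms by measurable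
  have "(cmod (u - v))\<^sup>2 \<le> 2 * (cmod u)\<^sup>2 + 2 * (cmod v)\<^sup>2" for u v
  proof -
    have "(cmod (u - v))\<^sup>2 \<le> (cmod u + cmod v)\<^sup>2" by (intro power_mono norm_triangle_ineq4) simp
    also have "\<dots> \<le> (cmod u + cmod v)\<^sup>2 + (cmod u - cmod v)\<^sup>2" by simp
    also have "\<dots> = 2 * (cmod u)\<^sup>2 + 2 * (cmod v)\<^sup>2" by (simp add: power2_eq_square algebra_simps)
    finally show ?thesis .
  qed
  thus "AE x in M. norm ((cmod (f x - g x))\<^sup>2) \<le> norm (2 * (cmod (f x))\<^sup>2 + 2 * (cmod (g x))\<^sup>2)"
    by (intro AE_I2) simp
qed

text \<open>Convergence in \<open>L\<^sup>2\<close> implies convergence of integrals: \<open>|z| \<le> \<delta> + |z|\<^sup>2/\<delta>\<close> for every \<open>\<delta> > 0\<close>.\<close>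

lemma fourier_coeff_trace:
  fixes w :: "real \<Rightarrow> real \<Rightarrow> complex"
  assumes t: "has_trace a w g" and c: "\<And>r. r > a \<Longrightarrow> continuous_on {0..2*pi} (w r)"
    and g: "g \<in> borel_measurable (lebesgue_on {0..2*pi})"
    and g2: "integrable (lebesgue_on {0..2*pi}) (\<lambda>\<theta>. (cmod (g \<theta>))\<^sup>2)"
  shows "((\<lambda>r. fc (w r) n) \<longlongrightarrow> fourier_coeff g n) (at_right a)"
proof (rule tendstoI)
  fix e :: real assume e: "e > 0"
  let ?L = "lebesgue_on {0..2*pi}"
  interpret L: finite_measure ?L by (rule lebesgue_on_circle)
  define \<delta> where "\<delta> = e / 2"
  have \<delta>: "\<delta> > 0" using e by (simp add: \<delta>_def)
  have young: "cmod z \<le> \<delta> + (cmod z)\<^sup>2 / \<delta>" for z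
  proof (cases "cmod z \<le> \<delta>")
    case True thus ?thesis using \<delta> by (simp add: add_increasing2)
  next
    case False
    hence "cmod z * \<delta> \<le> cmod z * cmod z" by (intro mult_left_mono) auto
    hence "cmod z \<le> (cmod z)\<^sup>2 / \<delta>" using \<delta> by (simp add: field_simps power2_eq_square)
    thus ?thesis using \<delta> by simp
  qed
  have mc: "(\<lambda>\<theta>. cis (- of_int n * \<theta>)) \<in> borel_measurable ?L"
    by (rule continuous_circle_integrable) (intro continuous_intros)
  have gi: "integrable ?L (\<lambda>\<theta>. g \<theta> * cis (- of_int n * \<theta>))"
  proof (rule Bochner_Integration.integrable_bound)
    show "integrable ?L (\<lambda>\<theta>. \<delta> + (cmod (g \<theta>))\<^sup>2 / \<delta>)" using g2 by simp
    show "(\<lambda>\<theta>. g \<theta> * cis (- of_int n * \<theta>)) \<in> borel_measurable ?L" using g mc by measurable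
    show "AE \<theta> in ?L. cmod (g \<theta> * cis (- of_int n * \<theta>)) \<le> norm (\<delta> + (cmod (g \<theta>))\<^sup>2 / \<delta>)"
      using young by (intro AE_I2) (auto simp: norm_mult intro: order_trans[OF _ abs_ge_self])
  qed
  have ev: "\<forall>\<^sub>F r in at_right a. dist (\<integral>\<theta>. (norm (w r \<theta> - g \<theta>))\<^sup>2 \<partial>?L) 0 < \<delta> * \<delta>"
    by (rule tendstoD[OF t[unfolded has_trace_def]]) (use \<delta> in simp)
  show "\<forall>\<^sub>F r in at_right a. dist (fc (w r) n) (fourier_coeff g n) < e"
    using ev eventually_at_right_less[of a]
  proof eventually_elim
    case (elim r)
    note cr = c[OF elim(2)]
    define D where "D = (\<integral>\<theta>. (norm (w r \<theta> - g \<theta>))\<^sup>2 \<partial>?L)"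
    have D: "D < \<delta> * \<delta>" using elim(1) unfolding D_def by (simp add: dist_real_def)
    have wi: "integrable ?L (\<lambda>\<theta>. w r \<theta> * cis (- of_int n * \<theta>))"
      by (rule continuous_circle_integrable) (intro continuous_intros cr)
    have w2: "integrable ?L (\<lambda>\<theta>. (cmod (w r \<theta>))\<^sup>2)"
      by (rule continuous_circle_integrable) (intro continuous_intros cr)
    have d2: "integrable ?L (\<lambda>\<theta>. (cmod (w r \<theta> - g \<theta>))\<^sup>2)"
      by (rule sq_integrable_diff[OF continuous_circle_integrable(1)[OF cr] g w2 g2])
    have "fc (w r) n - fourier_coeff g n = 1 / (2 * pi) * (\<integral>\<theta>. w r \<theta> * cis (- of_int n * \<theta>) - g \<theta> * cis (- of_int n * \<theta>) \<partial>?L)"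
      unfolding fc_eq_fourier_coeff[OF cr] fourier_coeff_def Bochner_Integration.integral_diff[OF wi gi]
      by (simp add: algebra_simps)
    hence "cmod (fc (w r) n - fourier_coeff g n) = 1 / (2 * pi) * cmod (\<integral>\<theta>. w r \<theta> * cis (- of_int n * \<theta>) - g \<theta> * cis (- of_int n * \<theta>) \<partial>?L)"
      by (simp add: norm_mult norm_divide)
    also have "\<dots> \<le> 1 / (2 * pi) * (\<integral>\<theta>. \<delta> + (cmod (w r \<theta> - g \<theta>))\<^sup>2 / \<delta> \<partial>?L)"
    proof (intro mult_left_mono Bochner_Integration.integral_norm_bound_integral)
      show "integrable ?L (\<lambda>\<theta>. w r \<theta> * cis (- of_int n * \<theta>) - g \<theta> * cis (- of_int n * \<theta>))" using wi gi by simp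
      show "integrable ?L (\<lambda>\<theta>. \<delta> + (cmod (w r \<theta> - g \<theta>))\<^sup>2 / \<delta>)" using d2 by simp
      show "cmod (w r \<theta> * cis (- of_int n * \<theta>) - g \<theta> * cis (- of_int n * \<theta>)) \<le> \<delta> + (cmod (w r \<theta> - g \<theta>))\<^sup>2 / \<delta>" for \<theta>
        using young[of "w r \<theta> - g \<theta>"] unfolding left_diff_distrib[symmetric] by (simp add: norm_mult)
    qed simp
    also have "(\<integral>\<theta>. \<delta> + (cmod (w r \<theta> - g \<theta>))\<^sup>2 / \<delta> \<partial>?L) = 2 * pi * \<delta> + D / \<delta>"
      using d2 by (simp add: D_def measure_restrict_space)
    also have "1 / (2 * pi) * (2 * pi * \<delta> + D / \<delta>) = \<delta> + D / \<delta> / (2 * pi)" by (simp add: field_simps)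
    also have "\<dots> < \<delta> + \<delta>"
    proof -
      have "D / \<delta> < \<delta>" using D \<delta> by (simp add: field_simps)
      moreover have "\<delta> / (2 * pi) \<le> \<delta> / 1" using \<delta> pi_ge_two by (intro divide_left_mono) auto
      moreover have "D / \<delta> / (2 * pi) < \<delta> / (2 * pi)" using calculation(1) by (intro divide_strict_right_mono) auto
      ultimately show ?thesis by simp
    qed
    finally show ?case by (simp add: dist_norm \<delta>_def)
  qed
qed

lemma hankel1_scaled_limits:
  assumes "k > 0" "a > 0"
  shows "((\<lambda>r. hankel1 m (k * r)) \<longlongrightarrow> hankel1 m (k * a)) (at_right a)"
    "((\<lambda>r. hankel1' m (k * r)) \<longlongrightarrow> hankel1' m (k * a)) (at_right a)"
proof -
  have ka: "k * a > 0" using assms by simp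
  have l: "((\<lambda>r. k * r) \<longlongrightarrow> k * a) (at_right a)" by (intro tendsto_intros)
  show "((\<lambda>r. hankel1 m (k * r)) \<longlongrightarrow> hankel1 m (k * a)) (at_right a)"
    by (rule isCont_tendsto_compose[OF has_vector_derivative_continuous[OF hankel1_deriv[OF ka]] l])
  show "((\<lambda>r. hankel1' m (k * r)) \<longlongrightarrow> hankel1' m (k * a)) (at_right a)"
    by (rule isCont_tendsto_compose[OF has_vector_derivative_continuous[OF hankel1_'_deriv[OF ka]] l])
qed

lemma mode_system_iff:
  assumes "a > 0" "kp > 0" "ks > 0"
  shows "mode_system a kp ks g n x y \<longleftrightarrow>
     of_real kp * hankel1' (nat \<bar>n\<bar>) (kp * a) * x + \<i> * of_int n / of_real a * hankel1 (nat \<bar>n\<bar>) (ks * a) * y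
           = fourier_coeff (\<lambda>\<theta>. rdot (e_r \<theta>) (g \<theta>)) n \<and>
     \<i> * of_int n / of_real a * hankel1 (nat \<bar>n\<bar>) (kp * a) * x - of_real ks * hankel1' (nat \<bar>n\<bar>) (ks * a) * y
           = fourier_coeff (\<lambda>\<theta>. rdot (e_\<theta> \<theta>) (g \<theta>)) n"
proof -
  have "kp * a > 0" "ks * a > 0" using assms by auto
  note d = this[THEN hankel1_deriv, THEN vector_derivative_at]
  show ?thesis unfolding mode_system_def Let_def d ..
qed

text \<open>For a solution \<open>X\<close>, \<open>Y\<close> of the homogeneous system, multiply the first equation by the conjugate of
  \<open>H(k\<^sub>p a) X\<close> and the second by that of \<open>H(k\<^sub>s a) Y\<close>. The imaginary parts of the coupling terms are
  equal, so what remains of the difference is the total flux \<open>2 / (\<pi> a) (|X|\<^sup>2 + |Y|\<^sup>2)\<close>.\<close>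

lemma mode_system_unique:
  assumes pos: "a > 0" "kp > 0" "ks > 0"
    and 1: "mode_system a kp ks g n x y" and 2: "mode_system a kp ks g n x' y'"
  shows "x = x' \<and> y = y'"
proof -
  define A A' B B' where "A = hankel1 (nat \<bar>n\<bar>) (kp * a)" and "A' = hankel1' (nat \<bar>n\<bar>) (kp * a)"
    and "B = hankel1 (nat \<bar>n\<bar>) (ks * a)" and "B' = hankel1' (nat \<bar>n\<bar>) (ks * a)"
  define X Y \<nu> where "X = x - x'" and "Y = y - y'" and "\<nu> = of_int n / a"
  have N: "\<i> * of_int n / of_real a = \<i> * of_real \<nu>" by (simp add: \<nu>_def)
  note eqs = 1[unfolded mode_system_iff[OF pos] N, folded A_def A'_def B_def B'_def]
    2[unfolded mode_system_iff[OF pos] N, folded A_def A'_def B_def B'_def]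
  have e1: "of_real kp * A' * X + \<i> * of_real \<nu> * B * Y = 0"
    using eqs unfolding X_def Y_def by (simp add: algebra_simps)
  have e2: "\<i> * of_real \<nu> * A * X - of_real ks * B' * Y = 0"
  proof -
    have "\<i> * of_real \<nu> * A * X - of_real ks * B' * Y
      = (\<i> * of_real \<nu> * A * x - of_real ks * B' * y) - (\<i> * of_real \<nu> * A * x' - of_real ks * B' * y')"
      unfolding X_def Y_def by (simp add: algebra_simps)
    thus ?thesis using eqs by simp
  qed
  have wA: "Im (cnj A * A') = 2 / (pi * (kp * a))" unfolding A_def A'_def by (rule Im_cnj_hankel1) (use pos in simp)
  have wB: "Im (cnj B * B') = 2 / (pi * (ks * a))" unfolding B_def B'_def by (rule Im_cnj_hankel1) (use pos in simp)
  \<comment> \<open>The coupling terms are \<open>i \<nu> Z\<close> and \<open>i \<nu> cnj Z\<close>; both have imaginary part \<open>\<nu> Re Z\<close>.\<close>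
  define Z where "Z = B * Y * cnj (A * X)"
  have "cnj (A * X) * (of_real kp * A' * X + \<i> * of_real \<nu> * B * Y)
     = of_real (kp * (cmod X)\<^sup>2) * (cnj A * A') + of_real \<nu> * (\<i> * Z)"
    unfolding Z_def of_real_mult complex_norm_square by (simp add: algebra_simps)
  hence "Im (of_real (kp * (cmod X)\<^sup>2) * (cnj A * A') + of_real \<nu> * (\<i> * Z)) = 0" unfolding e1 by simp
  hence i1: "kp * (cmod X)\<^sup>2 * (2 / (pi * (kp * a))) + \<nu> * Re Z = 0" unfolding plus_complex.sel Im_of_real_mult wA by simp
  have "cnj (B * Y) * (\<i> * of_real \<nu> * A * X - of_real ks * B' * Y)
     = of_real \<nu> * (\<i> * cnj Z) - of_real (ks * (cmod Y)\<^sup>2) * (cnj B * B')"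
    unfolding Z_def of_real_mult complex_norm_square by (simp add: algebra_simps)
  hence "Im (of_real \<nu> * (\<i> * cnj Z) - of_real (ks * (cmod Y)\<^sup>2) * (cnj B * B')) = 0" unfolding e2 by simp
  hence i2: "\<nu> * Re Z - ks * (cmod Y)\<^sup>2 * (2 / (pi * (ks * a))) = 0" unfolding minus_complex.sel Im_of_real_mult wB by simp
  have "2 / (pi * a) * ((cmod X)\<^sup>2 + (cmod Y)\<^sup>2) = 0"
  proof -
    have "2 / (pi * a) * ((cmod X)\<^sup>2 + (cmod Y)\<^sup>2) = kp * (cmod X)\<^sup>2 * (2 / (pi * (kp * a))) + ks * (cmod Y)\<^sup>2 * (2 / (pi * (ks * a)))"
      using pos by (simp add: field_simps)
    thus ?thesis using i1 i2 by linarith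
  qed
  moreover have "2 / (pi * a) \<noteq> 0" using pos by simp
  ultimately have "(cmod X)\<^sup>2 + (cmod Y)\<^sup>2 = 0" using mult_eq_0_iff by blast
  thus ?thesis unfolding sum_power2_eq_zero_iff by (simp add: X_def Y_def)
qed

text \<open>Only the traces of the combined boundary expressions enter. In each mode they converge by
  continuity of the Hankel functions at the boundary, although the individual potentials may have
  no trace there.\<close>

lemma coupled_modes:
  assumes pos: "a > 0" "kp > 0" "ks > 0"
    and Cp: "C_on 2 (exterior a) \<phi>p" and Cs: "C_on 2 (exterior a) \<phi>s"
    and Hp: "\<And>x. x \<in> exterior a \<Longrightarrow> laplacian \<phi>p x + of_real (kp\<^sup>2) * \<phi>p x = 0"
    and Hs: "\<And>x. x \<in> exterior a \<Longrightarrow> laplacian \<phi>s x + of_real (ks\<^sup>2) * \<phi>s x = 0"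
    and radp: "mode_radiating kp \<phi>p" and rads: "mode_radiating ks \<phi>s"
    and lim1: "\<And>n. ((\<lambda>r. fc (\<lambda>\<theta>. Dr \<phi>p r \<theta> + Dt \<phi>s r \<theta>) n) \<longlongrightarrow> fourier_coeff (\<lambda>\<theta>. rdot (e_r \<theta>) (g \<theta>)) n) (at_right a)"
    and lim2: "\<And>n. ((\<lambda>r. fc (\<lambda>\<theta>. Dt \<phi>p r \<theta> - Dr \<phi>s r \<theta>) n) \<longlongrightarrow> fourier_coeff (\<lambda>\<theta>. rdot (e_\<theta> \<theta>) (g \<theta>)) n) (at_right a)"
  obtains cp cs where "admissible (kp * a) cp" "has_modes a kp \<phi>p cp" "admissible (ks * a) cs" "has_modes a ks \<phi>s cs"
    "\<And>n x y. mode_system a kp ks g n x y \<longleftrightarrow> x = cp n \<and> y = cs n"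
proof -
  have a0: "a \<ge> 0" using pos by simp
  obtain cp where cp: "admissible (kp * a) cp" "has_modes a kp \<phi>p cp"
    using has_modes_exists[OF pos(1,2) Cp Hp radp] by blast
  obtain cs where cs: "admissible (ks * a) cs" "has_modes a ks \<phi>s cs"
    using has_modes_exists[OF pos(1,3) Cs Hs rads] by blast
  have T: "fc (Dt \<phi> r) n = \<i> * of_int n / of_real r * (c n * hankel1 (nat \<bar>n\<bar>) (k * r))"
    if "r > a" "C_on 2 (exterior a) \<phi>" "has_modes a k \<phi> c" for \<phi> r n k c
    using fc_Dt[OF a0 that(2,1), of n] that(1,3) pos unfolding has_modes_def by (simp add: field_simps)
  have sys: "mode_system a kp ks g n (cp n) (cs n)" for n
    unfolding mode_system_iff[OF pos]
  proof
    let ?m = "nat \<bar>n\<bar>"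
    have r: "((\<lambda>r::real. \<i> * of_int n / of_real r) \<longlongrightarrow> \<i> * of_int n / of_real a) (at_right a)"
      using pos by (intro tendsto_intros) auto
    have "((\<lambda>r. of_real kp * cp n * hankel1' ?m (kp * r) + \<i> * of_int n / of_real r * (cs n * hankel1 ?m (ks * r)))
       \<longlongrightarrow> of_real kp * cp n * hankel1' ?m (kp * a) + \<i> * of_int n / of_real a * (cs n * hankel1 ?m (ks * a))) (at_right a)"
      by (intro tendsto_intros r hankel1_scaled_limits pos)
    moreover have "\<forall>\<^sub>F r in at_right a. of_real kp * cp n * hankel1' ?m (kp * r) + \<i> * of_int n / of_real r * (cs n * hankel1 ?m (ks * r))
        = fc (\<lambda>\<theta>. Dr \<phi>p r \<theta> + Dt \<phi>s r \<theta>) n"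
      using eventually_at_right_less[of a]
    proof eventually_elim
      case (elim r)
      show ?case using cp(2) elim unfolding fc_add[OF continuous_Dr[OF a0 Cp elim] continuous_Dt[OF a0 Cs elim]] T[OF elim Cs cs(2)] has_modes_def by simp
    qed
    ultimately have "((\<lambda>r. fc (\<lambda>\<theta>. Dr \<phi>p r \<theta> + Dt \<phi>s r \<theta>) n) \<longlongrightarrow> of_real kp * cp n * hankel1' ?m (kp * a) + \<i> * of_int n / of_real a * (cs n * hankel1 ?m (ks * a))) (at_right a)"
      by (rule Lim_transform_eventually)
    from tendsto_unique[OF trivial_limit_at_right_real this lim1]
    show "of_real kp * hankel1' ?m (kp * a) * cp n + \<i> * of_int n / of_real a * hankel1 ?m (ks * a) * cs n
           = fourier_coeff (\<lambda>\<theta>. rdot (e_r \<theta>) (g \<theta>)) n" by (simp only: mult_ac)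
    have "((\<lambda>r. \<i> * of_int n / of_real r * (cp n * hankel1 ?m (kp * r)) - of_real ks * cs n * hankel1' ?m (ks * r))
       \<longlongrightarrow> \<i> * of_int n / of_real a * (cp n * hankel1 ?m (kp * a)) - of_real ks * cs n * hankel1' ?m (ks * a)) (at_right a)"
      by (intro tendsto_intros r hankel1_scaled_limits pos)
    moreover have "\<forall>\<^sub>F r in at_right a. \<i> * of_int n / of_real r * (cp n * hankel1 ?m (kp * r)) - of_real ks * cs n * hankel1' ?m (ks * r)
        = fc (\<lambda>\<theta>. Dt \<phi>p r \<theta> - Dr \<phi>s r \<theta>) n"
      using eventually_at_right_less[of a]
    proof eventually_elim
      case (elim r)
      show ?case using cs(2) elim unfolding fc_diff[OF continuous_Dt[OF a0 Cp elim] continuous_Dr[OF a0 Cs elim]] T[OF elim Cp cp(2)] has_modes_def by simp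
    qed
    ultimately have "((\<lambda>r. fc (\<lambda>\<theta>. Dt \<phi>p r \<theta> - Dr \<phi>s r \<theta>) n) \<longlongrightarrow> \<i> * of_int n / of_real a * (cp n * hankel1 ?m (kp * a)) - of_real ks * cs n * hankel1' ?m (ks * a)) (at_right a)"
      by (rule Lim_transform_eventually)
    from tendsto_unique[OF trivial_limit_at_right_real this lim2]
    show "\<i> * of_int n / of_real a * hankel1 ?m (kp * a) * cp n - of_real ks * hankel1' ?m (ks * a) * cs n
           = fourier_coeff (\<lambda>\<theta>. rdot (e_\<theta> \<theta>) (g \<theta>)) n" by (simp only: mult_ac)
  qed
  show ?thesis
  proof (rule that[OF cp cs])
    show "mode_system a kp ks g n x y \<longleftrightarrow> x = cp n \<and> y = cs n" for n x y
      using mode_system_unique[OF pos _ sys] sys by blast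
  qed
qed

lemma coupled_modes_from_traces:
  assumes pos: "a > 0" "kp > 0" "ks > 0" and g: "\<forall>j. H_half (\<lambda>\<theta>. g \<theta> $ j)"
    and Cp: "C_on 2 (exterior a) \<phi>p" and Cs: "C_on 2 (exterior a) \<phi>s"
    and Hp: "\<And>x. x \<in> exterior a \<Longrightarrow> laplacian \<phi>p x + of_real (kp\<^sup>2) * \<phi>p x = 0"
    and Hs: "\<And>x. x \<in> exterior a \<Longrightarrow> laplacian \<phi>s x + of_real (ks\<^sup>2) * \<phi>s x = 0"
    and radp: "mode_radiating kp \<phi>p" and rads: "mode_radiating ks \<phi>s"
    and t1: "has_trace a (\<lambda>r \<theta>. Dr \<phi>p r \<theta> + Dt \<phi>s r \<theta>) (\<lambda>\<theta>. rdot (e_r \<theta>) (g \<theta>))"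
    and t2: "has_trace a (\<lambda>r \<theta>. Dt \<phi>p r \<theta> - Dr \<phi>s r \<theta>) (\<lambda>\<theta>. rdot (e_\<theta> \<theta>) (g \<theta>))"
  obtains cp cs where "admissible (kp * a) cp" "has_modes a kp \<phi>p cp" "admissible (ks * a) cs" "has_modes a ks \<phi>s cs"
    "\<And>n x y. mode_system a kp ks g n x y \<longleftrightarrow> x = cp n \<and> y = cs n"
proof -
  have a0: "a \<ge> 0" using pos by simp
  have gm: "(\<lambda>\<theta>. g \<theta> $ j) \<in> borel_measurable (lebesgue_on {0..2*pi})"
    "integrable (lebesgue_on {0..2*pi}) (\<lambda>\<theta>. (cmod (g \<theta> $ j))\<^sup>2)" for j
    using g unfolding H_half_def by auto
  have L2: "(\<lambda>\<theta>. of_real (p \<theta>) * g \<theta> $ 1 + of_real (q \<theta>) * g \<theta> $ 2) \<in> borel_measurable (lebesgue_on {0..2*pi})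
     \<and> integrable (lebesgue_on {0..2*pi}) (\<lambda>\<theta>. (cmod (of_real (p \<theta>) * g \<theta> $ 1 + of_real (q \<theta>) * g \<theta> $ 2))\<^sup>2)"
    if c: "continuous_on {0..2*pi} p" "continuous_on {0..2*pi} q" and b: "\<And>\<theta>. \<bar>p \<theta>\<bar> \<le> 1" "\<And>\<theta>. \<bar>q \<theta>\<bar> \<le> 1"
    for p q :: "real \<Rightarrow> real"
  proof -
    have L: "(\<lambda>\<theta>. of_real (f \<theta>) * g \<theta> $ j) \<in> borel_measurable (lebesgue_on {0..2*pi})
     \<and> integrable (lebesgue_on {0..2*pi}) (\<lambda>\<theta>. (cmod (of_real (f \<theta>) * g \<theta> $ j))\<^sup>2)"
      if f: "continuous_on {0..2*pi} f" "\<And>\<theta>. \<bar>f \<theta>\<bar> \<le> 1" for f j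
    proof
      have "(\<lambda>\<theta>. complex_of_real (f \<theta>)) \<in> borel_measurable (lebesgue_on {0..2*pi})"
        by (rule continuous_circle_integrable) (intro continuous_intros f)
      thus m: "(\<lambda>\<theta>. of_real (f \<theta>) * g \<theta> $ j) \<in> borel_measurable (lebesgue_on {0..2*pi})"
        using gm(1) by (intro borel_measurable_times)
      show "integrable (lebesgue_on {0..2*pi}) (\<lambda>\<theta>. (cmod (of_real (f \<theta>) * g \<theta> $ j))\<^sup>2)"
      proof (rule Bochner_Integration.integrable_bound[OF gm(2)[of j]])
        show "(\<lambda>\<theta>. (cmod (of_real (f \<theta>) * g \<theta> $ j))\<^sup>2) \<in> borel_measurable (lebesgue_on {0..2*pi})" using m by measurable
        show "AE \<theta> in lebesgue_on {0..2*pi}. norm ((cmod (of_real (f \<theta>) * g \<theta> $ j))\<^sup>2) \<le> norm ((cmod (g \<theta> $ j))\<^sup>2)"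
          using f(2) by (intro AE_I2) (auto simp: norm_mult intro!: power_mono mult_left_le_one_le)
      qed
    qed
    have Lm: "(\<lambda>\<theta>. - (of_real (q \<theta>) * g \<theta> $ 2)) \<in> borel_measurable (lebesgue_on {0..2*pi})"
      "integrable (lebesgue_on {0..2*pi}) (\<lambda>\<theta>. (cmod (- (of_real (q \<theta>) * g \<theta> $ 2)))\<^sup>2)"
      using L[OF c(2) b(2), of 2] by auto
    show ?thesis
      using sq_integrable_diff[OF conjunct1[OF L[OF c(1) b(1), of 1]] Lm(1) conjunct2[OF L[OF c(1) b(1), of 1]] Lm(2)]
        borel_measurable_diff[OF conjunct1[OF L[OF c(1) b(1), of 1]] Lm(1)] by simp
  qed
  have er: "(\<lambda>\<theta>. rdot (e_r \<theta>) (g \<theta>)) = (\<lambda>\<theta>. of_real (cos \<theta>) * g \<theta> $ 1 + of_real (sin \<theta>) * g \<theta> $ 2)"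
    and et: "(\<lambda>\<theta>. rdot (e_\<theta> \<theta>) (g \<theta>)) = (\<lambda>\<theta>. of_real (- sin \<theta>) * g \<theta> $ 1 + of_real (cos \<theta>) * g \<theta> $ 2)"
    by (simp_all add: rdot_def sum_2)
  have Lr: "(\<lambda>\<theta>. rdot (e_r \<theta>) (g \<theta>)) \<in> borel_measurable (lebesgue_on {0..2*pi})
     \<and> integrable (lebesgue_on {0..2*pi}) (\<lambda>\<theta>. (cmod (rdot (e_r \<theta>) (g \<theta>)))\<^sup>2)"
    unfolding er[THEN fun_cong] by (rule L2) (auto intro!: continuous_intros)
  have Lt: "(\<lambda>\<theta>. rdot (e_\<theta> \<theta>) (g \<theta>)) \<in> borel_measurable (lebesgue_on {0..2*pi})
     \<and> integrable (lebesgue_on {0..2*pi}) (\<lambda>\<theta>. (cmod (rdot (e_\<theta> \<theta>) (g \<theta>)))\<^sup>2)"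
    unfolding et[THEN fun_cong] by (rule L2) (auto intro!: continuous_intros)
  have c1: "continuous_on {0..2*pi} (\<lambda>\<theta>. Dr \<phi>p r \<theta> + Dt \<phi>s r \<theta>)"
    and c2: "continuous_on {0..2*pi} (\<lambda>\<theta>. Dt \<phi>p r \<theta> - Dr \<phi>s r \<theta>)" if "r > a" for r
    by (intro continuous_intros continuous_Dr[OF a0 Cp that] continuous_Dt[OF a0 Cs that]
        continuous_Dt[OF a0 Cp that] continuous_Dr[OF a0 Cs that])+
  show ?thesis
    by (rule coupled_modes[OF pos Cp Cs Hp Hs radp rads
          fourier_coeff_trace[OF t1 c1 conjunct1[OF Lr] conjunct2[OF Lr]]
          fourier_coeff_trace[OF t2 c2 conjunct1[OF Lt] conjunct2[OF Lt]] that])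
qed

section \<open>Calculus of partial derivatives\<close>

lemma partial_cong:
  assumes "open S" "x \<in> S" "\<And>y. y \<in> S \<Longrightarrow> f y = g y"
  shows "partial j f x = partial j g x"
proof -
  have "(f has_derivative D) (at x) \<longleftrightarrow> (g has_derivative D) (at x)" for D
    using has_derivative_transform_within_open[OF _ assms(1,2)] assms(3) by metis
  thus ?thesis unfolding partial_def frechet_derivative_def by simp
qed

lemma C_on_cong:
  assumes S: "open S" and "\<And>y. y \<in> S \<Longrightarrow> f y = g y" and "C_on k S f"
  shows "C_on k S g"
  using assms(2,3)
proof (induction k arbitrary: f g)
  case 0 thus ?case using continuous_on_cong[of S S f g] by simp
next
  case (Suc k)
  have "g differentiable_on S" using Suc.prems(2)
    by (auto simp: differentiable_on_def intro: differentiable_transform_within[OF _ zero_less_one] simp: Suc.prems(1))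
  moreover have "C_on k S (partial j g)" for j
    by (rule Suc.IH[of "partial j f"]) (use Suc.prems in \<open>auto intro!: partial_cong[OF S]\<close>)
  ultimately show ?case by simp
qed

lemma partial_bounded_linear:
  assumes "bounded_linear L" "f differentiable at x"
  shows "partial j (\<lambda>y. L (f y)) x = L (partial j f x)"
  using frechet_derivative_at[OF bounded_linear.has_derivative[OF assms(1) assms(2)[unfolded frechet_derivative_works]]]
  unfolding partial_def by metis

lemma partial_add:
  assumes "f differentiable at x" "g differentiable at x"
  shows "partial j (\<lambda>y. f y + g y) x = partial j f x + partial j g x"
  using frechet_derivative_at[OF has_derivative_add[OF assms[unfolded frechet_derivative_works]]]
  unfolding partial_def by metis

lemma C_on_bounded_linear:
  assumes S: "open S" and L: "bounded_linear L" and "C_on k S f"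
  shows "C_on k S (\<lambda>x. L (f x))"
  using assms(3)
proof (induction k arbitrary: f)
  case 0 thus ?case using bounded_linear.continuous_on[OF L] by simp
next
  case (Suc k)
  hence d: "f differentiable at x" if "x \<in> S" for x
    using that differentiable_on_eq_differentiable_at[OF S] by auto
  have "(\<lambda>x. L (f x)) differentiable at x" if "x \<in> S" for x
    using bounded_linear.has_derivative[OF L d[OF that, unfolded frechet_derivative_works]] by (rule differentiableI)
  hence "(\<lambda>x. L (f x)) differentiable_on S" using differentiable_on_eq_differentiable_at[OF S] by auto
  moreover have "C_on k S (partial j (\<lambda>x. L (f x)))" for j
    by (rule C_on_cong[OF S _ Suc.IH[of "partial j f"]]) (use Suc.prems in \<open>auto simp: partial_bounded_linear[OF L d]\<close>)
  ultimately show ?case by simp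
qed

lemma C_on_add:
  assumes S: "open S" and "C_on k S f" "C_on k S g"
  shows "C_on k S (\<lambda>x. f x + g x)"
  using assms(2,3)
proof (induction k arbitrary: f g)
  case 0 thus ?case by (auto intro: continuous_on_add)
next
  case (Suc k)
  hence d: "f differentiable at x" "g differentiable at x" if "x \<in> S" for x
    using that differentiable_on_eq_differentiable_at[OF S] by auto
  have "(\<lambda>x. f x + g x) differentiable_on S" using Suc.prems by (auto intro: differentiable_on_add)
  moreover have "C_on k S (partial j (\<lambda>x. f x + g x))" for j
    by (rule C_on_cong[OF S _ Suc.IH[of "partial j f" "partial j g"]]) (use Suc.prems in \<open>auto simp: partial_add[OF d]\<close>)
  ultimately show ?case by simp
qed

lemma line_derivative:
  fixes f :: "real^2 \<Rightarrow> real"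
  assumes "f differentiable at (y + s *\<^sub>R axis i 1)"
  shows "((\<lambda>s. f (y + s *\<^sub>R axis i 1)) has_real_derivative partial i f (y + s *\<^sub>R axis i 1)) (at s)"
proof -
  have "((\<lambda>s. y + s *\<^sub>R axis i 1 :: real^2) has_vector_derivative axis i 1) (at s)"
    by (auto intro!: derivative_eq_intros)
  from vector_derivative_diff_chain_within[OF this has_derivative_at_withinI[OF assms[unfolded frechet_derivative_works]]]
  show ?thesis unfolding has_real_derivative_iff_has_vector_derivative partial_def by (simp add: comp_def)
qed

text \<open>The mean value theorem in both directions; exchanging the two directions leaves the second
  difference unchanged.\<close>

lemma second_difference:
  fixes f :: "real^2 \<Rightarrow> real"
  assumes d: "\<And>y. dist x y < 3 * h \<Longrightarrow> f differentiable at y" "\<And>y. dist x y < 3 * h \<Longrightarrow> partial i f differentiable at y"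
    and h: "h > 0"
  shows "\<exists>y. dist x y < 3 * h \<and> f (x + h *\<^sub>R axis i 1 + h *\<^sub>R axis j 1) - f (x + h *\<^sub>R axis i 1) - f (x + h *\<^sub>R axis j 1) + f x
     = h * (h * partial j (partial i f) y)"
proof -
  have near: "dist x (x + s *\<^sub>R axis i 1 + t *\<^sub>R axis j 1) < 3 * h" if "0 \<le> s" "s \<le> h" "0 \<le> t" "t \<le> h" for s t
  proof -
    have "norm (s *\<^sub>R axis i 1 + t *\<^sub>R axis j 1 :: real^2) \<le> s + t"
      by (rule order_trans[OF norm_triangle_ineq]) (use that in \<open>simp add: norm_axis_1\<close>)
    moreover have "dist x (x + v) = norm v" for v by (simp add: dist_norm)
    from this[of "s *\<^sub>R axis i 1 + t *\<^sub>R axis j 1"]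
    have "dist x (x + s *\<^sub>R axis i 1 + t *\<^sub>R axis j 1) = norm (s *\<^sub>R axis i 1 + t *\<^sub>R axis j 1 :: real^2)"
      by (simp only: add.assoc)
    ultimately show ?thesis using that h by linarith
  qed
  define g where "g s = f (x + h *\<^sub>R axis j 1 + s *\<^sub>R axis i 1) - f (x + s *\<^sub>R axis i 1)" for s
  have g': "(g has_real_derivative partial i f (x + h *\<^sub>R axis j 1 + s *\<^sub>R axis i 1) - partial i f (x + s *\<^sub>R axis i 1)) (at s)"
    if s: "0 \<le> s" "s \<le> h" for s
    unfolding g_def
  proof (intro DERIV_diff line_derivative d(1))
    show "dist x (x + h *\<^sub>R axis j 1 + s *\<^sub>R axis i 1) < 3 * h" using near[of s h] s h by (simp add: add_ac)
    show "dist x (x + s *\<^sub>R axis i 1) < 3 * h" using near[of s 0] s h by simp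
  qed
  obtain s where s: "0 < s" "s < h"
    "g h - g 0 = (h - 0) * (partial i f (x + h *\<^sub>R axis j 1 + s *\<^sub>R axis i 1) - partial i f (x + s *\<^sub>R axis i 1))"
    using MVT2[OF h g'] by blast
  define z where "z = x + s *\<^sub>R axis i 1"
  have k': "((\<lambda>t. partial i f (z + t *\<^sub>R axis j 1)) has_real_derivative partial j (partial i f) (z + t *\<^sub>R axis j 1)) (at t)"
    if t: "0 \<le> t" "t \<le> h" for t
    unfolding z_def by (intro line_derivative d(2) near) (use s t in auto)
  obtain t where t: "0 < t" "t < h"
    "partial i f (z + h *\<^sub>R axis j 1) - partial i f (z + 0 *\<^sub>R axis j 1) = (h - 0) * partial j (partial i f) (z + t *\<^sub>R axis j 1)"
    using MVT2[OF h k'] by blast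
  have "dist x (z + t *\<^sub>R axis j 1) < 3 * h" unfolding z_def by (rule near) (use s t in auto)
  moreover have "f (x + h *\<^sub>R axis i 1 + h *\<^sub>R axis j 1) - f (x + h *\<^sub>R axis i 1) - f (x + h *\<^sub>R axis j 1) + f x = g h - g 0"
    unfolding g_def by (simp add: add_ac)
  moreover have "g h - g 0 = h * (h * partial j (partial i f) (z + t *\<^sub>R axis j 1))"
    using s(3) t(3) unfolding z_def by (simp add: add_ac)
  ultimately show ?thesis by metis
qed

lemma C_on_2_facts:
  assumes "open S" "C_on 2 S f" "x \<in> S"
  shows "f differentiable at x" "partial j f differentiable at x" "isCont (partial i (partial j f)) x"
  using assms by (auto simp: numeral_2_eq_2 differentiable_on_eq_differentiable_at continuous_on_eq_continuous_at)

lemma symmetric_partials_real: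
  fixes f :: "real^2 \<Rightarrow> real"
  assumes S: "open S" and C: "C_on 2 S f" and x: "x \<in> S"
  shows "partial i (partial j f) x = partial j (partial i f) x"
proof (rule ccontr)
  assume ne: "\<not> ?thesis"
  define e where "e = \<bar>partial i (partial j f) x - partial j (partial i f) x\<bar> / 2"
  have e: "e > 0" using ne by (simp add: e_def)
  obtain d0 where d0: "d0 > 0" "ball x d0 \<subseteq> S" using S x open_contains_ball by blast
  obtain d1 where d1: "d1 > 0" "\<And>y. dist y x < d1 \<Longrightarrow> dist (partial i (partial j f) y) (partial i (partial j f) x) < e"
    using C_on_2_facts(3)[OF S C x, of i j] e unfolding continuous_at_eps_delta by (metis dist_commute)
  obtain d2 where d2: "d2 > 0" "\<And>y. dist y x < d2 \<Longrightarrow> dist (partial j (partial i f) y) (partial j (partial i f) x) < e"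
    using C_on_2_facts(3)[OF S C x, of j i] e unfolding continuous_at_eps_delta by (metis dist_commute)
  define h where "h = min d0 (min d1 d2) / 3"
  have h: "h > 0" using d0 d1 d2 by (simp add: h_def)
  have h3: "3 * h \<le> d0" "3 * h \<le> d1" "3 * h \<le> d2" by (auto simp: h_def)
  have inS: "y \<in> S" if "dist x y < 3 * h" for y using that h3(1) d0(2) by (auto simp: subset_eq)
  note dd = C_on_2_facts(1,2)[OF S C inS]
  obtain y where y: "dist x y < 3 * h" "f (x + h *\<^sub>R axis i 1 + h *\<^sub>R axis j 1) - f (x + h *\<^sub>R axis i 1) - f (x + h *\<^sub>R axis j 1) + f x
     = h * (h * partial j (partial i f) y)" using second_difference[OF dd h, where j = j and i = i] by blast
  obtain z where z: "dist x z < 3 * h" "f (x + h *\<^sub>R axis j 1 + h *\<^sub>R axis i 1) - f (x + h *\<^sub>R axis j 1) - f (x + h *\<^sub>R axis i 1) + f x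
     = h * (h * partial i (partial j f) z)" using second_difference[OF dd h, where j = i and i = j] by blast
  have "h * (h * partial j (partial i f) y) = h * (h * partial i (partial j f) z)"
    unfolding y(2)[symmetric] z(2)[symmetric] by (simp add: add_ac)
  hence "partial j (partial i f) y = partial i (partial j f) z" using h by simp
  moreover have "\<bar>partial j (partial i f) y - partial j (partial i f) x\<bar> < e"
    using d2(2)[of y] y(1) h3(3) by (simp add: dist_commute dist_real_def)
  moreover have "\<bar>partial i (partial j f) z - partial i (partial j f) x\<bar> < e"
    using d1(2)[of z] z(1) h3(2) by (simp add: dist_commute dist_real_def)
  moreover have "\<bar>partial i (partial j f) x - partial j (partial i f) x\<bar>
      \<le> \<bar>partial j (partial i f) y - partial j (partial i f) x\<bar> + \<bar>partial j (partial i f) y - partial i (partial j f) x\<bar>"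
    using abs_triangle_ineq4[of "partial j (partial i f) y - partial j (partial i f) x" "partial j (partial i f) y - partial i (partial j f) x"] by simp
  moreover have "b \<le> c + d \<Longrightarrow> c < b / 2 \<Longrightarrow> d < b / 2 \<Longrightarrow> False" for b c d :: real by linarith
  ultimately show False unfolding e_def by metis
qed

lemma symmetric_partials:
  fixes f :: "real^2 \<Rightarrow> complex"
  assumes S: "open S" and C: "C_on 2 S f" and x: "x \<in> S"
  shows "partial i (partial j f) x = partial j (partial i f) x"
proof -
  have L: "L (partial i (partial j f) x) = L (partial j (partial i f) x)" if L: "bounded_linear L" for L :: "complex \<Rightarrow> real"
  proof -
    have e: "partial a (partial b (\<lambda>y. L (f y))) x = L (partial a (partial b f) x)" for a b
    proof -
      have "partial a (partial b (\<lambda>y. L (f y))) x = partial a (\<lambda>y. L (partial b f y)) x"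
        by (rule partial_cong[OF S x]) (rule partial_bounded_linear[OF L C_on_2_facts(1)[OF S C]])
      also have "\<dots> = L (partial a (partial b f) x)" by (rule partial_bounded_linear[OF L C_on_2_facts(2)[OF S C x]])
      finally show ?thesis .
    qed
    show ?thesis unfolding e[symmetric] by (rule symmetric_partials_real[OF S C_on_bounded_linear[OF S L C] x])
  qed
  show ?thesis by (rule complex_eqI) (intro L bounded_linear_Re bounded_linear_Im)+
qed

section \<open>The Helmholtz decomposition of a Navier solution\<close>

text \<open>With \<open>\<Delta>u = \<nabla> div u - curl curl u\<close> the equation reads
  \<open>(\<lambda> + 2\<mu>) \<nabla> div u - \<mu> curl curl u + \<kappa> u = 0\<close>, which is the decomposition of \<open>u\<close>. Its divergence and
  its curl are the two Helmholtz equations.\<close>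

lemma navier_potentials:
  fixes a lam \<mu> \<kappa> kp ks :: real and u :: "real^2 \<Rightarrow> complex^2"
  assumes \<phi>p: "\<phi>p = (\<lambda>x. - (1 / kp\<^sup>2) *\<^sub>R div2 u x)" and \<phi>s: "\<phi>s = (\<lambda>x. (1 / ks\<^sup>2) *\<^sub>R scalar_curl u x)"
    and C: "C_on 3 (exterior a) u" and E: "\<forall>x\<in>exterior a. lame_op lam \<mu> u x + \<kappa> *\<^sub>R u x = 0"
    and k: "kp > 0" "ks > 0" "kp\<^sup>2 * (lam + 2 * \<mu>) = \<kappa>" "ks\<^sup>2 * \<mu> = \<kappa>" "\<kappa> > 0"
  shows "C_on 2 (exterior a) \<phi>p" "C_on 2 (exterior a) \<phi>s"
    "\<And>x. x \<in> exterior a \<Longrightarrow> u x $ 1 = partial 1 \<phi>p x + partial 2 \<phi>s x"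
    "\<And>x. x \<in> exterior a \<Longrightarrow> u x $ 2 = partial 2 \<phi>p x - partial 1 \<phi>s x"
    "\<And>x. x \<in> exterior a \<Longrightarrow> laplacian \<phi>p x + of_real (kp\<^sup>2) * \<phi>p x = 0"
    "\<And>x. x \<in> exterior a \<Longrightarrow> laplacian \<phi>s x + of_real (ks\<^sup>2) * \<phi>s x = 0"
    "\<And>x. x \<in> exterior a \<Longrightarrow> - (1 / kp\<^sup>2) *\<^sub>R grad2 (div2 u) x = axis 1 (partial 1 \<phi>p x) + axis 2 (partial 2 \<phi>p x)"
    "\<And>x. x \<in> exterior a \<Longrightarrow> (1 / ks\<^sup>2) *\<^sub>R vector_curl (scalar_curl u) x = axis 1 (partial 2 \<phi>s x) + axis 2 (- partial 1 \<phi>s x)"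
proof -
  let ?S = "exterior a"
  note S = open_exterior[of a]
  define U where "U i x = u x $ i" for i x
  define D where "D = div2 u"
  define W where "W = scalar_curl u"
  have C3: "C_on 3 ?S (U i)" for i unfolding U_def by (rule C_on_bounded_linear[OF S bounded_linear_vec_nth C])
  have C2: "C_on 2 ?S (partial j (U i))" for i j using C3[of i] by (simp add: eval_nat_numeral)
  have CU: "C_on 2 ?S (U i)" for i using C3[of i] by (auto simp: eval_nat_numeral intro: differentiable_imp_continuous_on)
  have D: "D = (\<lambda>x. partial 1 (U 1) x + partial 2 (U 2) x)" by (simp add: D_def div2_def[abs_def] U_def[abs_def] sum_2)
  have W: "W = (\<lambda>x. partial 1 (U 2) x + - partial 2 (U 1) x)" by (simp add: W_def scalar_curl_def[abs_def] U_def[abs_def])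
  have neg: "bounded_linear (\<lambda>z::complex. - z)" by (rule bounded_linear_minus[OF bounded_linear_ident])
  have sc: "bounded_linear (\<lambda>z::complex. c *\<^sub>R z)" for c by (rule bounded_linear_scaleR_right)
  have CD: "C_on 2 ?S D" unfolding D by (intro C_on_add[OF S] C2)
  have CW: "C_on 2 ?S W" unfolding W by (intro C_on_add[OF S] C_on_bounded_linear[OF S neg] C2)
  have p: "\<phi>p = (\<lambda>x. (- (1 / kp\<^sup>2)) *\<^sub>R D x)" and s: "\<phi>s = (\<lambda>x. (1 / ks\<^sup>2) *\<^sub>R W x)"
    by (simp_all add: \<phi>p \<phi>s D_def W_def)
  show Cp: "C_on 2 ?S \<phi>p" unfolding p by (rule C_on_bounded_linear[OF S sc CD])
  show Cs: "C_on 2 ?S \<phi>s" unfolding s by (rule C_on_bounded_linear[OF S sc CW])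
  note diff = C_on_2_facts(1,2)[OF S]
  have pp: "partial j \<phi>p x = (- (1 / kp\<^sup>2)) *\<^sub>R partial j D x" if "x \<in> ?S" for j x
    unfolding p by (rule partial_bounded_linear[OF sc diff(1)[OF CD that]])
  have ps: "partial j \<phi>s x = (1 / ks\<^sup>2) *\<^sub>R partial j W x" if "x \<in> ?S" for j x
    unfolding s by (rule partial_bounded_linear[OF sc diff(1)[OF CW that]])
  have pD: "partial j D x = partial j (partial 1 (U 1)) x + partial j (partial 2 (U 2)) x" if x: "x \<in> ?S" for j x
    unfolding D by (rule partial_add[OF diff(1)[OF C2 x] diff(1)[OF C2 x]])
  have pW: "partial j W x = partial j (partial 1 (U 2)) x - partial j (partial 2 (U 1)) x" if x: "x \<in> ?S" for j x
  proof -
    have "partial j (\<lambda>y. - partial 2 (U 1) y) x = - partial j (partial 2 (U 1)) x"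
      by (rule partial_bounded_linear[OF neg diff(1)[OF C2 x]])
    moreover have "partial j W x = partial j (partial 1 (U 2)) x + partial j (\<lambda>y. - partial 2 (U 1) y) x"
      unfolding W by (rule partial_add[OF diff(1)[OF C2 x] diff(1)[OF C_on_bounded_linear[OF S neg C2] x]])
    ultimately show ?thesis by simp
  qed
  have du: "u differentiable at x" "partial j u differentiable at x" if "x \<in> ?S" for x j
    using C that by (auto simp: eval_nat_numeral differentiable_on_eq_differentiable_at[OF S])
  have lap: "laplacian u x $ i = partial 1 (partial 1 (U i)) x + partial 2 (partial 2 (U i)) x" if x: "x \<in> ?S" for x i
  proof -
    have "partial j (partial j u) x $ i = partial j (partial j (U i)) x" for j
    proof -
      have "partial j (partial j (U i)) x = partial j (\<lambda>y. partial j u y $ i) x"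
        by (rule partial_cong[OF S x]) (simp only: U_def[abs_def] partial_bounded_linear[OF bounded_linear_vec_nth du(1)])
      also have "\<dots> = partial j (partial j u) x $ i" by (rule partial_bounded_linear[OF bounded_linear_vec_nth du(2)[OF x]])
      finally show ?thesis ..
    qed
    thus ?thesis by (simp add: laplacian_def sum_2)
  qed
  have eq: "\<mu> *\<^sub>R (partial 1 (partial 1 (U i)) x + partial 2 (partial 2 (U i)) x) + (lam + \<mu>) *\<^sub>R partial i D x + \<kappa> *\<^sub>R U i x = 0"
    if x: "x \<in> ?S" for x i
  proof -
    have "(lame_op lam \<mu> u x + \<kappa> *\<^sub>R u x) $ i = 0" using E x by simp
    thus ?thesis by (simp add: lame_op_def grad2_def lap[OF x] U_def flip: D_def)
  qed
  have sym: "partial 2 (partial 1 (U i)) x = partial 1 (partial 2 (U i)) x" if "x \<in> ?S" for x i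
    by (rule symmetric_partials[OF S CU that])
  have kk: "1 / kp\<^sup>2 = (lam + 2 * \<mu>) / \<kappa>" "1 / ks\<^sup>2 = \<mu> / \<kappa>" using k by (auto simp: field_simps)
  have alg: "z = (- ((lam + 2 * \<mu>) / \<kappa>)) *\<^sub>R (A + X) + (\<mu> / \<kappa>) *\<^sub>R (X - B)"
    if "\<mu> *\<^sub>R (A + B) + (lam + \<mu>) *\<^sub>R (A + X) + \<kappa> *\<^sub>R z = 0" for A B X z :: complex
  proof -
    have "\<kappa> *\<^sub>R z = - (\<mu> *\<^sub>R (A + B) + (lam + \<mu>) *\<^sub>R (A + X))" using that by (simp add: add_eq_0_iff2)
    also have "\<dots> = \<kappa> *\<^sub>R ((- ((lam + 2 * \<mu>) / \<kappa>)) *\<^sub>R (A + X) + (\<mu> / \<kappa>) *\<^sub>R (X - B))"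
      using k(5) by (simp add: scaleR_conv_of_real field_simps)
    finally show ?thesis using k(5) by simp
  qed
  show u1: "u x $ 1 = partial 1 \<phi>p x + partial 2 \<phi>s x" if x: "x \<in> ?S" for x
    using alg[OF eq[OF x, of 1, unfolded pD[OF x]]] unfolding pp[OF x] ps[OF x] kk pD[OF x] pW[OF x] sym[OF x] by (simp add: U_def)
  show u2: "u x $ 2 = partial 2 \<phi>p x - partial 1 \<phi>s x" if x: "x \<in> ?S" for x
  proof -
    have e: "\<mu> *\<^sub>R (partial 2 (partial 2 (U 2)) x + partial 1 (partial 1 (U 2)) x)
       + (lam + \<mu>) *\<^sub>R (partial 2 (partial 2 (U 2)) x + partial 1 (partial 2 (U 1)) x) + \<kappa> *\<^sub>R U 2 x = 0"
      using eq[OF x, of 2] unfolding pD[OF x] sym[OF x] by (simp add: add_ac)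
    have pp2: "partial 2 \<phi>p x = (- ((lam + 2 * \<mu>) / \<kappa>)) *\<^sub>R (partial 2 (partial 2 (U 2)) x + partial 1 (partial 2 (U 1)) x)"
      unfolding pp[OF x] kk pD[OF x] sym[OF x] by (simp only: add.commute)
    have ps1: "- partial 1 \<phi>s x = (\<mu> / \<kappa>) *\<^sub>R (partial 1 (partial 2 (U 1)) x - partial 1 (partial 1 (U 2)) x)"
      unfolding ps[OF x] kk pW[OF x] by (simp add: scaleR_diff_right)
    show ?thesis using alg[OF e, folded pp2 ps1] by (simp add: U_def)
  qed
  have lp: "laplacian \<phi>p x = D x" and ls: "laplacian \<phi>s x = - W x" if x: "x \<in> ?S" for x
  proof -
    note d = diff(2)[OF Cp x] diff(2)[OF Cs x]
    have n: "(\<lambda>y. - partial 1 \<phi>s y) differentiable at x" by (intro differentiable_minus d)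
    have a1: "partial j (U 1) x = partial j (partial 1 \<phi>p) x + partial j (partial 2 \<phi>s) x" for j
    proof -
      have "partial j (U 1) x = partial j (\<lambda>y. partial 1 \<phi>p y + partial 2 \<phi>s y) x"
        by (rule partial_cong[OF S x]) (simp only: U_def u1)
      also have "\<dots> = partial j (partial 1 \<phi>p) x + partial j (partial 2 \<phi>s) x" by (rule partial_add[OF d])
      finally show ?thesis .
    qed
    have a2: "partial j (U 2) x = partial j (partial 2 \<phi>p) x - partial j (partial 1 \<phi>s) x" for j
    proof -
      have "partial j (U 2) x = partial j (\<lambda>y. partial 2 \<phi>p y + - partial 1 \<phi>s y) x"
        by (rule partial_cong[OF S x]) (simp only: U_def u2 diff_conv_add_uminus)
      also have "\<dots> = partial j (partial 2 \<phi>p) x + partial j (\<lambda>y. - partial 1 \<phi>s y) x" by (rule partial_add[OF d(1) n])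
      also have "partial j (\<lambda>y. - partial 1 \<phi>s y) x = - partial j (partial 1 \<phi>s) x" by (rule partial_bounded_linear[OF neg d(2)])
      finally show ?thesis by simp
    qed
    have sy: "partial 2 (partial 1 \<phi>p) x = partial 1 (partial 2 \<phi>p) x" "partial 2 (partial 1 \<phi>s) x = partial 1 (partial 2 \<phi>s) x"
      by (rule symmetric_partials[OF S Cp x], rule symmetric_partials[OF S Cs x])
    show "laplacian \<phi>p x = D x" unfolding D a1 a2 sy by (simp add: laplacian_def sum_2)
    show "laplacian \<phi>s x = - W x" unfolding W a1 a2 sy by (simp add: laplacian_def sum_2)
  qed
  show "laplacian \<phi>p x + of_real (kp\<^sup>2) * \<phi>p x = 0" if "x \<in> ?S" for x
    unfolding lp[OF that] unfolding p using k(1) by (simp add: scaleR_conv_of_real)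
  show "laplacian \<phi>s x + of_real (ks\<^sup>2) * \<phi>s x = 0" if "x \<in> ?S" for x
    unfolding ls[OF that] unfolding s using k(2) by (simp add: scaleR_conv_of_real)
  show "- (1 / kp\<^sup>2) *\<^sub>R grad2 (div2 u) x = axis 1 (partial 1 \<phi>p x) + axis 2 (partial 2 \<phi>p x)" if "x \<in> ?S" for x
    unfolding pp[OF that] D_def[symmetric] by (simp add: vec_eq_iff forall_2 grad2_def axis_def)
  show "(1 / ks\<^sup>2) *\<^sub>R vector_curl (scalar_curl u) x = axis 1 (partial 2 \<phi>s x) + axis 2 (- partial 1 \<phi>s x)" if "x \<in> ?S" for x
    unfolding ps[OF that] W_def[symmetric] by (simp add: vec_eq_iff forall_2 vector_curl_def axis_def)
qed

section \<open>The Kupradze condition\<close>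

text \<open>By the differential equation, the hypothesis says that \<open>- i k r (\<psi>' - i k \<psi>) - \<psi>' + m\<^sup>2 \<psi> / r\<close> tends
  to zero. As \<open>\<psi>\<close> and \<open>\<psi>'\<close> are bounded, \<open>r (\<psi>' - i k \<psi>)\<close> is bounded, and the
  claim follows on division by \<open>sqrt r\<close>.\<close>

lemma kupradze_mode:
  fixes \<psi> \<psi>' :: "real \<Rightarrow> complex" and m :: nat
  assumes a: "a \<ge> 0" and k: "k > 0"
    and d1: "\<And>r. r > a \<Longrightarrow> (\<psi> has_vector_derivative \<psi>' r) (at r)"
    and d2: "\<And>r. r > a \<Longrightarrow> (\<psi>' has_vector_derivative - \<psi>' r / r - (of_real (k\<^sup>2) - of_real ((real m / r)\<^sup>2)) * \<psi> r) (at r)"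
    and lim: "((\<lambda>r. of_real r * ((- \<psi>' r / r - (of_real (k\<^sup>2) - of_real ((real m / r)\<^sup>2)) * \<psi> r) - \<i> * k * \<psi>' r)) \<longlongrightarrow> 0) at_top"
  shows "((\<lambda>r. of_real (sqrt r) * (\<psi>' r - \<i> * k * \<psi> r)) \<longlongrightarrow> 0) at_top"
proof -
  have ka: "k * a \<ge> 0" using a k by simp
  have bs: "bessel_solution m (k * a) (\<lambda>x. \<psi> (x / k)) (\<lambda>x. \<psi>' (x / k) / k)" by (rule bessel_rescale[OF a k d1 d2])
  obtain \<alpha> \<beta> where ab: "\<And>x. x > k * a \<Longrightarrow> \<psi> (x / k) = \<alpha> * hankel1 m x + \<beta> * cnj (hankel1 m x)"
    "\<And>x. x > k * a \<Longrightarrow> \<psi>' (x / k) / k = \<alpha> * hankel1' m x + \<beta> * cnj (hankel1' m x)"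
    by (rule bessel_solution_rep[OF bs ka]) (rule that; simp)
  define \<delta> where "\<delta> = k * (a + 1)"
  have \<delta>: "\<delta> > 0" using a k by (simp add: \<delta>_def)
  obtain B0 where B0: "B0 > 0" "\<And>x. x \<ge> \<delta> \<Longrightarrow> cmod (hankel1 m x) \<le> B0" using hankel1_bounded[OF \<delta>, of m] by blast
  obtain B1 where B1: "B1 > 0" "\<And>x. x \<ge> \<delta> \<Longrightarrow> cmod (hankel1 (Suc m) x) \<le> B1" using hankel1_bounded[OF \<delta>, of "Suc m"] by blast
  define B where "B = m / \<delta> * B0 + B1"
  have B: "cmod (hankel1' m x) \<le> B" if x: "x \<ge> \<delta>" for x
  proof -
    have "cmod (hankel1' m x) \<le> cmod (of_real (m / x) * hankel1 m x) + cmod (hankel1 (Suc m) x)"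
      unfolding hankel1'_def by (rule norm_triangle_ineq4)
    also have "cmod (of_real (m / x) * hankel1 m x) = m / x * cmod (hankel1 m x)" using x \<delta> by (simp add: norm_mult norm_divide)
    also have "m / x * cmod (hankel1 m x) + cmod (hankel1 (Suc m) x) \<le> m / \<delta> * B0 + B1"
      using x \<delta> by (intro add_mono mult_mono B0 B1 divide_left_mono) auto
    finally show ?thesis unfolding B_def .
  qed
  define M where "M = (cmod \<alpha> + cmod \<beta>) * B0"
  define M' where "M' = k * ((cmod \<alpha> + cmod \<beta>) * B)"
  have lc: "cmod (\<alpha> * z + \<beta> * cnj z) \<le> (cmod \<alpha> + cmod \<beta>) * b" if "cmod z \<le> b" for z b
  proof -
    have "cmod (\<alpha> * z + \<beta> * cnj z) \<le> (cmod \<alpha> + cmod \<beta>) * cmod z"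
      by (rule order_trans[OF norm_triangle_ineq]) (simp add: norm_mult algebra_simps)
    also have "\<dots> \<le> (cmod \<alpha> + cmod \<beta>) * b" by (intro mult_left_mono that) simp
    finally show ?thesis .
  qed
  have bd: "cmod (\<psi> r) \<le> M" "cmod (\<psi>' r) \<le> M'" if r: "r \<ge> a + 1" for r
  proof -
    have x: "k * r \<ge> \<delta>" using r k by (simp add: \<delta>_def)
    have xa: "k * r > k * a" using r k by simp
    show "cmod (\<psi> r) \<le> M" using ab(1)[OF xa] lc[OF B0(2)[OF x]] k by (simp add: M_def)
    have "cmod (\<psi>' r) / k \<le> (cmod \<alpha> + cmod \<beta>) * B" using arg_cong[OF ab(2)[OF xa], of cmod] lc[OF B[OF x]] k by (simp add: norm_divide)
    thus "cmod (\<psi>' r) \<le> M'" using k by (simp add: M'_def field_simps)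
  qed
  define E where "E r = of_real r * ((- \<psi>' r / r - (of_real (k\<^sup>2) - of_real ((real m / r)\<^sup>2)) * \<psi> r) - \<i> * k * \<psi>' r)" for r
  define K where "K = (1 + M' + (real m)\<^sup>2 * M) / k"
  have "\<forall>\<^sub>F r in at_top. dist (E r) 0 < 1" using tendstoD[OF lim, of 1] unfolding E_def by simp
  hence "\<forall>\<^sub>F r in at_top. norm (of_real (sqrt r) * (\<psi>' r - \<i> * k * \<psi> r)) \<le> K / sqrt r"
    using eventually_ge_at_top[of "a + 1"]
  proof eventually_elim
    case (elim r)
    have r: "r \<ge> 1" "r > 0" using elim(2) a by auto
    have M0: "M \<ge> 0" using bd(1)[OF elim(2)] norm_ge_zero order_trans by blast
    have id: "of_real k * (of_real r * (\<psi>' r - \<i> * k * \<psi> r)) = \<i> * (E r + \<psi>' r - of_real ((real m)\<^sup>2 / r) * \<psi> r)"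
      unfolding E_def using r by (simp add: field_simps power2_eq_square)
    have "k * (r * cmod (\<psi>' r - \<i> * k * \<psi> r)) = cmod (\<i> * (E r + \<psi>' r - of_real ((real m)\<^sup>2 / r) * \<psi> r))"
      unfolding id[symmetric] using k r by (simp add: norm_mult)
    also have "\<dots> = cmod (E r + \<psi>' r - of_real ((real m)\<^sup>2 / r) * \<psi> r)" by (simp add: norm_mult)
    also have "\<dots> \<le> (cmod (E r) + cmod (\<psi>' r)) + cmod (of_real ((real m)\<^sup>2 / r) * \<psi> r)"
      by (intro order_trans[OF norm_triangle_ineq4] add_mono norm_triangle_ineq order_refl)
    also have "cmod (of_real ((real m)\<^sup>2 / r) * \<psi> r) = (real m)\<^sup>2 / r * cmod (\<psi> r)" using r by (simp add: norm_mult norm_divide norm_power)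
    also have "(cmod (E r) + cmod (\<psi>' r)) + (real m)\<^sup>2 / r * cmod (\<psi> r) \<le> (1 + M') + (real m)\<^sup>2 / 1 * M"
      using elim(1) bd[OF elim(2)] r M0 by (intro add_mono mult_mono divide_left_mono) auto
    finally have "r * cmod (\<psi>' r - \<i> * k * \<psi> r) \<le> K" using k by (simp add: K_def field_simps)
    moreover have "r * cmod (\<psi>' r - \<i> * k * \<psi> r) = sqrt r * (sqrt r * cmod (\<psi>' r - \<i> * k * \<psi> r))"
      using r by (simp add: mult.assoc[symmetric])
    ultimately have "sqrt r * (sqrt r * cmod (\<psi>' r - \<i> * k * \<psi> r)) \<le> K" by (simp only:)
    moreover have "y * z \<le> K \<Longrightarrow> 0 < y \<Longrightarrow> z \<le> K / y" for y z by (simp add: pos_le_divide_eq mult.commute)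
    ultimately have "sqrt r * cmod (\<psi>' r - \<i> * k * \<psi> r) \<le> K / sqrt r" using r by simp
    thus ?case using r by (simp add: norm_mult)
  qed
  moreover have "((\<lambda>r. K / sqrt r) \<longlongrightarrow> 0) at_top" by real_asymp
  ultimately show ?thesis by (rule Lim_null_comparison)
qed

text \<open>A scalar component of the condition, radial for the compressional and tangential for the shear
  part, involves only \<open>\<partial>\<^sub>r\<^sup>2 \<phi> - i k \<partial>\<^sub>r \<phi>\<close>.\<close>

lemma kupradze_mode_radiating:
  fixes G :: "real^2 \<Rightarrow> 'b::real_normed_vector"
  assumes a: "a > 0" and k: "k > 0" and C: "C_on 2 (exterior a) \<phi>"
    and H: "\<And>x. x \<in> exterior a \<Longrightarrow> laplacian \<phi> x + of_real (k\<^sup>2) * \<phi> x = 0"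
    and lim: "(G \<longlongrightarrow> 0) at_infinity"
    and b: "\<And>r \<theta>. r > a \<Longrightarrow> cmod (of_real r * (Drr \<phi> r \<theta> - \<i> * k * Dr \<phi> r \<theta>)) \<le> norm (G (polar r \<theta>))"
  shows "mode_radiating k \<phi>"
  unfolding mode_radiating_def
proof
  fix n
  have a0: "a \<ge> 0" using a by simp
  have e: "(real (nat \<bar>n\<bar>) / r)\<^sup>2 = (of_int n / r)\<^sup>2" for r by (simp add: power_divide)
  have cRR: "continuous_on {0..2*pi} (Drr \<phi> r)" if "r > a" for r
  proof -
    have "continuous_on {0..2*pi} (\<lambda>\<theta>. Drr \<phi> (fst (r, \<theta>)) (snd (r, \<theta>)))"
      by (rule continuous_on_compose2[OF continuous_Drr[OF a0 C], where f = "\<lambda>\<theta>. (r, \<theta>)"])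
        (use that in \<open>auto intro!: continuous_intros\<close>)
    thus ?thesis by simp
  qed
  define Q where "Q r \<theta> = of_real r * (Drr \<phi> r \<theta> - \<i> * k * Dr \<phi> r \<theta>)" for r \<theta>
  have ci: "continuous_on {0..2*pi} (\<lambda>\<theta>. \<i> * k * Dr \<phi> r \<theta>)" if "r > a" for r
    by (intro continuous_intros continuous_Dr[OF a0 C that])
  have cQ: "continuous_on {0..2*pi} (Q r)" if "r > a" for r
    unfolding Q_def by (intro continuous_intros cRR ci that)
  have L: "((\<lambda>r. fc (Q r) n) \<longlongrightarrow> 0) at_top"
    by (rule fc_tendsto_at_top[OF lim a0 cQ]) (use b in \<open>simp_all add: Q_def\<close>)
  note md2 = mode_deriv2[OF a0 C _ H]
  show "((\<lambda>r. of_real (sqrt r) * (fc (Dr \<phi> r) n - \<i> * k * fc (\<lambda>\<theta>. \<phi> (polar r \<theta>)) n)) \<longlongrightarrow> 0) at_top"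
  proof (rule kupradze_mode[OF a0 k, where m = "nat \<bar>n\<bar>"])
    fix r assume r: "r > a"
    show "((\<lambda>r. fc (\<lambda>\<theta>. \<phi> (polar r \<theta>)) n) has_vector_derivative fc (Dr \<phi> r) n) (at r)"
      by (rule mode_deriv[OF a0 C r])
    show "((\<lambda>r. fc (Dr \<phi> r) n) has_vector_derivative - fc (Dr \<phi> r) n / r -
       (of_real (k\<^sup>2) - of_real ((real (nat \<bar>n\<bar>) / r)\<^sup>2)) * fc (\<lambda>\<theta>. \<phi> (polar r \<theta>)) n) (at r)"
      unfolding e by (rule md2[OF r])
  next
    have "\<forall>\<^sub>F r in at_top. fc (Q r) n = of_real r * ((- fc (Dr \<phi> r) n / r - (of_real (k\<^sup>2) - of_real ((real (nat \<bar>n\<bar>) / r)\<^sup>2)) * fc (\<lambda>\<theta>. \<phi> (polar r \<theta>)) n) - \<i> * k * fc (Dr \<phi> r) n)"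
      using eventually_gt_at_top[of a]
    proof eventually_elim
      case (elim r)
      have "fc (Drr \<phi> r) n = - fc (Dr \<phi> r) n / r - (of_real (k\<^sup>2) - of_real ((of_int n / r)\<^sup>2)) * fc (\<lambda>\<theta>. \<phi> (polar r \<theta>)) n"
        by (rule vector_derivative_unique_at[OF mode_deriv_Dr[OF a0 C elim] md2[OF elim]])
      thus ?case unfolding Q_def fc_cmult fc_diff[OF cRR[OF elim] ci[OF elim]] e by simp
    qed
    thus "((\<lambda>r. of_real r * ((- fc (Dr \<phi> r) n / r - (of_real (k\<^sup>2) - of_real ((real (nat \<bar>n\<bar>) / r)\<^sup>2)) * fc (\<lambda>\<theta>. \<phi> (polar r \<theta>)) n) - \<i> * k * fc (Dr \<phi> r) n)) \<longlongrightarrow> 0) at_top"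
      by (rule Lim_transform_eventually[OF L])
  qed
qed

lemma unit_combination_le_norm:
  fixes w :: "complex^2"
  assumes "p\<^sup>2 + q\<^sup>2 = 1"
  shows "cmod (of_real p * w $ 1 + of_real q * w $ 2) \<le> norm w"
proof -
  define A B where "A = cmod (w $ 1)" and "B = cmod (w $ 2)"
  have "cmod (of_real p * w $ 1 + of_real q * w $ 2) \<le> \<bar>p\<bar> * A + \<bar>q\<bar> * B"
    by (rule order_trans[OF norm_triangle_ineq]) (simp add: norm_mult A_def B_def)
  also have "\<dots> \<le> sqrt (A\<^sup>2 + B\<^sup>2)"
  proof (rule real_le_rsqrt)
    have "(\<bar>p\<bar> * A + \<bar>q\<bar> * B)\<^sup>2 + (\<bar>p\<bar> * B - \<bar>q\<bar> * A)\<^sup>2 = (\<bar>p\<bar>\<^sup>2 + \<bar>q\<bar>\<^sup>2) * (A\<^sup>2 + B\<^sup>2)"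
      by (simp only: power2_eq_square) (simp add: algebra_simps)
    also have "\<dots> = A\<^sup>2 + B\<^sup>2" using assms by simp
    finally show "(\<bar>p\<bar> * A + \<bar>q\<bar> * B)\<^sup>2 \<le> A\<^sup>2 + B\<^sup>2" using zero_le_power2[of "\<bar>p\<bar> * B - \<bar>q\<bar> * A"] by linarith
  qed
  also have "\<dots> = norm w" by (simp add: norm_vec_def L2_set_def sum_2 A_def B_def)
  finally show ?thesis .
qed

lemma kupradze_bound:
  fixes v :: "real^2 \<Rightarrow> complex^2"
  assumes a: "a > 0" and f: "f1 differentiable_on exterior a" "f2 differentiable_on exterior a"
    and v: "\<And>x. x \<in> exterior a \<Longrightarrow> v x = axis 1 (f1 x) + axis 2 (f2 x)"
    and r: "r > a" and pq: "p\<^sup>2 + q\<^sup>2 = 1"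
  shows "cmod (of_real r * (of_real p * (Dr f1 r \<theta> - \<i> * k * f1 (polar r \<theta>)) + of_real q * (Dr f2 r \<theta> - \<i> * k * f2 (polar r \<theta>))))
     \<le> norm (norm (polar r \<theta>) *\<^sub>R (radial_deriv v (polar r \<theta>) - (\<i> * of_real k) *s v (polar r \<theta>)))"
proof -
  have a0: "a \<ge> 0" using a by simp
  note S = open_exterior[of a]
  let ?x = "polar r \<theta>"
  have x: "?x \<in> exterior a" by (rule polar_exterior[OF r a0])
  have df: "f1 differentiable at y" "f2 differentiable at y" if "y \<in> exterior a" for y
    using f that differentiable_on_eq_differentiable_at[OF S] by auto
  have D: "(v has_derivative (\<lambda>h. axis 1 (frechet_derivative f1 (at y) h) + axis 2 (frechet_derivative f2 (at y) h))) (at y)"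
    if y: "y \<in> exterior a" for y
  proof -
    have base: "((\<lambda>x. axis 1 (f1 x) + axis 2 (f2 x) :: complex^2) has_derivative (\<lambda>h. axis 1 (frechet_derivative f1 (at y) h) + axis 2 (frechet_derivative f2 (at y) h))) (at y)"
      by (intro has_derivative_add bounded_linear.has_derivative[OF bounded_linear_axis] df[OF y, unfolded frechet_derivative_works])
    show ?thesis by (rule has_derivative_transform_within_open[OF base S y]) (simp add: v)
  qed
  note fr = frechet_derivative_at[OF D[OF x], symmetric]
  have "radial_deriv v ?x = dir_deriv (e_r \<theta>) v ?x" by (rule radial_deriv_polar[OF a0 r])
  also have "\<dots> = axis 1 (Dr f1 r \<theta>) + axis 2 (Dr f2 r \<theta>)"
    unfolding dir_deriv_def fr using dir_deriv_Dr[OF a0 f(1) r, of \<theta>] dir_deriv_Dr[OF a0 f(2) r, of \<theta>] by (simp add: dir_deriv_def)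
  finally have R: "radial_deriv v ?x = \<dots>" .
  have n: "norm ?x = r" using r a by simp
  define w where "w = norm ?x *\<^sub>R (radial_deriv v ?x - (\<i> * of_real k) *s v ?x)"
  have cv: "c *\<^sub>R z = of_real c * z" for c and z :: complex by (rule scaleR_conv_of_real)
  have w: "w $ 1 = of_real r * (Dr f1 r \<theta> - \<i> * k * f1 ?x)" "w $ 2 = of_real r * (Dr f2 r \<theta> - \<i> * k * f2 ?x)"
    unfolding w_def R v[OF x] n by (simp_all add: axis_def cv)
  have "of_real r * (of_real p * (Dr f1 r \<theta> - \<i> * k * f1 ?x) + of_real q * (Dr f2 r \<theta> - \<i> * k * f2 ?x)) = of_real p * w $ 1 + of_real q * w $ 2"
    unfolding w by (simp only: distrib_left mult.left_commute)
  thus ?thesis using unit_combination_le_norm[OF pq, of w] unfolding w_def by simp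
qed


lemma Dr_minus:
  assumes "f differentiable_on exterior a" "a \<ge> 0" "r > a"
  shows "Dr (\<lambda>x. - f x) r \<theta> = - Dr f r \<theta>"
proof -
  have "f differentiable at (polar r \<theta>)"
    using assms(1) polar_exterior[OF assms(3,2)] differentiable_on_eq_differentiable_at[OF open_exterior] by blast
  from partial_bounded_linear[OF bounded_linear_minus[OF bounded_linear_ident] this]
  show ?thesis unfolding Dr_def by simp
qed

lemma has_trace_cong:
  assumes "has_trace a w g" "\<And>r \<theta>. r > a \<Longrightarrow> w r \<theta> = w' r \<theta>"
  shows "has_trace a w' g"
  unfolding has_trace_def
proof (rule Lim_transform_eventually[OF assms(1)[unfolded has_trace_def]])
  show "\<forall>\<^sub>F r in at_right a. (\<integral>\<theta>. (norm (w r \<theta> - g \<theta>))\<^sup>2 \<partial>lebesgue_on {0..2*pi}) = (\<integral>\<theta>. (norm (w' r \<theta> - g \<theta>))\<^sup>2 \<partial>lebesgue_on {0..2*pi})"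
    using eventually_at_right_less[of a] by eventually_elim (simp add: assms(2))
qed

text \<open>A projection onto a unit direction does not increase the \<open>L\<^sup>2\<close>-distance.\<close>

lemma component_trace:
  fixes u :: "real^2 \<Rightarrow> complex^2"
  assumes a: "a > 0" and t: "has_trace a (\<lambda>r \<theta>. u (polar r \<theta>)) g" and c: "continuous_on (exterior a) u"
    and g: "\<forall>j. H_half (\<lambda>\<theta>. g \<theta> $ j)" and pq: "\<And>\<theta>. (p \<theta>)\<^sup>2 + (q \<theta>)\<^sup>2 = 1"
    and w: "\<And>r \<theta>. r > a \<Longrightarrow> w r \<theta> = of_real (p \<theta>) * u (polar r \<theta>) $ 1 + of_real (q \<theta>) * u (polar r \<theta>) $ 2"
    and G: "\<And>\<theta>. G \<theta> = of_real (p \<theta>) * g \<theta> $ 1 + of_real (q \<theta>) * g \<theta> $ 2"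
  shows "has_trace a w G"
  unfolding has_trace_def
proof (rule Lim_null_comparison[OF _ t[unfolded has_trace_def]])
  let ?L = "lebesgue_on {0..2*pi}"
  show "\<forall>\<^sub>F r in at_right a. norm (\<integral>\<theta>. (norm (w r \<theta> - G \<theta>))\<^sup>2 \<partial>?L) \<le> (\<integral>\<theta>. (norm (u (polar r \<theta>) - g \<theta>))\<^sup>2 \<partial>?L)"
    using eventually_at_right_less[of a]
  proof eventually_elim
    case (elim r)
    have cj: "continuous_on {0..2*pi} (\<lambda>\<theta>. u (polar r \<theta>) $ j)" for j
      by (intro continuous_on_component polar_continuous_circle[OF _ c elim]) (use a in simp)
    have c2: "integrable ?L (\<lambda>\<theta>. (cmod (u (polar r \<theta>) $ j))\<^sup>2)" for j
      by (rule continuous_circle_integrable) (intro continuous_intros cj)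
    have int: "integrable ?L (\<lambda>\<theta>. (cmod (u (polar r \<theta>) $ j - g \<theta> $ j))\<^sup>2)" for j
      by (rule sq_integrable_diff[OF continuous_circle_integrable(1)[OF cj] _ c2]) (use g in \<open>auto simp: H_half_def\<close>)
    have n: "(norm (u (polar r \<theta>) - g \<theta>))\<^sup>2 = (cmod (u (polar r \<theta>) $ 1 - g \<theta> $ 1))\<^sup>2 + (cmod (u (polar r \<theta>) $ 2 - g \<theta> $ 2))\<^sup>2" for \<theta>
      by (simp add: norm_vec_def L2_set_def sum_2)
    have "integrable ?L (\<lambda>\<theta>. (norm (u (polar r \<theta>) - g \<theta>))\<^sup>2)" unfolding n by (intro Bochner_Integration.integrable_add int)
    moreover have "(norm (w r \<theta> - G \<theta>))\<^sup>2 \<le> (norm (u (polar r \<theta>) - g \<theta>))\<^sup>2" for \<theta>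
    proof -
      have "w r \<theta> - G \<theta> = of_real (p \<theta>) * (u (polar r \<theta>) - g \<theta>) $ 1 + of_real (q \<theta>) * (u (polar r \<theta>) - g \<theta>) $ 2"
        unfolding w[OF elim] G by (simp add: algebra_simps)
      thus ?thesis using unit_combination_le_norm[OF pq, of \<theta> "u (polar r \<theta>) - g \<theta>"] by (intro power_mono) auto
    qed
    ultimately have "(\<integral>\<theta>. (norm (w r \<theta> - G \<theta>))\<^sup>2 \<partial>?L) \<le> (\<integral>\<theta>. (norm (u (polar r \<theta>) - g \<theta>))\<^sup>2 \<partial>?L)"
      by (rule integral_mono') simp
    thus ?case by simp
  qed
qed

section \<open>Assembling the expansions\<close>

lemma termwise_smooth_summable:
  fixes T :: "nat \<Rightarrow> real \<Rightarrow> real \<Rightarrow> 'b::banach"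
  assumes "termwise_smooth a T" "r > a"
  shows "summable (\<lambda>l. T l r \<theta>)"
proof -
  have "conv_abs_unif (\<lambda>(r, \<theta>). r \<ge> a + (r' - a)) (\<lambda>l (r, \<theta>). mixed_deriv [] (T l) r \<theta>)" if "r' > a" for r'
    using assms(1) that unfolding termwise_smooth_def by (metis diff_gt_0_iff_gt empty_set empty_subsetI)
  from this[OF assms(2)] have "\<forall>x. (case x of (s, \<theta>) \<Rightarrow> s \<ge> r) \<longrightarrow> summable (\<lambda>l. norm (case x of (r, \<theta>) \<Rightarrow> T l r \<theta>))"
    unfolding conv_abs_unif_def by simp
  from this[rule_format, of "(r, \<theta>)"] have "summable (\<lambda>l. norm (T l r \<theta>))" by simp
  thus ?thesis by (rule summable_norm_cancel)
qed

lemma vec2_suminf: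
  assumes "termwise_smooth a (inv_term k (vec2 f g))" "r > a"
  shows "(\<Sum>l. inv_term k (vec2 f g) l r \<theta>) $ 1 = (\<Sum>l. inv_term k f l r \<theta>)"
    "(\<Sum>l. inv_term k (vec2 f g) l r \<theta>) $ 2 = (\<Sum>l. inv_term k g l r \<theta>)"
  using bounded_linear.suminf[OF bounded_linear_vec_nth termwise_smooth_summable[OF assms]]
  by (simp_all add: inv_term_def)

lemma mode_sum_minus: "mode_sum (\<lambda>n. - 1 * c n) x \<theta> = - mode_sum c x \<theta>"
  and karp_minus: "karp_h (\<lambda>n. - 1 * c n) l \<theta> = - karp_h c l \<theta>" "karp_q (\<lambda>n. - 1 * c n) l \<theta> = - karp_q c l \<theta>"
  by (simp_all add: mode_sum_def fser_def karp_array_def infsum_uminus)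

theorem lemma2p3:
  fixes a \<rho> \<omega> lam \<mu> kp ks :: real
    and g :: "real \<Rightarrow> complex^2"
    and u :: "real^2 \<Rightarrow> complex^2"
    and \<phi>p \<phi>s :: "real^2 \<Rightarrow> complex"
  assumes "a > 0" "\<rho> > 0" "\<omega> > 0" "\<mu> > 0" "lam + \<mu> > 0"
    and "kp = \<omega> * sqrt (\<rho> / (lam + 2 * \<mu>))"
    and "ks = \<omega> * sqrt (\<rho> / \<mu>)"
    and "\<forall>j. H_half (\<lambda>\<theta>. g \<theta> $ j)"
    and "navier_solution a \<rho> \<omega> lam \<mu> kp ks g u"
    and "coupled_solution a kp ks g \<phi>p \<phi>s"
  shows "\<exists>hp qp hs qs Fp Gp Fs Gs.
    (\<forall>r>a. \<forall>\<theta>. u (polar r \<theta>) =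
         hankel1 0 (kp * r) *s (\<Sum>l. inv_term kp Fp l r \<theta>)
       + hankel1 1 (kp * r) *s (\<Sum>l. inv_term kp Gp l r \<theta>)
       + hankel1 0 (ks * r) *s (\<Sum>l. inv_term ks Fs l r \<theta>)
       + hankel1 1 (ks * r) *s (\<Sum>l. inv_term ks Gs l r \<theta>)) \<and>
    (\<forall>r>a. \<forall>\<theta>. \<phi>p (polar r \<theta>) =
         hankel1 0 (kp * r) * (\<Sum>l. inv_term kp hp l r \<theta>)
       + hankel1 1 (kp * r) * (\<Sum>l. inv_term kp qp l r \<theta>)) \<and>
    (\<forall>r>a. \<forall>\<theta>. \<phi>s (polar r \<theta>) =
         hankel1 0 (ks * r) * (\<Sum>l. inv_term ks hs l r \<theta>)
       + hankel1 1 (ks * r) * (\<Sum>l. inv_term ks qs l r \<theta>)) \<and>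
    vector_series_smooth a kp Fp Gp \<and> vector_series_smooth a ks Fs Gs \<and>
    scalar_series_smooth a kp hp qp \<and> scalar_series_smooth a ks hs qs \<and>
    determined_by_data a kp ks g hp qp hs qs Fp Gp Fs Gs"
proof -
  note a = assms(1) and gH = assms(8)
  have a0: "a \<ge> 0" using a by simp
  have l2: "lam + 2 * \<mu> > 0" using assms by linarith
  have kp: "kp > 0" and ks: "ks > 0" using assms l2 by simp_all
  have kk: "kp\<^sup>2 * (lam + 2 * \<mu>) = \<rho> * \<omega>\<^sup>2" "ks\<^sup>2 * \<mu> = \<rho> * \<omega>\<^sup>2" "\<rho> * \<omega>\<^sup>2 > 0"
    using assms(2-5) l2 unfolding assms(6,7) by (simp_all add: power_mult_distrib)
  have nC: "C_on 3 (exterior a) u" and nE: "\<forall>x\<in>exterior a. lame_op lam \<mu> u x + (\<rho> * \<omega>\<^sup>2) *\<^sub>R u x = 0"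
    and nT: "has_trace a (\<lambda>r \<theta>. u (polar r \<theta>)) g"
    and nKp: "kupradze kp (\<lambda>x. - (1 / kp\<^sup>2) *\<^sub>R grad2 (div2 u) x)"
    and nKs: "kupradze ks (\<lambda>x. (1 / ks\<^sup>2) *\<^sub>R vector_curl (scalar_curl u) x)"
    using assms(9) unfolding navier_solution_def by blast+
  have Cp: "C_on 2 (exterior a) \<phi>p" and Cs: "C_on 2 (exterior a) \<phi>s"
    and Hp: "\<And>x. x \<in> exterior a \<Longrightarrow> laplacian \<phi>p x + of_real (kp\<^sup>2) * \<phi>p x = 0"
    and Hs: "\<And>x. x \<in> exterior a \<Longrightarrow> laplacian \<phi>s x + of_real (ks\<^sup>2) * \<phi>s x = 0"
    and T1: "has_trace a (\<lambda>r \<theta>. dir_deriv (e_r \<theta>) \<phi>p (polar r \<theta>) + dir_deriv (e_\<theta> \<theta>) \<phi>s (polar r \<theta>)) (\<lambda>\<theta>. rdot (e_r \<theta>) (g \<theta>))"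
    and T2: "has_trace a (\<lambda>r \<theta>. dir_deriv (e_\<theta> \<theta>) \<phi>p (polar r \<theta>) - dir_deriv (e_r \<theta>) \<phi>s (polar r \<theta>)) (\<lambda>\<theta>. rdot (e_\<theta> \<theta>) (g \<theta>))"
    and Sp: "sommerfeld kp \<phi>p" and Ss: "sommerfeld ks \<phi>s"
    using assms(10) unfolding coupled_solution_def by simp_all
  note dp = C2_facts(1)[OF a0 Cp] and ds = C2_facts(1)[OF a0 Cs]
  have t1: "has_trace a (\<lambda>r \<theta>. Dr \<phi>p r \<theta> + Dt \<phi>s r \<theta>) (\<lambda>\<theta>. rdot (e_r \<theta>) (g \<theta>))"
    by (rule has_trace_cong[OF T1]) (simp only: dir_deriv_Dr[OF a0 dp] dir_deriv_Dt[OF a0 ds])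
  have t2: "has_trace a (\<lambda>r \<theta>. Dt \<phi>p r \<theta> - Dr \<phi>s r \<theta>) (\<lambda>\<theta>. rdot (e_\<theta> \<theta>) (g \<theta>))"
    by (rule has_trace_cong[OF T2]) (simp only: dir_deriv_Dr[OF a0 ds] dir_deriv_Dt[OF a0 dp])
  have cp_ex: "\<exists>c d. admissible (kp * a) c \<and> has_modes a kp \<phi>p c \<and> admissible (ks * a) d \<and> has_modes a ks \<phi>s d \<and>
      (\<forall>n x y. mode_system a kp ks g n x y \<longleftrightarrow> x = c n \<and> y = d n)"
    by (rule coupled_modes_from_traces[OF a kp ks gH Cp Cs Hp Hs sommerfeld_mode_radiating[OF a Cp Sp] sommerfeld_mode_radiating[OF a Cs Ss] t1 t2])
      (assumption+, blast)
  obtain cp cs where cp: "admissible (kp * a) cp" "has_modes a kp \<phi>p cp" and cs: "admissible (ks * a) cs" "has_modes a ks \<phi>s cs"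
    and sys: "\<And>n x y. mode_system a kp ks g n x y \<longleftrightarrow> x = cp n \<and> y = cs n"
    using cp_ex by blast

  \<comment> \<open>The canonical potentials of \<open>u\<close>, to be identified with the given ones.\<close>
  define \<psi>p where "\<psi>p = (\<lambda>x. - (1 / kp\<^sup>2) *\<^sub>R div2 u x)"
  define \<psi>s where "\<psi>s = (\<lambda>x. (1 / ks\<^sup>2) *\<^sub>R scalar_curl u x)"
  note N = navier_potentials[OF \<psi>p_def \<psi>s_def nC nE kp ks kk]
  have sc: "cos \<theta> *\<^sub>R x + sin \<theta> *\<^sub>R y = of_real (cos \<theta>) * x + of_real (sin \<theta>) * y" for \<theta> and x y :: complex
    by (simp add: scaleR_conv_of_real)
  have rp: "mode_radiating kp \<psi>p"
  proof (rule kupradze_mode_radiating[OF a kp N(1,5) nKp[unfolded kupradze_def]])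
    fix r \<theta> :: real assume r: "r > a"
    have "Drr \<psi>p r \<theta> - \<i> * kp * Dr \<psi>p r \<theta> = of_real (cos \<theta>) * (Dr (partial 1 \<psi>p) r \<theta> - \<i> * kp * partial 1 \<psi>p (polar r \<theta>))
        + of_real (sin \<theta>) * (Dr (partial 2 \<psi>p) r \<theta> - \<i> * kp * partial 2 \<psi>p (polar r \<theta>))"
      unfolding Drr_def Dr_def[of \<psi>p] sc by (simp add: algebra_simps)
    thus "cmod (of_real r * (Drr \<psi>p r \<theta> - \<i> * kp * Dr \<psi>p r \<theta>)) \<le> norm (norm (polar r \<theta>) *\<^sub>R
        (radial_deriv (\<lambda>x. - (1 / kp\<^sup>2) *\<^sub>R grad2 (div2 u) x) (polar r \<theta>) - (\<i> * of_real kp) *s (- (1 / kp\<^sup>2) *\<^sub>R grad2 (div2 u) (polar r \<theta>))))"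
      using kupradze_bound[OF a C2_facts(2)[OF a0 N(1)] C2_facts(2)[OF a0 N(1)] N(7) r, of "cos \<theta>" "sin \<theta>" \<theta> kp] by simp
  qed
  have rs: "mode_radiating ks \<psi>s"
  proof (rule kupradze_mode_radiating[OF a ks N(2,6) nKs[unfolded kupradze_def]])
    fix r \<theta> :: real assume r: "r > a"
    note d1 = C2_facts(2)[OF a0 N(2), of 1]
    have "Drr \<psi>s r \<theta> - \<i> * ks * Dr \<psi>s r \<theta> = of_real (sin \<theta>) * (Dr (partial 2 \<psi>s) r \<theta> - \<i> * ks * partial 2 \<psi>s (polar r \<theta>))
        + of_real (- cos \<theta>) * (Dr (\<lambda>x. - partial 1 \<psi>s x) r \<theta> - \<i> * ks * - partial 1 \<psi>s (polar r \<theta>))"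
      unfolding Drr_def Dr_def[of \<psi>s] sc Dr_minus[OF d1 a0 r] by (simp add: algebra_simps)
    thus "cmod (of_real r * (Drr \<psi>s r \<theta> - \<i> * ks * Dr \<psi>s r \<theta>)) \<le> norm (norm (polar r \<theta>) *\<^sub>R
        (radial_deriv (\<lambda>x. (1 / ks\<^sup>2) *\<^sub>R vector_curl (scalar_curl u) x) (polar r \<theta>) - (\<i> * of_real ks) *s ((1 / ks\<^sup>2) *\<^sub>R vector_curl (scalar_curl u) (polar r \<theta>))))"
      using kupradze_bound[OF a C2_facts(2)[OF a0 N(2)] differentiable_on_minus[OF d1] N(8) r, of "sin \<theta>" "- cos \<theta>" \<theta> ks] by simp
  qed
  have uc: "continuous_on (exterior a) u" using nC by (auto simp: eval_nat_numeral intro: differentiable_imp_continuous_on)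
  have s1: "has_trace a (\<lambda>r \<theta>. Dr \<psi>p r \<theta> + Dt \<psi>s r \<theta>) (\<lambda>\<theta>. rdot (e_r \<theta>) (g \<theta>))"
  proof (rule component_trace[OF a nT uc gH, of cos sin])
    fix r \<theta> :: real assume "r > a"
    note x = polar_exterior[OF this a0]
    show "Dr \<psi>p r \<theta> + Dt \<psi>s r \<theta> = of_real (cos \<theta>) * u (polar r \<theta>) $ 1 + of_real (sin \<theta>) * u (polar r \<theta>) $ 2"
      unfolding N(3)[OF x] N(4)[OF x] by (simp add: Dr_def Dt_def scaleR_conv_of_real algebra_simps sin_cos_squared_add3)
  qed (simp_all add: rdot_def sum_2)
  have s2: "has_trace a (\<lambda>r \<theta>. Dt \<psi>p r \<theta> - Dr \<psi>s r \<theta>) (\<lambda>\<theta>. rdot (e_\<theta> \<theta>) (g \<theta>))"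
  proof (rule component_trace[OF a nT uc gH, of "\<lambda>\<theta>. - sin \<theta>" cos])
    fix r \<theta> :: real assume "r > a"
    note x = polar_exterior[OF this a0]
    show "Dt \<psi>p r \<theta> - Dr \<psi>s r \<theta> = of_real (- sin \<theta>) * u (polar r \<theta>) $ 1 + of_real (cos \<theta>) * u (polar r \<theta>) $ 2"
      unfolding N(3)[OF x] N(4)[OF x] by (simp add: Dr_def Dt_def scaleR_conv_of_real algebra_simps)
  qed (simp_all add: rdot_def sum_2)
  have ep_ex: "\<exists>c d. admissible (kp * a) c \<and> has_modes a kp \<psi>p c \<and> admissible (ks * a) d \<and> has_modes a ks \<psi>s d \<and>
      (\<forall>n x y. mode_system a kp ks g n x y \<longleftrightarrow> x = c n \<and> y = d n)"
    by (rule coupled_modes_from_traces[OF a kp ks gH N(1,2,5,6) rp rs s1 s2]) (assumption+, blast)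
  obtain ep es where e: "has_modes a kp \<psi>p ep" "has_modes a ks \<psi>s es" "\<And>n x y. mode_system a kp ks g n x y \<longleftrightarrow> x = ep n \<and> y = es n"
    using ep_ex by blast
  \<comment> \<open>Both pairs of potentials have the same boundary data, hence the same amplitudes.\<close>
  have "ep = cp" "es = cs" using e(3) sys by (auto simp: fun_eq_iff)
  hence ep: "has_modes a kp \<psi>p cp" and es: "has_modes a ks \<psi>s cs" using e by auto

  have ka: "kp * a > 0" "ks * a > 0" using a kp ks by auto
  \<comment> \<open>The curl of \<open>\<phi>s\<close> is \<open>(\<partial>\<^sub>2 \<phi>s, - \<partial>\<^sub>1 \<phi>s)\<close>.\<close>
  define Xs where "Xs n = - 1 * grad_x ks cs n" for n
  note Xp = admissible_grad[OF cp(1) ka(1), of kp] and Ys = admissible_grad(2)[OF cs(1) ka(2), of ks]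
  have Xs: "admissible (ks * a) Xs" unfolding Xs_def[abs_def]
    by (rule admissible_mult[OF admissible_grad(1)[OF cs(1) ka(2)], of _ 1]) simp
  define Fp where "Fp = vec2 (karp_h (grad_x kp cp)) (karp_h (grad_y kp cp))"
  define Gp where "Gp = vec2 (karp_q (grad_x kp cp)) (karp_q (grad_y kp cp))"
  define Fs where "Fs = vec2 (karp_h (grad_y ks cs)) (karp_h Xs)"
  define Gs where "Gs = vec2 (karp_q (grad_y ks cs)) (karp_q Xs)"
  have smp: "vector_series_smooth a kp Fp Gp" unfolding Fp_def Gp_def by (rule karp_vector_smooth[OF a kp Xp])
  have sms: "vector_series_smooth a ks Fs Gs" unfolding Fs_def Gs_def by (rule karp_vector_smooth[OF a ks Ys Xs])
  have tm: "termwise_smooth a (inv_term kp Fp)" "termwise_smooth a (inv_term kp Gp)" "termwise_smooth a (inv_term ks Fs)" "termwise_smooth a (inv_term ks Gs)"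
    using smp sms unfolding vector_series_smooth_def by blast+
  have ex_u: "u (polar r \<theta>) =
         hankel1 0 (kp * r) *s (\<Sum>l. inv_term kp Fp l r \<theta>)
       + hankel1 1 (kp * r) *s (\<Sum>l. inv_term kp Gp l r \<theta>)
       + hankel1 0 (ks * r) *s (\<Sum>l. inv_term ks Fs l r \<theta>)
       + hankel1 1 (ks * r) *s (\<Sum>l. inv_term ks Gs l r \<theta>)" (is "_ = ?R") if r: "r > a" for r \<theta>
  proof -
    note x = polar_exterior[OF r a0]
    note P = potential_mode_sums[OF a kp N(1) cp(1) ep r] and Q = potential_mode_sums[OF a ks N(2) cs(1) es r]
    note S = vec2_suminf[OF tm(1)[unfolded Fp_def] r] vec2_suminf[OF tm(2)[unfolded Gp_def] r]
      vec2_suminf[OF tm(3)[unfolded Fs_def] r] vec2_suminf[OF tm(4)[unfolded Gs_def] r]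
    have u1: "u (polar r \<theta>) $ 1 = mode_sum (grad_x kp cp) (kp * r) \<theta> + mode_sum (grad_y ks cs) (ks * r) \<theta>"
      unfolding N(3)[OF x] P(2) Q(3) ..
    have u2: "u (polar r \<theta>) $ 2 = mode_sum (grad_y kp cp) (kp * r) \<theta> + mode_sum Xs (ks * r) \<theta>"
      unfolding N(4)[OF x] P(3) Q(2) Xs_def[abs_def] mode_sum_minus by simp
    have "u (polar r \<theta>) $ 1 = ?R $ 1"
      unfolding u1 mode_sum_karp[OF a kp Xp(1) r] mode_sum_karp[OF a ks Ys r] Fp_def Gp_def Fs_def Gs_def
      by (simp only: vector_add_component vector_smult_component S add.assoc)
    moreover have "u (polar r \<theta>) $ 2 = ?R $ 2"
      unfolding u2 mode_sum_karp[OF a kp Xp(2) r] mode_sum_karp[OF a ks Xs r] Fp_def Gp_def Fs_def Gs_def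
      by (simp only: vector_add_component vector_smult_component S add.assoc)
    ultimately show ?thesis unfolding vec_eq_iff forall_2 by blast
  qed
  note L = grad_leading[OF cp(1) ka(1), of kp] and M = grad_leading[OF cs(1) ka(2), of ks]
  have det: "determined_by_data a kp ks g (karp_h cp) (karp_q cp) (karp_h cs) (karp_q cs) Fp Gp Fs Gs"
    unfolding determined_by_data_def
  proof (intro conjI allI)
    show "\<exists>cp' cs'. (\<forall>n x y. mode_system a kp ks g n x y \<longleftrightarrow> x = cp' n \<and> y = cs' n) \<and>
        leading_coeffs cp' (karp_h cp 0) (karp_q cp 0) \<and> leading_coeffs cs' (karp_h cs 0) (karp_q cs 0)"
      using sys karp_leading[OF cp(1) ka(1)] karp_leading[OF cs(1) ka(2)] by blast
    fix \<theta>
    show "Fp 0 \<theta> = (of_real kp * karp_q cp 0 \<theta>) *s cvec (e_r \<theta>)" "Gp 0 \<theta> = - (of_real kp * karp_h cp 0 \<theta>) *s cvec (e_r \<theta>)"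
      unfolding Fp_def Gp_def by (simp_all add: vec_eq_iff forall_2 cvec_def L)
    show "Fs 0 \<theta> = - (of_real ks * karp_q cs 0 \<theta>) *s cvec (e_\<theta> \<theta>)" "Gs 0 \<theta> = (of_real ks * karp_h cs 0 \<theta>) *s cvec (e_\<theta> \<theta>)"
      unfolding Fs_def Gs_def Xs_def[abs_def] by (simp_all only: vec_eq_iff forall_2 vec2_nth karp_minus M) (simp_all add: cvec_def)
    show "karp_recursion (karp_h cp) (karp_q cp)" by (rule karp_scalar_recursion[OF a kp cp(1)])
    show "karp_recursion (karp_h cs) (karp_q cs)" by (rule karp_scalar_recursion[OF a ks cs(1)])
    show "karp_recursion Fp Gp" unfolding Fp_def Gp_def by (rule karp_vector_recursion[OF a kp Xp])
    show "karp_recursion Fs Gs" unfolding Fs_def Gs_def by (rule karp_vector_recursion[OF a ks Ys Xs])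
  qed
  have U: "\<forall>r>a. \<forall>\<theta>. u (polar r \<theta>) =
         hankel1 0 (kp * r) *s (\<Sum>l. inv_term kp Fp l r \<theta>)
       + hankel1 1 (kp * r) *s (\<Sum>l. inv_term kp Gp l r \<theta>)
       + hankel1 0 (ks * r) *s (\<Sum>l. inv_term ks Fs l r \<theta>)
       + hankel1 1 (ks * r) *s (\<Sum>l. inv_term ks Gs l r \<theta>)"
    by (intro allI impI) (rule ex_u)
  have P: "\<forall>r>a. \<forall>\<theta>. \<phi>p (polar r \<theta>) = hankel1 0 (kp * r) * (\<Sum>l. inv_term kp (karp_h cp) l r \<theta>)
       + hankel1 1 (kp * r) * (\<Sum>l. inv_term kp (karp_q cp) l r \<theta>)"
  proof (intro allI impI)
    fix r \<theta> assume r: "r > a"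
    show "\<phi>p (polar r \<theta>) = hankel1 0 (kp * r) * (\<Sum>l. inv_term kp (karp_h cp) l r \<theta>)
       + hankel1 1 (kp * r) * (\<Sum>l. inv_term kp (karp_q cp) l r \<theta>)"
      unfolding potential_mode_sums(1)[OF a kp Cp cp r] by (rule mode_sum_karp[OF a kp cp(1) r])
  qed
  have S: "\<forall>r>a. \<forall>\<theta>. \<phi>s (polar r \<theta>) = hankel1 0 (ks * r) * (\<Sum>l. inv_term ks (karp_h cs) l r \<theta>)
       + hankel1 1 (ks * r) * (\<Sum>l. inv_term ks (karp_q cs) l r \<theta>)"
  proof (intro allI impI)
    fix r \<theta> assume r: "r > a"
    show "\<phi>s (polar r \<theta>) = hankel1 0 (ks * r) * (\<Sum>l. inv_term ks (karp_h cs) l r \<theta>)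
       + hankel1 1 (ks * r) * (\<Sum>l. inv_term ks (karp_q cs) l r \<theta>)"
      unfolding potential_mode_sums(1)[OF a ks Cs cs r] by (rule mode_sum_karp[OF a ks cs(1) r])
  qed
  show ?thesis
    by (rule exI[of _ "karp_h cp"], rule exI[of _ "karp_q cp"], rule exI[of _ "karp_h cs"], rule exI[of _ "karp_q cs"],
        rule exI[of _ Fp], rule exI[of _ Gp], rule exI[of _ Fs], rule exI[of _ Gs],
        rule conjI[OF U], rule conjI[OF P], rule conjI[OF S], rule conjI[OF smp], rule conjI[OF sms],
        rule conjI[OF karp_scalar_smooth[OF a kp cp(1)]], rule conjI[OF karp_scalar_smooth[OF a ks cs(1)] det])
qed

end
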